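(* Let $A$ be a finite dimensional algebra over a field $k$ which is $g$-finite, $n:=|A|$, and $(h_0,\ldots,h_n)$ the $h$-vector of $\Delta(A)$. Then \[{\rm Ehr}_A(x)=\frac{\sum_{i=0}^nh_ix^i}{(1-x)^{n+1}};\] equivalently, for each $\ell\ge0$, $\#\mathrm{2\text{-}psilt}_\oplus^{\le\ell}A=\sum_{j=0}^n\binom{n+\ell-j}{n}h_j$.
   Context: $|X|$: number of isomorphism classes of indecomposable direct summands. A 2-term presilting complex is $T\in\mathsf{K}^{\rm b}(\operatorname{proj}A)$ concentrated in degrees $-1,0$ with $\operatorname{Hom}(T,T[\ell])=0$ for $\ell>0$; it is silting if also its thick closure is the whole category. $A$ is $g$-finite if there are finitely many isomorphism classes of basic 2-term silting complexes. $\mathrm{2\text{-}psilt}^jA$: isomorphism classes of basic 2-term presilting $T$ with $|T|=j$. $\Delta(A)$ is the simplicial complex whose $(j-1)$-simplices are the elements of $\mathrm{2\text{-}psilt}^jA$; $f_{-1}=1$, $f_{j-1}=\#\mathrm{2\text{-}psilt}^jA$, $h_j=\sum_{i=0}^j(-1)^{j-i}\binom{n-i}{j-i}f_{i-1}$. $\mathrm{2\text{-}psilt}_\oplus^{\le\ell}A$ is the set of isomorphism classes of (not necessarily basic) 2-term presilting complexes having at most $\ell$ indecomposable direct summands counted with multiplicity, and ${\rm Ehr}_A(x):=1+\sum_{\ell\ge1}\#(\mathrm{2\text{-}psilt}_\oplus^{\le\ell}A)x^\ell$. *)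

theory Defs
  imports "Jordan_Normal_Form.Matrix"
begin

text \<open>The algebra A is the ambient type 'a (a unital ring), made into a k-algebra
  by a scalar multiplication scale; finite dimensionality = finite spanning set.\<close>

definition fd_algebra :: "('k::field \<Rightarrow> 'a::ring_1 \<Rightarrow> 'a) \<Rightarrow> bool" where
  "fd_algebra scale \<longleftrightarrow>
     (\<forall>c x y. scale c (x + y) = scale c x + scale c y) \<and>
     (\<forall>c d x. scale (c + d) x = scale c x + scale d x) \<and>
     (\<forall>c d x. scale (c * d) x = scale c (scale d x)) \<and>
     (\<forall>x. scale 1 x = x) \<and>
     (\<forall>c x y. scale c (x * y) = scale c x * y) \<and>
     (\<forall>c x y. scale c (x * y) = x * scale c y) \<and>
     (\<exists>B. finite B \<and> (\<forall>x. \<exists>c. x = (\<Sum>b\<in>B. scale (c b) b)))"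

text \<open>A projective object is a pair (m, e) with e an idempotent m x m matrix over A;
  it stands for the module e A^m. Morphisms (m,e) -> (m',e') are matrices f with f = e' f e.\<close>

type_synonym 'a pobj = "nat \<times> 'a mat"

definition proj_obj :: "'a::ring_1 pobj \<Rightarrow> bool" where
  "proj_obj P \<longleftrightarrow> snd P \<in> carrier_mat (fst P) (fst P) \<and> snd P * snd P = snd P"

definition phom :: "'a::ring_1 pobj \<Rightarrow> 'a pobj \<Rightarrow> 'a mat set" where
  "phom P Q = {f. f \<in> carrier_mat (fst Q) (fst P) \<and> snd Q * f * snd P = f}"

type_synonym 'a cplx = "(int \<Rightarrow> 'a pobj) \<times> (int \<Rightarrow> 'a mat)"

definition cobj :: "'a cplx \<Rightarrow> int \<Rightarrow> 'a pobj" where "cobj X = fst X"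
definition cdif :: "'a cplx \<Rightarrow> int \<Rightarrow> 'a mat" where "cdif X = snd X"

definition is_complex :: "'a::ring_1 cplx \<Rightarrow> bool" where
  "is_complex X \<longleftrightarrow>
     (\<forall>i. proj_obj (cobj X i)) \<and>
     (\<forall>i. cdif X i \<in> phom (cobj X i) (cobj X (i + 1))) \<and>
     (\<forall>i. cdif X (i + 1) * cdif X i = 0\<^sub>m (fst (cobj X (i + 2))) (fst (cobj X i))) \<and>
     (\<exists>N::nat. \<forall>i. \<bar>i\<bar> > int N \<longrightarrow> snd (cobj X i) = 0\<^sub>m (fst (cobj X i)) (fst (cobj X i)))"

definition chain_map :: "'a::ring_1 cplx \<Rightarrow> 'a cplx \<Rightarrow> (int \<Rightarrow> 'a mat) \<Rightarrow> bool" where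
  "chain_map X Y f \<longleftrightarrow>
     (\<forall>i. f i \<in> phom (cobj X i) (cobj Y i)) \<and>
     (\<forall>i. cdif Y i * f i = f (i + 1) * cdif X i)"

definition null_homotopic :: "'a::ring_1 cplx \<Rightarrow> 'a cplx \<Rightarrow> (int \<Rightarrow> 'a mat) \<Rightarrow> bool" where
  "null_homotopic X Y f \<longleftrightarrow>
     (\<exists>h. (\<forall>i. h i \<in> phom (cobj X i) (cobj Y (i - 1))) \<and>
          (\<forall>i. f i = cdif Y (i - 1) * h i + h (i + 1) * cdif X i))"

definition id_cmap :: "'a::ring_1 cplx \<Rightarrow> int \<Rightarrow> 'a mat" where
  "id_cmap X i = snd (cobj X i)"

text \<open>Isomorphism in K^b(proj A) = homotopy equivalence.\<close>

definition htpy_equiv :: "'a::ring_1 cplx \<Rightarrow> 'a cplx \<Rightarrow> bool" (infix \<open>\<simeq>\<^sub>K\<close> 50) where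
  "X \<simeq>\<^sub>K Y \<longleftrightarrow> is_complex X \<and> is_complex Y \<and>
     (\<exists>f g. chain_map X Y f \<and> chain_map Y X g \<and>
        null_homotopic X X (\<lambda>i. g i * f i - id_cmap X i) \<and>
        null_homotopic Y Y (\<lambda>i. f i * g i - id_cmap Y i))"

definition zero_cplx :: "'a::ring_1 cplx" where
  "zero_cplx = ((\<lambda>i. (0, 0\<^sub>m 0 0)), (\<lambda>i. 0\<^sub>m 0 0))"

definition pobj_sum :: "'a::ring_1 pobj \<Rightarrow> 'a pobj \<Rightarrow> 'a pobj" where
  "pobj_sum P Q = (fst P + fst Q,
     four_block_mat (snd P) (0\<^sub>m (fst P) (fst Q)) (0\<^sub>m (fst Q) (fst P)) (snd Q))"

definition dsum :: "'a::ring_1 cplx \<Rightarrow> 'a cplx \<Rightarrow> 'a cplx" (infixr \<open>\<oplus>\<^sub>K\<close> 65) where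
  "X \<oplus>\<^sub>K Y = ((\<lambda>i. pobj_sum (cobj X i) (cobj Y i)),
     (\<lambda>i. four_block_mat (cdif X i) (0\<^sub>m (fst (cobj X (i + 1))) (fst (cobj Y i)))
                         (0\<^sub>m (fst (cobj Y (i + 1))) (fst (cobj X i))) (cdif Y i)))"

fun dsum_list :: "'a::ring_1 cplx list \<Rightarrow> 'a cplx" where
  "dsum_list [] = zero_cplx"
| "dsum_list (X # Xs) = X \<oplus>\<^sub>K dsum_list Xs"

definition shift :: "int \<Rightarrow> 'a::ring_1 cplx \<Rightarrow> 'a cplx" where
  "shift k X = ((\<lambda>i. cobj X (i + k)),
     (\<lambda>i. if even k then cdif X (i + k) else - cdif X (i + k)))"

definition cone :: "'a::ring_1 cplx \<Rightarrow> 'a cplx \<Rightarrow> (int \<Rightarrow> 'a mat) \<Rightarrow> 'a cplx" where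
  "cone X Y f = ((\<lambda>i. pobj_sum (cobj X (i + 1)) (cobj Y i)),
     (\<lambda>i. four_block_mat (- cdif X (i + 1)) (0\<^sub>m (fst (cobj X (i + 2))) (fst (cobj Y i)))
                         (f (i + 1)) (cdif Y i)))"

inductive_set thick :: "'a::ring_1 cplx set \<Rightarrow> 'a cplx set" for S where
  base: "X \<in> S \<Longrightarrow> is_complex X \<Longrightarrow> X \<in> thick S"
| zero: "zero_cplx \<in> thick S"
| iso: "X \<in> thick S \<Longrightarrow> X \<simeq>\<^sub>K Y \<Longrightarrow> Y \<in> thick S"
| shft: "X \<in> thick S \<Longrightarrow> shift k X \<in> thick S"
| cne: "X \<in> thick S \<Longrightarrow> Y \<in> thick S \<Longrightarrow> chain_map X Y f \<Longrightarrow> cone X Y f \<in> thick S"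
| summand: "X \<oplus>\<^sub>K Y \<in> thick S \<Longrightarrow> is_complex X \<Longrightarrow> is_complex Y \<Longrightarrow> X \<in> thick S"

definition indec :: "'a::ring_1 cplx \<Rightarrow> bool" where
  "indec X \<longleftrightarrow> is_complex X \<and> \<not> X \<simeq>\<^sub>K zero_cplx \<and>
     (\<forall>Y Z. is_complex Y \<longrightarrow> is_complex Z \<longrightarrow> X \<simeq>\<^sub>K Y \<oplus>\<^sub>K Z \<longrightarrow>
        Y \<simeq>\<^sub>K zero_cplx \<or> Z \<simeq>\<^sub>K zero_cplx)"

definition iso_class :: "'a::ring_1 cplx \<Rightarrow> 'a cplx set" where
  "iso_class X = {Y. Y \<simeq>\<^sub>K X}"

definition num_summands :: "'a::ring_1 cplx \<Rightarrow> nat" where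
  "num_summands X = card (iso_class ` {Y. indec Y \<and> (\<exists>Z. is_complex Z \<and> X \<simeq>\<^sub>K Y \<oplus>\<^sub>K Z)})"

definition basic :: "'a::ring_1 cplx \<Rightarrow> bool" where
  "basic X \<longleftrightarrow> (\<exists>Ts. X \<simeq>\<^sub>K dsum_list Ts \<and> (\<forall>Y\<in>set Ts. indec Y) \<and>
      (\<forall>i j. i < j \<longrightarrow> j < length Ts \<longrightarrow> \<not> Ts ! i \<simeq>\<^sub>K Ts ! j))"

definition two_term :: "'a::ring_1 cplx \<Rightarrow> bool" where
  "two_term X \<longleftrightarrow> is_complex X \<and>
     (\<forall>i. i \<noteq> -1 \<and> i \<noteq> 0 \<longrightarrow> snd (cobj X i) = 0\<^sub>m (fst (cobj X i)) (fst (cobj X i)))"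

definition presilting :: "'a::ring_1 cplx \<Rightarrow> bool" where
  "presilting T \<longleftrightarrow> is_complex T \<and>
     (\<forall>l::nat. l > 0 \<longrightarrow> (\<forall>f. chain_map T (shift (int l) T) f \<longrightarrow>
                               null_homotopic T (shift (int l) T) f))"

definition silting :: "'a::ring_1 cplx \<Rightarrow> bool" where
  "silting T \<longleftrightarrow> presilting T \<and> (\<forall>X. is_complex X \<longrightarrow> X \<in> thick {T})"

definition alg_cplx :: "'a::ring_1 cplx" where
  "alg_cplx = ((\<lambda>i. if i = 0 then (1, 1\<^sub>m 1) else (0, 0\<^sub>m 0 0)),
               (\<lambda>i. if i = 0 then 0\<^sub>m 0 1 else if i = -1 then 0\<^sub>m 1 0 else 0\<^sub>m 0 0))"

definition g_finite :: "'a::ring_1 itself \<Rightarrow> bool" where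
  "g_finite _ \<longleftrightarrow> finite (iso_class ` {T :: 'a cplx. two_term T \<and> silting T \<and> basic T})"

definition psilt_count :: "'a::ring_1 itself \<Rightarrow> nat \<Rightarrow> nat" where
  "psilt_count _ j = card (iso_class `
      {T :: 'a cplx. two_term T \<and> presilting T \<and> basic T \<and> num_summands T = j})"

text \<open>f_(i-1) of Delta(A), with f_(-1) = 1.\<close>

definition fvec :: "'a::ring_1 itself \<Rightarrow> nat \<Rightarrow> int" where
  "fvec a i = (if i = 0 then 1 else int (psilt_count a i))"

definition hvec :: "'a::ring_1 itself \<Rightarrow> nat \<Rightarrow> nat \<Rightarrow> int" where
  "hvec a n j = (\<Sum>i = 0..j. (-1) ^ (j - i) * int ((n - i) choose (j - i)) * fvec a i)"

definition psilt_oplus_le_count :: "'a::ring_1 itself \<Rightarrow> nat \<Rightarrow> nat" where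
  "psilt_oplus_le_count _ l = card (iso_class `
      {T :: 'a cplx. two_term T \<and> presilting T \<and>
         (\<exists>Ts. length Ts \<le> l \<and> (\<forall>Y\<in>set Ts. indec Y) \<and> T \<simeq>\<^sub>K dsum_list Ts)})"

end

theory Submission
  imports Defs "HOL-Library.Multiset"
begin

text \<open>
  By the Krull-Schmidt theorem in the homotopy category, two-term presilting complexes correspond to
  multisets of indecomposable two-term classes whose support is a face of \<open>\<Delta>(A)\<close>. A face with \<open>i\<close>
  vertices supports \<open>l choose i\<close> multisets of size at most \<open>l\<close>, so the counting function is
  \<open>\<Sum>i. f_(i-1) * (l choose i)\<close>, and repeated differences turn the \<open>f\<close>-vector into the \<open>h\<close>-vector.

  Two facts make the sum meaningful. There are finitely many faces, since the Bongartz completion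
  places every presilting complex inside one of the finitely many silting ones. A face has at most
  \<open>n = |A|\<close> vertices: otherwise there is a linear relation between their \<open>g\<close>-vectors, that is, there
  are presilting complexes \<open>X\<close> and \<open>Y\<close> without common summands whose terms agree after adding
  contractible complexes, so that they are maps \<open>d, d' : P \<rightarrow> Q\<close>. Vanishing of extensions says that
  \<open>Hom(P, Q)\<close> is \<open>End(Q) d + d End(P)\<close>, and likewise for \<open>d'\<close>; comparing dimensions, \<open>coker d\<close> is
  generated by its image under endomorphisms of \<open>X\<close> factoring through \<open>Y\<close>. These are radical, hence
  \<open>d\<close> is a split surjection by Nakayama's lemma; likewise \<open>d'\<close>, and cancellation gives \<open>X \<simeq> Y\<close>.
\<close>

section \<open>Linear algebra in finitely spanned subspaces\<close>

context vector_space
begin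

lemma extend_to_finite_basis:
  assumes "C \<subseteq> V" "independent C" "V \<subseteq> span B" "finite B"
  obtains D where "C \<subseteq> D" "D \<subseteq> V" "independent D" "V \<subseteq> span D" "finite D"
proof -
  obtain D where D: "C \<subseteq> D" "D \<subseteq> V" "independent D" "V \<subseteq> span D"
    by (rule maximal_independent_subset_extend[OF assms(1,2)])
  then have "finite D" using independent_span_bound[OF assms(4)] assms(3) by blast
  then show thesis using that D by blast
qed

lemma finite_basis_exists:
  assumes "V \<subseteq> span B" "finite B"
  obtains C where "C \<subseteq> V" "independent C" "V \<subseteq> span C" "finite C"
  by (rule extend_to_finite_basis[OF empty_subsetI independent_empty assms]) (rule that)

lemma dim_strict_mono_finite_span:
  assumes subspace: "subspace S" and psubset: "S \<subset> T" and span: "T \<subseteq> span B" "finite B"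
  shows "dim S < dim T"
proof -
  obtain C where C: "C \<subseteq> S" "independent C" "S \<subseteq> span C"
    by (rule basis_exists[of S])
  obtain D where D: "C \<subseteq> D" "D \<subseteq> T" "independent D" "T \<subseteq> span D" "finite D"
    by (rule extend_to_finite_basis[OF _ C(2) span]) (use C(1) psubset in blast)
  have "C \<noteq> D"
    using span_minimal[OF C(1) subspace] D(4) psubset by blast
  then have "card C < card D" using D(1,5) by (meson psubsetI psubset_card_mono)
  then show ?thesis
    using basis_card_eq_dim[OF C(1,3,2)] basis_card_eq_dim[OF D(2,4,3)] by simp
qed

lemma descending_chain_stable:
  assumes subspaces: "\<And>n. subspace (K n)" and descending: "\<And>n. K (Suc n) \<subseteq> K n"
    and span: "K 0 \<subseteq> span B" "finite B"
  shows "\<exists>n::nat. K (Suc n) = K n"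
proof (rule ccontr)
  assume "\<not> ?thesis"
  then have strict: "K (Suc n) \<subset> K n" for n using descending[of n] by blast
  have "K n \<subseteq> K 0" for n by (induction n) (use descending in auto)
  then have less: "dim (K (Suc n)) < dim (K n)" for n
    using dim_strict_mono_finite_span[OF subspaces strict _ span(2)] span(1) by blast
  have "dim (K n) + n \<le> dim (K 0)" for n
  proof (induction n)
    case (Suc n) then show ?case using less[of n] by linarith
  qed simp
  from this[of "Suc (dim (K 0))"] show False by linarith
qed

lemma linear_with_kernel:
  assumes "subspace W"
  obtains \<pi> where "Vector_Spaces.linear scale scale \<pi>" "\<And>x. \<pi> x = 0 \<longleftrightarrow> x \<in> W"
proof -
  interpret vector_space_pair scale scale by unfold_locales
  obtain \<rho> where \<rho>: "range \<rho> \<subseteq> W" "Vector_Spaces.linear scale scale \<rho>" "\<And>x. x \<in> W \<Longrightarrow> \<rho> x = x"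
    using linear_exists_left_inverse_on[OF linear_id assms] by auto
  have "Vector_Spaces.linear scale scale (\<lambda>x. x - \<rho> x)"
    using linear_compose_sub[OF linear_id \<rho>(2)] by simp
  moreover have "x - \<rho> x = 0 \<longleftrightarrow> x \<in> W" for x
    using \<rho>(1,3) by (metis eq_iff_diff_eq_0 range_subsetD)
  ultimately show thesis using that by blast
qed

end

lemma (in vector_space_pair) linear_inj_on_kernel_complement:
  assumes lin: "Vector_Spaces.linear s1 s2 f" and D: "vs1.independent D" and C: "C \<subseteq> D"
    and kernel: "\<And>x. x \<in> vs1.span D \<Longrightarrow> f x = 0 \<Longrightarrow> x \<in> vs1.span C"
  shows "inj_on f (vs1.span (D - C))"
  unfolding linear_inj_on_iff_eq_0[OF lin vs1.subspace_span]
proof (intro ballI impI)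
  fix x assume x: "x \<in> vs1.span (D - C)" "f x = 0"
  then have x_D: "x \<in> vs1.span D" using vs1.span_mono[of "D - C" D] by blast
  then have "x \<in> vs1.span C" using x(2) by (rule kernel)
  then have "vs1.representation D x = vs1.representation C x"
    "vs1.representation D x = vs1.representation (D - C) x"
    using vs1.representation_extend[OF D] x(1) C by blast+
  then have "vs1.representation D x b = 0" for b
    using vs1.representation_ne_zero[of C x b] vs1.representation_ne_zero[of "D - C" x b] by force
  then show "x = 0" using vs1.sum_nonzero_representation_eq[OF D x_D] by simp
qed

lemma (in vector_space_pair) rank_nullity:
  assumes lin: "Vector_Spaces.linear s1 s2 f" and V: "vs1.subspace V" "V \<subseteq> vs1.span B" "finite B"
  shows "vs1.dim V = vs2.dim (f ` V) + vs1.dim {x\<in>V. f x = 0}"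
proof -
  let ?K = "{x\<in>V. f x = 0}"
  obtain C where C: "C \<subseteq> ?K" "vs1.independent C" "?K \<subseteq> vs1.span C"
    by (rule vs1.basis_exists[of ?K])
  have "C \<subseteq> V" using C(1) by blast
  then obtain D where D: "C \<subseteq> D" "D \<subseteq> V" "vs1.independent D" "V \<subseteq> vs1.span D" "finite D"
    by (rule vs1.extend_to_finite_basis[OF _ C(2) V(2,3)])
  define E where "E = D - C"
  have E: "E \<subseteq> D" "vs1.independent E" using vs1.independent_mono[OF D(3)] unfolding E_def by auto
  have "vs1.span D \<subseteq> V" by (rule vs1.span_minimal[OF D(2) V(1)])
  then have inj: "inj_on f (vs1.span E)"
    unfolding E_def using C(3) by (intro linear_inj_on_kernel_complement[OF lin D(3,1)]) blast
  have image_basis: "vs2.independent (f ` E)" "card (f ` E) = card E"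
    using linear_independent_injective_image[OF lin E(2) inj]
      card_image[OF inj_on_subset[OF inj vs1.span_superset]] by auto
  have "f ` D \<subseteq> vs2.span (f ` E)"
  proof
    fix y assume "y \<in> f ` D"
    then consider "y \<in> f ` C" | "y \<in> f ` E" unfolding E_def by blast
    then show "y \<in> vs2.span (f ` E)" using C(1) vs2.span_zero vs2.span_base by cases auto
  qed
  then have "f ` V \<subseteq> vs2.span (f ` E)"
    using D(4) linear_span_image[OF lin, of D] vs2.span_minimal[OF _ vs2.subspace_span] by blast
  then have "vs2.dim (f ` V) = card E"
    using vs2.basis_card_eq_dim[OF image_mono[OF order_trans[OF E(1) D(2)]] _ image_basis(1)]
      image_basis(2) by simp
  moreover have "card D = card E + card C"
    unfolding E_def using D(1,5) by (simp add: card_Diff_subset card_mono finite_subset)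
  ultimately show ?thesis
    unfolding vs1.basis_card_eq_dim[OF D(2,4,3), symmetric]
      vs1.basis_card_eq_dim[OF C(1,3,2), symmetric] by simp
qed

text \<open>By rank-nullity, the inclusion of kernels modulo \<open>W\<close> is an equality.\<close>

lemma (in vector_space) linear_preimages_coincide:
  assumes lin: "Vector_Spaces.linear scale scale f" "Vector_Spaces.linear scale scale g"
    and V: "subspace V" "V \<subseteq> span B" "finite B" and W: "subspace W"
    and image: "\<And>x. x \<in> V \<Longrightarrow> \<exists>y\<in>V. g x - f y \<in> W"
    and kernel: "\<And>x. x \<in> V \<Longrightarrow> g x \<in> W \<Longrightarrow> f x \<in> W"
    and x: "x \<in> V" "f x \<in> W"
  shows "g x \<in> W"
proof -
  interpret vector_space_pair scale scale by unfold_locales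
  obtain \<pi> where \<pi>: "Vector_Spaces.linear scale scale \<pi>" "\<And>x. \<pi> x = 0 \<longleftrightarrow> x \<in> W"
    using linear_with_kernel[OF W] by blast
  let ?f = "\<pi> \<circ> f" and ?g = "\<pi> \<circ> g"
  let ?Kf = "{x\<in>V. ?f x = 0}" and ?Kg = "{x\<in>V. ?g x = 0}"
  have lin_comp: "Vector_Spaces.linear scale scale ?f" "Vector_Spaces.linear scale scale ?g"
    by (rule Vector_Spaces.linear_compose[OF lin(1) \<pi>(1)],
      rule Vector_Spaces.linear_compose[OF lin(2) \<pi>(1)])
  have "?g ` V \<subseteq> ?f ` V"
  proof
    fix z assume "z \<in> ?g ` V"
    then obtain x where x: "x \<in> V" "z = ?g x" by blast
    then obtain y where "y \<in> V" "\<pi> (g x - f y) = 0" using image \<pi>(2) by blast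
    then show "z \<in> ?f ` V" using linear_diff[OF \<pi>(1)] x(2) by (intro image_eqI[of _ _ y]) simp_all
  qed
  moreover have "?f ` V \<subseteq> span (?f ` B)"
    unfolding linear_span_image[OF lin_comp(1)] using V(2) by (rule image_mono)
  ultimately have "dim (?g ` V) \<le> dim (?f ` V)"
    using dim_strict_mono_finite_span[OF linear_subspace_image[OF lin_comp(2) V(1)]
      _ _ finite_imageI[OF V(3)]]
    by (cases "?g ` V = ?f ` V") (auto simp: less_imp_le)
  then have "dim ?Kf \<le> dim ?Kg"
    using rank_nullity[OF lin_comp(1) V] rank_nullity[OF lin_comp(2) V] by simp
  moreover have "?Kg \<subseteq> ?Kf" using kernel \<pi>(2) by auto
  moreover have "subspace ?Kg"
    using subspace_inter[OF V(1) linear_subspace_kernel[OF lin_comp(2)]] by (simp add: Int_def)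
  moreover have "?Kf \<subseteq> span B" using V(2) by blast
  ultimately have "\<not> ?Kg \<subset> ?Kf" "?Kg \<subseteq> ?Kf"
    using dim_strict_mono_finite_span[of ?Kg ?Kf B] V(3) leD by blast+
  then have "?Kf = ?Kg" by blast
  then show ?thesis using x \<pi>(2) by auto
qed

section \<open>Algebras whose corners are finite dimensional\<close>

text \<open>For idempotents \<open>P\<close> and \<open>Q\<close>, these are the homomorphisms from the image of \<open>P\<close> to that
  of \<open>Q\<close>.\<close>

definition corner :: "'b::ring \<Rightarrow> 'b \<Rightarrow> 'b set" where
  "corner P Q = {x. Q * x = x \<and> x * P = x}"

lemma cornerI: "Q * x = x \<Longrightarrow> x * P = x \<Longrightarrow> x \<in> corner P Q"
  unfolding corner_def by auto

lemma cornerD: "x \<in> corner P Q \<Longrightarrow> Q * x = x" "x \<in> corner P Q \<Longrightarrow> x * P = x"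
  unfolding corner_def by auto

lemma corner_mult: "y \<in> corner Q R \<Longrightarrow> x \<in> corner P Q \<Longrightarrow> y * x \<in> corner P R"
  by (rule cornerI) (simp add: cornerD mult.assoc[symmetric], simp add: cornerD mult.assoc)

lemma corner_add: "x \<in> corner P Q \<Longrightarrow> y \<in> corner P Q \<Longrightarrow> x + y \<in> corner P Q"
  and corner_diff: "x \<in> corner P Q \<Longrightarrow> y \<in> corner P Q \<Longrightarrow> x - y \<in> corner P Q"
  and corner_zero: "0 \<in> corner P Q"
  and corner_uminus: "x \<in> corner P Q \<Longrightarrow> - x \<in> corner P Q"
  unfolding corner_def by (auto simp: algebra_simps)

lemma corner_sandwich: "P * P = P \<Longrightarrow> Q * Q = Q \<Longrightarrow> Q * x * P \<in> corner P Q"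
  by (rule cornerI) (simp add: mult.assoc[symmetric], simp add: mult.assoc)

lemma corner_orthogonal:
  assumes "x \<in> corner Q R" "y \<in> corner A B" "Q * B = 0"
  shows "x * y = 0"
proof -
  have "x * y = (x * Q) * (B * y)" using assms(1,2) by (simp add: cornerD)
  also have "\<dots> = x * (Q * B) * y" by (simp add: mult.assoc)
  finally show ?thesis using assms(3) by simp
qed

lemma corner_sum_cancel:
  assumes "x \<in> corner Q Q" "x' \<in> corner Q Q" "y \<in> corner P P" "y' \<in> corner P P"
    "Q * P = 0" "x + y = x' + y'"
  shows "x = x'"
proof -
  have "Q * y = 0" "Q * y' = 0"
    using cornerD(1)[OF assms(3)] cornerD(1)[OF assms(4)] assms(5)
    by (metis mult.assoc mult_zero_left)+
  then have "Q * x = Q * x'" using arg_cong[OF assms(6), of "\<lambda>z. Q * z"] by (simp add: distrib_left)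
  then show ?thesis using cornerD(1)[OF assms(1)] cornerD(1)[OF assms(2)] by simp
qed

lemma corner_subset_corner: "P \<in> corner E E \<Longrightarrow> Q \<in> corner E E \<Longrightarrow> corner P Q \<subseteq> corner E E"
  unfolding corner_def by (auto; metis mult.assoc)

locale ring_algebra = vector_space scale
  for scale :: "'k::field \<Rightarrow> 'b::ring \<Rightarrow> 'b" +
  assumes scale_mult_left: "scale c x * y = scale c (x * y)"
    and scale_mult_right: "x * scale c y = scale c (x * y)"
begin

lemma linear_mult_left: "Vector_Spaces.linear scale scale (\<lambda>x. y * x)"
  and linear_mult_right: "Vector_Spaces.linear scale scale (\<lambda>x. x * y)"
  by (simp_all add: Vector_Spaces.linear_iff vector_space_axioms distrib_left distrib_right
    scale_mult_left scale_mult_right)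

lemma subspace_image_mult_left: "subspace V \<Longrightarrow> subspace ((\<lambda>x. y * x) ` V)"
  and subspace_image_mult_right: "subspace V \<Longrightarrow> subspace ((\<lambda>x. x * y) ` V)"
  and subspace_vimage_mult_left: "subspace V \<Longrightarrow> subspace {x. y * x \<in> V}"
  and subspace_vimage_mult_right: "subspace V \<Longrightarrow> subspace {x. x * y \<in> V}"
proof -
  interpret vector_space_pair scale scale by unfold_locales
  show "subspace V \<Longrightarrow> subspace ((\<lambda>x. y * x) ` V)" "subspace V \<Longrightarrow> subspace ((\<lambda>x. x * y) ` V)"
    "subspace V \<Longrightarrow> subspace {x. y * x \<in> V}" "subspace V \<Longrightarrow> subspace {x. x * y \<in> V}"
    by (rule linear_subspace_image linear_subspace_linear_preimage,
      rule linear_mult_left linear_mult_right, assumption)+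
qed

lemma subspace_corner: "subspace (corner P Q)"
  unfolding corner_def
  by (rule subspaceI) (auto simp: distrib_left distrib_right scale_mult_left scale_mult_right)

lemma span_mult_subset:
  assumes "subspace V" "\<And>a b. a \<in> A \<Longrightarrow> b \<in> B \<Longrightarrow> a * b \<in> V" "x \<in> span A" "y \<in> span B"
  shows "x * y \<in> V"
proof -
  have "a * y \<in> V" if "a \<in> A" for a
    using span_minimal[OF _ subspace_vimage_mult_left[OF assms(1), of a]] assms(2,4) that by blast
  then show ?thesis
    using span_minimal[OF _ subspace_vimage_mult_right[OF assms(1), of y]] assms(3) by blast
qed

lemma span_commute:
  assumes "\<And>a b. a \<in> A \<Longrightarrow> b \<in> A \<Longrightarrow> a * b = b * a" "x \<in> span A" "y \<in> span A"
  shows "x * y = y * x"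
proof -
  have subspace_centralizer: "subspace {x. x * y = y * x}" for y
    by (rule subspaceI) (auto simp: distrib_left distrib_right scale_mult_left scale_mult_right)
  have "a * y = y * a" if "a \<in> A" for a
    using span_minimal[OF _ subspace_centralizer[of a], of A] assms(1,3) that by force
  then show ?thesis
    using span_minimal[OF _ subspace_centralizer[of y], of A] assms(2) by blast
qed

definition product_span :: "'b set \<Rightarrow> 'b set \<Rightarrow> 'b set" where
  "product_span A B = span {a * b | a b. a \<in> A \<and> b \<in> B}"

lemma subspace_product_span: "subspace (product_span A B)"
  unfolding product_span_def by (rule subspace_span)

lemma product_spanI: "a \<in> A \<Longrightarrow> b \<in> B \<Longrightarrow> a * b \<in> product_span A B"
  unfolding product_span_def by (rule span_base) blast

lemma product_span_subset:
  assumes "subspace V" "\<And>a b. a \<in> A \<Longrightarrow> b \<in> B \<Longrightarrow> a * b \<in> V" shows "product_span A B \<subseteq> V"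
  unfolding product_span_def by (rule span_minimal[OF _ assms(1)]) (use assms(2) in blast)

lemma product_span_induct [consumes 2, case_names zero add]:
  assumes "x \<in> product_span A B" "subspace B"
    and "R 0" "\<And>a b y. a \<in> A \<Longrightarrow> b \<in> B \<Longrightarrow> R y \<Longrightarrow> R (a * b + y)"
  shows "R x"
  using assms(1) unfolding product_span_def
proof (induction rule: span_induct_alt)
  case base
  then show ?case by (rule assms(3))
next
  case (step c x y)
  then obtain a b where "x = a * b" "a \<in> A" "b \<in> B" by blast
  then show ?case
    using assms(4)[of a "scale c b" y] step(2) subspace_scale[OF assms(2)]
    by (simp add: scale_mult_right)
qed

lemma product_span_mult_right:
  assumes "x \<in> product_span A B" "\<And>b. b \<in> B \<Longrightarrow> b * y \<in> C" shows "x * y \<in> product_span A C"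
  using product_span_subset[OF subspace_vimage_mult_right[OF subspace_product_span], of A B y A C]
    assms
  by (auto simp: mult.assoc product_spanI)

lemma product_span_mult_left:
  assumes "x \<in> product_span A B" "\<And>a. a \<in> A \<Longrightarrow> y * a \<in> C" shows "y * x \<in> product_span C B"
  using product_span_subset[OF subspace_vimage_mult_left[OF subspace_product_span], of A B y C B]
    assms
  by (auto simp: mult.assoc[symmetric] product_spanI)

end

locale corner_finite_algebra = ring_algebra +
  assumes corner_finitely_spanned: "\<exists>B. finite B \<and> corner P Q \<subseteq> span B"
begin

lemma dim_corner_strict_mono:
  assumes g: "g \<in> corner e e" "g \<noteq> e" and e: "e * e = e"
  shows "dim (corner g g) < dim (corner e e)"
proof -
  obtain B where B: "finite B" "corner e e \<subseteq> span B" using corner_finitely_spanned by blast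
  have "e \<in> corner e e" "e \<notin> corner g g" using e g(2) cornerD[OF g(1)] unfolding corner_def by auto
  then have "corner g g \<subset> corner e e" using corner_subset_corner[OF g(1,1)] by blast
  then show ?thesis by (rule dim_strict_mono_finite_span[OF subspace_corner _ B(2,1)])
qed

end

subsection \<open>Fitting's lemma\<close>

primrec corner_power :: "'b::ring \<Rightarrow> 'b \<Rightarrow> nat \<Rightarrow> 'b" where
  "corner_power e f 0 = e"
| "corner_power e f (Suc n) = f * corner_power e f n"

lemma corner_power_mem: "e * e = e \<Longrightarrow> f \<in> corner e e \<Longrightarrow> corner_power e f n \<in> corner e e"
  by (induction n) (auto intro: cornerI corner_mult)

lemma corner_power_add:
  assumes "e * e = e" "f \<in> corner e e"
  shows "corner_power e f (m + n) = corner_power e f m * corner_power e f n"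
proof (induction m)
  case 0 then show ?case using cornerD(1)[OF corner_power_mem[OF assms]] by simp
qed (simp add: mult.assoc)

lemma corner_power_geometric_sum:
  assumes "e * e = e" "f \<in> corner e e"
  shows "(\<Sum>i<n. corner_power e f i) * (e - f) = e - corner_power e f n"
proof (induction n)
  case (Suc n)
  have "corner_power e f n * (e - f) = corner_power e f n - corner_power e f (Suc n)"
    using corner_power_add[OF assms, of n 1] cornerD(2)[OF corner_power_mem[OF assms]]
      cornerD(2)[OF assms(2)]
    by (simp add: right_diff_distrib)
  then show ?case using Suc by (simp only: sum.lessThan_Suc distrib_right) simp
qed (simp add: assms)

context corner_finite_algebra
begin

definition power_span :: "'b \<Rightarrow> 'b \<Rightarrow> 'b set" where
  "power_span e f = span (range (corner_power e f))"

context
  fixes e f :: 'b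
  assumes e: "e * e = e" and f: "f \<in> corner e e"
begin

lemma subspace_power_span: "subspace (power_span e f)"
  unfolding power_span_def by (rule subspace_span)

lemma corner_power_in_power_span: "corner_power e f n \<in> power_span e f"
  unfolding power_span_def by (intro span_base rangeI)

lemma power_span_subset_corner: "power_span e f \<subseteq> corner e e"
  unfolding power_span_def using corner_power_mem[OF e f]
  by (intro span_minimal subspace_corner) blast

lemma power_span_mult: "x \<in> power_span e f \<Longrightarrow> y \<in> power_span e f \<Longrightarrow> x * y \<in> power_span e f"
  unfolding power_span_def
  by (rule span_mult_subset[OF subspace_span, rotated])
     (auto simp: corner_power_add[OF e f, symmetric] intro: span_base)

lemma power_span_commute: "x \<in> power_span e f \<Longrightarrow> y \<in> power_span e f \<Longrightarrow> x * y = y * x"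
  unfolding power_span_def
  by (rule span_commute) (auto simp: corner_power_add[OF e f, symmetric] add.commute)

lemma strongly_pi_regular:
  obtains m y where "y \<in> power_span e f"
    "corner_power e f (Suc m) * corner_power e f (Suc m) * y = corner_power e f (Suc m)"
proof -
  let ?p = "corner_power e f"
  define K where "K n = span (?p ` {2 ^ n..})" for n :: nat
  obtain B where B: "finite B" "corner e e \<subseteq> span B" using corner_finitely_spanned by blast
  have "K 0 \<subseteq> corner e e"
    unfolding K_def using corner_power_mem[OF e f] by (intro span_minimal subspace_corner) blast
  then have "K 0 \<subseteq> span B" using B(2) by (rule order_trans)
  moreover have "K (Suc n) \<subseteq> K n" for n unfolding K_def by (intro span_mono image_mono) auto
  ultimately obtain n where "K (Suc n) = K n"
    using descending_chain_stable[OF _ _ _ B(1), of K] unfolding K_def by blast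
  then have "?p (2 ^ n) \<in> K (Suc n)" unfolding K_def by (auto intro: span_base)
  moreover have "K (Suc n) \<subseteq> (\<lambda>y. ?p (2 ^ n) * ?p (2 ^ n) * y) ` power_span e f"
    unfolding K_def
  proof (rule span_minimal[OF _ subspace_image_mult_left[OF subspace_power_span]], rule subsetI)
    fix x assume "x \<in> ?p ` {2 ^ Suc n..}"
    then obtain k where k: "x = ?p k" "2 ^ n + 2 ^ n \<le> k" by auto
    then have "x = ?p (2 ^ n) * ?p (2 ^ n) * ?p (k - (2 ^ n + 2 ^ n))"
      unfolding corner_power_add[OF e f, symmetric] by simp
    then show "x \<in> (\<lambda>y. ?p (2 ^ n) * ?p (2 ^ n) * y) ` power_span e f"
      using corner_power_in_power_span by blast
  qed
  ultimately obtain y where "y \<in> power_span e f" "?p (2 ^ n) * ?p (2 ^ n) * y = ?p (2 ^ n)" by auto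
  then show thesis using that[of y "2 ^ n - 1"] by simp
qed

text \<open>The idempotent \<open>g\<close> projects onto the part of the image of \<open>e\<close> on which \<open>f\<close> is invertible; on the
  complementary part \<open>f\<close> is nilpotent and hence \<open>e - f\<close> is invertible.\<close>

lemma fitting:
  assumes S: "subspace S" "\<And>x y. x \<in> S \<Longrightarrow> y \<in> S \<Longrightarrow> x * y \<in> S" "e \<in> S" "f \<in> S"
  obtains g u v where "g \<in> S" "u \<in> S" "v \<in> S" "g * g = g" "g \<in> corner e e"
    "f * u = g" "u * f = g" "(e - f) * v = e - g" "v * (e - f) = e - g"
proof -
  let ?p = "corner_power e f" and ?P = "power_span e f"
  have "range ?p \<subseteq> S"
  proof (rule image_subsetI)
    fix n show "?p n \<in> S" by (induction n) (auto intro: S)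
  qed
  then have power_span_S: "?P \<subseteq> S" unfolding power_span_def by (rule span_minimal[OF _ S(1)])
  obtain m y where y: "y \<in> ?P" "?p (Suc m) * ?p (Suc m) * y = ?p (Suc m)"
    by (rule strongly_pi_regular)
  define g u r where "g = ?p (Suc m) * y" and "u = ?p m * y" and "r = (\<Sum>i<Suc m. ?p i)"
  have e_mem: "e \<in> ?P" and f_mem: "f \<in> ?P"
    using corner_power_in_power_span[of 0] corner_power_in_power_span[of 1] cornerD(2)[OF f]
    by simp_all
  have mem: "g \<in> ?P" "u \<in> ?P" "r \<in> ?P" "e - g \<in> ?P" "e - f \<in> ?P"
    unfolding g_def u_def r_def
    by (intro power_span_mult corner_power_in_power_span y(1) subspace_sum[OF subspace_power_span]
        subspace_diff[OF subspace_power_span] e_mem f_mem)+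
  then have v_mem: "(e - g) * r \<in> ?P" by (intro power_span_mult)
  have g_power: "g * ?p (Suc m) = ?p (Suc m)"
    unfolding g_def using y(2)
    by (simp only: mult.assoc power_span_commute[OF y(1) corner_power_in_power_span])
  then have g_idem: "g * g = g" unfolding g_def by (metis mult.assoc)
  have g_corner: "g \<in> corner e e" using mem(1) power_span_subset_corner by blast
  have fu: "f * u = g" unfolding u_def g_def by (simp add: mult.assoc)
  have "(e - g) * r * (e - f) = (e - g) * (e - ?p (Suc m))"
    unfolding r_def by (simp only: mult.assoc corner_power_geometric_sum[OF e f])
  also have "\<dots> = e - g"
    using cornerD[OF g_corner] cornerD(1)[OF corner_power_mem[OF e f]] g_power e
    by (simp only: left_diff_distrib right_diff_distrib) simp
  finally have v: "(e - g) * r * (e - f) = e - g" .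
  show thesis
  proof (rule that[of g u "(e - g) * r"])
    show "g \<in> S" "u \<in> S" "(e - g) * r \<in> S" using mem v_mem power_span_S by blast+
    show "u * f = g" "(e - f) * ((e - g) * r) = e - g"
      using fu v power_span_commute[OF f_mem mem(2)] power_span_commute[OF mem(5) v_mem] by simp_all
  qed (fact g_idem g_corner fu v)+
qed

end

end

subsection \<open>Nakayama's lemma\<close>

definition (in ring_algebra) module_span :: "'b set \<Rightarrow> 'b set \<Rightarrow> 'b set \<Rightarrow> 'b set" where
  "module_span Z N G = span (N \<union> {z * g | z g. z \<in> Z \<and> g \<in> G})"

context ring_algebra
begin

context
  fixes Z N :: "'b set"
  assumes Z: "subspace Z" "\<And>x y. x \<in> Z \<Longrightarrow> y \<in> Z \<Longrightarrow> x * y \<in> Z"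
    and N: "subspace N" "\<And>z x. z \<in> Z \<Longrightarrow> x \<in> N \<Longrightarrow> z * x \<in> N"
begin

lemma subspace_module_span: "subspace (module_span Z N G)"
  unfolding module_span_def by (rule subspace_span)

lemma module_span_base: "N \<subseteq> module_span Z N G"
  unfolding module_span_def by (rule order_trans[OF Un_upper1 span_superset])

lemma module_span_generator: "z \<in> Z \<Longrightarrow> g \<in> G \<Longrightarrow> z * g \<in> module_span Z N G"
  unfolding module_span_def by (rule span_base) blast

lemma module_span_minimal:
  assumes "subspace V" "N \<subseteq> V" "\<And>z g. z \<in> Z \<Longrightarrow> g \<in> G \<Longrightarrow> z * g \<in> V"
  shows "module_span Z N G \<subseteq> V"
  unfolding module_span_def by (rule span_minimal[OF _ assms(1)]) (use assms(2,3) in blast)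

lemma module_span_empty: "module_span Z N {} = N"
  unfolding module_span_def using N(1) by simp

lemma module_span_mult:
  assumes "z \<in> Z" "x \<in> module_span Z N G" shows "z * x \<in> module_span Z N G"
proof -
  have "module_span Z N G \<subseteq> {x. z * x \<in> module_span Z N G}"
  proof (rule module_span_minimal[OF subspace_vimage_mult_left[OF subspace_module_span]])
    show "N \<subseteq> {x. z * x \<in> module_span Z N G}"
      using N(2)[OF assms(1)] module_span_base by blast
    show "w * g \<in> {x. z * x \<in> module_span Z N G}" if "w \<in> Z" "g \<in> G" for w g
      using module_span_generator[OF Z(2)[OF assms(1) that(1)] that(2)] by (simp add: mult.assoc)
  qed
  then show ?thesis using assms(2) by blast
qed

lemma module_span_insertE:
  assumes "x \<in> module_span Z N (insert g G)"
  obtains y z where "y \<in> module_span Z N G" "z \<in> Z" "x = y + z * g"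
proof -
  let ?V = "{y + w | y w. y \<in> module_span Z N G \<and> w \<in> (\<lambda>z. z * g) ` Z}"
  have "module_span Z N (insert g G) \<subseteq> ?V"
  proof (rule module_span_minimal)
    show "subspace ?V" by (intro subspace_sums subspace_module_span subspace_image_mult_right Z(1))
    have zero: "0 \<in> module_span Z N G" "0 \<in> (\<lambda>z. z * g) ` Z"
      using subspace_0[OF subspace_module_span] subspace_0[OF subspace_image_mult_right[OF Z(1)]]
      by auto
    show "N \<subseteq> ?V"
    proof
      fix x assume "x \<in> N"
      then have "x = x + 0 \<and> x \<in> module_span Z N G" using module_span_base by auto
      then show "x \<in> ?V" using zero(2) by blast
    qed
    fix z h assume zh: "z \<in> Z" "h \<in> insert g G"
    then consider "z * h = 0 + z * g" | "z * h = z * h + 0" "z * h \<in> module_span Z N G"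
      using module_span_generator by fastforce
    then show "z * h \<in> ?V" using zero zh(1) by cases blast+
  qed
  then show thesis using assms that by blast
qed

text \<open>Modulo \<open>N\<close> and the span of the other generators, \<open>g\<close> equals \<open>a * g\<close> for some \<open>a\<close>
  in the radical \<open>I\<close>.\<close>

lemma redundant_generator:
  assumes I: "subspace I" "I \<subseteq> Z" "\<And>a z. a \<in> I \<Longrightarrow> z \<in> Z \<Longrightarrow> a * z \<in> I"
    and left_inverse: "\<And>a. a \<in> I \<Longrightarrow> \<exists>v\<in>Z. v * (g - a * g) - g \<in> N"
    and M: "M \<subseteq> module_span Z N (insert g G)"
    and g: "x \<in> N" "y \<in> product_span I M" "g = x + y"
  shows "g \<in> module_span Z N G"
proof -
  let ?S = "module_span Z N G"
  let ?V = "{l + w | l w. l \<in> ?S \<and> w \<in> (\<lambda>a. a * g) ` I}"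
  have "product_span I M \<subseteq> ?V"
  proof (rule product_span_subset)
    show "subspace ?V" by (intro subspace_sums subspace_module_span subspace_image_mult_right I(1))
    fix a m assume am: "a \<in> I" "m \<in> M"
    obtain l z where lz: "l \<in> ?S" "z \<in> Z" "m = l + z * g" using module_span_insertE M am(2) by blast
    have "a * m = a * l + (a * z) * g" using lz(3) by (simp add: distrib_left mult.assoc)
    moreover have "a * l \<in> ?S" using am(1) I(2) lz(1) by (intro module_span_mult) auto
    ultimately show "a * m \<in> ?V" using I(3)[OF am(1) lz(2)] by blast
  qed
  then obtain l a where la: "l \<in> ?S" "a \<in> I" "y = l + a * g" using g(2) by blast
  obtain v where v: "v \<in> Z" "v * (g - a * g) - g \<in> N" using left_inverse[OF la(2)] by blast
  have x: "x \<in> ?S" using g(1) module_span_base by blast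
  have "g - a * g = x + l" using g(3) la(3) by (metis add.assoc add_diff_cancel_right')
  then have "v * (g - a * g) \<in> ?S"
    using module_span_mult[OF v(1)] subspace_add[OF subspace_module_span x la(1)] by simp
  moreover have "v * (g - a * g) - g \<in> ?S" using v(2) module_span_base by blast
  ultimately show ?thesis using subspace_diff[OF subspace_module_span] by fastforce
qed

lemma nakayama:
  assumes I: "subspace I" "I \<subseteq> Z" "\<And>a z. a \<in> I \<Longrightarrow> z \<in> Z \<Longrightarrow> a * z \<in> I"
    and unit: "q \<in> Z" "\<And>m. m \<in> M \<Longrightarrow> q * m = m"
    and M: "M \<subseteq> span B" "finite B"
    and generated: "\<And>m. m \<in> M \<Longrightarrow> \<exists>x\<in>N. \<exists>y\<in>product_span I M. m = x + y"
    and left_inverse: "\<And>a m. a \<in> I \<Longrightarrow> m \<in> M \<Longrightarrow> \<exists>v\<in>Z. v * (m - a * m) - m \<in> N"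
  shows "M \<subseteq> N"
proof -
  have drop_generators: "M \<subseteq> N" if "finite G" "G \<subseteq> M" "M \<subseteq> module_span Z N G" for G
    using that
  proof (induction G rule: finite_induct)
    case empty
    then show ?case unfolding module_span_empty by simp
  next
    case (insert g G)
    have "g \<in> M" using insert.prems(1) by simp
    obtain x y where "x \<in> N" "y \<in> product_span I M" "g = x + y" using generated[OF \<open>g \<in> M\<close>] by blast
    then have "g \<in> module_span Z N G"
      using redundant_generator[OF I left_inverse[OF _ \<open>g \<in> M\<close>] insert.prems(2)] by blast
    then have "module_span Z N (insert g G) \<subseteq> module_span Z N G"
      by (intro module_span_minimal subspace_module_span module_span_base)
        (auto intro: module_span_generator module_span_mult)
    then show ?case using insert.prems insert.IH by blast
  qed
  obtain C where C: "C \<subseteq> M" "M \<subseteq> span C" "finite C" by (rule finite_basis_exists[OF M]) blast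
  have "C \<subseteq> module_span Z N C"
  proof
    fix c assume "c \<in> C"
    then show "c \<in> module_span Z N C"
      using module_span_generator[OF unit(1), of c C] unit(2)[of c] C(1) by auto
  qed
  then have "M \<subseteq> module_span Z N C" using C(2) span_minimal[OF _ subspace_module_span] by blast
  then show ?thesis by (rule drop_generators[OF C(3,1)])
qed

end

end

subsection \<open>Maps of idempotents without extensions\<close>

text \<open>Every homomorphism from the complex \<open>d\<^sub>1 : P \<rightarrow> Q\<close> to the shift of \<open>d\<^sub>2 : P \<rightarrow> Q\<close> is
  null-homotopic.\<close>

definition ext1_zero :: "'b::ring \<Rightarrow> 'b \<Rightarrow> 'b \<Rightarrow> 'b \<Rightarrow> bool" where
  "ext1_zero P Q d\<^sub>1 d\<^sub>2 \<longleftrightarrow> (\<forall>b\<in>corner P Q. \<exists>h\<in>corner P P. \<exists>k\<in>corner Q Q. b = k * d\<^sub>1 + d\<^sub>2 * h)"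

text \<open>The degree zero components of chain maps from \<open>d\<^sub>1 : P \<rightarrow> Q\<close> to \<open>d\<^sub>2 : P \<rightarrow> Q\<close>.\<close>

definition target_maps :: "'b::ring \<Rightarrow> 'b \<Rightarrow> 'b \<Rightarrow> 'b \<Rightarrow> 'b set" where
  "target_maps P Q d\<^sub>1 d\<^sub>2 = {\<phi>\<in>corner Q Q. \<exists>\<rho>\<in>corner P P. \<phi> * d\<^sub>1 = d\<^sub>2 * \<rho>}"

lemma target_mapsI: "\<phi> \<in> corner Q Q \<Longrightarrow> \<rho> \<in> corner P P \<Longrightarrow> \<phi> * d\<^sub>1 = d\<^sub>2 * \<rho> \<Longrightarrow> \<phi> \<in> target_maps P Q d\<^sub>1 d\<^sub>2"
  unfolding target_maps_def by blast

lemma target_mapsE: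
  assumes "\<phi> \<in> target_maps P Q d\<^sub>1 d\<^sub>2"
  obtains \<rho> where "\<phi> \<in> corner Q Q" "\<rho> \<in> corner P P" "\<phi> * d\<^sub>1 = d\<^sub>2 * \<rho>"
  using assms unfolding target_maps_def by blast

lemma target_maps_corner: "target_maps P Q d\<^sub>1 d\<^sub>2 \<subseteq> corner Q Q"
  unfolding target_maps_def by blast

lemma target_maps_mult:
  assumes \<psi>: "\<psi> \<in> target_maps P Q d\<^sub>2 d\<^sub>3" and \<phi>: "\<phi> \<in> target_maps P Q d\<^sub>1 d\<^sub>2"
  shows "\<psi> * \<phi> \<in> target_maps P Q d\<^sub>1 d\<^sub>3"
proof -
  obtain \<rho> where \<rho>: "\<phi> \<in> corner Q Q" "\<rho> \<in> corner P P" "\<phi> * d\<^sub>1 = d\<^sub>2 * \<rho>"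
    using \<phi> by (rule target_mapsE)
  obtain \<sigma> where \<sigma>: "\<psi> \<in> corner Q Q" "\<sigma> \<in> corner P P" "\<psi> * d\<^sub>2 = d\<^sub>3 * \<sigma>"
    using \<psi> by (rule target_mapsE)
  have "\<psi> * \<phi> * d\<^sub>1 = d\<^sub>3 * (\<sigma> * \<rho>)" using \<rho>(3) \<sigma>(3) by (metis mult.assoc)
  then show ?thesis
    using corner_mult[OF \<sigma>(1) \<rho>(1)] corner_mult[OF \<sigma>(2) \<rho>(2)] by (intro target_mapsI)
qed

context corner_finite_algebra
begin

lemma subspace_target_maps: "subspace (target_maps P Q d\<^sub>1 d\<^sub>2)"
proof (rule subspaceI)
  show "0 \<in> target_maps P Q d\<^sub>1 d\<^sub>2" by (rule target_mapsI[OF corner_zero corner_zero]) simp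
next
  fix x y assume "x \<in> target_maps P Q d\<^sub>1 d\<^sub>2" "y \<in> target_maps P Q d\<^sub>1 d\<^sub>2"
  then obtain r s where "x \<in> corner Q Q" "r \<in> corner P P" "x * d\<^sub>1 = d\<^sub>2 * r"
    "y \<in> corner Q Q" "s \<in> corner P P" "y * d\<^sub>1 = d\<^sub>2 * s" by (elim target_mapsE)
  then show "x + y \<in> target_maps P Q d\<^sub>1 d\<^sub>2"
    by (intro target_mapsI[of _ _ "r + s"]) (auto simp: corner_add distrib_left distrib_right)
next
  fix c x assume "x \<in> target_maps P Q d\<^sub>1 d\<^sub>2"
  then obtain r where "x \<in> corner Q Q" "r \<in> corner P P" "x * d\<^sub>1 = d\<^sub>2 * r" by (rule target_mapsE)
  then show "scale c x \<in> target_maps P Q d\<^sub>1 d\<^sub>2"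
    by (intro target_mapsI[of _ _ "scale c r"])
       (auto simp: subspace_scale[OF subspace_corner] scale_mult_left scale_mult_right)
qed

definition image_trace :: "'b \<Rightarrow> 'b \<Rightarrow> 'b \<Rightarrow> 'b set \<Rightarrow> 'b \<Rightarrow> 'b set" where
  "image_trace P Q d J U = {x + y | x y. x \<in> (\<lambda>c. d * c) ` corner U P \<and>
      y \<in> product_span J (corner U Q)}"

lemma image_traceI:
  "c \<in> corner U P \<Longrightarrow> y \<in> product_span J (corner U Q) \<Longrightarrow> x = d * c + y \<Longrightarrow> x \<in> image_trace P Q d J U"
  unfolding image_trace_def by blast

lemma image_traceE:
  assumes "x \<in> image_trace P Q d J U"
  obtains c y where "c \<in> corner U P" "y \<in> product_span J (corner U Q)" "x = d * c + y"
  using assms unfolding image_trace_def by blast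

lemma subspace_image_trace: "subspace (image_trace P Q d J U)"
  unfolding image_trace_def
  by (intro subspace_sums subspace_image_mult_left subspace_corner subspace_product_span)

lemma image_trace_mult:
  assumes "x \<in> image_trace P Q d J U" "y \<in> corner V U" shows "x * y \<in> image_trace P Q d J V"
proof -
  obtain c z where cz: "c \<in> corner U P" "z \<in> product_span J (corner U Q)" "x = d * c + z"
    using assms(1) by (rule image_traceE)
  have "z * y \<in> product_span J (corner V Q)"
    using cz(2) by (rule product_span_mult_right) (rule corner_mult[OF _ assms(2)])
  then show ?thesis
    using corner_mult[OF cz(1) assms(2)] cz(3) by (intro image_traceI)
      (auto simp: distrib_right mult.assoc)
qed

lemma product_span_target_maps_corner:
  "product_span (target_maps P Q d\<^sub>1 d\<^sub>2) (corner U Q) \<subseteq> corner U Q"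
  by (intro product_span_subset subspace_corner corner_mult)
    (auto intro: subsetD[OF target_maps_corner])

lemma trace_factorization:
  assumes ext: "ext1_zero P Q d' d'" and z: "z \<in> product_span (target_maps P Q d' d) (corner P Q)"
  obtains r w where "r \<in> corner P P" "w \<in> product_span (target_maps P Q d' d) (corner Q Q)"
    "z = d * r + w * d'"
proof -
  let ?J = "target_maps P Q d' d"
  let ?V = "{x + y | x y. x \<in> (\<lambda>r. d * r) ` corner P P \<and>
      y \<in> (\<lambda>w. w * d') ` product_span ?J (corner Q Q)}"
  have "product_span ?J (corner P Q) \<subseteq> ?V"
  proof (rule product_span_subset)
    show "subspace ?V"
      by (intro subspace_sums subspace_image_mult_left subspace_image_mult_right subspace_corner
        subspace_product_span)
    fix a b assume a: "a \<in> ?J" and b: "b \<in> corner P Q"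
    obtain h k where hk: "h \<in> corner P P" "k \<in> corner Q Q" "b = k * d' + d' * h"
      using ext b unfolding ext1_zero_def by blast
    obtain s where s: "s \<in> corner P P" "a * d' = d * s" using a by (rule target_mapsE)
    have "a * b = a * k * d' + a * d' * h" using hk(3) by (simp add: distrib_left mult.assoc)
    then have "a * b = d * (s * h) + (a * k) * d'" using s(2) by (simp add: mult.assoc add.commute)
    then show "a * b \<in> ?V" using corner_mult[OF s(1) hk(1)] product_spanI[OF a hk(2)] by blast
  qed
  then show thesis using z that by blast
qed

lemma image_trace_reflected:
  assumes Q: "Q * Q = Q" and ext: "ext1_zero P Q d' d'"
    and x: "x \<in> corner Q Q" "x * d' \<in> image_trace P Q d (target_maps P Q d' d) P"
  shows "x \<in> image_trace P Q d (target_maps P Q d' d) Q"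
proof -
  let ?J = "target_maps P Q d' d"
  obtain c z where cz: "c \<in> corner P P" "z \<in> product_span ?J (corner P Q)" "x * d' = d * c + z"
    using x(2) by (rule image_traceE)
  obtain r w where rw: "r \<in> corner P P" "w \<in> product_span ?J (corner Q Q)" "z = d * r + w * d'"
    using trace_factorization[OF ext cz(2)] .
  have "(x - w) * d' = d * (c + r)" using cz(3) rw(3) by (simp add: left_diff_distrib distrib_left)
  moreover have diff: "x - w \<in> corner Q Q"
    using x(1) rw(2) product_span_target_maps_corner by (blast intro: corner_diff)
  ultimately have "x - w \<in> ?J" using corner_add[OF cz(1) rw(1)] by (intro target_mapsI)
  then have "(x - w) * Q \<in> product_span ?J (corner Q Q)"
    by (rule product_spanI) (use Q in \<open>intro cornerI\<close>)
  then have "x - w \<in> product_span ?J (corner Q Q)" using cornerD(2)[OF diff] by simp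
  then have "x \<in> product_span ?J (corner Q Q)"
    using subspace_add[OF subspace_product_span _ rw(2)] by fastforce
  then show ?thesis by (intro image_traceI[OF corner_zero]) simp_all
qed

text \<open>Multiplication by \<open>d\<close> and by \<open>d'\<close> are maps between the same quotients of \<open>corner Q Q\<close> and
  \<open>corner P Q\<close>; the first one is surjective and the second one is injective.\<close>

lemma unit_in_image_trace:
  assumes P: "P * P = P" and Q: "Q * Q = Q" and d: "d \<in> corner P Q" "d' \<in> corner P Q"
    and ext: "ext1_zero P Q d d" "ext1_zero P Q d' d'"
  shows "Q \<in> image_trace P Q d (target_maps P Q d' d) Q"
proof -
  let ?J = "target_maps P Q d' d"
  let ?W = "image_trace P Q d ?J"
  have unit: "P \<in> corner P P" "Q \<in> corner Q Q" using P Q by (auto intro: cornerI)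
  have zero_mem: "0 \<in> product_span ?J (corner U Q)" for U
    by (rule subspace_0[OF subspace_product_span])
  obtain B where B: "finite B" "corner Q Q \<subseteq> span B" using corner_finitely_spanned by blast
  note injective = image_trace_reflected[OF Q ext(2)]
  have "Q * d' \<in> ?W P"
  proof (rule linear_preimages_coincide[OF linear_mult_right linear_mult_right subspace_corner
    B(2,1) subspace_image_trace _ _ unit(2)])
    show "Q * d \<in> ?W P"
      using cornerD[OF d(1)] by (intro image_traceI[OF unit(1) zero_mem]) simp
    show "\<exists>y\<in>corner Q Q. x * d' - y * d \<in> ?W P" if x: "x \<in> corner Q Q" for x
    proof -
      obtain h k where hk: "h \<in> corner P P" "k \<in> corner Q Q" "x * d' = k * d + d * h"
        using ext(1) corner_mult[OF x d(2)] unfolding ext1_zero_def by blast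
      have "x * d' - k * d \<in> ?W P" using hk by (intro image_traceI[OF hk(1) zero_mem]) simp
      then show ?thesis using hk(2) by blast
    qed
    show "x * d \<in> ?W P" if "x \<in> corner Q Q" "x * d' \<in> ?W P" for x
      using image_trace_mult[OF injective[OF that] d(1)] .
  qed
  then show ?thesis by (rule injective[OF unit(2)])
qed

text \<open>The cokernel of \<open>d\<close> is generated by its image under the endomorphisms factoring through \<open>d'\<close>.\<close>

lemma corner_eq_image_plus_product:
  assumes P: "P * P = P" and Q: "Q * Q = Q" and d: "d \<in> corner P Q" "d' \<in> corner P Q"
    and ext: "ext1_zero P Q d d" "ext1_zero P Q d' d'" and m: "m \<in> corner Q Q"
  shows "\<exists>x\<in>(\<lambda>c. d * c) ` corner Q P.
    \<exists>y\<in>product_span (product_span (target_maps P Q d' d) (target_maps P Q d d'))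
      (corner Q Q). m = x + y"
proof -
  let ?J = "target_maps P Q d' d" and ?J' = "target_maps P Q d d'"
  let ?V = "{x + y | x y. x \<in> (\<lambda>c. d * c) ` corner Q P \<and>
      y \<in> product_span (product_span ?J ?J') (corner Q Q)}"
  have V: "subspace ?V"
    by (intro subspace_sums subspace_image_mult_left subspace_corner subspace_product_span)
  have zero_mem: "0 \<in> product_span (product_span ?J ?J') (corner Q Q)"
    by (rule subspace_0[OF subspace_product_span])
  have "product_span ?J (corner Q Q) \<subseteq> ?V"
  proof (rule product_span_subset[OF V])
    fix a b assume a: "a \<in> ?J" and b: "b \<in> corner Q Q"
    have "b \<in> image_trace P Q d' ?J' Q"
      using image_trace_mult[OF unit_in_image_trace[OF P Q d(2,1) ext(2,1)] b] cornerD(1)[OF b]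
      by simp
    then obtain c y where cy: "c \<in> corner Q P" "y \<in> product_span ?J' (corner Q Q)" "b = d' * c + y"
      by (rule image_traceE)
    obtain \<rho> where \<rho>: "\<rho> \<in> corner P P" "a * d' = d * \<rho>" using a by (rule target_mapsE)
    have "a * b = d * (\<rho> * c) + a * y"
      using cy(3) \<rho>(2) by (simp add: distrib_left mult.assoc[symmetric])
    moreover have "a * y \<in> product_span (product_span ?J ?J') (corner Q Q)"
      using cy(2) by (rule product_span_mult_left) (rule product_spanI[OF a])
    ultimately show "a * b \<in> ?V" using corner_mult[OF \<rho>(1) cy(1)] by blast
  qed
  moreover have "m \<in> image_trace P Q d ?J Q"
    using image_trace_mult[OF unit_in_image_trace[OF P Q d ext] m] cornerD(1)[OF m] by simp
  then obtain c y where cy: "c \<in> corner Q P" "y \<in> product_span ?J (corner Q Q)" "m = d * c + y"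
    by (rule image_traceE)
  moreover have "d * c \<in> ?V"
  proof -
    have "d * c = d * c + 0" by simp
    then show ?thesis using cy(1) zero_mem by blast
  qed
  ultimately have "m \<in> ?V" using subspace_add[OF V] by blast
  then show ?thesis by blast
qed

lemma split_surjection:
  assumes P: "P * P = P" and Q: "Q * Q = Q" and d: "d \<in> corner P Q" "d' \<in> corner P Q"
    and ext: "ext1_zero P Q d d" "ext1_zero P Q d' d'"
    and radical: "\<And>a. a \<in> product_span (target_maps P Q d' d) (target_maps P Q d d') \<Longrightarrow>
      \<exists>v\<in>target_maps P Q d d. \<exists>c\<in>corner Q P. v * (Q - a) - Q = d * c"
  obtains c where "c \<in> corner Q P" "Q = d * c"
proof -
  let ?Z = "target_maps P Q d d" and ?N = "(\<lambda>c. d * c) ` corner Q P"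
  let ?I = "product_span (target_maps P Q d' d) (target_maps P Q d d')"
  have unit: "P \<in> corner P P" "Q \<in> corner Q Q" using P Q by (auto intro: cornerI)
  obtain B where B: "finite B" "corner Q Q \<subseteq> span B" using corner_finitely_spanned by blast
  have "corner Q Q \<subseteq> ?N"
  proof (rule nakayama[OF subspace_target_maps target_maps_mult
    subspace_image_mult_left[OF subspace_corner]
      _ subspace_product_span _ _ _ _ B(2,1)])
    fix z x assume z: "z \<in> ?Z" and x: "x \<in> ?N"
    obtain \<rho> where \<rho>: "\<rho> \<in> corner P P" "z * d = d * \<rho>" using z by (rule target_mapsE)
    obtain c where c: "c \<in> corner Q P" "x = d * c" using x by blast
    have "z * x = d * (\<rho> * c)" using c(2) \<rho>(2) by (simp add: mult.assoc[symmetric])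
    then show "z * x \<in> ?N" using corner_mult[OF \<rho>(1) c(1)] by blast
  next
    show "?I \<subseteq> ?Z" by (intro product_span_subset subspace_target_maps target_maps_mult)
    show "a * z \<in> ?I" if "a \<in> ?I" "z \<in> ?Z" for a z
      using that(1) by (rule product_span_mult_right) (rule target_maps_mult[OF _ that(2)])
    show "Q \<in> ?Z" using cornerD[OF d(1)] by (intro target_mapsI[OF unit(2,1)]) simp
    show "Q * m = m" if "m \<in> corner Q Q" for m using that by (rule cornerD)
    show "\<exists>x\<in>?N. \<exists>y\<in>product_span ?I (corner Q Q). m = x + y" if "m \<in> corner Q Q" for m
      by (rule corner_eq_image_plus_product[OF P Q d ext that])
    show "\<exists>v\<in>?Z. v * (m - a * m) - m \<in> ?N" if a: "a \<in> ?I" and m: "m \<in> corner Q Q" for a m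
    proof -
      obtain v c where v: "v \<in> ?Z" "c \<in> corner Q P" "v * (Q - a) - Q = d * c"
        using radical[OF a] by blast
      have "v * (m - a * m) - m = (v * (Q - a) - Q) * m"
        using cornerD(1)[OF m] by (simp add: left_diff_distrib right_diff_distrib mult.assoc)
      then have "v * (m - a * m) - m = d * (c * m)" using v(3) by (simp add: mult.assoc)
      then show ?thesis using v(1) corner_mult[OF v(2) m] by blast
    qed
  qed
  then show thesis using unit(2) that by blast
qed

end

section \<open>Isomorphisms and direct sums of idempotents\<close>

definition idem_iso :: "'b::ring \<Rightarrow> 'b \<Rightarrow> 'b \<Rightarrow> 'b \<Rightarrow> bool" where
  "idem_iso P Q u v \<longleftrightarrow> u \<in> corner P Q \<and> v \<in> corner Q P \<and> v * u = P \<and> u * v = Q"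

lemma idem_isoD:
  assumes "idem_iso P Q u v" shows "u \<in> corner P Q" "v \<in> corner Q P" "v * u = P" "u * v = Q"
  using assms unfolding idem_iso_def by auto

lemma idem_iso_sym: "idem_iso P Q u v \<Longrightarrow> idem_iso Q P v u"
  unfolding idem_iso_def by auto

lemma idem_iso_trans:
  assumes "idem_iso P Q u u'" "idem_iso Q R v v'" shows "idem_iso P R (v * u) (u' * v')"
proof -
  note u = idem_isoD[OF assms(1)] and v = idem_isoD[OF assms(2)]
  have "(u' * v') * (v * u) = u' * ((v' * v) * u)" "(v * u) * (u' * v') = v * ((u * u') * v')"
    by (simp_all add: mult.assoc)
  then show ?thesis
    unfolding idem_iso_def using u v cornerD(1)[OF u(1)] cornerD(1)[OF v(2)]
    by (simp add: corner_mult[OF v(1) u(1)] corner_mult[OF u(2) v(2)])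
qed

text \<open>The image of \<open>B\<close> is the direct sum of those of \<open>Y\<close> and \<open>Z\<close>.\<close>

locale idem_biproduct =
  fixes B Y Z i\<^sub>1 i\<^sub>2 p\<^sub>1 p\<^sub>2 :: "'b::ring"
  assumes inj\<^sub>1_unit: "i\<^sub>1 * Y = i\<^sub>1" and unit_proj\<^sub>1: "Y * p\<^sub>1 = p\<^sub>1"
    and inj\<^sub>2_unit: "i\<^sub>2 * Z = i\<^sub>2" and unit_proj\<^sub>2: "Z * p\<^sub>2 = p\<^sub>2"
    and proj\<^sub>1_inj\<^sub>1: "p\<^sub>1 * i\<^sub>1 = Y" and proj\<^sub>2_inj\<^sub>2: "p\<^sub>2 * i\<^sub>2 = Z"
    and proj\<^sub>1_inj\<^sub>2: "p\<^sub>1 * i\<^sub>2 = 0" and proj\<^sub>2_inj\<^sub>1: "p\<^sub>2 * i\<^sub>1 = 0"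
    and decomposition: "B = i\<^sub>1 * p\<^sub>1 + i\<^sub>2 * p\<^sub>2"
begin

lemma unit_inj\<^sub>1: "B * i\<^sub>1 = i\<^sub>1" and unit_inj\<^sub>2: "B * i\<^sub>2 = i\<^sub>2"
  and proj\<^sub>1_unit: "p\<^sub>1 * B = p\<^sub>1" and proj\<^sub>2_unit: "p\<^sub>2 * B = p\<^sub>2"
  unfolding decomposition distrib_left distrib_right
  by (simp_all add: mult.assoc proj\<^sub>1_inj\<^sub>1 proj\<^sub>2_inj\<^sub>2 proj\<^sub>1_inj\<^sub>2 proj\<^sub>2_inj\<^sub>1 inj\<^sub>1_unit inj\<^sub>2_unit)
     (simp_all add: mult.assoc[symmetric] proj\<^sub>1_inj\<^sub>1 proj\<^sub>2_inj\<^sub>2 proj\<^sub>1_inj\<^sub>2 proj\<^sub>2_inj\<^sub>1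
       unit_proj\<^sub>1 unit_proj\<^sub>2)

lemma inj\<^sub>1_corner: "i\<^sub>1 \<in> corner Y B" and inj\<^sub>2_corner: "i\<^sub>2 \<in> corner Z B"
  and proj\<^sub>1_corner: "p\<^sub>1 \<in> corner B Y" and proj\<^sub>2_corner: "p\<^sub>2 \<in> corner B Z"
  by (intro cornerI unit_inj\<^sub>1 unit_inj\<^sub>2 proj\<^sub>1_unit proj\<^sub>2_unit inj\<^sub>1_unit inj\<^sub>2_unit
    unit_proj\<^sub>1 unit_proj\<^sub>2)+

lemma idem\<^sub>1: "Y * Y = Y" and idem\<^sub>2: "Z * Z = Z" and idem: "B * B = B"
proof -
  show "Y * Y = Y" "Z * Z = Z"
    using proj\<^sub>1_inj\<^sub>1 proj\<^sub>2_inj\<^sub>2 unit_proj\<^sub>1 unit_proj\<^sub>2 by (metis mult.assoc)+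
  show "B * B = B"
    by (subst (2 3) decomposition)
      (simp add: distrib_left mult.assoc[symmetric] unit_inj\<^sub>1 unit_inj\<^sub>2)
qed

lemmas reduce = inj\<^sub>1_unit unit_proj\<^sub>1 inj\<^sub>2_unit unit_proj\<^sub>2 proj\<^sub>1_inj\<^sub>1 proj\<^sub>2_inj\<^sub>2 proj\<^sub>1_inj\<^sub>2
  proj\<^sub>2_inj\<^sub>1 unit_inj\<^sub>1 unit_inj\<^sub>2 proj\<^sub>1_unit proj\<^sub>2_unit idem\<^sub>1 idem\<^sub>2 idem

lemma reduce_assoc:
  "i\<^sub>1 * (Y * y) = i\<^sub>1 * y" "Y * (p\<^sub>1 * y) = p\<^sub>1 * y" "i\<^sub>2 * (Z * y) = i\<^sub>2 * y" "Z * (p\<^sub>2 * y) = p\<^sub>2 * y"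
  "p\<^sub>1 * (i\<^sub>1 * y) = Y * y" "p\<^sub>2 * (i\<^sub>2 * y) = Z * y" "p\<^sub>1 * (i\<^sub>2 * y) = 0" "p\<^sub>2 * (i\<^sub>1 * y) = 0"
  "B * (i\<^sub>1 * y) = i\<^sub>1 * y" "B * (i\<^sub>2 * y) = i\<^sub>2 * y" "p\<^sub>1 * (B * y) = p\<^sub>1 * y" "p\<^sub>2 * (B * y) = p\<^sub>2 * y"
  "Y * (Y * y) = Y * y" "Z * (Z * y) = Z * y" "B * (B * y) = B * y"
  by (simp_all add: mult.assoc[symmetric] reduce)

end

lemma idem_biproduct_swap: "idem_biproduct B Y Z i\<^sub>1 i\<^sub>2 p\<^sub>1 p\<^sub>2 \<Longrightarrow> idem_biproduct B Z Y i\<^sub>2 i\<^sub>1 p\<^sub>2 p\<^sub>1"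
  unfolding idem_biproduct_def by (auto simp: add.commute)

lemma idem_biproduct_orthogonal:
  assumes "Y * Y = Y" "Z * Z = Z" "Y * Z = 0" "Z * Y = 0"
  shows "idem_biproduct (Y + Z) Y Z Y Z Y Z"
  unfolding idem_biproduct_def using assms by simp

lemma idem_biproduct_comparison:
  assumes "idem_biproduct B Y Z i\<^sub>1 i\<^sub>2 p\<^sub>1 p\<^sub>2" "idem_biproduct C Y Z j\<^sub>1 j\<^sub>2 q\<^sub>1 q\<^sub>2"
  shows "(i\<^sub>1 * q\<^sub>1 + i\<^sub>2 * q\<^sub>2) * (j\<^sub>1 * p\<^sub>1 + j\<^sub>2 * p\<^sub>2) = B"
proof -
  interpret B: idem_biproduct B Y Z i\<^sub>1 i\<^sub>2 p\<^sub>1 p\<^sub>2 by fact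
  interpret C: idem_biproduct C Y Z j\<^sub>1 j\<^sub>2 q\<^sub>1 q\<^sub>2 by fact
  show ?thesis
    by (simp add: distrib_left distrib_right mult.assoc C.reduce_assoc
      B.reduce_assoc B.decomposition)
qed

lemma idem_biproduct_unique:
  assumes B: "idem_biproduct B Y Z i\<^sub>1 i\<^sub>2 p\<^sub>1 p\<^sub>2" and C: "idem_biproduct C Y Z j\<^sub>1 j\<^sub>2 q\<^sub>1 q\<^sub>2"
  shows "idem_iso B C (j\<^sub>1 * p\<^sub>1 + j\<^sub>2 * p\<^sub>2) (i\<^sub>1 * q\<^sub>1 + i\<^sub>2 * q\<^sub>2)"
proof -
  interpret B: idem_biproduct B Y Z i\<^sub>1 i\<^sub>2 p\<^sub>1 p\<^sub>2 by fact
  interpret C: idem_biproduct C Y Z j\<^sub>1 j\<^sub>2 q\<^sub>1 q\<^sub>2 by fact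
  show ?thesis
    unfolding idem_iso_def
    by (intro conjI idem_biproduct_comparison[OF B C] idem_biproduct_comparison[OF C B] corner_add)
       (rule corner_mult, rule B.inj\<^sub>1_corner B.inj\<^sub>2_corner C.inj\<^sub>1_corner C.inj\<^sub>2_corner,
         rule B.proj\<^sub>1_corner B.proj\<^sub>2_corner C.proj\<^sub>1_corner C.proj\<^sub>2_corner)+
qed

lemma idem_biproduct_iso_left:
  assumes B: "idem_biproduct B Y Z i\<^sub>1 i\<^sub>2 p\<^sub>1 p\<^sub>2" and iso: "idem_iso W Y u v"
  shows "idem_biproduct B W Z (i\<^sub>1 * u) i\<^sub>2 (v * p\<^sub>1) p\<^sub>2"
proof -
  interpret B: idem_biproduct B Y Z i\<^sub>1 i\<^sub>2 p\<^sub>1 p\<^sub>2 by fact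
  note iso = idem_isoD[OF iso]
  note units = cornerD[OF iso(1)] cornerD[OF iso(2)]
  have uv: "u * (v * y) = Y * y" for y using iso(4) by (simp add: mult.assoc[symmetric])
  have "Y * (u * y) = u * y" "W * (v * y) = v * y" for y
    using units by (simp_all add: mult.assoc[symmetric])
  then show ?thesis
    by unfold_locales
       (simp_all add: mult.assoc units uv iso B.reduce B.reduce_assoc B.decomposition)
qed

lemma idem_biproduct_iso_summands:
  assumes "idem_biproduct B Y Z i\<^sub>1 i\<^sub>2 p\<^sub>1 p\<^sub>2" "idem_iso V Y u u'" "idem_iso W Z v v'"
  shows "idem_biproduct B V W (i\<^sub>1 * u) (i\<^sub>2 * v) (u' * p\<^sub>1) (v' * p\<^sub>2)"
  by (rule idem_biproduct_swap[OF idem_biproduct_iso_left[OF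
    idem_biproduct_swap[OF idem_biproduct_iso_left[OF assms(1,2)]] assms(3)]])

lemma idem_biproduct_iso_whole:
  assumes B: "idem_biproduct B Y Z i\<^sub>1 i\<^sub>2 p\<^sub>1 p\<^sub>2" and iso: "idem_iso B C u v"
  shows "idem_biproduct C Y Z (u * i\<^sub>1) (u * i\<^sub>2) (p\<^sub>1 * v) (p\<^sub>2 * v)"
proof -
  interpret B: idem_biproduct B Y Z i\<^sub>1 i\<^sub>2 p\<^sub>1 p\<^sub>2 by fact
  note iso = idem_isoD[OF iso]
  have vu: "v * (u * y) = B * y" for y using iso(3) by (simp add: mult.assoc[symmetric])
  have "C = u * (B * v)" using iso(4) cornerD(1)[OF iso(2)] by simp
  then have "C = u * i\<^sub>1 * (p\<^sub>1 * v) + u * i\<^sub>2 * (p\<^sub>2 * v)"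
    by (simp add: B.decomposition distrib_left distrib_right mult.assoc)
  moreover have "Y * (p\<^sub>1 * y) = p\<^sub>1 * y" "Z * (p\<^sub>2 * y) = p\<^sub>2 * y" for y
    by (simp_all add: B.reduce_assoc)
  ultimately show ?thesis
    by unfold_locales (simp_all add: mult.assoc vu B.reduce)
qed

lemma idem_biproduct_restrict:
  assumes B: "idem_biproduct B Y Z i\<^sub>1 i\<^sub>2 p\<^sub>1 p\<^sub>2"
    and y: "y \<in> corner Y Y" "y * y = y" and z: "z \<in> corner Z Z" "z * z = z"
  shows "idem_biproduct (i\<^sub>1 * y * p\<^sub>1 + i\<^sub>2 * z * p\<^sub>2) y z (i\<^sub>1 * y) (i\<^sub>2 * z) (y * p\<^sub>1) (z * p\<^sub>2)"
proof -
  interpret B: idem_biproduct B Y Z i\<^sub>1 i\<^sub>2 p\<^sub>1 p\<^sub>2 by fact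
  note units = cornerD[OF y(1)] cornerD[OF z(1)]
  have "Y * (y * w) = y * w" "Z * (z * w) = z * w" "y * (y * w) = y * w" "z * (z * w) = z * w" for w
    using units y(2) z(2) by (simp_all add: mult.assoc[symmetric])
  then show ?thesis
    by unfold_locales (simp_all add: mult.assoc units y(2) z(2) B.reduce_assoc)
qed

section \<open>Matrices with finite support\<close>

text \<open>Rows and columns of all matrices occurring in a complex are indexed by pairs of a degree
  and a position. A separate datatype keeps quantifiers over indices from being split.\<close>

datatype index = Index int nat

definition supported_by :: "index set \<Rightarrow> (index \<Rightarrow> index \<Rightarrow> 'a::zero) \<Rightarrow> bool" where
  "supported_by I f \<longleftrightarrow> (\<forall>u v. u \<notin> I \<or> v \<notin> I \<longrightarrow> f u v = 0)"

lemma supported_by_mono: "supported_by I f \<Longrightarrow> I \<subseteq> J \<Longrightarrow> supported_by J f"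
  unfolding supported_by_def by blast

definition finite_entries :: "(index \<Rightarrow> index \<Rightarrow> 'a::zero) \<Rightarrow> bool" where
  "finite_entries f \<longleftrightarrow> (\<exists>I. finite I \<and> supported_by I f)"

lemma finite_entriesI: "finite I \<Longrightarrow> supported_by I f \<Longrightarrow> finite_entries f"
  unfolding finite_entries_def by blast

lemma finite_entries2E:
  assumes "finite_entries f" "finite_entries g"
  obtains I where "finite I" "supported_by I f" "supported_by I g"
proof -
  obtain I J where "finite I" "supported_by I f" "finite J" "supported_by J g"
    using assms unfolding finite_entries_def by blast
  then show thesis by (intro that[of "I \<union> J"]) (auto elim: supported_by_mono)
qed

lemma finite_entries_bounded:
  assumes "\<And>i a j b. \<bar>i\<bar> > N \<or> \<bar>j\<bar> > N \<or> a \<ge> v i \<or> b \<ge> u j \<Longrightarrow> f (Index i a) (Index j b) = 0"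
  shows "finite_entries f"
proof (rule finite_entriesI)
  let ?I = "(\<lambda>(i, a). Index i a) ` (SIGMA i:{-N..N}. {..<v i + u i})"
  show "finite ?I" by simp
  have mem: "Index i a \<in> ?I" if "\<bar>i\<bar> \<le> N" "a < v i + u i" for i a
    using that by (intro image_eqI[of _ _ "(i, a)"]) auto
  show "supported_by ?I f"
    unfolding supported_by_def
  proof (intro allI impI)
    fix x y assume outside: "x \<notin> ?I \<or> y \<notin> ?I"
    obtain i a j b where indices: "x = Index i a" "y = Index j b" by (metis index.exhaust)
    then have "\<bar>i\<bar> > N \<or> \<bar>j\<bar> > N \<or> a \<ge> v i \<or> b \<ge> u j"
      using outside mem[of i a] mem[of j b] by (meson not_less trans_less_add1 trans_less_add2)
    then show "f x y = 0" unfolding indices by (rule assms)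
  qed
qed

typedef (overloaded) 'a fin_mat = "{f :: index \<Rightarrow> index \<Rightarrow> 'a::zero. finite_entries f}"
  morphisms entry Fin_mat
  by (rule exI[of _ "\<lambda>_ _. 0"]) (simp add: finite_entriesI[of "{}"] supported_by_def)

setup_lifting type_definition_fin_mat

lemma entry_Fin_mat: "finite_entries f \<Longrightarrow> entry (Fin_mat f) = f"
  by (simp add: Fin_mat_inverse)

lemma fin_mat_eqI:
  assumes "\<And>i a j b. entry x (Index i a) (Index j b) = entry y (Index i a) (Index j b)"
  shows "x = y"
proof -
  have "entry x u v = entry y u v" for u v using assms by (cases u; cases v) simp
  then show ?thesis by (simp add: entry_inject[symmetric] fun_eq_iff)
qed

definition supported_on :: "index set \<Rightarrow> 'a::zero fin_mat \<Rightarrow> bool" where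
  "supported_on I x \<longleftrightarrow> supported_by I (entry x)"

lemma supported_onD: "supported_on I x \<Longrightarrow> u \<notin> I \<or> v \<notin> I \<Longrightarrow> entry x u v = 0"
  unfolding supported_on_def supported_by_def by blast

lemma common_support:
  assumes "finite S" shows "\<exists>I. finite I \<and> (\<forall>x\<in>S. supported_on I x)"
proof -
  have "\<exists>I. finite I \<and> supported_on I x" for x :: "'a fin_mat"
    using entry[of x] unfolding supported_on_def finite_entries_def by simp
  then obtain I where I: "\<And>x :: 'a fin_mat. finite (I x) \<and> supported_on (I x) x" by metis
  show ?thesis
    by (rule exI[of _ "\<Union>x\<in>S. I x"])
       (use assms I in \<open>auto simp: supported_on_def intro: supported_by_mono\<close>)
qed

instantiation fin_mat :: (ring) ring
begin

lift_definition zero_fin_mat :: "'a fin_mat" is "\<lambda>_ _. 0"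
  by (simp add: finite_entriesI[of "{}"] supported_by_def)

lift_definition plus_fin_mat :: "'a fin_mat \<Rightarrow> 'a fin_mat \<Rightarrow> 'a fin_mat" is "\<lambda>x y u v. x u v + y u v"
  by (erule (1) finite_entries2E, rule finite_entriesI) (auto simp: supported_by_def)

lift_definition minus_fin_mat :: "'a fin_mat \<Rightarrow> 'a fin_mat \<Rightarrow> 'a fin_mat" is "\<lambda>x y u v. x u v - y u v"
  by (erule (1) finite_entries2E, rule finite_entriesI) (auto simp: supported_by_def)

lift_definition uminus_fin_mat :: "'a fin_mat \<Rightarrow> 'a fin_mat" is "\<lambda>x u v. - x u v"
  unfolding finite_entries_def supported_by_def by auto

lift_definition times_fin_mat :: "'a fin_mat \<Rightarrow> 'a fin_mat \<Rightarrow> 'a fin_mat"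
  is "\<lambda>x y u v. \<Sum>w | x u w \<noteq> 0. x u w * y w v"
proof -
  fix x y :: "index \<Rightarrow> index \<Rightarrow> 'a" assume "finite_entries x" "finite_entries y"
  then obtain I where I: "finite I" "supported_by I x" "supported_by I y" by (rule finite_entries2E)
  then show "finite_entries (\<lambda>u v. \<Sum>w | x u w \<noteq> 0. x u w * y w v)"
    by (intro finite_entriesI[OF I(1)]) (auto simp: supported_by_def intro!: sum.neutral)
qed

lemma entry_zero [simp]: "entry (0 :: 'a fin_mat) u v = 0"
  and entry_add [simp]: "entry (x + y :: 'a fin_mat) u v = entry x u v + entry y u v"
  and entry_diff [simp]: "entry (x - y :: 'a fin_mat) u v = entry x u v - entry y u v"
  and entry_uminus [simp]: "entry (- x :: 'a fin_mat) u v = - entry x u v"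
  by (simp_all add: zero_fin_mat.rep_eq plus_fin_mat.rep_eq minus_fin_mat.rep_eq
    uminus_fin_mat.rep_eq)

lemma entry_mult:
  assumes I: "finite I" "\<And>w. w \<notin> I \<Longrightarrow> entry x u w = 0 \<or> entry y w v = 0"
  shows "entry (x * y :: 'a fin_mat) u v = (\<Sum>w\<in>I. entry x u w * entry y w v)"
proof -
  let ?J = "{w. entry x u w \<noteq> 0}"
  obtain J where J: "finite J" "supported_on J x" using common_support[of "{x}"] by auto
  have "?J \<subseteq> J" using supported_onD[OF J(2)] by blast
  then have fin: "finite ?J" using J(1) by (rule finite_subset)
  have "(\<Sum>w\<in>?J. entry x u w * entry y w v) = (\<Sum>w\<in>?J \<union> I. entry x u w * entry y w v)"
    by (rule sum.mono_neutral_left) (use fin I(1) in auto)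
  also have "\<dots> = (\<Sum>w\<in>I. entry x u w * entry y w v)"
    by (rule sum.mono_neutral_right) (use fin I in \<open>auto, fastforce\<close>)
  finally show ?thesis by (simp add: times_fin_mat.rep_eq)
qed

lemma entry_mult_supported:
  "finite I \<Longrightarrow> supported_on I x \<Longrightarrow> entry (x * y :: 'a fin_mat) u v =
      (\<Sum>w\<in>I. entry x u w * entry y w v)"
  by (rule entry_mult) (auto dest: supported_onD)

lemma supported_on_mult:
  assumes "supported_on I x" "supported_on I y" shows "supported_on I (x * y :: 'a fin_mat)"
proof -
  obtain J where J: "finite J" "supported_on J x" using common_support[of "{x}"] by auto
  have "entry (x * y) u v = 0" if "u \<notin> I \<or> v \<notin> I" for u v
    using that by (auto simp: entry_mult_supported[OF J] supported_onD[OF assms(1)]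
      supported_onD[OF assms(2)])
  then show ?thesis by (simp add: supported_on_def supported_by_def)
qed

instance
proof
  fix x y z :: "'a fin_mat"
  show "x + y + z = x + (y + z)" "x + y = y + x" "0 + x = x" "- x + x = 0" "x - y = x + - y"
    by (rule fin_mat_eqI, simp add: algebra_simps)+
  obtain I where I: "finite I" "supported_on I x" "supported_on I y" "supported_on I z"
    using common_support[of "{x, y, z}"] by auto
  then have "supported_on I (x + y)" by (simp add: supported_on_def supported_by_def)
  then show "(x + y) * z = x * z + y * z" "x * (y + z) = x * y + x * z"
    using I by (auto intro!: fin_mat_eqI simp: entry_mult_supported distrib_left
      distrib_right sum.distrib)
  show "x * y * z = x * (y * z)"
  proof (rule fin_mat_eqI)
    fix i a j b
    let ?u = "Index i a" and ?v = "Index j b"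
    have "entry (x * y * z) ?u ?v = (\<Sum>w\<in>I. \<Sum>w'\<in>I. entry x ?u w' * entry y w' w * entry z w ?v)"
      using I by (simp add: entry_mult_supported supported_on_mult sum_distrib_right)
    also have "\<dots> = (\<Sum>w'\<in>I. \<Sum>w\<in>I. entry x ?u w' * entry y w' w * entry z w ?v)"
      by (rule sum.swap)
    also have "\<dots> = entry (x * (y * z)) ?u ?v"
      using I by (simp add: entry_mult_supported sum_distrib_left mult.assoc)
    finally show "entry (x * y * z) ?u ?v = entry (x * (y * z)) ?u ?v" .
  qed
qed

end

lemma entry_mult_single:
  assumes "\<And>w. w \<noteq> z \<Longrightarrow> entry x u w = 0 \<or> entry y w v = 0"
  shows "entry (x * y :: 'a::ring fin_mat) u v = entry x u z * entry y z v"
  using entry_mult[of "{z}" x u y v] assms by simp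

lemma entry_mult_nonzeroE:
  assumes "entry (x * y :: 'a::ring fin_mat) u v \<noteq> 0"
  obtains i a where "entry x u (Index i a) \<noteq> 0" "entry y (Index i a) v \<noteq> 0"
proof -
  obtain w where "entry x u w \<noteq> 0" "entry y w v \<noteq> 0" using assms entry_mult[of "{}" x u y v] by auto
  then show thesis using that by (cases w) auto
qed

lemma entry_sum: "entry (sum F A :: 'a::ring fin_mat) u v = (\<Sum>i\<in>A. entry (F i) u v)"
  by (induction A rule: infinite_finite_induct) auto

subsection \<open>Sizes of matrices\<close>

definition sized :: "int \<Rightarrow> (int \<Rightarrow> nat) \<Rightarrow> (int \<Rightarrow> nat) \<Rightarrow> 'a::zero fin_mat \<Rightarrow> bool" where
  "sized N v u x \<longleftrightarrow>
     (\<forall>i a j b. \<bar>i\<bar> > N \<or> \<bar>j\<bar> > N \<or> a \<ge> v i \<or> b \<ge> u j \<longrightarrow> entry x (Index i a) (Index j b) = 0)"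

lemma sizedD:
  "sized N v u x \<Longrightarrow> \<bar>i\<bar> > N \<or> \<bar>j\<bar> > N \<or> a \<ge> v i \<or> b \<ge> u j \<Longrightarrow> entry x (Index i a) (Index j b) = 0"
  unfolding sized_def by blast

lemma sized_zero: "sized N v u (0 :: 'a::ring fin_mat)"
  unfolding sized_def by simp

lemma common_size:
  assumes "finite S" obtains N n where "\<And>x. x \<in> S \<Longrightarrow> sized N (\<lambda>_. n) (\<lambda>_. n) x"
proof -
  obtain I where I: "finite I" "\<And>x. x \<in> S \<Longrightarrow> supported_on I x"
    using common_support[OF assms] by blast
  define N where "N = Max (insert 0 ((\<lambda>u. case u of Index i a \<Rightarrow> \<bar>i\<bar>) ` I))"
  define n where "n = Suc (Max (insert 0 ((\<lambda>u. case u of Index i a \<Rightarrow> a) ` I)))"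
  have bounds: "\<bar>i\<bar> \<le> N \<and> a < n" if "Index i a \<in> I" for i a
  proof -
    have "\<bar>i\<bar> \<in> (\<lambda>u. case u of Index i a \<Rightarrow> \<bar>i\<bar>) ` I" "a \<in> (\<lambda>u. case u of Index i a \<Rightarrow> a) ` I"
      using that by (auto intro: rev_image_eqI)
    then show ?thesis unfolding N_def n_def less_Suc_eq_le using I(1) by (intro conjI Max_ge) auto
  qed
  have "sized N (\<lambda>_. n) (\<lambda>_. n) x" if "x \<in> S" for x
    unfolding sized_def using bounds supported_onD[OF I(2)[OF that]] by (meson not_less)
  then show thesis by (rule that)
qed

subsection \<open>Matrix units\<close>

lift_definition single_entry :: "index \<Rightarrow> index \<Rightarrow> 'a::zero \<Rightarrow> 'a fin_mat"
  is "\<lambda>u v a x y. if x = u \<and> y = v then a else 0"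
  by (rule finite_entriesI[of "{u, v}" for u v]) (auto simp: supported_by_def)

lemma entry_single_entry: "entry (single_entry u v a) x y = (if x = u \<and> y = v then a else 0)"
  by (simp add: single_entry.rep_eq)

lemma fin_mat_eq_sum_single_entry:
  assumes "finite I" "supported_on I (x :: 'a::ring fin_mat)"
  shows "x = (\<Sum>u\<in>I. \<Sum>v\<in>I. single_entry u v (entry x u v))"
proof (rule fin_mat_eqI)
  fix i a j b
  let ?u = "Index i a" and ?v = "Index j b"
  have "(\<Sum>u\<in>I. \<Sum>v\<in>I. if ?u = u \<and> ?v = v then entry x u v else 0)
      = (\<Sum>u\<in>I. if ?u = u then (\<Sum>v\<in>I. if ?v = v then entry x u v else 0) else 0)"
    by (intro sum.cong refl) auto
  also have "\<dots> = entry x ?u ?v" using assms(1) supported_onD[OF assms(2), of ?u ?v] by simp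
  finally show "entry x ?u ?v = entry (\<Sum>u\<in>I. \<Sum>v\<in>I. single_entry u v (entry x u v)) ?u ?v"
    by (simp add: entry_sum entry_single_entry)
qed

definition matrix_unit :: "index \<Rightarrow> index \<Rightarrow> 'a::ring_1 fin_mat" where
  "matrix_unit u v = single_entry u v 1"

lemma entry_matrix_unit: "entry (matrix_unit u v :: 'a::ring_1 fin_mat) x y =
    (if x = u \<and> y = v then 1 else 0)"
  unfolding matrix_unit_def by (rule entry_single_entry)

lemma entry_matrix_unit_mult:
  "entry (matrix_unit u v * y :: 'a::ring_1 fin_mat) x w = (if x = u then entry y v w else 0)"
  using entry_mult_single[of v "matrix_unit u v" x y w] by (auto simp: entry_matrix_unit)

lemma matrix_unit_mult: "matrix_unit u v * matrix_unit v w =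
    (matrix_unit u w :: 'a::ring_1 fin_mat)"
  and matrix_unit_mult_zero: "v \<noteq> v' \<Longrightarrow> matrix_unit u v * matrix_unit v' w =
      (0 :: 'a::ring_1 fin_mat)"
  by (auto intro!: fin_mat_eqI simp: entry_matrix_unit_mult entry_matrix_unit)

definition block_unit :: "int \<Rightarrow> nat \<Rightarrow> 'a::ring_1 fin_mat" where
  "block_unit t n = (\<Sum>a<n. matrix_unit (Index t a) (Index t a))"

lemma block_unit_0: "block_unit t 0 = (0 :: 'a::ring_1 fin_mat)"
  and block_unit_Suc: "block_unit t (Suc n) = matrix_unit (Index t n) (Index t n) +
      (block_unit t n :: 'a fin_mat)"
  unfolding block_unit_def by (simp_all add: add.commute)

lemma matrix_unit_block_unit_orthogonal:
  "matrix_unit (Index t n) (Index t n) * block_unit t n = (0 :: 'a::ring_1 fin_mat)"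
  "block_unit t n * matrix_unit (Index t n) (Index t n) = (0 :: 'a::ring_1 fin_mat)"
  unfolding block_unit_def sum_distrib_left sum_distrib_right
  by (auto intro!: sum.neutral matrix_unit_mult_zero)

lemma entry_block_unit:
  "entry (block_unit t n :: 'a::ring_1 fin_mat) (Index i a) (Index j b) =
     (if i = t \<and> j = t \<and> a = b \<and> a < n then 1 else 0)"
proof -
  have "entry (block_unit t n :: 'a fin_mat) (Index i a) (Index j b) =
      (\<Sum>c<n. if c = a then (if i = t \<and> j = t \<and> a = b then 1 else 0) else 0)"
    unfolding block_unit_def entry_sum entry_matrix_unit by (intro sum.cong) auto
  then show ?thesis by auto
qed

lemma entry_block_unit_mult:
  "entry (block_unit t n * x :: 'a::ring_1 fin_mat) (Index i a) y =
      (if i = t \<and> a < n then entry x (Index i a) y else 0)"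
proof (subst entry_mult_single[of "Index i a"])
  fix w assume "w \<noteq> Index i a"
  then show "entry (block_unit t n :: 'a fin_mat) (Index i a) w = 0 \<or> entry x w y = 0"
    by (cases w) (auto simp: entry_block_unit)
qed (auto simp: entry_block_unit)

lemma entry_mult_block_unit:
  "entry (x * block_unit t n :: 'a::ring_1 fin_mat) y (Index j b) =
      (if j = t \<and> b < n then entry x y (Index j b) else 0)"
proof (subst entry_mult_single[of "Index j b"])
  fix w assume "w \<noteq> Index j b"
  then show "entry x y w = 0 \<or> entry (block_unit t n :: 'a fin_mat) w (Index j b) = 0"
    by (cases w) (auto simp: entry_block_unit)
qed (auto simp: entry_block_unit)

lemma block_unit_idem: "block_unit t n * block_unit t n = (block_unit t n :: 'a::ring_1 fin_mat)"
  by (rule fin_mat_eqI) (auto simp: entry_block_unit_mult entry_block_unit)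

subsection \<open>Homogeneous matrices\<close>

definition homogeneous :: "int \<Rightarrow> 'a::zero fin_mat \<Rightarrow> bool" where
  "homogeneous k x \<longleftrightarrow> (\<forall>i a j b. entry x (Index i a) (Index j b) \<noteq> 0 \<longrightarrow> i = j + k)"

lemma homogeneousD: "homogeneous k x \<Longrightarrow> entry x (Index i a) (Index j b) \<noteq> 0 \<Longrightarrow> i = j + k"
  unfolding homogeneous_def by blast

lemma homogeneous_zero [simp]: "homogeneous k (0 :: 'a::ring fin_mat)"
  and homogeneous_add: "homogeneous k x \<Longrightarrow> homogeneous k y \<Longrightarrow>
      homogeneous k (x + y :: 'a::ring fin_mat)"
  and homogeneous_uminus: "homogeneous k x \<Longrightarrow> homogeneous k (- x :: 'a::ring fin_mat)"
  and homogeneous_diff: "homogeneous k x \<Longrightarrow> homogeneous k y \<Longrightarrow>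
      homogeneous k (x - y :: 'a::ring fin_mat)"
  unfolding homogeneous_def by (simp_all, (metis add.right_neutral diff_zero)+)

lemma homogeneous_mult:
  assumes "homogeneous k x" "homogeneous l y" "m = k + l"
  shows "homogeneous m (x * y :: 'a::ring fin_mat)"
  unfolding homogeneous_def
proof (intro allI impI)
  fix i a j b assume "entry (x * y) (Index i a) (Index j b) \<noteq> 0"
  then obtain i' a' where "entry x (Index i a) (Index i' a') \<noteq> 0"
    "entry y (Index i' a') (Index j b) \<noteq> 0"
    by (rule entry_mult_nonzeroE)
  then have "i = i' + k" "i' = j + l" using assms(1,2) homogeneousD by blast+
  then show "i = j + m" using assms(3) by simp
qed

definition koszul_sign :: "int \<Rightarrow> 'b::ring \<Rightarrow> 'b" where
  "koszul_sign k x = (if even k then x else - x)"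

lemma koszul_sign_add: "koszul_sign k (x + y) = koszul_sign k x + koszul_sign k y"
  and koszul_sign_uminus: "koszul_sign k (- x) = - koszul_sign k x"
  and koszul_sign_mult_left: "koszul_sign k x * y = koszul_sign k (x * y)"
  and koszul_sign_mult_right: "x * koszul_sign k y = koszul_sign k (x * y)"
  and koszul_sign_koszul_sign: "koszul_sign k (koszul_sign l x) = koszul_sign (k + l) x"
  and koszul_sign_0 [simp]: "koszul_sign 0 x = x"
  and koszul_sign_1 [simp]: "koszul_sign 1 x = - x"
  and koszul_sign_zero [simp]: "koszul_sign k 0 = 0"
  for x y :: "'b::ring"
  unfolding koszul_sign_def by auto

lemma homogeneous_koszul_sign: "homogeneous l x \<Longrightarrow>
    homogeneous l (koszul_sign k x :: 'a::ring fin_mat)"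
  unfolding koszul_sign_def by (simp add: homogeneous_uminus)

subsection \<open>Matrices concentrated in one block\<close>

definition in_block :: "int \<Rightarrow> int \<Rightarrow> 'a::zero fin_mat \<Rightarrow> bool" where
  "in_block s t x \<longleftrightarrow> (\<forall>i a j b. entry x (Index i a) (Index j b) \<noteq> 0 \<longrightarrow> i = s \<and> j = t)"

lemma in_blockD: "in_block s t x \<Longrightarrow> entry x (Index i a) (Index j b) \<noteq> 0 \<Longrightarrow> i = s \<and> j = t"
  unfolding in_block_def by blast

lemma in_block_zero: "in_block s t (0 :: 'a::ring fin_mat)"
  and in_block_add: "in_block s t x \<Longrightarrow> in_block s t y \<Longrightarrow> in_block s t (x + y :: 'a::ring fin_mat)"
  unfolding in_block_def by (simp, metis add.right_neutral entry_add)

lemma in_block_matrix_unit: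
  "in_block s t (matrix_unit (Index s a) (Index t b) :: 'a::ring_1 fin_mat)"
  and in_block_block_unit: "in_block t t (block_unit t n :: 'a::ring_1 fin_mat)"
  unfolding in_block_def entry_matrix_unit entry_block_unit by (auto split: if_splits)

lemma in_block_homogeneous: "in_block s t x \<Longrightarrow> k = s - t \<Longrightarrow> homogeneous k x"
  unfolding in_block_def homogeneous_def by force

lemma in_block_mult:
  assumes "in_block s t x" "in_block t' r y" shows "in_block s r (x * y :: 'a::ring fin_mat)"
  unfolding in_block_def using assms by (auto elim!: entry_mult_nonzeroE dest: in_blockD)

lemma in_block_mult_zero:
  assumes "in_block s t x" "in_block t' r y" "t \<noteq> t'" shows "x * y = (0 :: 'a::ring fin_mat)"
proof (rule fin_mat_eqI, rule ccontr)
  fix i a j b assume "entry (x * y) (Index i a) (Index j b) \<noteq> entry 0 (Index i a) (Index j b)"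
  then have "entry (x * y) (Index i a) (Index j b) \<noteq> 0" by simp
  then show False using assms by (auto elim!: entry_mult_nonzeroE dest: in_blockD)
qed

lemma in_block_corner:
  assumes "in_block s s P" "in_block t t Q" "x \<in> corner P Q"
  shows "in_block t s (x :: 'a::ring fin_mat)"
  unfolding in_block_def
proof (intro allI impI conjI)
  fix i a j b assume nonzero: "entry x (Index i a) (Index j b) \<noteq> 0"
  then have "entry (Q * x) (Index i a) (Index j b) \<noteq> 0" using cornerD(1)[OF assms(3)] by simp
  then show "i = t" using assms(2) by (auto elim!: entry_mult_nonzeroE dest: in_blockD)
  from nonzero have "entry (x * P) (Index i a) (Index j b) \<noteq> 0"
    using cornerD(2)[OF assms(3)] by simp
  then show "j = s" using assms(1) by (auto elim!: entry_mult_nonzeroE dest: in_blockD)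
qed

lemma homogeneous_mult_in_block:
  assumes "homogeneous k x" "in_block s t y" "r = s + k"
  shows "in_block r t (x * y :: 'a::ring fin_mat)"
  unfolding in_block_def using assms
  by (auto elim!: entry_mult_nonzeroE dest!: in_blockD homogeneousD)

lemma in_block_mult_homogeneous:
  assumes "in_block s t y" "homogeneous k x" "r = t - k"
  shows "in_block s r (y * x :: 'a::ring fin_mat)"
  unfolding in_block_def using assms
  by (auto elim!: entry_mult_nonzeroE dest!: in_blockD homogeneousD)

lemma in_block_homogeneous_sandwich_zero:
  assumes "in_block s s P" "in_block t t Q" "homogeneous k x" "s \<noteq> t + k"
  shows "P * x * Q = (0 :: 'a::ring fin_mat)"
  using in_block_mult_zero[OF in_block_mult_homogeneous[OF assms(1,3) refl] assms(2)] assms(4)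
  by simp

lemma block_unit_covers:
  assumes "in_block t t (x :: 'a::ring_1 fin_mat)"
  obtains n where "block_unit t n * x = x" "x * block_unit t n = x"
proof -
  obtain N n where n: "sized N (\<lambda>_. n) (\<lambda>_. n) x" using common_size[of "{x}"] by auto
  have "i = t \<and> a < n \<and> j = t \<and> b < n" if "entry x (Index i a) (Index j b) \<noteq> 0" for i a j b
    using in_blockD[OF assms that] sizedD[OF n] that by (meson not_less)
  then have "block_unit t n * x = x" "x * block_unit t n = x"
    by (intro fin_mat_eqI; fastforce simp: entry_block_unit_mult entry_mult_block_unit)+
  then show thesis by (rule that)
qed

lemma idempotent_block_part:
  assumes e: "homogeneous 0 e" "e * e = (e :: 'a::ring_1 fin_mat)"
  obtains x where "in_block t t x" "x * x = x" "x \<in> corner e e"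
    "\<And>i a j b. entry x (Index i a) (Index j b) =
        (if i = t then entry e (Index i a) (Index j b) else 0)"
proof -
  obtain N n where n: "sized N (\<lambda>_. n) (\<lambda>_. n) e" using common_size[of "{e}"] by auto
  let ?x = "block_unit t n * e"
  have entries: "entry ?x (Index i a) (Index j b) =
      (if i = t then entry e (Index i a) (Index j b) else 0)" for i a j b
    unfolding entry_block_unit_mult using sizedD[OF n, of i j a b] by auto
  have commute: "block_unit t n * e = e * block_unit t n"
  proof (rule fin_mat_eqI)
    fix i a j b
    show "entry (block_unit t n * e) (Index i a) (Index j b) =
        entry (e * block_unit t n) (Index i a) (Index j b)"
      unfolding entry_block_unit_mult entry_mult_block_unit
      using sizedD[OF n, of i j a b] homogeneousD[OF e(1), of i a j b]
      by (cases "entry e (Index i a) (Index j b) = 0") (auto simp: not_less)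
  qed
  have "?x * ?x = block_unit t n * (e * block_unit t n) * e" by (simp add: mult.assoc)
  also have "\<dots> = (block_unit t n * block_unit t n) * (e * e)"
    unfolding commute[symmetric] by (simp add: mult.assoc)
  finally have "?x * ?x = ?x" by (simp add: block_unit_idem e(2))
  moreover have "?x \<in> corner e e"
    using e(2) commute by (intro cornerI) (metis mult.assoc)+
  moreover have "in_block t t ?x"
    unfolding in_block_def entries using homogeneousD[OF e(1)] by auto
  ultimately show thesis using that entries by blast
qed

section \<open>Matrices over a finite dimensional algebra\<close>

lemma corner_supported_on:
  assumes "supported_on I P" "supported_on I Q" "x \<in> corner P Q"
  shows "supported_on I (x :: 'a::ring fin_mat)"
proof -
  have "entry (Q * x) u v = 0" if "u \<notin> I" for u v
    using supported_onD[OF assms(2)] that by (subst entry_mult[of "{}"]) auto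
  moreover have "entry (x * P) u v = 0" if "v \<notin> I" for u v
    using supported_onD[OF assms(1)] that by (subst entry_mult[of "{}"]) auto
  ultimately show ?thesis
    unfolding supported_on_def supported_by_def using cornerD[OF assms(3)] by metis
qed

locale fin_dim_algebra =
  fixes scale :: "'k::field \<Rightarrow> 'a::ring_1 \<Rightarrow> 'a"
  assumes fd_algebra: "fd_algebra scale"
begin

lemma scale_simps:
  "scale c (x + y) = scale c x + scale c y" "scale (c + d) x = scale c x + scale d x"
  "scale (c * d) x = scale c (scale d x)" "scale 1 x = x"
  "scale c (x * y) = scale c x * y" "scale c x * y = x * scale c y"
  using fd_algebra unfolding fd_algebra_def by simp_all (metis)

lemma scale_zero: "scale c 0 = 0"
  using scale_simps(1)[of c 0 0] by simp

lemma scale_sum: "scale c (sum f A) = (\<Sum>i\<in>A. scale c (f i))"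
  by (induction A rule: infinite_finite_induct) (auto simp: scale_simps scale_zero)

definition scale_mat :: "'k \<Rightarrow> 'a fin_mat \<Rightarrow> 'a fin_mat" where
  "scale_mat c x = Fin_mat (\<lambda>u v. scale c (entry x u v))"

lemma entry_scale_mat: "entry (scale_mat c x) u v = scale c (entry x u v)"
proof -
  obtain I where I: "finite I" "supported_on I x" using common_support[of "{x}"] by auto
  have "finite_entries (\<lambda>u v. scale c (entry x u v))"
    by (rule finite_entriesI[OF I(1)])
      (use supported_onD[OF I(2)] in \<open>auto simp: supported_by_def scale_zero\<close>)
  then show ?thesis unfolding scale_mat_def by (simp add: entry_Fin_mat)
qed

lemma scale_mat_mult:
  "scale_mat c x * y = scale_mat c (x * y)" "x * scale_mat c y = scale_mat c (x * y)"
proof -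
  obtain I where I: "finite I" "supported_on I x" using common_support[of "{x}"] by auto
  then have "supported_on I (scale_mat c x)"
    by (simp add: supported_on_def supported_by_def entry_scale_mat scale_zero)
  with I show "scale_mat c x * y = scale_mat c (x * y)" "x * scale_mat c y = scale_mat c (x * y)"
    by (auto intro!: fin_mat_eqI simp: entry_mult_supported entry_scale_mat
      scale_sum scale_simps(5,6))
qed

lemma homogeneous_scale_mat: "homogeneous k x \<Longrightarrow> homogeneous k (scale_mat c x)"
  unfolding homogeneous_def by (metis entry_scale_mat scale_zero)

sublocale vs: vector_space scale_mat
  by unfold_locales (rule fin_mat_eqI, simp add: entry_scale_mat scale_simps)+

lemma finite_span_supported_on:
  assumes "finite I" shows "\<exists>B. finite B \<and> {x. supported_on I x} \<subseteq> vs.span B"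
proof -
  obtain B where B: "finite B" "\<And>x. \<exists>c. x = (\<Sum>b\<in>B. scale (c b) b)"
    using fd_algebra unfolding fd_algebra_def by auto
  let ?E = "(\<lambda>(u, v, b). single_entry u v b) ` (I \<times> I \<times> B)"
  have single_entry_span: "single_entry u v a \<in> vs.span ?E" if "u \<in> I" "v \<in> I" for u v a
  proof -
    obtain c where c: "a = (\<Sum>b\<in>B. scale (c b) b)" using B(2) by blast
    have "single_entry u v a = (\<Sum>b\<in>B. scale_mat (c b) (single_entry u v b))"
      by (rule fin_mat_eqI) (auto simp: entry_single_entry entry_scale_mat entry_sum c scale_zero)
    also have "\<dots> \<in> vs.span ?E"
      using that by (intro vs.span_sum vs.span_scale vs.span_base) force
    finally show ?thesis .
  qed
  have "x \<in> vs.span ?E" if "supported_on I x" for x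
    by (subst fin_mat_eq_sum_single_entry[OF assms that]) (intro vs.span_sum single_entry_span)
  then show ?thesis using assms B(1) by (intro exI[of _ ?E]) auto
qed

sublocale vs: corner_finite_algebra scale_mat
proof
  fix P Q :: "'a fin_mat"
  obtain I where I: "finite I" "supported_on I P" "supported_on I Q"
    using common_support[of "{P, Q}"] by auto
  obtain B where "finite B" "{x. supported_on I x} \<subseteq> vs.span B"
    using finite_span_supported_on[OF I(1)] by blast
  then show "\<exists>B. finite B \<and> corner P Q \<subseteq> vs.span B" using corner_supported_on[OF I(2,3)] by blast
qed (rule scale_mat_mult)+

end

section \<open>Total complexes\<close>

text \<open>A bounded complex of projectives is encoded by a pair of matrices: the idempotent cutting out
  all terms at once and the total differential; the degree is recorded in the indices.\<close>

type_synonym 'a tot_cplx = "'a fin_mat \<times> 'a fin_mat"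

abbreviation idem :: "'a::ring tot_cplx \<Rightarrow> 'a fin_mat" where "idem X \<equiv> fst X"

abbreviation diff :: "'a::ring tot_cplx \<Rightarrow> 'a fin_mat" where "diff X \<equiv> snd X"

locale tot_complex =
  fixes X :: "'a::ring tot_cplx"
  assumes homogeneous_idem: "homogeneous 0 (idem X)" and homogeneous_diff: "homogeneous 1 (diff X)"
    and idem_idem: "idem X * idem X = idem X" and idem_diff: "idem X * diff X = diff X"
    and diff_idem: "diff X * idem X = diff X" and diff_diff: "diff X * diff X = 0"
begin

lemmas reduce = idem_idem idem_diff diff_idem diff_diff

lemma reduce_assoc:
  "idem X * (idem X * y) = idem X * y" "idem X * (diff X * y) = diff X * y"
  "diff X * (idem X * y) = diff X * y" "diff X * (diff X * y) = 0"
  by (simp_all add: mult.assoc[symmetric] reduce)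

end

definition graded_hom :: "int \<Rightarrow> 'a::ring tot_cplx \<Rightarrow> 'a tot_cplx \<Rightarrow> 'a fin_mat set" where
  "graded_hom k X Y = {f \<in> corner (idem X) (idem Y). homogeneous k f}"

text \<open>These are the chain maps from \<open>X\<close> to the \<open>k\<close>-fold shift of \<open>Y\<close>, whose differential
  is \<open>(-1)\<^sup>k diff Y\<close>.\<close>

definition cocycles :: "int \<Rightarrow> 'a::ring tot_cplx \<Rightarrow> 'a tot_cplx \<Rightarrow> 'a fin_mat set" where
  "cocycles k X Y = {f \<in> graded_hom k X Y. koszul_sign k (diff Y * f) = f * diff X}"

definition coboundaries :: "int \<Rightarrow> 'a::ring tot_cplx \<Rightarrow> 'a tot_cplx \<Rightarrow> 'a fin_mat set" where
  "coboundaries k X Y = {koszul_sign k (diff Y * h) + h * diff X | h. h \<in> graded_hom (k - 1) X Y}"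

lemma graded_homI:
  "homogeneous k f \<Longrightarrow> idem Y * f = f \<Longrightarrow> f * idem X = f \<Longrightarrow> f \<in> graded_hom k X Y"
  unfolding graded_hom_def by (auto intro: cornerI)

lemma graded_homD:
  assumes "f \<in> graded_hom k X Y" shows "homogeneous k f" "idem Y * f = f" "f * idem X = f"
  using assms unfolding graded_hom_def by (auto dest: cornerD)

lemma cocyclesI: "f \<in> graded_hom k X Y \<Longrightarrow> koszul_sign k (diff Y * f) = f * diff X \<Longrightarrow>
    f \<in> cocycles k X Y"
  unfolding cocycles_def by auto

lemma cocyclesD:
  assumes "f \<in> cocycles k X Y"
  shows "f \<in> graded_hom k X Y" "koszul_sign k (diff Y * f) = f * diff X"
  using assms unfolding cocycles_def by auto

lemma cocycles_0D: "f \<in> cocycles 0 X Y \<Longrightarrow> diff Y * f = f * diff X"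
  using cocyclesD(2) by fastforce

lemma coboundariesE:
  assumes "f \<in> coboundaries k X Y"
  obtains h where "h \<in> graded_hom (k - 1) X Y" "f = koszul_sign k (diff Y * h) + h * diff X"
  using assms unfolding coboundaries_def by auto

lemma graded_hom_zero [simp]: "0 \<in> graded_hom k X Y"
  and graded_hom_add: "f \<in> graded_hom k X Y \<Longrightarrow> g \<in> graded_hom k X Y \<Longrightarrow> f + g \<in> graded_hom k X Y"
  and graded_hom_uminus: "f \<in> graded_hom k X Y \<Longrightarrow> - f \<in> graded_hom k X Y"
  and graded_hom_diff: "f \<in> graded_hom k X Y \<Longrightarrow> g \<in> graded_hom k X Y \<Longrightarrow> f - g \<in> graded_hom k X Y"
  and graded_hom_koszul_sign: "f \<in> graded_hom k X Y \<Longrightarrow> koszul_sign l f \<in> graded_hom k X Y"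
  unfolding graded_hom_def koszul_sign_def
  by (auto intro: corner_zero corner_add corner_uminus corner_diff homogeneous_add
    homogeneous_uminus homogeneous_diff)

lemma graded_hom_mult:
  "g \<in> graded_hom l Y W \<Longrightarrow> f \<in> graded_hom k X Y \<Longrightarrow> m = k + l \<Longrightarrow> g * f \<in> graded_hom m X W"
  unfolding graded_hom_def by (auto intro: corner_mult homogeneous_mult)

lemma cocycles_zero [simp]: "0 \<in> cocycles k X Y"
  and cocycles_add: "f \<in> cocycles k X Y \<Longrightarrow> g \<in> cocycles k X Y \<Longrightarrow> f + g \<in> cocycles k X Y"
  and cocycles_uminus: "f \<in> cocycles k X Y \<Longrightarrow> - f \<in> cocycles k X Y"
  unfolding cocycles_def
  by (auto simp: graded_hom_add graded_hom_uminus distrib_left distrib_right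
    koszul_sign_add koszul_sign_uminus)

lemma cocycles_diff: "f \<in> cocycles k X Y \<Longrightarrow> g \<in> cocycles k X Y \<Longrightarrow> f - g \<in> cocycles k X Y"
  using cocycles_add[of f k X Y "- g"] cocycles_uminus[of g k X Y] by simp

lemma coboundaries_zero [simp]: "0 \<in> coboundaries k X Y"
  unfolding coboundaries_def by (auto intro!: exI[of _ 0])

lemma coboundaries_add:
  assumes "f \<in> coboundaries k X Y" "g \<in> coboundaries k X Y" shows "f + g \<in> coboundaries k X Y"
proof -
  obtain h h' where "h \<in> graded_hom (k - 1) X Y" "f = koszul_sign k (diff Y * h) + h * diff X"
    "h' \<in> graded_hom (k - 1) X Y" "g = koszul_sign k (diff Y * h') + h' * diff X"
    using assms by (elim coboundariesE)
  then show ?thesis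
    unfolding coboundaries_def
    by (auto intro!: exI[of _ "h + h'"] simp: graded_hom_add algebra_simps koszul_sign_add)
qed

lemma coboundaries_uminus:
  assumes "f \<in> coboundaries k X Y" shows "- f \<in> coboundaries k X Y"
proof -
  obtain h where h: "h \<in> graded_hom (k - 1) X Y" "f = koszul_sign k (diff Y * h) + h * diff X"
    using assms by (rule coboundariesE)
  then have "- f = koszul_sign k (diff Y * - h) + - h * diff X" by (simp add: koszul_sign_uminus)
  then show ?thesis using graded_hom_uminus[OF h(1)] unfolding coboundaries_def by blast
qed

lemma coboundaries_diff: "f \<in> coboundaries k X Y \<Longrightarrow> g \<in> coboundaries k X Y \<Longrightarrow>
    f - g \<in> coboundaries k X Y"
  using coboundaries_add[of f k X Y "- g"] coboundaries_uminus[of g k X Y] by simp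

lemma cocycles_mult:
  assumes g: "g \<in> cocycles l Y W" and f: "f \<in> cocycles k X Y" shows "g * f \<in> cocycles (k + l) X W"
proof (rule cocyclesI)
  have "koszul_sign (k + l) (diff W * (g * f)) = koszul_sign k (koszul_sign l (diff W * g) * f)"
    by (simp add: koszul_sign_koszul_sign koszul_sign_mult_left mult.assoc)
  also have "\<dots> = g * koszul_sign k (diff Y * f)"
    unfolding cocyclesD(2)[OF g] by (simp add: koszul_sign_mult_right mult.assoc)
  also have "\<dots> = g * f * diff X" unfolding cocyclesD(2)[OF f] by (simp add: mult.assoc)
  finally show "koszul_sign (k + l) (diff W * (g * f)) = g * f * diff X" .
qed (rule graded_hom_mult[OF cocyclesD(1)[OF g] cocyclesD(1)[OF f] refl])

lemma cocycles_0_mult: "g \<in> cocycles 0 Y W \<Longrightarrow> f \<in> cocycles 0 X Y \<Longrightarrow> g * f \<in> cocycles 0 X W"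
  using cocycles_mult[of g 0 Y W f 0 X] by simp

lemma coboundaries_mult_left:
  assumes g: "g \<in> cocycles l Y W" and f: "f \<in> coboundaries k X Y"
  shows "g * f \<in> coboundaries (k + l) X W"
proof -
  obtain h where h: "h \<in> graded_hom (k - 1) X Y" "f = koszul_sign k (diff Y * h) + h * diff X"
    using f by (rule coboundariesE)
  have "g * f = koszul_sign k (g * diff Y * h) + g * h * diff X"
    by (simp add: h distrib_left koszul_sign_mult_right mult.assoc)
  also have "g * diff Y = koszul_sign l (diff W * g)" using cocyclesD(2)[OF g] by simp
  also have "koszul_sign k (koszul_sign l (diff W * g) * h) =
      koszul_sign (k + l) (diff W * (g * h))"
    by (simp add: koszul_sign_koszul_sign koszul_sign_mult_left mult.assoc)
  moreover have "g * h \<in> graded_hom (k + l - 1) X W"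
    by (rule graded_hom_mult[OF cocyclesD(1)[OF g] h(1)]) simp
  ultimately show ?thesis unfolding coboundaries_def by auto
qed

lemma coboundaries_mult_right:
  assumes g: "g \<in> coboundaries l Y W" and f: "f \<in> cocycles k X Y"
  shows "g * f \<in> coboundaries (k + l) X W"
proof -
  obtain h where h: "h \<in> graded_hom (l - 1) Y W" "g = koszul_sign l (diff W * h) + h * diff Y"
    using g by (rule coboundariesE)
  have "diff Y * f = koszul_sign k (f * diff X)"
    unfolding cocyclesD(2)[OF f, symmetric] by (simp add: koszul_sign_def)
  then have "g * f = koszul_sign (k + l) (diff W * koszul_sign k (h * f)) +
      koszul_sign k (h * f) * diff X"
    by (simp add: h koszul_sign_def distrib_right mult.assoc)
  moreover have "koszul_sign k (h * f) \<in> graded_hom (k + l - 1) X W"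
    by (rule graded_hom_koszul_sign, rule graded_hom_mult[OF h(1) cocyclesD(1)[OF f]]) simp
  ultimately show ?thesis unfolding coboundaries_def by auto
qed

lemma (in tot_complex) idem_cocycle: "idem X \<in> cocycles 0 X X"
  by (intro cocyclesI graded_homI homogeneous_idem) (simp_all add: reduce)

lemma graded_hom_diff_left:
  assumes "tot_complex Y" "f \<in> graded_hom k X Y" shows "diff Y * f \<in> graded_hom (k + 1) X Y"
proof -
  interpret Y: tot_complex Y by fact
  have "diff Y \<in> graded_hom 1 Y Y" by (intro graded_homI Y.homogeneous_diff Y.reduce)
  then show ?thesis using assms(2) by (rule graded_hom_mult) simp
qed

lemma graded_hom_diff_right:
  assumes "tot_complex X" "f \<in> graded_hom k X Y" shows "f * diff X \<in> graded_hom (k + 1) X Y"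
proof -
  interpret X: tot_complex X by fact
  have "diff X \<in> graded_hom 1 X X" by (intro graded_homI X.homogeneous_diff X.reduce)
  then show ?thesis by (rule graded_hom_mult[OF assms(2)]) simp
qed

definition tot_equiv :: "'a::ring tot_cplx \<Rightarrow> 'a tot_cplx \<Rightarrow> bool" where
  "tot_equiv X Y \<longleftrightarrow> (\<exists>f\<in>cocycles 0 X Y. \<exists>g\<in>cocycles 0 Y X.
     g * f - idem X \<in> coboundaries 0 X X \<and> f * g - idem Y \<in> coboundaries 0 Y Y)"

subsection \<open>Stalk complexes\<close>

lemma tot_complex_zero_diff: "homogeneous 0 e \<Longrightarrow> e * e = e \<Longrightarrow> tot_complex (e, 0 :: 'a::ring fin_mat)"
  by unfold_locales simp_all

lemma stalk_tot_complex: "in_block s s P \<Longrightarrow> P * P = P \<Longrightarrow> tot_complex (P, 0 :: 'a::ring fin_mat)"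
  by (rule tot_complex_zero_diff[OF in_block_homogeneous]) simp_all

lemma stalk_cocycles:
  assumes "in_block s s P" "in_block s s Q"
  shows "cocycles 0 (P, 0) (Q, 0 :: 'a::ring fin_mat) = corner P Q"
  unfolding cocycles_def graded_hom_def using in_block_homogeneous[OF in_block_corner[OF assms]]
  by auto

lemma stalk_coboundaries: "coboundaries k (P, 0) (Q, 0 :: 'a::ring fin_mat) = {0}"
  unfolding coboundaries_def by (auto intro!: exI[of _ 0])

lemma stalk_tot_equiv_iff:
  assumes "in_block s s P" "in_block s s (Q :: 'a::ring fin_mat)"
  shows "tot_equiv (P, 0) (Q, 0) \<longleftrightarrow> (\<exists>u v. idem_iso P Q u v)"
  unfolding tot_equiv_def idem_iso_def stalk_cocycles[OF assms] stalk_cocycles[OF assms(2,1)]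
    stalk_coboundaries by auto

subsection \<open>Idempotent endomorphisms\<close>

lemma tot_complex_image:
  assumes X: "tot_complex X" and g: "g \<in> cocycles 0 X X" "g * g = g"
  shows "tot_complex (g, g * diff X)" "g \<in> cocycles 0 (g, g * diff X) X"
    "g \<in> cocycles 0 X (g, g * diff X)"
proof -
  interpret X: tot_complex X by fact
  note g_hom = graded_homD[OF cocyclesD(1)[OF g(1)]]
  have commute: "diff X * (g * y) = g * (diff X * y)" "g * (g * y) = g * y" for y
    using cocycles_0D[OF g(1)] g(2) by (simp_all add: mult.assoc[symmetric])
  note reduce = cocycles_0D[OF g(1)] commute g(2) g_hom(2,3) X.reduce X.reduce_assoc
  have "homogeneous 1 (g * diff X)" by (rule homogeneous_mult[OF g_hom(1) X.homogeneous_diff]) simp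
  then show "tot_complex (g, g * diff X)"
    by unfold_locales (simp_all add: g_hom(1) mult.assoc reduce)
  show "g \<in> cocycles 0 (g, g * diff X) X" "g \<in> cocycles 0 X (g, g * diff X)"
    by (intro cocyclesI graded_homI g_hom(1); simp add: mult.assoc reduce)+
qed

context fin_dim_algebra
begin

lemma subspace_cocycles: "vs.subspace (cocycles k X Y)"
proof (rule vs.subspaceI)
  fix c f assume f: "f \<in> cocycles k X Y"
  have "koszul_sign k (scale_mat c x) = scale_mat c (koszul_sign k x)" for x
    unfolding koszul_sign_def by simp
  then show "scale_mat c f \<in> cocycles k X Y"
    using cocyclesD(2)[OF f] graded_homD[OF cocyclesD(1)[OF f]]
    by (intro cocyclesI graded_homI) (simp_all add: scale_mat_mult homogeneous_scale_mat)
qed (auto intro: cocycles_add)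

lemma fitting_cocycles:
  fixes X :: "'a tot_cplx"
  assumes X: "tot_complex X" and f: "f \<in> cocycles 0 X X"
  obtains g u v where "g \<in> cocycles 0 X X" "u \<in> cocycles 0 X X" "v \<in> cocycles 0 X X" "g * g = g"
    "f * u = g" "u * f = g" "(idem X - f) * v = idem X - g" "v * (idem X - f) = idem X - g"
proof (rule vs.fitting[of "idem X" f "cocycles 0 X X"])
  interpret X: tot_complex X by fact
  show "idem X * idem X = idem X" "idem X \<in> cocycles 0 X X" by (rule X.idem_idem X.idem_cocycle)+
  show "f \<in> corner (idem X) (idem X)"
    using graded_homD[OF cocyclesD(1)[OF f]] by (intro cornerI)
qed (blast intro: subspace_cocycles f that cocycles_0_mult)+

lemma strict_idempotent:
  fixes X :: "'a tot_cplx"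
  assumes X: "tot_complex X" and f: "f \<in> cocycles 0 X X" "f * f - f \<in> coboundaries 0 X X"
  obtains g where "g \<in> cocycles 0 X X" "g * g = g" "g - f \<in> coboundaries 0 X X"
proof -
  obtain g u v where g: "g \<in> cocycles 0 X X" "u \<in> cocycles 0 X X" "v \<in> cocycles 0 X X" "g * g = g"
    "f * u = g" "u * f = g" "(idem X - f) * v = idem X - g" "v * (idem X - f) = idem X - g"
    using fitting_cocycles[OF X f(1)] .
  have f_right: "f * idem X = f" using graded_homD[OF cocyclesD(1)[OF f(1)]] by blast
  have "f * (idem X - g) = f * (idem X - f) * v" using g(7) by (simp add: mult.assoc)
  then have "f * g - f = (f * f - f) * v" using f_right by (simp add: algebra_simps)
  moreover have "f * g - g = (f * f - f) * u" using g(5) by (simp add: left_diff_distrib mult.assoc)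
  moreover have "g - f = (f * g - f) - (f * g - g)" by simp
  ultimately have "g - f = (f * f - f) * v - (f * f - f) * u" by simp
  moreover have "(f * f - f) * v \<in> coboundaries 0 X X" "(f * f - f) * u \<in> coboundaries 0 X X"
    using coboundaries_mult_right[OF f(2) g(3)] coboundaries_mult_right[OF f(2) g(2)] by auto
  ultimately have "g - f \<in> coboundaries 0 X X" using coboundaries_diff by simp
  then show thesis using that g(1,4) by blast
qed

end

section \<open>The total complex of a complex\<close>

subsection \<open>Families of matrices\<close>

definition bounded_family :: "int \<Rightarrow> (int \<Rightarrow> nat) \<Rightarrow> (int \<Rightarrow> nat) \<Rightarrow> (int \<Rightarrow> 'a::zero mat) \<Rightarrow> bool" where
  "bounded_family k v u f \<longleftrightarrow> (\<forall>i. f i \<in> carrier_mat (v (i + k)) (u i)) \<and>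
     (\<exists>N. \<forall>i. \<bar>i\<bar> > N \<longrightarrow> f i = 0\<^sub>m (v (i + k)) (u i))"

lemma bounded_familyD: "bounded_family k v u f \<Longrightarrow> f i \<in> carrier_mat (v (i + k)) (u i)"
  unfolding bounded_family_def by blast

lemma bounded_familyE:
  assumes "bounded_family k v u f" obtains N where "\<And>i. \<bar>i\<bar> > N \<Longrightarrow> f i = 0\<^sub>m (v (i + k)) (u i)"
  using assms unfolding bounded_family_def by blast

lemma bounded_familyI:
  "(\<And>i. f i \<in> carrier_mat (v (i + k)) (u i)) \<Longrightarrow> (\<And>i. \<bar>i\<bar> > N \<Longrightarrow> f i = 0\<^sub>m (v (i + k)) (u i)) \<Longrightarrow>
    bounded_family k v u f"
  unfolding bounded_family_def by blast

lemma bounded_family_zero: "bounded_family k v u (\<lambda>i. 0\<^sub>m (v (i + k)) (u i))"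
  by (rule bounded_familyI) simp_all

definition assemble :: "int \<Rightarrow> (int \<Rightarrow> nat) \<Rightarrow> (int \<Rightarrow> nat) \<Rightarrow> (int \<Rightarrow> 'a::zero mat) \<Rightarrow> 'a fin_mat" where
  "assemble k v u f = Fin_mat (\<lambda>x y. case x of Index i a \<Rightarrow> (case y of Index j b \<Rightarrow>
     if i = j + k \<and> a < v i \<and> b < u j then f j $$ (a, b) else 0))"

lemma entry_assemble:
  assumes "bounded_family k v u f"
  shows "entry (assemble k v u f) (Index i a) (Index j b) =
    (if i = j + k \<and> a < v i \<and> b < u j then f j $$ (a, b) else 0)"
proof -
  obtain N where N: "\<And>i. \<bar>i\<bar> > N \<Longrightarrow> f i = 0\<^sub>m (v (i + k)) (u i)"
    using assms by (rule bounded_familyE) blast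
  have "finite_entries (\<lambda>x y. case x of Index i a \<Rightarrow> (case y of Index j b \<Rightarrow>
     if i = j + k \<and> a < v i \<and> b < u j then f j $$ (a, b) else 0))"
  proof (rule finite_entries_bounded[where N = "\<bar>N\<bar> + \<bar>k\<bar>" and v = v and u = u])
    fix i a j b assume "\<bar>i\<bar> > \<bar>N\<bar> + \<bar>k\<bar> \<or> \<bar>j\<bar> > \<bar>N\<bar> + \<bar>k\<bar> \<or> a \<ge> v i \<or> b \<ge> u j"
    then have "i = j + k \<Longrightarrow> a < v i \<Longrightarrow> b < u j \<Longrightarrow> f j $$ (a, b) = 0"
      using N[of j] by (cases "\<bar>j\<bar> > N") auto
    then show "(case Index i a of Index i a \<Rightarrow> (case Index j b of Index j b \<Rightarrow>
     if i = j + k \<and> a < v i \<and> b < u j then f j $$ (a, b) else 0)) = 0" by auto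
  qed
  then show ?thesis unfolding assemble_def by (simp add: entry_Fin_mat)
qed

lemma sized_assemble:
  assumes "bounded_family k v u f" "sized N (\<lambda>_. n) (\<lambda>_. n) (assemble k v u f)"
  shows "sized N v u (assemble k v u f)"
  unfolding sized_def
proof (intro allI impI)
  fix i a j b assume "\<bar>i\<bar> > N \<or> \<bar>j\<bar> > N \<or> a \<ge> v i \<or> b \<ge> u j"
  then show "entry (assemble k v u f) (Index i a) (Index j b) = 0"
    using sizedD[OF assms(2), of i j a b] by (auto simp: entry_assemble[OF assms(1)])
qed

lemma homogeneous_assemble: "bounded_family k v u f \<Longrightarrow> homogeneous k (assemble k v u f)"
  unfolding homogeneous_def by (auto simp: entry_assemble split: if_splits)

lemma assemble_zero: "assemble k v u (\<lambda>i. 0\<^sub>m (v (i + k)) (u i)) = (0 :: 'a::ring_1 fin_mat)"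
  by (rule fin_mat_eqI) (auto simp: entry_assemble[OF bounded_family_zero])

lemma assemble_eq_iff:
  assumes f: "bounded_family k v u f" and g: "bounded_family k v u g"
  shows "assemble k v u f = assemble k v u g \<longleftrightarrow> (\<forall>i. f i = g i)"
proof (intro iffI allI)
  fix i assume eq: "assemble k v u f = assemble k v u g"
  show "f i = g i"
  proof (rule eq_matI)
    fix a b assume "a < dim_row (g i)" "b < dim_col (g i)"
    then have "a < v (i + k)" "b < u i" using bounded_familyD[OF g, of i] by auto
    then show "f i $$ (a, b) = g i $$ (a, b)"
      using arg_cong[OF eq, of "\<lambda>x. entry x (Index (i + k) a) (Index i b)"]
      by (simp add: entry_assemble[OF f] entry_assemble[OF g])
  qed (use bounded_familyD[OF f, of i] bounded_familyD[OF g, of i] in auto)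
qed presburger

lemma bounded_family_mult:
  assumes g: "bounded_family l w v g" and f: "bounded_family k v u f" and m: "m = k + l"
  shows "bounded_family m w u (\<lambda>i. g (i + k) * f i :: 'a::ring_1 mat)"
proof -
  obtain N where N: "\<And>i. \<bar>i\<bar> > N \<Longrightarrow> f i = 0\<^sub>m (v (i + k)) (u i)"
    using f by (rule bounded_familyE) blast
  show ?thesis
  proof (rule bounded_familyI)
    fix i
    show "g (i + k) * f i \<in> carrier_mat (w (i + m)) (u i)"
      using bounded_familyD[OF g, of "i + k"] bounded_familyD[OF f, of i] m by (simp add: add.assoc)
    show "g (i + k) * f i = 0\<^sub>m (w (i + m)) (u i)" if "\<bar>i\<bar> > N"
      using N[OF that] bounded_familyD[OF g, of "i + k"] m by (simp add: add.assoc)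
  qed
qed

lemma assemble_mult:
  assumes g: "bounded_family l w v g" and f: "bounded_family k v u f" and m: "m = k + l"
  shows "assemble l w v g * assemble k v u f =
      assemble m w u (\<lambda>i. g (i + k) * f i :: 'a::ring_1 mat)"
proof (unfold m, rule fin_mat_eqI)
  fix i a j b
  note entries = entry_assemble[OF f] entry_assemble[OF g]
    entry_assemble[OF bounded_family_mult[OF g f refl]]
  let ?J = "Index (j + k) ` {0..<v (j + k)}"
  have "entry (assemble l w v g) (Index i a) x = 0 \<or> entry (assemble k v u f) x (Index j b) = 0"
    if "x \<notin> ?J" for x using that by (cases x) (auto simp: entries)
  then have "entry (assemble l w v g * assemble k v u f) (Index i a) (Index j b) =
      (\<Sum>x\<in>?J. entry (assemble l w v g) (Index i a) x * entry (assemble k v u f) x (Index j b))"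
    by (intro entry_mult) auto
  also have "\<dots> = (\<Sum>c = 0..<v (j + k). entry (assemble l w v g) (Index i a) (Index (j + k) c) *
      entry (assemble k v u f) (Index (j + k) c) (Index j b))"
    by (subst sum.reindex) (auto simp: inj_on_def)
  also have "\<dots> = entry (assemble (k + l) w u (\<lambda>i. g (i + k) * f i)) (Index i a) (Index j b)"
  proof (cases "i = j + (k + l) \<and> a < w i \<and> b < u j")
    case True
    then have "(g (j + k) * f j) $$ (a, b) =
        (\<Sum>c = 0..<v (j + k). g (j + k) $$ (a, c) * f j $$ (c, b))"
      using bounded_familyD[OF g, of "j + k"] bounded_familyD[OF f, of j]
      by (auto simp: scalar_prod_def add.assoc intro!: sum.cong)
    then show ?thesis using True by (simp add: entries add.assoc)
  next
    case False
    then show ?thesis by (auto simp: entries add.assoc intro!: sum.neutral)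
  qed
  finally show "entry (assemble l w v g * assemble k v u f) (Index i a) (Index j b) =
      entry (assemble (k + l) w u (\<lambda>i. g (i + k) * f i)) (Index i a) (Index j b)" .
qed

lemma bounded_family_add:
  assumes f: "bounded_family k v u f" and g: "bounded_family k v u g"
  shows "bounded_family k v u (\<lambda>i. f i + g i :: 'a::ring_1 mat)"
proof -
  obtain N N' where "\<And>i. \<bar>i\<bar> > N \<Longrightarrow> f i = 0\<^sub>m (v (i + k)) (u i)"
    "\<And>i. \<bar>i\<bar> > N' \<Longrightarrow> g i = 0\<^sub>m (v (i + k)) (u i)"
    by (rule bounded_familyE[OF f], rule bounded_familyE[OF g]) blast
  then show ?thesis
    using bounded_familyD[OF f] bounded_familyD[OF g]
    by (intro bounded_familyI[where N = "max N N'"]) auto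
qed

lemma assemble_add:
  assumes f: "bounded_family k v u f" and g: "bounded_family k v u g"
  shows "assemble k v u (\<lambda>i. f i + g i) = assemble k v u f +
      (assemble k v u g :: 'a::ring_1 fin_mat)"
proof (rule fin_mat_eqI)
  fix i a j b
  have "(f j + g j) $$ (a, b) = f j $$ (a, b) + g j $$ (a, b)" if "a < v (j + k)" "b < u j"
    using bounded_familyD[OF f, of j] bounded_familyD[OF g, of j] that by simp
  then show "entry (assemble k v u (\<lambda>i. f i + g i)) (Index i a) (Index j b) =
      entry (assemble k v u f + assemble k v u g) (Index i a) (Index j b)"
    by (auto simp: entry_assemble bounded_family_add f g)
qed

lemma bounded_family_uminus:
  assumes f: "bounded_family k v u f" shows "bounded_family k v u (\<lambda>i. - f i :: 'a::ring_1 mat)"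
proof -
  obtain N where "\<And>i. \<bar>i\<bar> > N \<Longrightarrow> f i = 0\<^sub>m (v (i + k)) (u i)" using f by (rule bounded_familyE) blast
  then show ?thesis using bounded_familyD[OF f] by (intro bounded_familyI[where N = N]) auto
qed

lemma assemble_uminus:
  assumes f: "bounded_family k v u f"
  shows "assemble k v u (\<lambda>i. - f i) = - (assemble k v u f :: 'a::ring_1 fin_mat)"
proof (rule fin_mat_eqI)
  fix i a j b
  have "(- f j) $$ (a, b) = - f j $$ (a, b)" if "a < v (j + k)" "b < u j"
    using bounded_familyD[OF f, of j] that by simp
  then show "entry (assemble k v u (\<lambda>i. - f i)) (Index i a) (Index j b) =
      entry (- assemble k v u f) (Index i a) (Index j b)"
    by (auto simp: entry_assemble bounded_family_uminus f)
qed

lemma bounded_family_diff: "bounded_family k v u (\<lambda>i. f i - g i :: 'a::ring_1 mat)"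
  and assemble_diff: "assemble k v u (\<lambda>i. f i - g i) = assemble k v u f -
      (assemble k v u g :: 'a::ring_1 fin_mat)"
  if f: "bounded_family k v u f" and g: "bounded_family k v u g"
proof -
  have "(\<lambda>i. f i - g i) = (\<lambda>i. f i + - g i)"
    using bounded_familyD[OF f] bounded_familyD[OF g]
    by (auto simp: fun_eq_iff minus_add_uminus_mat)
  then show "bounded_family k v u (\<lambda>i. f i - g i)"
    "assemble k v u (\<lambda>i. f i - g i) = assemble k v u f - assemble k v u g"
    using f g by (simp_all add: bounded_family_add bounded_family_uminus
      assemble_add assemble_uminus)
qed

lemma bounded_family_koszul_sign:
  "bounded_family k v u (\<lambda>i. if even l then f i else - f i :: 'a::ring_1 mat)"
  and assemble_koszul_sign:
    "assemble k v u (\<lambda>i. if even l then f i else - f i) =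
        koszul_sign l (assemble k v u f :: 'a::ring_1 fin_mat)"
  if "bounded_family k v u f"
  using that by (cases "even l"; simp add: koszul_sign_def bounded_family_uminus assemble_uminus)+

lemma assemble_surj:
  assumes F: "homogeneous k F" "sized N v u F"
  obtains f where "bounded_family k v u f" "assemble k v u f = (F :: 'a::ring_1 fin_mat)"
    "f = (\<lambda>i. mat (v (i + k)) (u i) (\<lambda>(a, b). entry F (Index (i + k) a) (Index i b)))"
proof -
  define f where "f = (\<lambda>i. mat (v (i + k)) (u i) (\<lambda>(a, b). entry F (Index (i + k) a) (Index i b)))"
  have bounded: "bounded_family k v u f"
  proof (rule bounded_familyI)
    fix i assume "\<bar>i\<bar> > N"
    then show "f i = 0\<^sub>m (v (i + k)) (u i)"
      unfolding f_def by (intro eq_matI) (simp_all add: sizedD[OF F(2)])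
  qed (simp add: f_def)
  moreover have "assemble k v u f = F"
  proof (rule fin_mat_eqI)
    fix i a j b
    show "entry (assemble k v u f) (Index i a) (Index j b) = entry F (Index i a) (Index j b)"
      unfolding entry_assemble[OF bounded]
      using homogeneousD[OF F(1), of i a j b] sizedD[OF F(2), of i j a b]
      by (auto simp: f_def not_less)
  qed
  ultimately show thesis using that f_def by blast
qed

subsection \<open>Encoding complexes\<close>

definition dims :: "'a cplx \<Rightarrow> int \<Rightarrow> nat" where "dims X i = fst (cobj X i)"

definition Tot :: "'a::ring_1 cplx \<Rightarrow> 'a tot_cplx" where
  "Tot X = (assemble 0 (dims X) (dims X) (id_cmap X), assemble 1 (dims X) (dims X) (cdif X))"

lemma phom_iff_units:
  assumes "proj_obj P" "proj_obj Q"
  shows "f \<in> phom P Q \<longleftrightarrow> f \<in> carrier_mat (fst Q) (fst P) \<and> snd Q * f = f \<and> f * snd P = f"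
proof
  assume f: "f \<in> phom P Q"
  then have carrier: "f \<in> carrier_mat (fst Q) (fst P)" and f_eq: "snd Q * f * snd P = f"
    unfolding phom_def by auto
  have P: "snd P \<in> carrier_mat (fst P) (fst P)" "snd P * snd P = snd P"
    and Q: "snd Q \<in> carrier_mat (fst Q) (fst Q)" "snd Q * snd Q = snd Q"
    using assms unfolding proj_obj_def by auto
  have "snd Q * f * snd P * snd P = snd Q * f * snd P"
    using assoc_mult_mat[OF mult_carrier_mat[OF Q(1) carrier] P(1) P(1)] P(2) by simp
  moreover have "snd Q * (snd Q * f * snd P) = snd Q * f * snd P"
    using assoc_mult_mat[OF Q(1) mult_carrier_mat[OF Q(1) carrier] P(1)]
      assoc_mult_mat[OF Q(1) Q(1) carrier] Q(2)
    by simp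
  ultimately show "f \<in> carrier_mat (fst Q) (fst P) \<and> snd Q * f = f \<and> f * snd P = f"
    unfolding f_eq using carrier by blast
next
  assume "f \<in> carrier_mat (fst Q) (fst P) \<and> snd Q * f = f \<and> f * snd P = f"
  then show "f \<in> phom P Q" unfolding phom_def by simp
qed

lemma tot_complex_Tot_iff:
  assumes id: "bounded_family 0 (dims X) (dims X) (id_cmap X)"
    and cdif: "bounded_family 1 (dims X) (dims X) (cdif X)"
  shows "tot_complex (Tot X) \<longleftrightarrow> (\<forall>i. id_cmap X i * id_cmap X i = id_cmap X i) \<and>
    (\<forall>i. id_cmap X (i + 1) * cdif X i = cdif X i) \<and> (\<forall>i. cdif X i * id_cmap X i = cdif X i) \<and>
    (\<forall>i. cdif X (i + 1) * cdif X i = 0\<^sub>m (dims X (i + 2)) (dims X i))"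
  unfolding tot_complex_def Tot_def fst_conv snd_conv assemble_mult[OF id id refl]
    assemble_mult[OF cdif id refl] assemble_mult[OF id cdif refl]
    assemble_mult[OF cdif cdif refl] assemble_zero[symmetric, of 2 "dims X" "dims X"]
  using assemble_eq_iff[OF bounded_family_mult[OF id id] id]
    assemble_eq_iff[OF bounded_family_mult[OF cdif id] cdif]
    assemble_eq_iff[OF bounded_family_mult[OF id cdif] cdif]
    assemble_eq_iff[OF bounded_family_mult[OF cdif cdif] bounded_family_zero, of 2]
    homogeneous_assemble[OF id] homogeneous_assemble[OF cdif] by simp

lemma
  assumes X: "is_complex X"
  shows bounded_id_cmap: "bounded_family 0 (dims X) (dims X) (id_cmap X)"
    and bounded_cdif: "bounded_family 1 (dims X) (dims X) (cdif X)"
proof -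
  obtain N :: nat where N: "\<And>i. \<bar>i\<bar> > int N \<Longrightarrow> id_cmap X i = 0\<^sub>m (dims X i) (dims X i)"
    using X unfolding is_complex_def dims_def id_cmap_def by blast
  have proj: "proj_obj (cobj X i)" and carrier: "cdif X i \<in> carrier_mat (dims X (i + 1)) (dims X i)"
    and unit: "cdif X i * id_cmap X i = cdif X i" for i
    using X phom_iff_units[of "cobj X i" "cobj X (i + 1)" "cdif X i"]
    unfolding is_complex_def dims_def id_cmap_def by auto
  have "cdif X i = 0\<^sub>m (dims X (i + 1)) (dims X i)" if "\<bar>i\<bar> > int N" for i
    using unit[of i] carrier[of i] unfolding N[OF that] by simp
  then show "bounded_family 1 (dims X) (dims X) (cdif X)"
    using carrier by (auto simp: bounded_family_def)
  show "bounded_family 0 (dims X) (dims X) (id_cmap X)"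
    using N proj unfolding proj_obj_def by (auto simp: bounded_family_def id_cmap_def dims_def)
qed

lemma tot_complex_Tot: "tot_complex (Tot X)" if X: "is_complex X"
proof -
  have "cdif X i * id_cmap X i = cdif X i \<and> id_cmap X (i + 1) * cdif X i = cdif X i" for i
    using X phom_iff_units[of "cobj X i" "cobj X (i + 1)" "cdif X i"]
    unfolding is_complex_def id_cmap_def by auto
  then show ?thesis
    unfolding tot_complex_Tot_iff[OF bounded_id_cmap[OF X] bounded_cdif[OF X]]
    using X unfolding is_complex_def proj_obj_def id_cmap_def dims_def by simp
qed

lemma is_complexI:
  assumes id: "bounded_family 0 (dims X) (dims X) (id_cmap X)"
    and cdif: "bounded_family 1 (dims X) (dims X) (cdif X)"
    and "tot_complex (Tot X)"
  shows "is_complex X"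
proof -
  note equations = assms(3)[unfolded tot_complex_Tot_iff[OF id cdif]]
  have proj: "proj_obj (cobj X i)" for i
    using equations bounded_familyD[OF id, of i] unfolding proj_obj_def id_cmap_def dims_def by auto
  obtain N where "\<And>i. \<bar>i\<bar> > N \<Longrightarrow> id_cmap X i = 0\<^sub>m (dims X i) (dims X i)"
    using bounded_familyE[OF id] by auto
  then have "\<exists>N::nat. \<forall>i. \<bar>i\<bar> > int N \<longrightarrow> snd (cobj X i) = 0\<^sub>m (fst (cobj X i)) (fst (cobj X i))"
    unfolding id_cmap_def dims_def by (intro exI[of _ "nat N"]) auto
  then show "is_complex X"
    using proj phom_iff_units[OF proj proj] equations bounded_familyD[OF cdif]
    unfolding is_complex_def id_cmap_def dims_def by simp
qed

lemma Tot_surj: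
  assumes "tot_complex (e, d :: 'a::ring_1 fin_mat)"
  obtains X where "is_complex X" "Tot X = (e, d)"
proof -
  interpret E: tot_complex "(e, d)" by fact
  obtain N n where n: "\<And>x. x \<in> {e, d} \<Longrightarrow> sized N (\<lambda>_. n) (\<lambda>_. n) x"
    using common_size[of "{e, d}"] by auto
  obtain f where f: "bounded_family 0 (\<lambda>_. n) (\<lambda>_. n) f" "assemble 0 (\<lambda>_. n) (\<lambda>_. n) f = e"
    using assemble_surj[OF E.homogeneous_idem n] by auto
  obtain g where g: "bounded_family 1 (\<lambda>_. n) (\<lambda>_. n) g" "assemble 1 (\<lambda>_. n) (\<lambda>_. n) g = d"
    using assemble_surj[OF E.homogeneous_diff n] by auto
  define X where "X = ((\<lambda>i. (n, f i)), g)"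
  have X: "dims X = (\<lambda>_. n)" "id_cmap X = f" "cdif X = g"
    by (simp_all add: X_def dims_def cobj_def id_cmap_def cdif_def fun_eq_iff)
  have "Tot X = (e, d)" unfolding Tot_def X f(2) g(2) ..
  moreover have "is_complex X"
    by (rule is_complexI) (simp_all add: X \<open>Tot X = (e, d)\<close> f(1) g(1) assms)
  ultimately show thesis using that by blast
qed

definition graded_maps :: "int \<Rightarrow> 'a::ring_1 cplx \<Rightarrow> 'a cplx \<Rightarrow> (int \<Rightarrow> 'a mat) set" where
  "graded_maps k X Y = {f. \<forall>i. f i \<in> phom (cobj X i) (cobj Y (i + k))}"

definition Tot_map :: "int \<Rightarrow> 'a::ring_1 cplx \<Rightarrow> 'a cplx \<Rightarrow> (int \<Rightarrow> 'a mat) \<Rightarrow> 'a fin_mat" where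
  "Tot_map k X Y f = assemble k (dims Y) (dims X) f"

context
  fixes X Y :: "'a::ring_1 cplx"
  assumes X: "is_complex X" and Y: "is_complex Y"
begin

lemma graded_maps_iff:
  "f \<in> graded_maps k X Y \<longleftrightarrow> (\<forall>i. f i \<in> carrier_mat (dims Y (i + k)) (dims X i) \<and>
     id_cmap Y (i + k) * f i = f i \<and> f i * id_cmap X i = f i)"
proof -
  have "proj_obj (cobj X i)" "proj_obj (cobj Y i)" for i
    using X Y unfolding is_complex_def by blast+
  then show ?thesis unfolding graded_maps_def dims_def id_cmap_def by (auto simp: phom_iff_units)
qed

lemma bounded_graded_maps:
  assumes "f \<in> graded_maps k X Y" shows "bounded_family k (dims Y) (dims X) f"
proof -
  obtain N where N: "\<And>i. \<bar>i\<bar> > N \<Longrightarrow> id_cmap X i = 0\<^sub>m (dims X i) (dims X i)"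
    using bounded_familyE[OF bounded_id_cmap[OF X]] by auto
  show ?thesis
  proof (rule bounded_familyI)
    show carrier: "f i \<in> carrier_mat (dims Y (i + k)) (dims X i)" for i
      using assms graded_maps_iff by blast
    fix i assume "\<bar>i\<bar> > N"
    then have "f i * 0\<^sub>m (dims X i) (dims X i) = f i" using assms graded_maps_iff N[of i] by metis
    then show "f i = 0\<^sub>m (dims Y (i + k)) (dims X i)" using carrier[of i] by simp
  qed
qed

lemma graded_maps_iff_graded_hom:
  assumes f: "bounded_family k (dims Y) (dims X) f"
  shows "f \<in> graded_maps k X Y \<longleftrightarrow> Tot_map k X Y f \<in> graded_hom k (Tot X) (Tot Y)"
proof -
  have "Tot_map k X Y f \<in> graded_hom k (Tot X) (Tot Y) \<longleftrightarrow>
      idem (Tot Y) * Tot_map k X Y f = Tot_map k X Y f \<and> Tot_map k X Y f * idem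
        (Tot X) = Tot_map k X Y f"
    unfolding graded_hom_def corner_def using homogeneous_assemble[OF f] by (simp add: Tot_map_def)
  also have "\<dots> \<longleftrightarrow> (\<forall>i. id_cmap Y (i + k) * f i = f i) \<and> (\<forall>i. f i * id_cmap X i = f i)"
    unfolding Tot_map_def Tot_def fst_conv
    using assemble_mult[OF bounded_id_cmap[OF Y] f, of k]
      assemble_mult[OF f bounded_id_cmap[OF X], of k]
      assemble_eq_iff[OF bounded_family_mult[OF bounded_id_cmap[OF Y] f] f]
      assemble_eq_iff[OF bounded_family_mult[OF f bounded_id_cmap[OF X]] f] by simp
  also have "\<dots> \<longleftrightarrow> f \<in> graded_maps k X Y"
    unfolding graded_maps_iff using bounded_familyD[OF f] by blast
  finally show ?thesis by blast
qed

lemma Tot_map_graded_hom: "f \<in> graded_maps k X Y \<Longrightarrow> Tot_map k X Y f \<in> graded_hom k (Tot X) (Tot Y)"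
  using graded_maps_iff_graded_hom bounded_graded_maps by blast

lemma Tot_map_surj:
  assumes F: "F \<in> graded_hom k (Tot X) (Tot Y)"
  obtains f where "f \<in> graded_maps k X Y" "Tot_map k X Y f = F"
proof -
  obtain N n where "sized N (\<lambda>_. n) (\<lambda>_. n) F"
    "sized N (\<lambda>_. n) (\<lambda>_. n) (idem (Tot X))" "sized N (\<lambda>_. n) (\<lambda>_. n) (idem (Tot Y))"
    using common_size[of "{F, idem (Tot X), idem (Tot Y)}"]
    by (metis finite.emptyI finite_insert insertCI)
  then have sized: "sized N (\<lambda>_. n) (\<lambda>_. n) F" "sized N (dims X) (dims X) (idem (Tot X))"
    "sized N (dims Y) (dims Y) (idem (Tot Y))"
    using sized_assemble[OF bounded_id_cmap[OF X]] sized_assemble[OF bounded_id_cmap[OF Y]]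
    by (auto simp: Tot_def)
  have "sized N (dims Y) (dims X) F"
    unfolding sized_def
  proof (intro allI impI)
    fix i a j b assume "\<bar>i\<bar> > N \<or> \<bar>j\<bar> > N \<or> a \<ge> dims Y i \<or> b \<ge> dims X j"
    then consider (degree) "\<bar>i\<bar> > N \<or> \<bar>j\<bar> > N" | (row) "a \<ge> dims Y i" | (column) "b \<ge> dims X j"
      by blast
    then show "entry F (Index i a) (Index j b) = 0"
    proof cases
      case row
      then have "entry (idem (Tot Y)) (Index i a) w = 0" for w
        by (cases w) (simp add: sizedD[OF sized(3)])
      then have "entry (idem (Tot Y) * F) (Index i a) (Index j b) = 0"
        by (subst entry_mult[of "{}"]) auto
      then show ?thesis using graded_homD(2)[OF F] by simp
    next
      case column
      then have "entry (idem (Tot X)) w (Index j b) = 0" for w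
        by (cases w) (simp add: sizedD[OF sized(2)])
      then have "entry (F * idem (Tot X)) (Index i a) (Index j b) = 0"
        by (subst entry_mult[of "{}"]) auto
      then show ?thesis using graded_homD(3)[OF F] by simp
    qed (use sizedD[OF sized(1)] in blast)
  qed
  then obtain f where "bounded_family k (dims Y) (dims X) f" "assemble k (dims Y) (dims X) f = F"
    using assemble_surj[OF graded_homD(1)[OF F]] by blast
  then show thesis using that[of f] graded_maps_iff_graded_hom F unfolding Tot_map_def by simp
qed

end

subsection \<open>Chain maps and homotopies\<close>

lemma shift_simps: "cobj (shift k X) i = cobj X (i + k)"
  "cdif (shift k X) i = (if even k then cdif X (i + k) else - cdif X (i + k))"
  unfolding shift_def cobj_def cdif_def by auto

lemma shift_0 [simp]: "shift 0 X = X"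
  unfolding shift_def cobj_def cdif_def by simp

lemma shift_shift_uminus: "shift (- k) (shift k X) = X"
proof -
  have "- (- A) = A" for A :: "'b::ring_1 mat" by (rule eq_matI) auto
  then show ?thesis unfolding shift_def cobj_def cdif_def by (cases X) (auto simp: fun_eq_iff)
qed

context
  fixes X Y :: "'a::ring_1 cplx"
  assumes X: "is_complex X" and Y: "is_complex Y"
begin

lemma shift_diff_mult:
  assumes h: "h \<in> graded_maps k X Y"
  shows "bounded_family (k + 1) (dims Y) (dims X) (\<lambda>i. cdif (shift l Y) (i + k - l) * h i)"
    and "koszul_sign l (diff (Tot Y) * Tot_map k X Y h) =
      assemble (k + 1) (dims Y) (dims X) (\<lambda>i. cdif (shift l Y) (i + k - l) * h i)"
proof -
  note bounded = bounded_graded_maps[OF X Y h]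
  have "- cdif Y (i + k) * h i = - (cdif Y (i + k) * h i)" for i
    using bounded_familyD[OF bounded_cdif[OF Y], of "i + k"] bounded_familyD[OF bounded, of i]
    by (intro uminus_mult_left_mat) auto
  then have signed: "(\<lambda>i. cdif (shift l Y) (i + k - l) * h i) =
      (\<lambda>i. if even l then cdif Y (i + k) * h i else - (cdif Y (i + k) * h i))"
    by (simp add: shift_simps fun_eq_iff)
  have mult: "bounded_family (k + 1) (dims Y) (dims X) (\<lambda>i. cdif Y (i + k) * h i)"
    by (rule bounded_family_mult[OF bounded_cdif[OF Y] bounded refl])
  show "bounded_family (k + 1) (dims Y) (dims X) (\<lambda>i. cdif (shift l Y) (i + k - l) * h i)"
    unfolding signed by (rule bounded_family_koszul_sign[OF mult])
  show "koszul_sign l (diff (Tot Y) * Tot_map k X Y h) =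
      assemble (k + 1) (dims Y) (dims X) (\<lambda>i. cdif (shift l Y) (i + k - l) * h i)"
    unfolding signed assemble_koszul_sign[OF mult] Tot_def Tot_map_def snd_conv
      assemble_mult[OF bounded_cdif[OF Y] bounded refl] ..
qed

lemma mult_diff:
  assumes h: "h \<in> graded_maps k X Y"
  shows "bounded_family (k + 1) (dims Y) (dims X) (\<lambda>i. h (i + 1) * cdif X i)"
    and "Tot_map k X Y h * diff (Tot X) =
        assemble (k + 1) (dims Y) (dims X) (\<lambda>i. h (i + 1) * cdif X i)"
  unfolding Tot_def Tot_map_def snd_conv
  using bounded_family_mult[OF bounded_graded_maps[OF X Y h] bounded_cdif[OF X]]
    assemble_mult[OF bounded_graded_maps[OF X Y h] bounded_cdif[OF X]]
      by (simp_all add: add.commute)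

lemma chain_map_iff:
  "chain_map X (shift l Y) f \<longleftrightarrow> f \<in> graded_maps l X Y \<and> Tot_map l X Y f \<in> cocycles l (Tot X) (Tot Y)"
proof (cases "f \<in> graded_maps l X Y")
  case True
  have "chain_map X (shift l Y) f \<longleftrightarrow> (\<forall>i. cdif (shift l Y) i * f i = f (i + 1) * cdif X i)"
    using True unfolding chain_map_def graded_maps_def by (simp add: shift_simps)
  also have "\<dots> \<longleftrightarrow> koszul_sign l (diff (Tot Y) * Tot_map l X Y f) = Tot_map l X Y f * diff (Tot X)"
    unfolding shift_diff_mult(2)[OF True] mult_diff(2)[OF True]
    using assemble_eq_iff[OF shift_diff_mult(1)[OF True, of l] mult_diff(1)[OF True]] by simp
  finally show ?thesis using True Tot_map_graded_hom[OF X Y True] unfolding cocycles_def by auto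
next
  case False
  then show ?thesis unfolding chain_map_def graded_maps_def by (auto simp: shift_simps)
qed

lemma homotopy_iff:
  assumes f: "bounded_family l (dims Y) (dims X) f" and h: "h \<in> graded_maps (l - 1) X Y"
  shows "(\<forall>i. f i = cdif (shift l Y) (i - 1) * h i + h (i + 1) * cdif X i) \<longleftrightarrow>
    Tot_map l X Y f = koszul_sign l (diff (Tot Y) * Tot_map (l - 1) X Y h) + Tot_map (l - 1)
      X Y h * diff (Tot X)"
proof -
  have "i + (l - 1) - l = i - 1" for i :: int by simp
  note left = shift_diff_mult[OF h, of l, unfolded this diff_add_cancel]
    and right = mult_diff[OF h, unfolded diff_add_cancel]
  show ?thesis
    unfolding left(2) right(2) unfolding assemble_add[OF left(1) right(1), symmetric] Tot_map_def
    using assemble_eq_iff[OF f bounded_family_add[OF left(1) right(1)]] by simp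
qed

lemma null_homotopic_iff:
  assumes f: "bounded_family l (dims Y) (dims X) f"
  shows "null_homotopic X (shift l Y) f \<longleftrightarrow> Tot_map l X Y f \<in> coboundaries l (Tot X) (Tot Y)"
proof -
  have degree: "i - 1 + l = i + (l - 1)" for i :: int by simp
  have "null_homotopic X (shift l Y) f \<longleftrightarrow>
      (\<exists>h\<in>graded_maps (l - 1) X Y. \<forall>i. f i = cdif (shift l Y) (i - 1) * h i + h (i + 1) * cdif X i)"
    unfolding null_homotopic_def graded_maps_def shift_simps(1) degree by blast
  also have "\<dots> \<longleftrightarrow> (\<exists>h\<in>graded_maps (l - 1) X Y. Tot_map l X Y f =
      koszul_sign l (diff (Tot Y) * Tot_map (l - 1) X Y h) + Tot_map (l - 1) X Y h * diff (Tot X))"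
    using homotopy_iff[OF f] by blast
  also have "\<dots> \<longleftrightarrow> Tot_map l X Y f \<in> coboundaries l (Tot X) (Tot Y)"
    unfolding coboundaries_def using Tot_map_graded_hom[OF X Y] Tot_map_surj[OF X Y]
    by (smt (verit) mem_Collect_eq)
  finally show ?thesis .
qed

lemma chain_map_surj:
  assumes F: "F \<in> cocycles l (Tot X) (Tot Y)"
  obtains f where "chain_map X (shift l Y) f" "f \<in> graded_maps l X Y" "Tot_map l X Y f = F"
proof -
  obtain f where "f \<in> graded_maps l X Y" "Tot_map l X Y f = F"
    using Tot_map_surj[OF X Y cocyclesD(1)[OF F]] .
  then show thesis using that chain_map_iff F by simp
qed

end

lemma null_homotopic_id_iff:
  assumes X: "is_complex X" and Y: "is_complex Y" and f: "f \<in> graded_maps 0 X Y"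
    and g: "g \<in> graded_maps 0 Y X"
  shows "null_homotopic X X (\<lambda>i. g i * f i - id_cmap X i) \<longleftrightarrow>
    Tot_map 0 Y X g * Tot_map 0 X Y f - idem (Tot X) \<in> coboundaries 0 (Tot X) (Tot X)"
proof -
  note bounded = bounded_graded_maps[OF X Y f] bounded_graded_maps[OF Y X g]
    and id = bounded_id_cmap[OF X]
  have mult: "bounded_family 0 (dims X) (dims X) (\<lambda>i. g i * f i)"
    "assemble 0 (dims X) (dims Y) g * assemble 0 (dims Y) (dims X) f =
        assemble 0 (dims X) (dims X) (\<lambda>i. g i * f i)"
    using bounded_family_mult[OF bounded(2,1), of 0] assemble_mult[OF bounded(2,1), of 0]
    by simp_all
  show ?thesis
    using null_homotopic_iff[OF X X bounded_family_diff[OF mult(1) id]]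
    by (simp add: Tot_map_def Tot_def mult(2) assemble_diff[OF mult(1) id])
qed

lemma htpy_equiv_iff: "X \<simeq>\<^sub>K Y \<longleftrightarrow> is_complex X \<and> is_complex Y \<and> tot_equiv (Tot X) (Tot Y)"
proof -
  have "(\<exists>f g. chain_map X Y f \<and> chain_map Y X g \<and>
        null_homotopic X X (\<lambda>i. g i * f i - id_cmap X i) \<and>
        null_homotopic Y Y (\<lambda>i. f i * g i - id_cmap Y i)) \<longleftrightarrow> tot_equiv (Tot X) (Tot
          Y)" (is "?htpy \<longleftrightarrow> _")
    if X: "is_complex X" and Y: "is_complex Y"
  proof
    note chain_maps = chain_map_iff[OF X Y, of 0, unfolded shift_0]
      chain_map_iff[OF Y X, of 0, unfolded shift_0]
    show "tot_equiv (Tot X) (Tot Y)" if ?htpy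
      using that null_homotopic_id_iff[OF X Y] null_homotopic_id_iff[OF Y X]
      unfolding tot_equiv_def chain_maps by blast
    show ?htpy if equiv: "tot_equiv (Tot X) (Tot Y)"
    proof -
      obtain F G where FG: "F \<in> cocycles 0 (Tot X) (Tot Y)" "G \<in> cocycles 0 (Tot Y) (Tot X)"
        "G * F - idem (Tot X) \<in> coboundaries 0 (Tot X) (Tot X)"
          "F * G - idem (Tot Y) \<in> coboundaries 0 (Tot Y) (Tot Y)"
        using equiv unfolding tot_equiv_def by blast
      obtain f where f: "chain_map X Y f" "f \<in> graded_maps 0 X Y" "Tot_map 0 X Y f = F"
        using chain_map_surj[OF X Y FG(1)] by auto
      obtain g where g: "chain_map Y X g" "g \<in> graded_maps 0 Y X" "Tot_map 0 Y X g = G"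
        using chain_map_surj[OF Y X FG(2)] by auto
      show ?htpy
        using FG(3,4) f g null_homotopic_id_iff[OF X Y f(2) g(2)]
          null_homotopic_id_iff[OF Y X g(2) f(2)]
        by (intro exI[of _ f] exI[of _ g]) simp
    qed
  qed
  then show ?thesis unfolding htpy_equiv_def by blast
qed

definition ext_orthogonal :: "'a::ring tot_cplx \<Rightarrow> 'a tot_cplx \<Rightarrow> bool" where
  "ext_orthogonal X Y \<longleftrightarrow> (\<forall>l::nat. l > 0 \<longrightarrow> cocycles (int l) X Y \<subseteq> coboundaries (int l) X Y)"

lemma presilting_iff: "presilting T \<longleftrightarrow> is_complex T \<and> ext_orthogonal (Tot T) (Tot T)"
proof -
  have "(\<forall>f. chain_map T (shift l T) f \<longrightarrow> null_homotopic T (shift l T) f) \<longleftrightarrow>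
      cocycles l (Tot T) (Tot T) \<subseteq> coboundaries l (Tot T) (Tot T)" if T: "is_complex T" for l
  proof
    assume null: "\<forall>f. chain_map T (shift l T) f \<longrightarrow> null_homotopic T (shift l T) f"
    show "cocycles l (Tot T) (Tot T) \<subseteq> coboundaries l (Tot T) (Tot T)"
    proof
      fix F assume "F \<in> cocycles l (Tot T) (Tot T)"
      then obtain f where f: "chain_map T (shift l T) f" "f \<in> graded_maps l T T"
        "Tot_map l T T f = F"
        using chain_map_surj[OF T T] by blast
      then show "F \<in> coboundaries l (Tot T) (Tot T)"
        using null null_homotopic_iff[OF T T bounded_graded_maps[OF T T f(2)]] by blast
    qed
  next
    assume "cocycles l (Tot T) (Tot T) \<subseteq> coboundaries l (Tot T) (Tot T)"
    then show "\<forall>f. chain_map T (shift l T) f \<longrightarrow> null_homotopic T (shift l T) f"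
      using chain_map_iff[OF T T] null_homotopic_iff[OF T T bounded_graded_maps[OF T T]] by blast
  qed
  then show ?thesis unfolding presilting_def ext_orthogonal_def by blast
qed

section \<open>The Krull-Schmidt theorem\<close>

subsection \<open>Biproducts modulo an ideal of morphisms\<close>

text \<open>Morphisms form hom groups inside one ring, and those in the ideal \<open>null\<close> are to be
  regarded as zero.\<close>

locale category_with_ideal =
  fixes obj :: "'o \<Rightarrow> bool" and hom null :: "'o \<Rightarrow> 'o \<Rightarrow> 'm::ring set" and ident :: "'o \<Rightarrow> 'm"
  assumes hom_zero: "0 \<in> hom X Y"
    and hom_add: "f \<in> hom X Y \<Longrightarrow> g \<in> hom X Y \<Longrightarrow> f + g \<in> hom X Y"
    and hom_mult: "g \<in> hom Y W \<Longrightarrow> f \<in> hom X Y \<Longrightarrow> g * f \<in> hom X W"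
    and ident_hom: "obj X \<Longrightarrow> ident X \<in> hom X X"
    and ident_left: "f \<in> hom X Y \<Longrightarrow> ident Y * f = f"
    and ident_right: "f \<in> hom X Y \<Longrightarrow> f * ident X = f"
    and null_zero: "0 \<in> null X Y"
    and null_add: "f \<in> null X Y \<Longrightarrow> g \<in> null X Y \<Longrightarrow> f + g \<in> null X Y"
    and null_uminus: "f \<in> null X Y \<Longrightarrow> - f \<in> null X Y"
    and null_left: "g \<in> hom Y W \<Longrightarrow> f \<in> null X Y \<Longrightarrow> g * f \<in> null X W"
    and null_right: "g \<in> null Y W \<Longrightarrow> f \<in> hom X Y \<Longrightarrow> g * f \<in> null X W"
begin

lemma null_diff: "f \<in> null X Y \<Longrightarrow> g \<in> null X Y \<Longrightarrow> f - g \<in> null X Y"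
  using null_add[of f X Y "- g"] null_uminus[of g X Y] by simp

lemma null_sandwich: "x \<in> null A B \<Longrightarrow> g \<in> hom B C \<Longrightarrow> f \<in> hom D A \<Longrightarrow> g * x * f \<in> null D C"
  using null_left null_right by blast

lemma null_cong: "f - g \<in> null X Y \<Longrightarrow> g \<in> null X Y \<Longrightarrow> f \<in> null X Y"
  using null_add[of "f - g" X Y g] by simp

lemma null_trans: "f - g \<in> null X Y \<Longrightarrow> g - h \<in> null X Y \<Longrightarrow> f - h \<in> null X Y"
  using null_add[of "f - g" X Y "g - h"] by simp

lemma null_sym: "f - g \<in> null X Y \<Longrightarrow> g - f \<in> null X Y"
  using null_uminus[of "f - g" X Y] by simp

lemma null_collapse:
  assumes "h - ident B \<in> null B B" "g \<in> hom B C" "f \<in> hom D B" shows "g * h * f - g * f \<in> null D C"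
proof -
  have "g * h * f - g * f = g * (h - ident B) * f"
    using ident_left[OF assms(3)] by (simp add: algebra_simps)
  then show ?thesis using null_sandwich[OF assms] by simp
qed

definition iso :: "'o \<Rightarrow> 'o \<Rightarrow> bool" where
  "iso X Y \<longleftrightarrow> obj X \<and> obj Y \<and>
     (\<exists>f\<in>hom X Y. \<exists>g\<in>hom Y X. g * f - ident X \<in> null X X \<and> f * g - ident Y \<in> null Y Y)"

lemma iso_obj: "iso X Y \<Longrightarrow> obj X" "iso X Y \<Longrightarrow> obj Y"
  unfolding iso_def by auto

lemma iso_refl: "obj X \<Longrightarrow> iso X X"
  unfolding iso_def using ident_hom[of X] ident_left[of "ident X" X X]
  by (auto intro!: bexI[of _ "ident X"] simp: null_zero)

lemma iso_sym: "iso X Y \<Longrightarrow> iso Y X"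
  unfolding iso_def by blast

lemma null_ident_composition:
  assumes "f \<in> hom X Y" "g \<in> hom Y X" "g * f - ident X \<in> null X X" "g' * f' - ident Y \<in> null Y Y"
  shows "(g * g') * (f' * f) - ident X \<in> null X X"
proof -
  have "(g * g') * (f' * f) - g * f \<in> null X X"
    using null_collapse[OF assms(4,2,1)] by (simp add: mult.assoc)
  then show ?thesis using assms(3) by (rule null_trans)
qed

lemma iso_trans:
  assumes "iso X Y" "iso Y W" shows "iso X W"
proof -
  obtain f g where fg: "f \<in> hom X Y" "g \<in> hom Y X" "g * f - ident X \<in> null X X"
    "f * g - ident Y \<in> null Y Y"
    using assms(1) unfolding iso_def by blast
  obtain f' g' where fg': "f' \<in> hom Y W" "g' \<in> hom W Y" "g' * f' - ident Y \<in> null Y Y"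
    "f' * g' - ident W \<in> null W W"
    using assms(2) unfolding iso_def by blast
  show ?thesis
    unfolding iso_def using iso_obj[OF assms(1)] iso_obj[OF assms(2)] hom_mult[OF fg'(1) fg(1)]
      hom_mult[OF fg(2) fg'(2)] null_ident_composition[OF fg(1-3) fg'(3)]
      null_ident_composition[OF fg'(2,1,4) fg(4)] by blast
qed

definition biproduct :: "'o \<Rightarrow> 'o \<Rightarrow> 'o \<Rightarrow> 'm \<Rightarrow> 'm \<Rightarrow> 'm \<Rightarrow> 'm \<Rightarrow> bool" where
  "biproduct B Y Z i\<^sub>1 i\<^sub>2 p\<^sub>1 p\<^sub>2 \<longleftrightarrow> obj B \<and> obj Y \<and> obj Z \<and>
     i\<^sub>1 \<in> hom Y B \<and> i\<^sub>2 \<in> hom Z B \<and> p\<^sub>1 \<in> hom B Y \<and> p\<^sub>2 \<in> hom B Z \<and>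
     p\<^sub>1 * i\<^sub>1 - ident Y \<in> null Y Y \<and> p\<^sub>2 * i\<^sub>2 - ident Z \<in> null Z Z \<and>
     p\<^sub>1 * i\<^sub>2 \<in> null Z Y \<and> p\<^sub>2 * i\<^sub>1 \<in> null Y Z \<and>
     i\<^sub>1 * p\<^sub>1 + i\<^sub>2 * p\<^sub>2 - ident B \<in> null B B"

lemma biproductD:
  assumes "biproduct B Y Z i\<^sub>1 i\<^sub>2 p\<^sub>1 p\<^sub>2"
  shows biproduct_obj: "obj B" "obj Y" "obj Z"
    and biproduct_hom: "i\<^sub>1 \<in> hom Y B" "i\<^sub>2 \<in> hom Z B" "p\<^sub>1 \<in> hom B Y" "p\<^sub>2 \<in> hom B Z"
    and proj\<^sub>1_inj\<^sub>1: "p\<^sub>1 * i\<^sub>1 - ident Y \<in> null Y Y" and proj\<^sub>2_inj\<^sub>2: "p\<^sub>2 * i\<^sub>2 - ident Z \<in> null Z Z"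
    and proj\<^sub>1_inj\<^sub>2: "p\<^sub>1 * i\<^sub>2 \<in> null Z Y" and proj\<^sub>2_inj\<^sub>1: "p\<^sub>2 * i\<^sub>1 \<in> null Y Z"
    and inj_proj_sum: "i\<^sub>1 * p\<^sub>1 + i\<^sub>2 * p\<^sub>2 - ident B \<in> null B B"
  using assms unfolding biproduct_def by auto

lemma biproduct_swap: "biproduct B Y Z i\<^sub>1 i\<^sub>2 p\<^sub>1 p\<^sub>2 \<Longrightarrow> biproduct B Z Y i\<^sub>2 i\<^sub>1 p\<^sub>2 p\<^sub>1"
  unfolding biproduct_def by (auto simp: add.commute)

lemma biproduct_comparison:
  assumes sum: "biproduct B Y Z i\<^sub>1 i\<^sub>2 p\<^sub>1 p\<^sub>2" and sum': "biproduct B' Y Z j\<^sub>1 j\<^sub>2 q\<^sub>1 q\<^sub>2"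
  shows "(i\<^sub>1 * q\<^sub>1 + i\<^sub>2 * q\<^sub>2) * (j\<^sub>1 * p\<^sub>1 + j\<^sub>2 * p\<^sub>2) - ident B \<in> null B B"
proof -
  note homs = biproduct_hom[OF sum]
  have "(i\<^sub>1 * q\<^sub>1 + i\<^sub>2 * q\<^sub>2) * (j\<^sub>1 * p\<^sub>1 + j\<^sub>2 * p\<^sub>2) - ident B =
    (i\<^sub>1 * (q\<^sub>1 * j\<^sub>1) * p\<^sub>1 - i\<^sub>1 * p\<^sub>1) + (i\<^sub>2 * (q\<^sub>2 * j\<^sub>2) * p\<^sub>2 - i\<^sub>2 * p\<^sub>2)
    + i\<^sub>1 * (q\<^sub>1 * j\<^sub>2) * p\<^sub>2 + i\<^sub>2 * (q\<^sub>2 * j\<^sub>1) * p\<^sub>1 + (i\<^sub>1 * p\<^sub>1 + i\<^sub>2 * p\<^sub>2 - ident B)"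
    by (simp add: algebra_simps)
  also have "\<dots> \<in> null B B"
    by (intro null_add null_collapse[OF proj\<^sub>1_inj\<^sub>1[OF sum']] null_collapse[OF proj\<^sub>2_inj\<^sub>2[OF sum']]
        null_sandwich[OF proj\<^sub>1_inj\<^sub>2[OF sum']] null_sandwich[OF proj\<^sub>2_inj\<^sub>1[OF sum']]
          inj_proj_sum[OF sum] homs)
  finally show ?thesis .
qed

lemma biproduct_unique:
  assumes sum: "biproduct B Y Z i\<^sub>1 i\<^sub>2 p\<^sub>1 p\<^sub>2" and sum': "biproduct B' Y Z j\<^sub>1 j\<^sub>2 q\<^sub>1 q\<^sub>2"
  shows "iso B B'"
  unfolding iso_def
  using biproduct_comparison[OF sum sum'] biproduct_comparison[OF sum' sum]
    biproductD[OF sum] biproductD[OF sum']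
  by (intro conjI bexI[of _ "j\<^sub>1 * p\<^sub>1 + j\<^sub>2 * p\<^sub>2"] bexI[of _ "i\<^sub>1 * q\<^sub>1 + i\<^sub>2 * q\<^sub>2"])
    (auto intro!: hom_add hom_mult)

lemma biproduct_change_summand:
  assumes sum: "biproduct B Y Z i\<^sub>1 i\<^sub>2 p\<^sub>1 p\<^sub>2" and Y': "obj Y'"
    and a: "a \<in> hom Y Y'" "a' \<in> hom Y' Y" "a' * a - ident Y \<in> null Y Y"
      "a * a' - ident Y' \<in> null Y' Y'"
  shows "biproduct B Y' Z (i\<^sub>1 * a') i\<^sub>2 (a * p\<^sub>1) p\<^sub>2"
proof -
  note homs = biproduct_hom[OF sum]
  have "a * p\<^sub>1 * (i\<^sub>1 * a') - ident Y' = (a * (p\<^sub>1 * i\<^sub>1) * a' - a * a') + (a * a' - ident Y')"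
    by (simp add: algebra_simps)
  also have "\<dots> \<in> null Y' Y'" by (intro null_add null_collapse[OF proj\<^sub>1_inj\<^sub>1[OF sum]] a)
  finally have retraction: "a * p\<^sub>1 * (i\<^sub>1 * a') - ident Y' \<in> null Y' Y'" .
  have "(i\<^sub>1 * a') * (a * p\<^sub>1) + i\<^sub>2 * p\<^sub>2 - ident B =
    (i\<^sub>1 * (a' * a) * p\<^sub>1 - i\<^sub>1 * p\<^sub>1) + (i\<^sub>1 * p\<^sub>1 + i\<^sub>2 * p\<^sub>2 - ident B)" by (simp add: algebra_simps)
  also have "\<dots> \<in> null B B" by (intro null_add null_collapse[OF a(3)] inj_proj_sum[OF sum] homs)
  finally have resolution: "(i\<^sub>1 * a') * (a * p\<^sub>1) + i\<^sub>2 * p\<^sub>2 - ident B \<in> null B B" .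
  show ?thesis
    unfolding biproduct_def
    using retraction resolution a biproductD[OF sum] Y' null_left[OF a(1) proj\<^sub>1_inj\<^sub>2[OF sum]]
      null_right[OF proj\<^sub>2_inj\<^sub>1[OF sum] a(2)]
    by (auto intro!: hom_mult simp: mult.assoc)
qed

lemma biproduct_iso:
  assumes sum: "biproduct B Y Z i\<^sub>1 i\<^sub>2 p\<^sub>1 p\<^sub>2" and sum': "biproduct B' Y' Z' j\<^sub>1 j\<^sub>2 q\<^sub>1 q\<^sub>2"
    and iso: "iso Y Y'" "iso Z Z'"
  shows "iso B B'"
proof -
  obtain a a' where a: "a \<in> hom Y Y'" "a' \<in> hom Y' Y" "a' * a - ident Y \<in> null Y Y"
    "a * a' - ident Y' \<in> null Y' Y'"
    using iso(1) unfolding iso_def by blast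
  obtain d d' where d: "d \<in> hom Z Z'" "d' \<in> hom Z' Z" "d' * d - ident Z \<in> null Z Z"
    "d * d' - ident Z' \<in> null Z' Z'"
    using iso(2) unfolding iso_def by blast
  note biproduct_swap[OF biproduct_change_summand[OF sum iso_obj(2)[OF iso(1)] a]]
  from biproduct_change_summand[OF this iso_obj(2)[OF iso(2)] d] show ?thesis
    by (rule biproduct_unique) (rule biproduct_swap[OF sum'])
qed

lemma biproduct_transport:
  assumes sum: "biproduct B Y Z i\<^sub>1 i\<^sub>2 p\<^sub>1 p\<^sub>2" and "iso B' B"
  obtains j\<^sub>1 j\<^sub>2 q\<^sub>1 q\<^sub>2 where "biproduct B' Y Z j\<^sub>1 j\<^sub>2 q\<^sub>1 q\<^sub>2"
proof -
  obtain f g where fg: "f \<in> hom B' B" "g \<in> hom B B'" "g * f - ident B' \<in> null B' B'"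
    "f * g - ident B \<in> null B B"
    and B': "obj B'" using assms(2) unfolding iso_def by blast
  note homs = biproduct_hom[OF sum]
  have collapse: "p * f * (g * i) - p * i \<in> null A C" if "p \<in> hom B C" "i \<in> hom A B" for p i A C
    using null_collapse[OF fg(4) that] by (simp add: mult.assoc)
  have "g * i\<^sub>1 * (p\<^sub>1 * f) + g * i\<^sub>2 * (p\<^sub>2 * f) - ident B' =
      (g * (i\<^sub>1 * p\<^sub>1 + i\<^sub>2 * p\<^sub>2) * f - g * f) + (g * f - ident B')"
    by (simp add: algebra_simps)
  also have "\<dots> \<in> null B' B'" by (intro null_add fg null_collapse[OF inj_proj_sum[OF sum]])
  finally have "biproduct B' Y Z (g * i\<^sub>1) (g * i\<^sub>2) (p\<^sub>1 * f) (p\<^sub>2 * f)"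
    unfolding biproduct_def
    using null_trans[OF collapse[OF homs(3,1)] proj\<^sub>1_inj\<^sub>1[OF sum]]
      null_trans[OF collapse[OF homs(4,2)] proj\<^sub>2_inj\<^sub>2[OF sum]]
      null_cong[OF collapse[OF homs(3,2)] proj\<^sub>1_inj\<^sub>2[OF sum]]
      null_cong[OF collapse[OF homs(4,1)] proj\<^sub>2_inj\<^sub>1[OF sum]] B' biproduct_obj[OF sum] homs fg(1,2)
    by (auto intro: hom_mult)
  then show thesis using that by blast
qed

lemma biproduct_assoc_swap:
  assumes sum: "biproduct B X W j\<^sub>1 j\<^sub>2 q\<^sub>1 q\<^sub>2" and w: "biproduct W Y W' f i g p"
    and v: "biproduct V X W' k\<^sub>1 k\<^sub>2 r\<^sub>1 r\<^sub>2"
  shows "biproduct B Y V (j\<^sub>2 * f) (j\<^sub>1 * r\<^sub>1 + j\<^sub>2 * i * r\<^sub>2) (g * q\<^sub>2) (k\<^sub>1 * q\<^sub>1 + k\<^sub>2 * p * q\<^sub>2)"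
proof -
  note homs = biproduct_hom[OF sum] biproduct_hom[OF w] biproduct_hom[OF v]
  note nulls = null_collapse[OF proj\<^sub>1_inj\<^sub>1[OF sum]] null_collapse[OF proj\<^sub>2_inj\<^sub>2[OF sum]]
    null_collapse[OF proj\<^sub>2_inj\<^sub>2[OF w]] null_collapse[OF proj\<^sub>1_inj\<^sub>1[OF v]]
    null_collapse[OF proj\<^sub>2_inj\<^sub>2[OF v]] null_collapse[OF inj_proj_sum[OF w]]
    null_sandwich[OF proj\<^sub>1_inj\<^sub>2[OF sum]] null_sandwich[OF proj\<^sub>2_inj\<^sub>1[OF sum]]
    null_sandwich[OF proj\<^sub>1_inj\<^sub>2[OF v]] null_sandwich[OF proj\<^sub>2_inj\<^sub>1[OF v]]
    null_right[OF proj\<^sub>1_inj\<^sub>2[OF w]] null_left[OF _ proj\<^sub>2_inj\<^sub>1[OF w]] proj\<^sub>1_inj\<^sub>1[OF w]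
    inj_proj_sum[OF sum] inj_proj_sum[OF v]
  have expand: "g * q\<^sub>2 * (j\<^sub>2 * f) - ident Y = (g * (q\<^sub>2 * j\<^sub>2) * f - g * f) + (g * f - ident Y)"
    "(k\<^sub>1 * q\<^sub>1 + k\<^sub>2 * p * q\<^sub>2) * (j\<^sub>1 * r\<^sub>1 + j\<^sub>2 * i * r\<^sub>2) - ident V =
      (k\<^sub>1 * (q\<^sub>1 * j\<^sub>1) * r\<^sub>1 - k\<^sub>1 * r\<^sub>1) + k\<^sub>1 * (q\<^sub>1 * j\<^sub>2) * (i * r\<^sub>2) + (k\<^sub>2 * p) * (q\<^sub>2 * j\<^sub>1) * r\<^sub>1
      + ((k\<^sub>2 * p) * (q\<^sub>2 * j\<^sub>2) * (i * r\<^sub>2) - (k\<^sub>2 * p) * (i * r\<^sub>2)) + (k\<^sub>2 * (p * i) * r\<^sub>2 - k\<^sub>2 * r\<^sub>2)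
      + (k\<^sub>1 * r\<^sub>1 + k\<^sub>2 * r\<^sub>2 - ident V)"
    "g * q\<^sub>2 * (j\<^sub>1 * r\<^sub>1 + j\<^sub>2 * i * r\<^sub>2) =
      g * (q\<^sub>2 * j\<^sub>1) * r\<^sub>1 + (g * (q\<^sub>2 * j\<^sub>2) * (i * r\<^sub>2) - g * (i * r\<^sub>2)) + (g * i) * r\<^sub>2"
    "(k\<^sub>1 * q\<^sub>1 + k\<^sub>2 * p * q\<^sub>2) * (j\<^sub>2 * f) =
      k\<^sub>1 * (q\<^sub>1 * j\<^sub>2) * f + ((k\<^sub>2 * p) * (q\<^sub>2 * j\<^sub>2) * f - (k\<^sub>2 * p) * f) + k\<^sub>2 * (p * f)"
    "j\<^sub>2 * f * (g * q\<^sub>2) + (j\<^sub>1 * r\<^sub>1 + j\<^sub>2 * i * r\<^sub>2) * (k\<^sub>1 * q\<^sub>1 + k\<^sub>2 * p * q\<^sub>2) - ident B =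
      (j\<^sub>1 * (r\<^sub>1 * k\<^sub>1) * q\<^sub>1 - j\<^sub>1 * q\<^sub>1) + j\<^sub>1 * (r\<^sub>1 * k\<^sub>2) * (p * q\<^sub>2) + (j\<^sub>2 * i) * (r\<^sub>2 * k\<^sub>1) * q\<^sub>1
      + ((j\<^sub>2 * i) * (r\<^sub>2 * k\<^sub>2) * (p * q\<^sub>2) - (j\<^sub>2 * i) * (p * q\<^sub>2)) +
        (j\<^sub>2 * (f * g + i * p) * q\<^sub>2 - j\<^sub>2 * q\<^sub>2)
      + (j\<^sub>1 * q\<^sub>1 + j\<^sub>2 * q\<^sub>2 - ident B)"
    by (simp_all add: algebra_simps)
  show ?thesis
    unfolding biproduct_def expand
    by (intro conjI biproduct_obj[OF sum] biproduct_obj[OF w] biproduct_obj[OF v] null_add nulls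
      hom_add; blast intro: hom_mult homs)
qed

lemma complement_comparison:
  assumes sum: "biproduct B Y Z i\<^sub>1 i\<^sub>2 p\<^sub>1 p\<^sub>2" and sum': "biproduct B X W j\<^sub>1 j\<^sub>2 q\<^sub>1 q\<^sub>2"
    and "(p\<^sub>2 * j\<^sub>1) * (q\<^sub>1 * i\<^sub>2) \<in> null Z Z"
  shows "(p\<^sub>2 * j\<^sub>2) * (q\<^sub>2 * i\<^sub>2) - ident Z \<in> null Z Z"
proof -
  have "(p\<^sub>2 * j\<^sub>2) * (q\<^sub>2 * i\<^sub>2) - ident Z =
      (p\<^sub>2 * (j\<^sub>1 * q\<^sub>1 + j\<^sub>2 * q\<^sub>2) * i\<^sub>2 - p\<^sub>2 * i\<^sub>2) + (p\<^sub>2 * i\<^sub>2 - ident Z) - (p\<^sub>2 * j\<^sub>1) * (q\<^sub>1 * i\<^sub>2)"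
    by (simp add: algebra_simps)
  also have "\<dots> \<in> null Z Z"
    by (intro null_add null_diff null_collapse[OF inj_proj_sum[OF sum']] proj\<^sub>2_inj\<^sub>2[OF sum]
      biproduct_hom[OF sum] assms(3))
  finally show ?thesis .
qed

lemma complement_unique:
  assumes sum: "biproduct B Y Z i\<^sub>1 i\<^sub>2 p\<^sub>1 p\<^sub>2" and sum': "biproduct B X W j\<^sub>1 j\<^sub>2 q\<^sub>1 q\<^sub>2"
    and "(p\<^sub>2 * j\<^sub>1) * (q\<^sub>1 * i\<^sub>2) \<in> null Z Z" "(q\<^sub>2 * i\<^sub>1) * (p\<^sub>1 * j\<^sub>2) \<in> null W W"
  shows "iso Z W"
  unfolding iso_def
  using complement_comparison[OF sum sum' assms(3)] complement_comparison[OF sum' sum assms(4)]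
    biproductD[OF sum] biproductD[OF sum']
  by (intro conjI bexI[of _ "q\<^sub>2 * i\<^sub>2"] bexI[of _ "p\<^sub>2 * j\<^sub>2"]) (auto intro: hom_mult)

lemma null_ident_factor: "ident Y \<in> null Y Y \<Longrightarrow> i \<in> hom Y X \<Longrightarrow> p \<in> hom W Y \<Longrightarrow> i * p \<in> null W X"
  using null_sandwich[of "ident Y" Y Y i X p W] ident_right by simp

lemma null_inj_proj:
  assumes sum: "biproduct B Y Z i\<^sub>1 i\<^sub>2 p\<^sub>1 p\<^sub>2" and "i\<^sub>1 * p\<^sub>1 \<in> null B B" shows "ident Y \<in> null Y Y"
proof -
  note homs = biproduct_hom[OF sum] and retraction = proj\<^sub>1_inj\<^sub>1[OF sum]
  have "p\<^sub>1 * i\<^sub>1 = p\<^sub>1 * (i\<^sub>1 * p\<^sub>1) * i\<^sub>1 - (p\<^sub>1 * i\<^sub>1) * (p\<^sub>1 * i\<^sub>1 - ident Y)"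
    using ident_right[OF hom_mult[OF homs(3,1)]] by (simp add: algebra_simps)
  also have "\<dots> \<in> null Y Y"
    by (intro null_diff null_sandwich[OF assms(2)] null_left[OF _ retraction]
      hom_mult[OF homs(3,1)] homs)
  finally show ?thesis using null_cong[OF null_sym[OF retraction]] by blast
qed

lemma null_idempotent:
  assumes "f \<in> hom Y X" "g \<in> hom X Y" "g * f - ident Y \<in> null Y Y"
  shows "f * g * (f * g) - f * g \<in> null X X"
  using null_collapse[OF assms(3,1,2)] by (simp add: mult.assoc)

lemma idempotent_summand_comparison:
  assumes sum: "biproduct X Y Z i\<^sub>1 i\<^sub>2 p\<^sub>1 p\<^sub>2" and eq: "j\<^sub>1 * q\<^sub>1 - i\<^sub>1 * p\<^sub>1 \<in> null X X"
  shows "(p\<^sub>1 * j\<^sub>1) * (q\<^sub>1 * i\<^sub>1) - ident Y \<in> null Y Y"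
proof -
  note homs = biproduct_hom[OF sum]
  have "(p\<^sub>1 * j\<^sub>1) * (q\<^sub>1 * i\<^sub>1) - ident Y =
      p\<^sub>1 * (j\<^sub>1 * q\<^sub>1 - i\<^sub>1 * p\<^sub>1) * i\<^sub>1 + (p\<^sub>1 * i\<^sub>1 - ident Y) * (p\<^sub>1 * i\<^sub>1) + (p\<^sub>1 * i\<^sub>1 - ident Y)"
    using ident_left[OF hom_mult[OF homs(3,1)]] by (simp add: algebra_simps)
  also have "\<dots> \<in> null Y Y"
    by (intro null_add null_sandwich[OF eq] null_right[OF proj\<^sub>1_inj\<^sub>1[OF sum]] proj\<^sub>1_inj\<^sub>1[OF sum]
      hom_mult[OF homs(3,1)] homs)
  finally show ?thesis .
qed

lemma idempotent_summand_unique: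
  assumes sum: "biproduct X Y Z i\<^sub>1 i\<^sub>2 p\<^sub>1 p\<^sub>2" and sum': "biproduct X Y' Z' j\<^sub>1 j\<^sub>2 q\<^sub>1 q\<^sub>2"
    and eq: "j\<^sub>1 * q\<^sub>1 - i\<^sub>1 * p\<^sub>1 \<in> null X X"
  shows "iso Y Y'"
  unfolding iso_def
  using idempotent_summand_comparison[OF sum eq]
    idempotent_summand_comparison[OF sum' null_sym[OF eq]]
    biproductD[OF sum] biproductD[OF sum']
  by (intro conjI bexI[of _ "q\<^sub>1 * i\<^sub>1"] bexI[of _ "p\<^sub>1 * j\<^sub>1"]) (auto intro: hom_mult)

end

subsection \<open>Decomposition into indecomposable objects\<close>

text \<open>The assumption \<open>exchange\<close> says that endomorphism rings modulo \<open>null\<close> are exchange rings;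
  \<open>weight\<close> bounds the number of summands.\<close>

locale krull_schmidt_category = category_with_ideal obj hom null ident
  for obj :: "'o \<Rightarrow> bool" and hom null :: "'o \<Rightarrow> 'o \<Rightarrow> 'm::ring set" and ident :: "'o \<Rightarrow> 'm" +
  fixes biprod :: "'o \<Rightarrow> 'o \<Rightarrow> 'o" and zero_obj :: 'o and weight :: "'o \<Rightarrow> nat"
  assumes obj_zero_obj: "obj zero_obj" and ident_zero_obj: "ident zero_obj = 0"
    and biprod_exists: "obj X \<Longrightarrow> obj Y \<Longrightarrow> \<exists>i\<^sub>1 i\<^sub>2 p\<^sub>1 p\<^sub>2. biproduct (biprod X Y) X Y i\<^sub>1 i\<^sub>2 p\<^sub>1 p\<^sub>2"
    and exchange: "obj X \<Longrightarrow> f \<in> hom X X \<Longrightarrow> \<exists>e\<in>hom X X. \<exists>u\<in>hom X X. \<exists>v\<in>hom X X. e * e - e \<in> null X X \<and>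
      f * u - e \<in> null X X \<and> u * f - e \<in> null X X \<and>
      (ident X - f) * v - (ident X - e) \<in> null X X \<and> v * (ident X - f) - (ident X - e) \<in> null X X"
    and splitting: "obj X \<Longrightarrow> f \<in> hom X X \<Longrightarrow> f * f - f \<in> null X X \<Longrightarrow>
        \<exists>Y Z i\<^sub>1 i\<^sub>2 p\<^sub>1 p\<^sub>2. biproduct X Y Z i\<^sub>1 i\<^sub>2 p\<^sub>1 p\<^sub>2 \<and>
      i\<^sub>1 * p\<^sub>1 - f \<in> null X X \<and>
      (f \<notin> null X X \<longrightarrow> ident X - f \<notin> null X X \<longrightarrow> weight Y < weight X \<and> weight Z < weight X)"
begin

lemma biproduct_biprod:
  assumes "obj X" "obj Y" obtains i\<^sub>1 i\<^sub>2 p\<^sub>1 p\<^sub>2 where "biproduct (biprod X Y) X Y i\<^sub>1 i\<^sub>2 p\<^sub>1 p\<^sub>2"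
  using biprod_exists[OF assms] by blast

lemma obj_biprod: "obj X \<Longrightarrow> obj Y \<Longrightarrow> obj (biprod X Y)"
  using biproduct_biprod biproduct_obj(1) by metis

lemma biproduct_imp_iso: "biproduct B Y Z i\<^sub>1 i\<^sub>2 p\<^sub>1 p\<^sub>2 \<Longrightarrow> iso B (biprod Y Z)"
  using biproduct_biprod[of Y Z] biproduct_unique biproduct_obj(2,3) by metis

lemma iso_imp_biproduct:
  assumes "iso B (biprod Y Z)" "obj Y" "obj Z"
  obtains i\<^sub>1 i\<^sub>2 p\<^sub>1 p\<^sub>2 where "biproduct B Y Z i\<^sub>1 i\<^sub>2 p\<^sub>1 p\<^sub>2"
proof -
  obtain j\<^sub>1 j\<^sub>2 q\<^sub>1 q\<^sub>2 where "biproduct (biprod Y Z) Y Z j\<^sub>1 j\<^sub>2 q\<^sub>1 q\<^sub>2"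
    using biproduct_biprod[OF assms(2,3)] .
  then show thesis using assms(1) that by (rule biproduct_transport)
qed

lemma biprod_cong: "iso X X' \<Longrightarrow> iso Y Y' \<Longrightarrow> iso (biprod X Y) (biprod X' Y')"
  using biproduct_biprod[of X Y] biproduct_biprod[of X' Y'] biproduct_iso iso_obj by metis

lemma biprod_comm: "obj X \<Longrightarrow> obj Y \<Longrightarrow> iso (biprod X Y) (biprod Y X)"
  using biproduct_biprod[of X Y] biproduct_swap biproduct_imp_iso by metis

lemma biprod_left_comm:
  assumes "obj X" "obj Y" "obj Z" shows "iso (biprod X (biprod Y Z)) (biprod Y (biprod X Z))"
proof -
  obtain i\<^sub>1 i\<^sub>2 p\<^sub>1 p\<^sub>2 where outer: "biproduct (biprod X (biprod Y Z)) X (biprod Y Z) i\<^sub>1 i\<^sub>2 p\<^sub>1 p\<^sub>2"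
    using biproduct_biprod[OF assms(1) obj_biprod[OF assms(2,3)]] .
  obtain j\<^sub>1 j\<^sub>2 q\<^sub>1 q\<^sub>2 where inner: "biproduct (biprod Y Z) Y Z j\<^sub>1 j\<^sub>2 q\<^sub>1 q\<^sub>2"
    using biproduct_biprod[OF assms(2,3)] .
  obtain k\<^sub>1 k\<^sub>2 r\<^sub>1 r\<^sub>2 where "biproduct (biprod X Z) X Z k\<^sub>1 k\<^sub>2 r\<^sub>1 r\<^sub>2"
    using biproduct_biprod[OF assms(1,3)] .
  from biproduct_imp_iso[OF biproduct_assoc_swap[OF outer inner this]] show ?thesis .
qed

lemma biprod_assoc:
  assumes "obj X" "obj Y" "obj Z" shows "iso (biprod (biprod X Y) Z) (biprod X (biprod Y Z))"
proof -
  have "iso (biprod (biprod X Y) Z) (biprod Z (biprod X Y))"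
    using assms by (intro biprod_comm obj_biprod)
  moreover have "iso (biprod Z (biprod X Y)) (biprod X (biprod Z Y))"
    using assms by (intro biprod_left_comm)
  moreover have "iso (biprod X (biprod Z Y)) (biprod X (biprod Y Z))"
    using assms by (intro biprod_cong iso_refl biprod_comm)
  ultimately show ?thesis using iso_trans by blast
qed

lemma iso_zero_obj_iff: "obj X \<Longrightarrow> iso X zero_obj \<longleftrightarrow> ident X \<in> null X X"
proof
  assume "obj X" "ident X \<in> null X X"
  then show "iso X zero_obj"
    unfolding iso_def using obj_zero_obj hom_zero ident_zero_obj null_uminus null_zero
    by (auto intro!: bexI[of _ 0])
next
  assume "iso X zero_obj"
  then obtain f g where fg: "f \<in> hom X zero_obj" "g \<in> hom zero_obj X" "g * f - ident X \<in> null X X"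
    unfolding iso_def by blast
  have "f = 0" using ident_left[OF fg(1)] ident_zero_obj by simp
  then show "ident X \<in> null X X" using null_uminus[OF fg(3)] by simp
qed

lemma biprod_zero_obj: assumes "obj X" shows "iso (biprod X zero_obj) X"
proof -
  have "biproduct X X zero_obj (ident X) 0 (ident X) 0"
    unfolding biproduct_def using assms ident_hom[OF assms] ident_left[OF ident_hom[OF assms]]
      obj_zero_obj hom_zero null_zero ident_zero_obj by auto
  then show ?thesis using biproduct_imp_iso iso_sym by blast
qed

lemma zero_summand:
  assumes sum: "biproduct B Y Z i\<^sub>1 i\<^sub>2 p\<^sub>1 p\<^sub>2" and "iso B zero_obj" shows "iso Y zero_obj"
proof -
  note homs = biproduct_hom[OF sum]
  have "i\<^sub>1 * p\<^sub>1 = i\<^sub>1 * p\<^sub>1 * ident B" using ident_right hom_mult homs by metis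
  also have "\<dots> \<in> null B B"
    using assms(2) iso_zero_obj_iff biproduct_obj[OF sum] null_left hom_mult homs by metis
  finally show ?thesis using null_inj_proj[OF sum] iso_zero_obj_iff biproduct_obj[OF sum] by blast
qed

definition indec :: "'o \<Rightarrow> bool" where
  "indec X \<longleftrightarrow> obj X \<and> \<not> iso X zero_obj \<and>
     (\<forall>Y Z. obj Y \<longrightarrow> obj Z \<longrightarrow> iso X (biprod Y Z) \<longrightarrow> iso Y zero_obj \<or> iso Z zero_obj)"

lemma indec_obj: "indec X \<Longrightarrow> obj X" and indec_nonzero: "indec X \<Longrightarrow> ident X \<notin> null X X"
  unfolding indec_def using iso_zero_obj_iff by blast+

lemma indec_summand_null:
  assumes "indec X" and sum: "biproduct X Y Z i\<^sub>1 i\<^sub>2 p\<^sub>1 p\<^sub>2"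
  shows "i\<^sub>1 * p\<^sub>1 \<in> null X X \<or> i\<^sub>2 * p\<^sub>2 \<in> null X X"
proof -
  have "ident Y \<in> null Y Y \<or> ident Z \<in> null Z Z"
    using assms(1) biproduct_obj[OF sum] biproduct_imp_iso[OF sum] iso_zero_obj_iff
    unfolding indec_def
    by blast
  then show ?thesis using null_ident_factor biproduct_hom[OF sum] by blast
qed

lemma indec_local:
  assumes X: "indec X" and f: "f \<in> hom X X"
  shows "(\<exists>u\<in>hom X X. u * f - ident X \<in> null X X) \<or>
      (\<exists>v\<in>hom X X. v * (ident X - f) - ident X \<in> null X X)"
proof -
  obtain e u v where e: "e \<in> hom X X" "e * e - e \<in> null X X"
    and u: "u \<in> hom X X" "u * f - e \<in> null X X"
    and v: "v \<in> hom X X" "v * (ident X - f) - (ident X - e) \<in> null X X"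
    using exchange[OF indec_obj[OF X] f] by blast
  obtain Y Z i\<^sub>1 i\<^sub>2 p\<^sub>1 p\<^sub>2 where sum: "biproduct X Y Z i\<^sub>1 i\<^sub>2 p\<^sub>1 p\<^sub>2"
    and e_split: "i\<^sub>1 * p\<^sub>1 - e \<in> null X X"
    using splitting[OF indec_obj[OF X] e] by blast
  from indec_summand_null[OF X sum] show ?thesis
  proof
    assume "i\<^sub>1 * p\<^sub>1 \<in> null X X"
    then have "e \<in> null X X" using null_cong[OF null_sym[OF e_split]] by blast
    then have "ident X - e - ident X \<in> null X X" using null_uminus by simp
    then show ?thesis using null_trans[OF v(2)] v(1) by blast
  next
    assume "i\<^sub>2 * p\<^sub>2 \<in> null X X"
    from null_add[OF null_sym[OF e_split] null_diff[OF inj_proj_sum[OF sum] this]]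
    have "e - ident X \<in> null X X" by (simp add: algebra_simps)
    then show ?thesis using null_trans[OF u(2)] u(1) by blast
  qed
qed

lemma split_retract:
  assumes f: "f \<in> hom Y W" "g \<in> hom W Y" "g * f - ident Y \<in> null Y Y" and obj: "obj Y" "obj W"
  obtains W' i p where "biproduct W Y W' f i g p"
proof -
  obtain Y' Z i\<^sub>1 i\<^sub>2 p\<^sub>1 p\<^sub>2 where sum: "biproduct W Y' Z i\<^sub>1 i\<^sub>2 p\<^sub>1 p\<^sub>2"
    and split: "i\<^sub>1 * p\<^sub>1 - f * g \<in> null W W"
    using splitting[OF obj(2) hom_mult[OF f(1,2)] null_idempotent[OF f]] by blast
  note homs = biproduct_hom[OF sum]
  have "p\<^sub>2 * f = - (p\<^sub>2 * (i\<^sub>1 * p\<^sub>1 - f * g) * f) - (p\<^sub>2 * f) * (g * f - ident Y) +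
      (p\<^sub>2 * i\<^sub>1) * (p\<^sub>1 * f)"
    using ident_right[OF f(1)] by (simp add: algebra_simps)
  also have "\<dots> \<in> null Y Z"
    by (intro null_add null_uminus null_diff null_sandwich[OF split homs(4) f(1)]
      null_left[OF hom_mult[OF homs(4) f(1)] f(3)]
        null_right[OF proj\<^sub>2_inj\<^sub>1[OF sum] hom_mult[OF homs(3) f(1)]])
  finally have proj: "p\<^sub>2 * f \<in> null Y Z" .
  have "g * i\<^sub>2 = - (g * (i\<^sub>1 * p\<^sub>1 - f * g) * i\<^sub>2) - (g * f - ident Y) * (g * i\<^sub>2) +
      (g * i\<^sub>1) * (p\<^sub>1 * i\<^sub>2)"
    using ident_left[OF f(2)] ident_left[OF hom_mult[OF f(2) homs(2)]] by (simp add: algebra_simps)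
  also have "\<dots> \<in> null Z Y"
    by (intro null_add null_uminus null_diff null_sandwich[OF split f(2) homs(2)]
      null_right[OF f(3) hom_mult[OF f(2) homs(2)]]
        null_left[OF hom_mult[OF f(2) homs(1)] proj\<^sub>1_inj\<^sub>2[OF sum]])
  finally have inj: "g * i\<^sub>2 \<in> null Z Y" .
  have "f * g + i\<^sub>2 * p\<^sub>2 - ident W \<in> null W W"
    using null_add[OF null_sym[OF split] inj_proj_sum[OF sum]] by (simp add: algebra_simps)
  then have "biproduct W Y Z f i\<^sub>2 g p\<^sub>2"
    unfolding biproduct_def using f obj proj inj biproductD[OF sum] by blast
  then show thesis using that by blast
qed

lemma retract_of_indec:
  assumes X: "indec X" and Y: "obj Y" "ident Y \<notin> null Y Y"
    and f: "f \<in> hom Y X" "g \<in> hom X Y" "g * f - ident Y \<in> null Y Y"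
  shows "f * g - ident X \<in> null X X"
proof -
  obtain Z i p where sum: "biproduct X Y Z f i g p" using split_retract[OF f Y(1) indec_obj[OF X]] .
  then have "i * p \<in> null X X" using indec_summand_null[OF X sum] null_inj_proj[OF sum] Y(2) by blast
  from null_diff[OF inj_proj_sum[OF sum] this] show ?thesis by (simp add: algebra_simps)
qed

lemma biproduct_cancel:
  assumes sum: "biproduct B Y Z i\<^sub>1 i\<^sub>2 p\<^sub>1 p\<^sub>2" and sum': "biproduct B Y W j\<^sub>1 j\<^sub>2 q\<^sub>1 q\<^sub>2"
    and retract: "q\<^sub>1 * i\<^sub>1 - ident Y \<in> null Y Y"
  shows "iso Z W"
proof -
  note homs = biproduct_hom[OF sum] biproduct_hom[OF sum']
  obtain V k r where v: "biproduct B Y V i\<^sub>1 k q\<^sub>1 r"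
    using split_retract[OF homs(1) homs(7) retract biproduct_obj(2,1)[OF sum]] .
  note homs = homs biproduct_hom[OF v]
  have "iso Z V"
    by (rule complement_unique[OF sum v];
        intro null_right[OF proj\<^sub>2_inj\<^sub>1[OF sum] hom_mult[OF homs(7,2)]]
        null_right[OF proj\<^sub>2_inj\<^sub>1[OF v] hom_mult[OF homs(3,10)]])
  moreover have "iso V W"
    by (rule complement_unique[OF v sum'];
        intro null_left[OF hom_mult[OF homs(12,5)] proj\<^sub>1_inj\<^sub>2[OF v]]
        null_left[OF hom_mult[OF homs(8,1)] proj\<^sub>1_inj\<^sub>2[OF sum']])
  ultimately show ?thesis by (rule iso_trans)
qed

lemma cancel_via_first:
  assumes sum: "biproduct B Y Z i\<^sub>1 i\<^sub>2 p\<^sub>1 p\<^sub>2" and sum': "biproduct B X W j\<^sub>1 j\<^sub>2 q\<^sub>1 q\<^sub>2"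
    and indec: "indec X" "indec Y"
    and u: "u \<in> hom Y Y" "u * (p\<^sub>1 * j\<^sub>1 * (q\<^sub>1 * i\<^sub>1)) - ident Y \<in> null Y Y"
  shows "iso Y X" "iso Z W"
proof -
  have hom: "q\<^sub>1 * i\<^sub>1 \<in> hom Y X" "u * (p\<^sub>1 * j\<^sub>1) \<in> hom X Y"
    using hom_mult biproduct_hom[OF sum] biproduct_hom[OF sum'] u(1) by blast+
  have left_inverse: "u * (p\<^sub>1 * j\<^sub>1) * (q\<^sub>1 * i\<^sub>1) - ident Y \<in> null Y Y"
    using u(2) by (simp add: mult.assoc)
  have right_inverse: "q\<^sub>1 * i\<^sub>1 * (u * (p\<^sub>1 * j\<^sub>1)) - ident X \<in> null X X"
    by (rule retract_of_indec[OF indec(1) _ _ hom left_inverse])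
      (use indec(2) indec_obj indec_nonzero in blast)+
  show "iso Y X" unfolding iso_def using indec indec_obj hom left_inverse right_inverse by blast
  show "iso Z W"
    by (rule biproduct_cancel[OF sum biproduct_change_summand[OF sum' indec_obj[OF indec(2)] hom(2,1)
      right_inverse left_inverse]])
       (use left_inverse in \<open>simp add: mult.assoc\<close>)
qed

lemma cancel_via_second:
  assumes sum: "biproduct B Y Z i\<^sub>1 i\<^sub>2 p\<^sub>1 p\<^sub>2" and sum': "biproduct B X W j\<^sub>1 j\<^sub>2 q\<^sub>1 q\<^sub>2"
    and v: "v \<in> hom Y Y" "v * (p\<^sub>1 * j\<^sub>2 * (q\<^sub>2 * i\<^sub>1)) - ident Y \<in> null Y Y"
  obtains W' where "obj W'" "iso W (biprod Y W')" "iso Z (biprod X W')"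
proof -
  have hom: "q\<^sub>2 * i\<^sub>1 \<in> hom Y W" "v * (p\<^sub>1 * j\<^sub>2) \<in> hom W Y"
    using hom_mult biproduct_hom[OF sum] biproduct_hom[OF sum'] v(1) by blast+
  have left_inverse: "v * (p\<^sub>1 * j\<^sub>2) * (q\<^sub>2 * i\<^sub>1) - ident Y \<in> null Y Y"
    using v(2) by (simp add: mult.assoc)
  obtain W' i p where w: "biproduct W Y W' (q\<^sub>2 * i\<^sub>1) i (v * (p\<^sub>1 * j\<^sub>2)) p"
    using split_retract[OF hom left_inverse biproduct_obj(2)[OF sum] biproduct_obj(3)[OF sum']] .
  obtain k\<^sub>1 k\<^sub>2 r\<^sub>1 r\<^sub>2 where "biproduct (biprod X W') X W' k\<^sub>1 k\<^sub>2 r\<^sub>1 r\<^sub>2"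
    using biproduct_biprod[OF biproduct_obj(2)[OF sum'] biproduct_obj(3)[OF w]] .
  from biproduct_assoc_swap[OF sum' w this] have "iso Z (biprod X W')"
    by (rule biproduct_cancel[OF sum]) (use left_inverse in \<open>simp add: mult.assoc\<close>)
  then show thesis using that biproduct_obj(3)[OF w] biproduct_imp_iso[OF w] by blast
qed

lemma indec_cancel:
  assumes sum: "biproduct B Y Z i\<^sub>1 i\<^sub>2 p\<^sub>1 p\<^sub>2" and sum': "biproduct B X W j\<^sub>1 j\<^sub>2 q\<^sub>1 q\<^sub>2"
    and indec: "indec X" "indec Y"
  obtains (first) "iso Y X" "iso Z W" | (second) W' where "obj W'" "iso W (biprod Y W')"
    "iso Z (biprod X W')"
proof -
  note homs = biproduct_hom[OF sum] biproduct_hom[OF sum']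
  let ?a = "p\<^sub>1 * j\<^sub>1 * (q\<^sub>1 * i\<^sub>1)"
  have "p\<^sub>1 * j\<^sub>2 * (q\<^sub>2 * i\<^sub>1) - (ident Y - ?a) = (p\<^sub>1 * (j\<^sub>1 * q\<^sub>1 + j\<^sub>2 * q\<^sub>2) * i\<^sub>1 - p\<^sub>1 * i\<^sub>1) +
      (p\<^sub>1 * i\<^sub>1 - ident Y)"
    by (simp add: algebra_simps)
  also have "\<dots> \<in> null Y Y"
    by (intro null_add null_collapse[OF inj_proj_sum[OF sum']] proj\<^sub>1_inj\<^sub>1[OF sum] homs)
  finally have complement: "p\<^sub>1 * j\<^sub>2 * (q\<^sub>2 * i\<^sub>1) - (ident Y - ?a) \<in> null Y Y" .
  have "?a \<in> hom Y Y" by (blast intro: hom_mult homs)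
  from indec_local[OF indec(2) this] consider (first) u where "u \<in> hom Y Y"
    "u * ?a - ident Y \<in> null Y Y"
    | (second) v where "v \<in> hom Y Y" "v * (ident Y - ?a) - ident Y \<in> null Y Y" by blast
  then show thesis
  proof cases
    case first
    then show ?thesis using cancel_via_first[OF sum sum' indec] that(1) by blast
  next
    case second
    have "v * (p\<^sub>1 * j\<^sub>2 * (q\<^sub>2 * i\<^sub>1)) - v * (ident Y - ?a) \<in> null Y Y"
      using null_left[OF second(1) complement] by (simp add: right_diff_distrib)
    from null_trans[OF this second(2)] show ?thesis
      by (rule cancel_via_second[OF sum sum' second(1)]) (rule that(2))
  qed
qed

definition biprod_list :: "'o list \<Rightarrow> 'o" where "biprod_list Xs = foldr biprod Xs zero_obj"

lemma biprod_list_simps [simp]: "biprod_list [] = zero_obj"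
  "biprod_list (X # Xs) = biprod X (biprod_list Xs)"
  unfolding biprod_list_def by auto

lemma obj_biprod_list: "(\<forall>X\<in>set Xs. obj X) \<Longrightarrow> obj (biprod_list Xs)"
  by (induction Xs) (auto simp: obj_zero_obj obj_biprod)

lemma biprod_list_remove:
  "\<forall>Y\<in>set (Xs @ X # Ys). obj Y \<Longrightarrow> iso (biprod_list (Xs @ X # Ys)) (biprod X (biprod_list (Xs @ Ys)))"
proof (induction Xs)
  case Nil
  then show ?case using obj_biprod_list[of "X # Ys"] by (auto intro!: iso_refl)
next
  case (Cons W Xs)
  then have "iso (biprod_list ((W # Xs) @ X # Ys)) (biprod W (biprod X (biprod_list (Xs @ Ys))))"
    by (auto intro!: biprod_cong iso_refl)
  moreover have "iso (biprod W (biprod X (biprod_list (Xs @ Ys))))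
      (biprod X (biprod W (biprod_list (Xs @ Ys))))"
    using Cons.prems obj_biprod_list[of "Xs @ Ys"] by (intro biprod_left_comm) auto
  ultimately show ?case using iso_trans by simp
qed

lemma biprod_list_append:
  "\<forall>Y\<in>set (Xs @ Ys). obj Y \<Longrightarrow> iso (biprod_list (Xs @ Ys)) (biprod (biprod_list Xs) (biprod_list Ys))"
proof (induction Xs)
  case Nil
  then have "obj (biprod_list Ys)" using obj_biprod_list by auto
  then show ?case
    using iso_trans[OF iso_sym[OF biprod_zero_obj] biprod_comm[OF _ obj_zero_obj],
      of "biprod_list Ys"] by simp
next
  case (Cons X Xs)
  have obj: "obj X" "obj (biprod_list Xs)" "obj (biprod_list Ys)"
    using Cons.prems obj_biprod_list by auto
  have "iso (biprod_list ((X # Xs) @ Ys)) (biprod X (biprod (biprod_list Xs) (biprod_list Ys)))"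
    using Cons obj by (auto intro!: biprod_cong iso_refl)
  moreover have "iso (biprod X (biprod (biprod_list Xs) (biprod_list Ys)))
      (biprod (biprod_list (X # Xs)) (biprod_list Ys))"
    using iso_sym[OF biprod_assoc[OF obj]] by simp
  ultimately show ?case by (rule iso_trans)
qed

lemma indec_exchange:
  assumes "\<forall>X\<in>set Xs. indec X" "indec Y" "obj Z" "iso (biprod Y Z) (biprod_list Xs)"
  obtains Us X Vs where "Xs = Us @ X # Vs" "iso Y X" "iso Z (biprod_list (Us @ Vs))"
  using assms
proof (induction Xs arbitrary: Z thesis)
  case Nil
  then have "iso Y zero_obj"
    using biproduct_biprod[OF indec_obj] zero_summand by (metis biprod_list_simps(1))
  then show ?case using Nil(3) unfolding indec_def by blast
next
  case (Cons X Xs)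
  have obj: "obj X" "obj (biprod_list Xs)" "obj Y" "obj Z"
    using Cons.prems obj_biprod_list[of Xs] indec_obj by auto
  obtain i\<^sub>1 i\<^sub>2 p\<^sub>1 p\<^sub>2 where sum: "biproduct (biprod Y Z) Y Z i\<^sub>1 i\<^sub>2 p\<^sub>1 p\<^sub>2"
    using biproduct_biprod[OF obj(3,4)] .
  obtain j\<^sub>1 j\<^sub>2 q\<^sub>1 q\<^sub>2 where sum': "biproduct (biprod Y Z) X (biprod_list Xs) j\<^sub>1 j\<^sub>2 q\<^sub>1 q\<^sub>2"
    using iso_imp_biproduct[OF Cons.prems(5)[unfolded biprod_list_simps] obj(1,2)] .
  have "indec X" using Cons.prems(2) by simp
  from sum sum' this Cons.prems(3) show ?case
  proof (cases rule: indec_cancel)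
    case first
    then show ?thesis using Cons.prems(1)[of "[]" X Xs] by simp
  next
    case (second W')
    obtain Us X' Vs where tail: "Xs = Us @ X' # Vs" "iso Y X'" "iso W' (biprod_list (Us @ Vs))"
      using Cons.IH[OF _ _ Cons.prems(3) second(1) iso_sym[OF second(2)]] Cons.prems(2) by auto
    have "iso (biprod X W') (biprod_list ((X # Us) @ Vs))"
      using tail(3) obj by (simp add: biprod_cong iso_refl)
    then show ?thesis using Cons.prems(1)[of "X # Us" X' Vs] tail iso_trans[OF second(3)] by simp
  qed
qed

definition iso_class_of :: "'o \<Rightarrow> 'o set" where "iso_class_of X = {Y. iso Y X}"

lemma iso_class_of_eq_iff:
  assumes "obj X" shows "iso_class_of X = iso_class_of Y \<longleftrightarrow> iso X Y"
proof
  assume "iso_class_of X = iso_class_of Y"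
  then show "iso X Y" using iso_refl[OF assms] unfolding iso_class_of_def by blast
next
  assume iso: "iso X Y"
  show "iso_class_of X = iso_class_of Y"
    unfolding iso_class_of_def using iso_trans[OF _ iso] iso_trans[OF _ iso_sym[OF iso]] by blast
qed

lemma biprod_list_cong:
  "mset (map iso_class_of Xs) = mset (map iso_class_of Ys) \<Longrightarrow> \<forall>X\<in>set Xs. obj X \<Longrightarrow> \<forall>X\<in>set Ys. obj X \<Longrightarrow>
    iso (biprod_list Xs) (biprod_list Ys)"
proof (induction Xs arbitrary: Ys)
  case Nil
  then show ?case using iso_refl[OF obj_zero_obj] by simp
next
  case (Cons X Xs)
  have "iso_class_of X \<in># mset (map iso_class_of Ys)"
    using Cons.prems(1) by (metis list.simps(9) list.set_intros(1) set_mset_mset)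
  then obtain Y where Y: "Y \<in> set Ys" "iso_class_of Y = iso_class_of X" by auto
  then obtain Us Vs where Ys: "Ys = Us @ Y # Vs" by (meson split_list)
  have "iso X Y" using Y(2) iso_class_of_eq_iff[of X Y] Cons.prems by auto
  moreover have "mset (map iso_class_of Xs) = mset (map iso_class_of (Us @ Vs))"
    using Cons.prems(1) Y(2) unfolding Ys by simp
  then have "iso (biprod_list Xs) (biprod_list (Us @ Vs))"
    using Cons.IH[of "Us @ Vs"] Cons.prems Ys by auto
  ultimately have "iso (biprod_list (X # Xs)) (biprod Y (biprod_list (Us @ Vs)))"
    by (simp add: biprod_cong)
  moreover have "iso (biprod Y (biprod_list (Us @ Vs))) (biprod_list Ys)"
    using biprod_list_remove[of Us Y Vs] Cons.prems(3) Ys iso_sym by blast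
  ultimately show ?case by (rule iso_trans)
qed

theorem krull_schmidt:
  "\<forall>X\<in>set Xs. indec X \<Longrightarrow> \<forall>X\<in>set Ys. indec X \<Longrightarrow> iso (biprod_list Xs) (biprod_list Ys) \<Longrightarrow>
   mset (map iso_class_of Xs) = mset (map iso_class_of Ys)"
proof (induction Xs arbitrary: Ys)
  case Nil
  show ?case
  proof (cases Ys)
    case (Cons Y Ys')
    have obj: "obj Y" "obj (biprod_list Ys')"
      using Nil(2) Cons obj_biprod_list[of Ys'] indec_obj by auto
    obtain i\<^sub>1 i\<^sub>2 p\<^sub>1 p\<^sub>2
      where "biproduct (biprod Y (biprod_list Ys')) Y (biprod_list Ys') i\<^sub>1 i\<^sub>2 p\<^sub>1 p\<^sub>2"
      using biproduct_biprod[OF obj] .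
    then have "iso Y zero_obj" by (rule zero_summand) (use Nil(3) Cons iso_sym in simp)
    then show ?thesis using Nil Cons unfolding indec_def by auto
  qed simp
next
  case (Cons X Xs)
  have "obj (biprod_list Xs)" using Cons.prems obj_biprod_list indec_obj by auto
  then obtain Us Y Vs where Y: "Ys = Us @ Y # Vs" "iso X Y"
    "iso (biprod_list Xs) (biprod_list (Us @ Vs))"
    using indec_exchange[of Ys X "biprod_list Xs"] Cons.prems by auto
  have "mset (map iso_class_of Xs) = mset (map iso_class_of (Us @ Vs))"
    using Cons.IH[of "Us @ Vs"] Cons.prems Y by auto
  moreover have "iso_class_of X = iso_class_of Y" using Y(2) iso_class_of_eq_iff iso_obj by blast
  ultimately show ?case using Y(1) by simp
qed

lemma decomposable_smaller_summands:
  assumes X: "obj X" "\<not> iso X zero_obj" "\<not> indec X"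
  obtains Y Z where "obj Y" "obj Z" "iso X (biprod Y Z)" "weight Y < weight X" "weight Z < weight X"
proof -
  obtain Y Z where YZ: "obj Y" "obj Z" "iso X (biprod Y Z)" "\<not> iso Y zero_obj" "\<not> iso Z zero_obj"
    using X unfolding indec_def by blast
  then obtain i\<^sub>1 i\<^sub>2 p\<^sub>1 p\<^sub>2 where sum: "biproduct X Y Z i\<^sub>1 i\<^sub>2 p\<^sub>1 p\<^sub>2" using iso_imp_biproduct by metis
  note homs = biproduct_hom[OF sum]
  have "ident X - i\<^sub>1 * p\<^sub>1 \<notin> null X X"
  proof
    assume "ident X - i\<^sub>1 * p\<^sub>1 \<in> null X X"
    from null_add[OF inj_proj_sum[OF sum] this] have "i\<^sub>2 * p\<^sub>2 \<in> null X X"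
      by (simp add: algebra_simps)
    then show False using null_inj_proj[OF biproduct_swap[OF sum]] YZ iso_zero_obj_iff by blast
  qed
  moreover have "i\<^sub>1 * p\<^sub>1 \<notin> null X X" using null_inj_proj[OF sum] YZ iso_zero_obj_iff by blast
  ultimately obtain Y' Z' j\<^sub>1 j\<^sub>2 q\<^sub>1 q\<^sub>2 where sum': "biproduct X Y' Z' j\<^sub>1 j\<^sub>2 q\<^sub>1 q\<^sub>2"
      and smaller: "weight Y' < weight X" "weight Z' < weight X"
    using splitting[OF X(1) hom_mult[OF homs(1,3)] null_idempotent[OF homs(1,3) proj\<^sub>1_inj\<^sub>1[OF sum]]]
    by blast
  show thesis using that[OF biproduct_obj(2,3)[OF sum'] biproduct_imp_iso[OF sum'] smaller] .
qed

lemma decompose: "obj X \<Longrightarrow> \<exists>Xs. (\<forall>Y\<in>set Xs. indec Y) \<and> iso X (biprod_list Xs)"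
proof (induction "weight X" arbitrary: X rule: less_induct)
  case less
  consider (zero) "iso X zero_obj" | (indec) "indec X" | (decomposable) "\<not> iso X zero_obj"
    "\<not> indec X" by blast
  then show ?case
  proof cases
    case zero
    then show ?thesis by (intro exI[of _ "[]"]) simp
  next
    case indec
    then show ?thesis
      using iso_sym[OF biprod_zero_obj[OF less.prems]] by (intro exI[of _ "[X]"]) simp
  next
    case decomposable
    then obtain Y Z where YZ: "obj Y" "obj Z" "iso X (biprod Y Z)" "weight Y < weight X"
      "weight Z < weight X"
      using decomposable_smaller_summands[OF less.prems] by blast
    obtain Ys Zs where "\<forall>Y\<in>set Ys. indec Y" "iso Y (biprod_list Ys)" "\<forall>Y\<in>set Zs. indec Y"
      "iso Z (biprod_list Zs)"
      using less.hyps[OF YZ(4,1)] less.hyps[OF YZ(5,2)] by blast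
    then have indec: "\<forall>Y\<in>set (Ys @ Zs). indec Y"
      and iso: "iso (biprod Y Z) (biprod (biprod_list Ys) (biprod_list Zs))"
      using biprod_cong by auto
    have "iso (biprod (biprod_list Ys) (biprod_list Zs)) (biprod_list (Ys @ Zs))"
      by (rule iso_sym, rule biprod_list_append) (use indec indec_obj in blast)
    from iso_trans[OF YZ(3) iso_trans[OF iso this]] show ?thesis using indec by blast
  qed
qed

subsection \<open>The multiset of indecomposable summands\<close>

definition summands :: "'o \<Rightarrow> 'o set multiset" where
  "summands X = (SOME M. \<exists>Xs. (\<forall>Y\<in>set Xs. indec Y) \<and> iso X (biprod_list Xs) \<and>
     M = mset (map iso_class_of Xs))"

lemma summands_eqI:
  assumes "\<forall>Y\<in>set Xs. indec Y" "iso X (biprod_list Xs)"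
  shows "summands X = mset (map iso_class_of Xs)"
proof -
  have "\<exists>M. \<exists>Xs. (\<forall>Y\<in>set Xs. indec Y) \<and> iso X (biprod_list Xs) \<and> M = mset (map iso_class_of Xs)"
    using assms by blast
  from someI_ex[OF this] obtain Ys where "\<forall>Y\<in>set Ys. indec Y" "iso X (biprod_list Ys)"
    "summands X = mset (map iso_class_of Ys)"
    unfolding summands_def by blast
  then show ?thesis
    using krull_schmidt[OF assms(1) _ iso_trans[OF iso_sym[OF assms(2)]], of Ys] by simp
qed

lemma summands_decompose:
  assumes "obj X"
  obtains Xs where "\<forall>Y\<in>set Xs. indec Y" "iso X (biprod_list Xs)"
    "summands X = mset (map iso_class_of Xs)"
  using decompose[OF assms] summands_eqI by blast

lemma summands_biprod:
  assumes "obj X" "obj Y" shows "summands (biprod X Y) = summands X + summands Y"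
proof -
  obtain Xs where X: "\<forall>Y\<in>set Xs. indec Y" "iso X (biprod_list Xs)"
    "summands X = mset (map iso_class_of Xs)"
    using summands_decompose[OF assms(1)] .
  obtain Ys where Y: "\<forall>Y\<in>set Ys. indec Y" "iso Y (biprod_list Ys)"
    "summands Y = mset (map iso_class_of Ys)"
    using summands_decompose[OF assms(2)] .
  have "iso (biprod (biprod_list Xs) (biprod_list Ys)) (biprod_list (Xs @ Ys))"
    by (rule iso_sym, rule biprod_list_append) (use X(1) Y(1) indec_obj in auto)
  from iso_trans[OF biprod_cong[OF X(2) Y(2)] this]
    have "iso (biprod X Y) (biprod_list (Xs @ Ys))" .
  then show ?thesis using summands_eqI[of "Xs @ Ys"] X Y by auto
qed

lemma summands_iso: "iso X Y \<Longrightarrow> summands X = summands Y"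
  using summands_decompose[OF iso_obj(2)] summands_eqI[OF _ iso_trans] by metis

lemma summands_biproduct: "biproduct B Y Z i\<^sub>1 i\<^sub>2 p\<^sub>1 p\<^sub>2 \<Longrightarrow> summands B = summands Y + summands Z"
  using summands_iso[OF biproduct_imp_iso] summands_biprod[OF biproduct_obj(2,3)] by metis

lemma iso_iff_summands: "obj X \<Longrightarrow> obj Y \<Longrightarrow> iso X Y \<longleftrightarrow> summands X = summands Y"
proof
  assume obj: "obj X" "obj Y" and eq: "summands X = summands Y"
  obtain Xs where X: "\<forall>Y\<in>set Xs. indec Y" "iso X (biprod_list Xs)"
    "summands X = mset (map iso_class_of Xs)"
    using summands_decompose[OF obj(1)] .
  obtain Ys where Y: "\<forall>Y\<in>set Ys. indec Y" "iso Y (biprod_list Ys)"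
    "summands Y = mset (map iso_class_of Ys)"
    using summands_decompose[OF obj(2)] .
  have "iso (biprod_list Xs) (biprod_list Ys)"
    using biprod_list_cong[of Xs Ys] X Y eq indec_obj by auto
  then show "iso X Y" by (rule iso_trans[OF X(2) iso_trans[OF _ iso_sym[OF Y(2)]]])
qed (rule summands_iso)

lemma summands_zero_obj: "summands zero_obj = {#}"
  using summands_eqI[of "[]" zero_obj] iso_refl[OF obj_zero_obj] by simp

lemma summands_indec: "indec X \<Longrightarrow> summands X = {#iso_class_of X#}"
  using summands_eqI[of "[X]" X] iso_sym[OF biprod_zero_obj] indec_obj by simp

lemma summands_class_of_indec:
  assumes "obj X" "c \<in># summands X" shows "\<exists>Y. indec Y \<and> c = iso_class_of Y"
proof -
  obtain Xs where "\<forall>Y\<in>set Xs. indec Y" "summands X = mset (map iso_class_of Xs)"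
    using summands_decompose[OF assms(1)] .
  then show ?thesis using assms(2) by auto
qed

lemma summands_surj: "(\<forall>c\<in>#M. \<exists>Y. indec Y \<and> c = iso_class_of Y) \<Longrightarrow> \<exists>X. obj X \<and> summands X = M"
proof (induction M)
  case empty
  then show ?case using obj_zero_obj summands_zero_obj by blast
next
  case (add c M)
  then obtain Y X where "indec Y" "c = iso_class_of Y" "obj X" "summands X = M" by auto
  then show ?case
    using summands_biprod[of Y X] summands_indec obj_biprod indec_obj
    by (intro exI[of _ "biprod Y X"]) auto
qed

lemma summands_empty_iff: "obj X \<Longrightarrow> summands X = {#} \<longleftrightarrow> ident X \<in> null X X"
  using iso_iff_summands[OF _ obj_zero_obj] summands_zero_obj iso_zero_obj_iff by simp

lemma indec_summand_iff:
  assumes X: "obj X" and Y: "indec Y"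
  shows "iso_class_of Y \<in># summands X \<longleftrightarrow> (\<exists>Z. obj Z \<and> iso X (biprod Y Z))"
proof
  assume mem: "iso_class_of Y \<in># summands X"
  have "\<forall>c\<in>#summands X - {#iso_class_of Y#}. \<exists>Y. indec Y \<and> c = iso_class_of Y"
    using summands_class_of_indec[OF X] in_diffD by metis
  from summands_surj[OF this] obtain Z where Z: "obj Z"
    "summands Z = summands X - {#iso_class_of Y#}" by blast
  then have "summands (biprod Y Z) = summands X"
    using summands_biprod[of Y Z] summands_indec[OF Y] indec_obj[OF Y] mem by simp
  then show "\<exists>Z. obj Z \<and> iso X (biprod Y Z)"
    using iso_iff_summands[OF X] obj_biprod indec_obj[OF Y] Z(1) by metis
next
  assume "\<exists>Z. obj Z \<and> iso X (biprod Y Z)"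
  then obtain Z where Z: "obj Z" "iso X (biprod Y Z)" by blast
  then have "summands X = {#iso_class_of Y#} + summands Z"
    using summands_iso summands_biprod summands_indec indec_obj[OF Y] Y by metis
  then show "iso_class_of Y \<in># summands X" by simp
qed

lemma summands_retract:
  assumes "f \<in> hom Y W" "g \<in> hom W Y" "g * f - ident Y \<in> null Y Y" "obj Y" "obj W"
  shows "summands Y \<subseteq># summands W"
proof -
  obtain W' i p where "biproduct W Y W' f i g p" by (rule split_retract[OF assms])
  then show ?thesis using summands_biproduct by simp
qed

lemma disjoint_summands_quasi_inverse:
  assumes X: "obj X" and W: "obj W"
    and disjoint: "set_mset (summands X) \<inter> set_mset (summands W) = {}"
    and F: "F \<in> hom W X" and G: "G \<in> hom X W"
  obtains v where "v \<in> hom X X" "v * (ident X - F * G) - ident X \<in> null X X"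
proof -
  obtain e u v where e: "e \<in> hom X X" "e * e - e \<in> null X X"
    and u: "u \<in> hom X X" "F * G * u - e \<in> null X X"
    and v: "v \<in> hom X X" "v * (ident X - F * G) - (ident X - e) \<in> null X X"
    using exchange[OF X hom_mult[OF F G]] by blast
  obtain Y Z i\<^sub>1 i\<^sub>2 p\<^sub>1 p\<^sub>2 where sum: "biproduct X Y Z i\<^sub>1 i\<^sub>2 p\<^sub>1 p\<^sub>2" and split: "i\<^sub>1 * p\<^sub>1 - e \<in> null X X"
    using splitting[OF X e] by blast
  note homs = biproduct_hom[OF sum]
  have "(p\<^sub>1 * F) * (G * u * i\<^sub>1) - ident Y = p\<^sub>1 * (F * G * u - e) * i\<^sub>1 - p\<^sub>1 * (i\<^sub>1 * p\<^sub>1 - e) * i\<^sub>1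
      + (p\<^sub>1 * i\<^sub>1 - ident Y) * (p\<^sub>1 * i\<^sub>1) + (p\<^sub>1 * i\<^sub>1 - ident Y)"
    using ident_left[OF hom_mult[OF homs(3,1)]] by (simp add: algebra_simps)
  also have "\<dots> \<in> null Y Y"
    by (intro null_add null_diff null_sandwich[OF u(2)] null_sandwich[OF split]
      null_right[OF proj\<^sub>1_inj\<^sub>1[OF sum]]
        proj\<^sub>1_inj\<^sub>1[OF sum] hom_mult[OF homs(3,1)] homs)
  finally have "summands Y \<subseteq># summands W"
    by (intro summands_retract[OF hom_mult[OF hom_mult[OF G u(1)] homs(1)] hom_mult[OF homs(3) F]]
      biproduct_obj[OF sum] W)
  moreover have "summands Y \<subseteq># summands X" using summands_biproduct[OF sum] by simp
  ultimately have "summands Y = {#}"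
    using disjoint by (metis disjoint_iff mset_subset_eqD multiset_nonemptyE)
  then have "ident Y \<in> null Y Y" using summands_empty_iff biproduct_obj[OF sum] by blast
  from null_ident_factor[OF this homs(1,3)] have "e \<in> null X X"
    using null_cong[OF null_sym[OF split]] by blast
  then have "ident X - e - ident X \<in> null X X" using null_uminus by simp
  then show thesis using that v(1) null_trans[OF v(2)] by blast
qed

end

section \<open>Direct sums, cones and shifts\<close>

subsection \<open>Block matrices\<close>

lift_definition transpose_fin_mat :: "'a::zero fin_mat \<Rightarrow> 'a fin_mat" is "\<lambda>x u v. x v u"
  unfolding finite_entries_def supported_by_def by blast

lemma entry_transpose: "entry (transpose_fin_mat x) u v = entry x v u"
  by (simp add: transpose_fin_mat.rep_eq)

lemma transpose_mult_zero:
  assumes "\<And>w u v. entry x w u = 0 \<or> entry y w v = 0"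
  shows "transpose_fin_mat x * y = (0 :: 'a::ring fin_mat)"
proof (rule fin_mat_eqI)
  fix i a j b
  show "entry (transpose_fin_mat x * y) (Index i a) (Index j b) = entry 0 (Index i a) (Index j b)"
    by (subst entry_mult[of "{}"]) (use assms in \<open>auto simp: entry_transpose\<close>)
qed

text \<open>Position \<open>b\<close> in degree \<open>j\<close> goes to position \<open>b + m j\<close> in degree \<open>j - c\<close>; the bounds \<open>n\<close> and \<open>N\<close>
  keep the support finite.\<close>

definition embed_mat :: "int \<Rightarrow> (int \<Rightarrow> nat) \<Rightarrow> (int \<Rightarrow> nat) \<Rightarrow> int \<Rightarrow> 'a::ring_1 fin_mat" where
  "embed_mat c m n N = Fin_mat (\<lambda>x y. case x of Index i a \<Rightarrow> (case y of Index j b \<Rightarrow>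
     if j = i + c \<and> a = b + m j \<and> b < n j \<and> \<bar>j\<bar> \<le> N then 1 else 0))"

lemma entry_embed_mat: "entry (embed_mat c m n N :: 'a::ring_1 fin_mat) (Index i a) (Index j b) =
     (if j = i + c \<and> a = b + m j \<and> b < n j \<and> \<bar>j\<bar> \<le> N then 1 else 0)"
proof -
  have "finite_entries (\<lambda>x y. case x of Index i a \<Rightarrow> (case y of Index j b \<Rightarrow>
     if j = i + c \<and> a = b + m j \<and> b < n j \<and> \<bar>j\<bar> \<le> N then 1 else (0::'a)))"
    by (rule finite_entries_bounded[where N = "\<bar>N\<bar> + \<bar>c\<bar>" and v = "\<lambda>i. n (i + c) +
        m (i + c)" and u = n]) auto
  then show ?thesis unfolding embed_mat_def by (simp add: entry_Fin_mat)
qed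

lemma homogeneous_embed_mat: "homogeneous (- c) (embed_mat c m n N)"
  and homogeneous_transpose_embed_mat: "homogeneous c (transpose_fin_mat (embed_mat c m n N))"
  unfolding homogeneous_def entry_transpose entry_embed_mat by (auto split: if_splits)

lemma entry_embed_mat_mult:
  "entry (embed_mat c m n N * y) (Index i a) v =
    (if m (i + c) \<le> a \<and> a < m (i + c) + n (i + c) \<and> \<bar>i + c\<bar> \<le> N then entry y
      (Index (i + c) (a - m (i + c))) v else 0)"
proof (subst entry_mult_single[of "Index (i + c) (a - m (i + c))"])
  fix w assume "w \<noteq> Index (i + c) (a - m (i + c))"
  then show "entry (embed_mat c m n N) (Index i a) w = 0 \<or> entry y w v = 0"
    by (cases w) (auto simp: entry_embed_mat)
qed (auto simp: entry_embed_mat)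

lemma entry_mult_transpose_embed_mat:
  "entry (y * transpose_fin_mat (embed_mat c m n N)) v (Index i a) =
    (if m (i + c) \<le> a \<and> a < m (i + c) + n (i + c) \<and> \<bar>i + c\<bar> \<le> N then entry y v
      (Index (i + c) (a - m (i + c))) else 0)"
proof (subst entry_mult_single[of "Index (i + c) (a - m (i + c))"])
  fix w assume "w \<noteq> Index (i + c) (a - m (i + c))"
  then show "entry y v w = 0 \<or> entry (transpose_fin_mat (embed_mat c m n N)) w (Index i a) = 0"
    by (cases w) (auto simp: entry_embed_mat entry_transpose)
qed (auto simp: entry_embed_mat entry_transpose)

lemma entry_embed_mat_sandwich:
  assumes "sized N v u x"
  shows "entry (embed_mat c m v N * x * transpose_fin_mat (embed_mat c' m' u N))
      (Index i a) (Index j b) =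
    (if m (i + c) \<le> a \<and> m' (j + c') \<le> b
     then entry x (Index (i + c) (a - m (i + c))) (Index (j + c') (b - m' (j + c'))) else 0)"
  unfolding entry_mult_transpose_embed_mat entry_embed_mat_mult
  using sizedD[OF assms, of "i + c" "j + c'" "a - m (i + c)" "b - m' (j + c')"]
  by (cases "m (i + c) \<le> a"; cases "m' (j + c') \<le> b")
    (auto simp: le_diff_conv2 not_less add.commute)

lemma transpose_embed_mat_embed_mat:
  assumes "sized N v u x"
  shows "transpose_fin_mat (embed_mat c m v N) * (embed_mat c m v N * x) = x"
proof (rule fin_mat_eqI)
  fix i a j b
  let ?z = "Index (i - c) (a + m i)"
  have "entry (transpose_fin_mat (embed_mat c m v N) * (embed_mat c m v N * x))
      (Index i a) (Index j b) =
      entry (transpose_fin_mat (embed_mat c m v N)) (Index i a) ?z * entry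
        (embed_mat c m v N * x) ?z (Index j b)"
  proof (rule entry_mult_single)
    fix w assume "w \<noteq> ?z"
    then show "entry (transpose_fin_mat (embed_mat c m v N)) (Index i a) w = 0 \<or>
        entry (embed_mat c m v N * x) w (Index j b) = 0"
      by (cases w) (auto simp: entry_transpose entry_embed_mat)
  qed
  then show "entry (transpose_fin_mat (embed_mat c m v N) * (embed_mat c m v N * x)) (Index i a)
      (Index j b) = entry x (Index i a) (Index j b)"
    using sizedD[OF assms, of i j a b]
    by (auto simp: entry_transpose entry_embed_mat entry_embed_mat_mult not_less not_le)
qed

lemma transpose_embed_mat_orthogonal:
  "transpose_fin_mat (embed_mat c (\<lambda>_. 0) u N) * embed_mat 0 (\<lambda>i. u (i + c)) w M =
      (0 :: 'a::ring_1 fin_mat)"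
  "transpose_fin_mat (embed_mat 0 (\<lambda>i. u (i + c)) w M) * embed_mat c (\<lambda>_. 0) u N =
      (0 :: 'a::ring_1 fin_mat)"
proof -
  have disjoint: "entry (embed_mat c (\<lambda>_. 0) u N :: 'a fin_mat) x y = 0 \<or>
      entry (embed_mat 0 (\<lambda>i. u (i + c)) w M :: 'a fin_mat) x z = 0" for x y z
    by (cases x; cases y; cases z) (auto simp: entry_embed_mat)
  then show "transpose_fin_mat (embed_mat c (\<lambda>_. 0) u N) * embed_mat 0 (\<lambda>i. u (i + c)) w M =
      (0 :: 'a fin_mat)"
    by (rule transpose_mult_zero)
  show "transpose_fin_mat (embed_mat 0 (\<lambda>i. u (i + c)) w M) * embed_mat c (\<lambda>_. 0) u N =
      (0 :: 'a fin_mat)"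
    by (rule transpose_mult_zero) (use disjoint in blast)
qed

definition block_family ::
  "int \<Rightarrow> int \<Rightarrow> (int \<Rightarrow> nat) \<Rightarrow> (int \<Rightarrow> nat) \<Rightarrow> (int \<Rightarrow> 'a mat) \<Rightarrow> (int \<Rightarrow> 'a mat) \<Rightarrow> (int \<Rightarrow> 'a mat) \<Rightarrow> int
      \<Rightarrow> 'a::zero mat" where
  "block_family k c v u A C D i =
      four_block_mat (A (i + c)) (0\<^sub>m (v (i + k + c)) (u i)) (C (i + c)) (D i)"

context
  fixes A C D :: "int \<Rightarrow> 'a::ring_1 mat" and k c v v' u u'
  assumes A: "bounded_family k v u A" and C: "bounded_family (k - c) v' u C"
    and D: "bounded_family k v' u' D"
begin

lemma block_carriers:
  "A (i + c) \<in> carrier_mat (v (i + k + c)) (u (i + c))"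
    "C (i + c) \<in> carrier_mat (v' (i + k)) (u (i + c))"
  "D i \<in> carrier_mat (v' (i + k)) (u' i)"
  using bounded_familyD[OF A, of "i + c"] bounded_familyD[OF C, of "i + c"]
    bounded_familyD[OF D, of i]
  by (simp_all add: algebra_simps)

lemma bounded_block_family:
  "bounded_family k (\<lambda>i. v (i + c) + v' i) (\<lambda>i. u (i + c) + u' i) (block_family k c v u' A C D)"
proof -
  obtain N\<^sub>A where N\<^sub>A: "\<And>i. \<bar>i\<bar> > N\<^sub>A \<Longrightarrow> A i = 0\<^sub>m (v (i + k)) (u i)"
    using A by (rule bounded_familyE) blast
  obtain N\<^sub>C where N\<^sub>C: "\<And>i. \<bar>i\<bar> > N\<^sub>C \<Longrightarrow> C i = 0\<^sub>m (v' (i + (k - c))) (u i)"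
    using C by (rule bounded_familyE) blast
  obtain N\<^sub>D where N\<^sub>D: "\<And>i. \<bar>i\<bar> > N\<^sub>D \<Longrightarrow> D i = 0\<^sub>m (v' (i + k)) (u' i)"
    using D by (rule bounded_familyE) blast
  show ?thesis
  proof (rule bounded_familyI[where N = "\<bar>N\<^sub>A\<bar> + \<bar>N\<^sub>C\<bar> + \<bar>N\<^sub>D\<bar> + \<bar>c\<bar>"])
    show "block_family k c v u' A C D i \<in> carrier_mat (v (i + k + c) +
        v' (i + k)) (u (i + c) + u' i)" for i
      unfolding block_family_def by (rule four_block_carrier_mat[OF block_carriers(1,3)])
    fix i assume "\<bar>i\<bar> > \<bar>N\<^sub>A\<bar> + \<bar>N\<^sub>C\<bar> + \<bar>N\<^sub>D\<bar> + \<bar>c\<bar>"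
    then have "\<bar>i + c\<bar> > N\<^sub>A" "\<bar>i + c\<bar> > N\<^sub>C" "\<bar>i\<bar> > N\<^sub>D" by linarith+
    then show "block_family k c v u' A C D i = 0\<^sub>m (v (i + k + c) + v' (i + k)) (u (i + c) + u' i)"
      unfolding block_family_def using N\<^sub>A N\<^sub>C N\<^sub>D by (intro eq_matI) (auto simp: algebra_simps)
  qed
qed

lemma block_family_index:
  assumes "a < v (j + k + c) + v' (j + k)" "b < u (j + c) + u' j"
  shows "block_family k c v u' A C D j $$ (a, b) =
    (if a < v (j + k + c) then if b < u (j + c) then A (j + c) $$ (a, b) else 0
     else if b < u (j + c) then C (j + c) $$ (a - v (j + k + c), b) else D j $$
       (a - v (j + k + c), b - u (j + c)))"
  unfolding block_family_def using assms block_carriers[of j] by auto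

lemma assemble_block_family:
  assumes sized: "sized N v u (assemble k v u A)" "sized N v' u (assemble (k - c) v' u C)"
    "sized N v' u' (assemble k v' u' D)"
  defines "E \<equiv> embed_mat c (\<lambda>_. 0) v N" and "E' \<equiv> embed_mat 0 (\<lambda>i. v (i + c)) v' N"
    and "P \<equiv> transpose_fin_mat (embed_mat c (\<lambda>_. 0) u N)"
      and "P' \<equiv> transpose_fin_mat (embed_mat 0 (\<lambda>i. u (i + c)) u' N)"
  shows "assemble k (\<lambda>i. v (i + c) + v' i) (\<lambda>i. u (i + c) + u' i) (block_family k c v u' A C D) =
    E * assemble k v u A * P + E' * assemble (k - c) v' u C * P + E' * assemble k v' u' D * P'"
proof (rule fin_mat_eqI)
  fix i a j b
  have degree: "i + c = j + c + k \<longleftrightarrow> i = j + k" "i = j + c + (k - c) \<longleftrightarrow> i = j + k" by auto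
  show "entry (assemble k (\<lambda>i. v (i + c) + v' i) (\<lambda>i. u (i + c) + u' i)
        (block_family k c v u' A C D)) (Index i a) (Index j b) =
      entry (E * assemble k v u A * P + E' * assemble (k - c) v' u C * P +
        E' * assemble k v' u' D * P') (Index i a) (Index j b)"
    unfolding E_def E'_def P_def P'_def entry_add entry_embed_mat_sandwich[OF sized(1)]
      entry_embed_mat_sandwich[OF sized(2)] entry_embed_mat_sandwich[OF sized(3)]
      entry_assemble[OF bounded_block_family] entry_assemble[OF A] entry_assemble[OF C]
      entry_assemble[OF D] degree add_0_right
    using block_family_index[of a j b] by (cases "i = j + k") auto
qed

end

subsection \<open>Twisted sums\<close>

text \<open>The mapping cone of a chain map \<open>f\<close> from \<open>X\<close>, shifted \<open>c - 1\<close> times, to \<open>Y\<close>: an extension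
  by \<open>Y\<close> of the \<open>c\<close>-fold shift of \<open>X\<close>.\<close>

locale twisted_sum = idem_biproduct "idem B" "idem X" "idem Y" i\<^sub>1 i\<^sub>2 p\<^sub>1 p\<^sub>2
  for c :: int and B X Y :: "'a::ring tot_cplx" and f i\<^sub>1 i\<^sub>2 p\<^sub>1 p\<^sub>2 :: "'a fin_mat" +
  assumes homogeneous_inj\<^sub>1: "homogeneous (- c) i\<^sub>1" and homogeneous_proj\<^sub>1: "homogeneous c p\<^sub>1"
    and homogeneous_inj\<^sub>2: "homogeneous 0 i\<^sub>2" and homogeneous_proj\<^sub>2: "homogeneous 0 p\<^sub>2"
    and diff_eq: "diff B = i\<^sub>1 * koszul_sign c (diff X) * p\<^sub>1 + i\<^sub>2 * f * p\<^sub>1 + i\<^sub>2 * diff Y * p\<^sub>2"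

lemma tot_complex_twisted_sum:
  assumes "twisted_sum c B X Y f i\<^sub>1 i\<^sub>2 p\<^sub>1 p\<^sub>2" "tot_complex X" "tot_complex Y"
    and f: "f \<in> cocycles (1 - c) X Y"
  shows "tot_complex B"
proof -
  interpret twisted_sum c B X Y f i\<^sub>1 i\<^sub>2 p\<^sub>1 p\<^sub>2 by fact
  interpret X: tot_complex X by fact
  interpret Y: tot_complex Y by fact
  note f_hom = graded_homD[OF cocyclesD(1)[OF f]]
  have f_assoc: "idem Y * (f * y) = f * y" "f * (idem X * y) = f * y" for y
    using f_hom by (simp_all add: mult.assoc[symmetric])
  have cocycle: "f * (diff X * y) = koszul_sign (1 - c) (diff Y * (f * y))" for y
    using arg_cong[OF cocyclesD(2)[OF f], of "\<lambda>x. x * y"]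
    by (simp add: koszul_sign_mult_left mult.assoc)
  note reduce = reduce reduce_assoc X.reduce X.reduce_assoc Y.reduce Y.reduce_assoc f_hom(2,3)
    f_assoc koszul_sign_mult_left koszul_sign_mult_right koszul_sign_koszul_sign
  show ?thesis
  proof
    show "homogeneous 0 (idem B)"
      unfolding decomposition
      by (intro homogeneous_add; rule homogeneous_mult[OF homogeneous_inj\<^sub>1 homogeneous_proj\<^sub>1]
        homogeneous_mult[OF homogeneous_inj\<^sub>2 homogeneous_proj\<^sub>2]) simp_all
    show "homogeneous 1 (diff B)"
      unfolding diff_eq
      using homogeneous_mult[OF homogeneous_mult[OF homogeneous_inj\<^sub>1
        homogeneous_koszul_sign[OF X.homogeneous_diff] refl] homogeneous_proj\<^sub>1]
        homogeneous_mult[OF homogeneous_mult[OF homogeneous_inj\<^sub>2 f_hom(1) refl] homogeneous_proj\<^sub>1]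
        homogeneous_mult[OF homogeneous_mult[OF homogeneous_inj\<^sub>2 Y.homogeneous_diff refl]
          homogeneous_proj\<^sub>2]
      by (intro homogeneous_add) simp_all
    show "diff B * diff B = 0"
      unfolding diff_eq by (simp add: distrib_left distrib_right mult.assoc reduce cocycle)
  qed (simp_all add: diff_eq distrib_left distrib_right mult.assoc reduce)
qed

lemma twisted_sum_cocycles:
  assumes "twisted_sum c B X Y f i\<^sub>1 i\<^sub>2 p\<^sub>1 p\<^sub>2" "tot_complex X" "tot_complex Y"
  shows "i\<^sub>2 \<in> cocycles 0 Y B" "p\<^sub>1 \<in> cocycles c B X"
    "f = 0 \<Longrightarrow> i\<^sub>1 \<in> cocycles (- c) X B" "f = 0 \<Longrightarrow> p\<^sub>2 \<in> cocycles 0 B Y"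
proof -
  interpret twisted_sum c B X Y f i\<^sub>1 i\<^sub>2 p\<^sub>1 p\<^sub>2 by fact
  interpret X: tot_complex X by fact
  interpret Y: tot_complex Y by fact
  show "i\<^sub>2 \<in> cocycles 0 Y B" "p\<^sub>1 \<in> cocycles c B X"
    "f = 0 \<Longrightarrow> i\<^sub>1 \<in> cocycles (- c) X B" "f = 0 \<Longrightarrow> p\<^sub>2 \<in> cocycles 0 B Y"
    using homogeneous_inj\<^sub>1 homogeneous_inj\<^sub>2 homogeneous_proj\<^sub>1 homogeneous_proj\<^sub>2
    by (auto intro!: cocyclesI graded_homI
        simp: diff_eq distrib_left distrib_right mult.assoc reduce reduce_assoc X.reduce
          X.reduce_assoc Y.reduce Y.reduce_assoc
          koszul_sign_mult_left koszul_sign_mult_right koszul_sign_koszul_sign)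
qed

lemma twisted_sum_block_form:
  assumes X: "tot_complex X" and Y: "tot_complex Y" and f: "f \<in> graded_hom (1 - c) X Y"
    and homogeneous: "homogeneous (- c) j\<^sub>1" "homogeneous c q\<^sub>1" "homogeneous 0 j\<^sub>2" "homogeneous 0 q\<^sub>2"
    and inverse: "q\<^sub>1 * (j\<^sub>1 * idem X) = idem X" "q\<^sub>2 * (j\<^sub>2 * idem Y) = idem Y"
      and orthogonal: "q\<^sub>1 * j\<^sub>2 = 0" "q\<^sub>2 * j\<^sub>1 = 0"
    and B: "idem B = j\<^sub>1 * idem X * q\<^sub>1 + j\<^sub>2 * idem Y * q\<^sub>2"
      "diff B = j\<^sub>1 * koszul_sign c (diff X) * q\<^sub>1 + j\<^sub>2 * f * q\<^sub>1 + j\<^sub>2 * diff Y * q\<^sub>2"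
  shows "twisted_sum c B X Y f (j\<^sub>1 * idem X) (j\<^sub>2 * idem Y) (idem X * q\<^sub>1) (idem Y * q\<^sub>2)"
proof -
  interpret X: tot_complex X by fact
  interpret Y: tot_complex Y by fact
  have orthogonal_assoc: "q\<^sub>1 * (j\<^sub>2 * y) = 0" "q\<^sub>2 * (j\<^sub>1 * y) = 0" for y
    using orthogonal by (simp_all add: mult.assoc[symmetric])
  have f_assoc: "idem Y * (f * y) = f * y" "f * (idem X * y) = f * y" for y
    using graded_homD[OF f] by (simp_all add: mult.assoc[symmetric])
  show ?thesis
  proof
    show "homogeneous (- c) (j\<^sub>1 * idem X)" "homogeneous 0 (j\<^sub>2 * idem Y)"
      by (rule homogeneous_mult[OF homogeneous(1) X.homogeneous_idem]
        homogeneous_mult[OF homogeneous(3) Y.homogeneous_idem]; simp)+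
    show "homogeneous c (idem X * q\<^sub>1)" "homogeneous 0 (idem Y * q\<^sub>2)"
      by (rule homogeneous_mult[OF X.homogeneous_idem homogeneous(2)]
        homogeneous_mult[OF Y.homogeneous_idem homogeneous(4)]; simp)+
  qed (simp_all add: B mult.assoc inverse orthogonal orthogonal_assoc f_assoc X.reduce
    X.reduce_assoc Y.reduce Y.reduce_assoc
      koszul_sign_mult_left koszul_sign_mult_right)
qed

context
  fixes X Y B :: "'a::ring_1 cplx" and c f
  assumes X: "is_complex X" and Y: "is_complex Y" and f: "chain_map X (shift (1 - c) Y) f"
    and B: "\<And>i. cobj B i = pobj_sum (cobj X (i + c)) (cobj Y i)"
      "\<And>i. cdif B i =
          four_block_mat (cdif (shift c X) i) (0\<^sub>m (dims X (i + 1 + c)) (dims Y i))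
            (f (i + c)) (cdif Y i)"
begin

lemma block_cplx_families:
  "dims B = (\<lambda>i. dims X (i + c) + dims Y i)"
  "id_cmap B = block_family 0 c (dims X) (dims Y) (id_cmap X)
    (\<lambda>i. 0\<^sub>m (dims Y (i + (0 - c))) (dims X i)) (id_cmap Y)"
  "cdif B = block_family 1 c (dims X) (dims Y)
    (\<lambda>i. if even c then cdif X i else - cdif X i) f (cdif Y)"
  by (simp_all add: fun_eq_iff dims_def id_cmap_def B pobj_sum_def block_family_def shift_simps)

lemma block_cplx_bounded:
  "bounded_family 0 (dims B) (dims B) (id_cmap B)" "bounded_family 1 (dims B) (dims B) (cdif B)"
proof -
  have "f \<in> graded_maps (1 - c) X Y" using f chain_map_iff[OF X Y] by blast
  note bounded_graded_maps[OF X Y this]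
  then show "bounded_family 0 (dims B) (dims B) (id_cmap B)"
    "bounded_family 1 (dims B) (dims B) (cdif B)"
    unfolding block_cplx_families
    by (intro bounded_block_family bounded_family_zero bounded_id_cmap bounded_cdif
        bounded_family_koszul_sign X Y)+
qed

lemma block_cplx_sized:
  obtains N where "sized N (dims X) (dims X) (idem (Tot X))" "sized N (dims Y) (dims Y) (idem (Tot Y))"
    "sized N (dims X) (dims X) (koszul_sign c (diff (Tot X)))"
    "sized N (dims Y) (dims X) (Tot_map (1 - c) X Y f)" "sized N (dims Y) (dims Y) (diff (Tot Y))"
proof -
  let ?S = "{idem (Tot X), idem (Tot Y), koszul_sign c (diff (Tot X)), Tot_map (1 - c) X Y f,
    diff (Tot Y)}"
  obtain N n where size: "\<And>x. x \<in> ?S \<Longrightarrow> sized N (\<lambda>_. n) (\<lambda>_. n) x" by (rule common_size[of ?S]) auto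
  have "sized N v u (assemble k v u g)"
    if "bounded_family k v u g" "assemble k v u g \<in> ?S" for k v u g
    using sized_assemble[OF that(1) size[OF that(2)]] .
  note sized = this[OF bounded_id_cmap[OF X]] this[OF bounded_id_cmap[OF Y]]
    this[OF bounded_family_koszul_sign[OF bounded_cdif[OF X], of c]]
    this[OF bounded_graded_maps[OF X Y]] this[OF bounded_cdif[OF Y]]
  have "f \<in> graded_maps (1 - c) X Y" using f chain_map_iff[OF X Y] by blast
  then show thesis
    using that sized unfolding assemble_koszul_sign[OF bounded_cdif[OF X]]
    by (simp add: Tot_map_def Tot_def)
qed

lemma block_cplx_Tot:
  obtains j\<^sub>1 j\<^sub>2 q\<^sub>1 q\<^sub>2 where "twisted_sum c (Tot B) (Tot X) (Tot Y) (Tot_map (1 - c) X Y f)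
    (j\<^sub>1 * idem (Tot X)) (j\<^sub>2 * idem (Tot Y)) (idem (Tot X) * q\<^sub>1) (idem (Tot Y) * q\<^sub>2)"
proof -
  have f_graded: "f \<in> graded_maps (1 - c) X Y" using f chain_map_iff[OF X Y] by blast
  note id = bounded_id_cmap[OF X] bounded_family_zero[of "0 - c" "dims Y" "dims X"]
    bounded_id_cmap[OF Y]
    and cdif = bounded_family_koszul_sign[OF bounded_cdif[OF X], of c]
      bounded_graded_maps[OF X Y f_graded] bounded_cdif[OF Y]
  have koszul: "assemble 1 (dims X) (dims X) (\<lambda>i. if even c then cdif X i else - cdif X i) =
      koszul_sign c (diff (Tot X))"
    unfolding Tot_def snd_conv by (rule assemble_koszul_sign[OF bounded_cdif[OF X]])
  obtain N where sized: "sized N (dims X) (dims X) (idem (Tot X))"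
    "sized N (dims Y) (dims Y) (idem (Tot Y))"
    "sized N (dims X) (dims X) (koszul_sign c (diff (Tot X)))"
    "sized N (dims Y) (dims X) (Tot_map (1 - c) X Y f)" "sized N (dims Y) (dims Y) (diff (Tot Y))"
    by (rule block_cplx_sized)
  let ?j\<^sub>1 = "embed_mat c (\<lambda>_. 0) (dims X) N :: 'a fin_mat"
    and ?j\<^sub>2 = "embed_mat 0 (\<lambda>i. dims X (i + c)) (dims Y) N :: 'a fin_mat"
  let ?q\<^sub>1 = "transpose_fin_mat ?j\<^sub>1" and ?q\<^sub>2 = "transpose_fin_mat ?j\<^sub>2"
  have "idem (Tot B) = ?j\<^sub>1 * idem (Tot X) * ?q\<^sub>1 + ?j\<^sub>2 * idem (Tot Y) * ?q\<^sub>2"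
    using assemble_block_family[OF id, of N] sized(1,2)
    unfolding Tot_def fst_conv block_cplx_families assemble_zero by (simp add: sized_zero)
  moreover have "diff (Tot B) = ?j\<^sub>1 * koszul_sign c (diff (Tot X)) * ?q\<^sub>1 +
      ?j\<^sub>2 * Tot_map (1 - c) X Y f * ?q\<^sub>1 + ?j\<^sub>2 * diff (Tot Y) * ?q\<^sub>2"
    using assemble_block_family[OF cdif, of N] sized(3-5)
    unfolding koszul unfolding Tot_map_def Tot_def snd_conv block_cplx_families by simp
  ultimately have "twisted_sum c (Tot B) (Tot X) (Tot Y) (Tot_map (1 - c) X Y f)
      (?j\<^sub>1 * idem (Tot X)) (?j\<^sub>2 * idem (Tot Y)) (idem (Tot X) * ?q\<^sub>1) (idem (Tot Y) * ?q\<^sub>2)"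
    by (intro twisted_sum_block_form tot_complex_Tot X Y Tot_map_graded_hom f_graded
        homogeneous_embed_mat homogeneous_embed_mat[of 0, simplified] homogeneous_transpose_embed_mat
        transpose_embed_mat_embed_mat[OF sized(1)] transpose_embed_mat_embed_mat[OF sized(2)]
        transpose_embed_mat_orthogonal)
  then show thesis by (rule that)
qed

lemma block_twisted_sum:
  "is_complex B"
    "\<exists>i\<^sub>1 i\<^sub>2 p\<^sub>1 p\<^sub>2. twisted_sum c (Tot B) (Tot X) (Tot Y) (Tot_map (1 - c) X Y f) i\<^sub>1 i\<^sub>2 p\<^sub>1 p\<^sub>2"
proof -
  obtain i\<^sub>1 i\<^sub>2 p\<^sub>1 p\<^sub>2
    where sum: "twisted_sum c (Tot B) (Tot X) (Tot Y) (Tot_map (1 - c) X Y f) i\<^sub>1 i\<^sub>2 p\<^sub>1 p\<^sub>2"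
    by (rule block_cplx_Tot)
  show "\<exists>i\<^sub>1 i\<^sub>2 p\<^sub>1 p\<^sub>2. twisted_sum c (Tot B) (Tot X) (Tot Y) (Tot_map (1 - c) X Y f) i\<^sub>1 i\<^sub>2 p\<^sub>1 p\<^sub>2"
    using sum by blast
  have "Tot_map (1 - c) X Y f \<in> cocycles (1 - c) (Tot X) (Tot Y)"
    using f by (simp add: chain_map_iff[OF X Y])
  from tot_complex_twisted_sum[OF sum tot_complex_Tot[OF X] tot_complex_Tot[OF Y] this]
  show "is_complex B" by (rule is_complexI[OF block_cplx_bounded])
qed

end

subsection \<open>The constructions on complexes\<close>

lemma zero_cplx_Tot: "is_complex (zero_cplx :: 'a::ring_1 cplx)"
  "Tot (zero_cplx :: 'a cplx) = (0, 0)"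
proof -
  show "is_complex (zero_cplx :: 'a cplx)"
    unfolding is_complex_def zero_cplx_def proj_obj_def phom_def cobj_def cdif_def by auto
  have "dims (zero_cplx :: 'a cplx) = (\<lambda>_. 0)"
    "id_cmap (zero_cplx :: 'a cplx) = (\<lambda>i. 0\<^sub>m ((\<lambda>_. 0) (i + 0)) ((\<lambda>_. 0) i))"
    "cdif (zero_cplx :: 'a cplx) = (\<lambda>i. 0\<^sub>m ((\<lambda>_. 0) (i + 1)) ((\<lambda>_. 0) i))"
    by (simp_all add: fun_eq_iff zero_cplx_def dims_def cobj_def id_cmap_def cdif_def)
  then show "Tot (zero_cplx :: 'a cplx) = (0, 0)"
    using assemble_zero[of 0 "\<lambda>_. 0" "\<lambda>_. 0"] assemble_zero[of 1 "\<lambda>_. 0" "\<lambda>_. 0"]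
    by (simp add: Tot_def)
qed

lemma zero_chain_map:
  assumes "is_complex X" "is_complex (Y :: 'a::ring_1 cplx)"
  obtains f where "chain_map X (shift l Y) f" "Tot_map l X Y f = 0"
    "f = (\<lambda>i. 0\<^sub>m (dims Y (i + l)) (dims X i))"
proof -
  obtain f where f: "chain_map X (shift l Y) f" "f \<in> graded_maps l X Y" "Tot_map l X Y f = 0"
    using chain_map_surj[OF assms cocycles_zero] .
  have "assemble l (dims Y) (dims X) f =
      assemble l (dims Y) (dims X) (\<lambda>i. 0\<^sub>m (dims Y (i + l)) (dims X i))"
    using f(3) unfolding Tot_map_def assemble_zero .
  then have "f = (\<lambda>i. 0\<^sub>m (dims Y (i + l)) (dims X i))"
    using assemble_eq_iff[OF bounded_graded_maps[OF assms f(2)] bounded_family_zero] by blast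
  then show thesis using that f by blast
qed

lemma dsum_twisted_sum:
  fixes X Y :: "'a::ring_1 cplx"
  assumes X: "is_complex X" and Y: "is_complex Y"
  shows is_complex_dsum: "is_complex (X \<oplus>\<^sub>K Y)"
    and "\<exists>i\<^sub>1 i\<^sub>2 p\<^sub>1 p\<^sub>2. twisted_sum 0 (Tot (X \<oplus>\<^sub>K Y)) (Tot X) (Tot Y) 0 i\<^sub>1 i\<^sub>2 p\<^sub>1 p\<^sub>2"
proof -
  obtain f where f: "chain_map X (shift 1 Y) f" "Tot_map 1 X Y f = 0"
    "f = (\<lambda>i. 0\<^sub>m (dims Y (i + 1)) (dims X i))"
    using zero_chain_map[OF X Y] .
  have "cobj (X \<oplus>\<^sub>K Y) i = pobj_sum (cobj X (i + 0)) (cobj Y i)"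
    "cdif (X \<oplus>\<^sub>K Y) i =
        four_block_mat (cdif (shift 0 X) i) (0\<^sub>m (dims X (i + 1 + 0)) (dims Y i))
          (f (i + 0)) (cdif Y i)" for i
    unfolding f(3) by (simp_all add: dsum_def cobj_def cdif_def dims_def)
  from block_twisted_sum[OF X Y _ this] show "is_complex (X \<oplus>\<^sub>K Y)"
    "\<exists>i\<^sub>1 i\<^sub>2 p\<^sub>1 p\<^sub>2. twisted_sum 0 (Tot (X \<oplus>\<^sub>K Y)) (Tot X) (Tot Y) 0 i\<^sub>1 i\<^sub>2 p\<^sub>1 p\<^sub>2"
    using f(1,2) by simp_all
qed

lemma cone_twisted_sum:
  assumes X: "is_complex X" and Y: "is_complex Y" and f: "chain_map X Y f"
  shows is_complex_cone: "is_complex (cone X Y f)"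
    and "\<exists>i\<^sub>1 i\<^sub>2 p\<^sub>1 p\<^sub>2. twisted_sum 1 (Tot (cone X Y f)) (Tot X) (Tot Y) (Tot_map 0 X Y f) i\<^sub>1 i\<^sub>2
        p\<^sub>1 p\<^sub>2"
proof -
  have two: "i + 1 + 1 = i + 2" for i :: int by simp
  have "cobj (cone X Y f) i = pobj_sum (cobj X (i + 1)) (cobj Y i)"
    "cdif (cone X Y f) i =
        four_block_mat (cdif (shift 1 X) i) (0\<^sub>m (dims X (i + 1 + 1)) (dims Y i))
          (f (i + 1)) (cdif Y i)" for i
    unfolding two by (simp_all add: cone_def cobj_def cdif_def dims_def shift_def)
  from block_twisted_sum[OF X Y _ this] show "is_complex (cone X Y f)"
    "\<exists>i\<^sub>1 i\<^sub>2 p\<^sub>1 p\<^sub>2. twisted_sum 1 (Tot (cone X Y f)) (Tot X) (Tot Y) (Tot_map 0 X Y f) i\<^sub>1 i\<^sub>2 p\<^sub>1 p\<^sub>2"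
    using f by simp_all
qed

lemma shift_twisted_sum:
  fixes X :: "'a::ring_1 cplx"
  assumes X: "is_complex X"
  shows is_complex_shift: "is_complex (shift c X)"
    and "\<exists>i p. twisted_sum c (Tot (shift c X)) (Tot X) (0, 0) 0 i 0 p 0"
proof -
  obtain f :: "int \<Rightarrow> 'a mat" where f: "chain_map X (shift (1 - c) zero_cplx) f"
    "Tot_map (1 - c) X zero_cplx f = 0"
    "f = (\<lambda>i. 0\<^sub>m (dims (zero_cplx :: 'a cplx) (i + (1 - c))) (dims X i))"
    using zero_chain_map[OF X zero_cplx_Tot(1), of "1 - c"] .
  have "snd (cobj X i) \<in> carrier_mat (dims X i) (dims X i)"
    "cdif (shift c X) i \<in> carrier_mat (dims X (i + 1 + c)) (dims X (i + c))" for i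
    using bounded_familyD[OF bounded_id_cmap[OF X], of i]
      bounded_familyD[OF bounded_cdif[OF X], of "i + c"]
    by (simp_all add: id_cmap_def shift_simps algebra_simps)
  then have "cobj (shift c X) i = pobj_sum (cobj X (i + c)) (cobj zero_cplx i)"
    "cdif (shift c X) i =
        four_block_mat (cdif (shift c X) i) (0\<^sub>m (dims X (i + 1 + c)) (dims zero_cplx i)) (f (i + c))
          (cdif zero_cplx i)" for i
    unfolding f(3) shift_simps(1)
    by (auto simp: pobj_sum_def zero_cplx_def cobj_def cdif_def dims_def intro!: prod_eqI eq_matI)
  note block = block_twisted_sum[OF X zero_cplx_Tot(1) f(1) this]
  show "is_complex (shift c X)" by (rule block(1))
  obtain i\<^sub>1 i\<^sub>2 p\<^sub>1 p\<^sub>2 where sum: "twisted_sum c (Tot (shift c X)) (Tot X) (0, 0) 0 i\<^sub>1 i\<^sub>2 p\<^sub>1 p\<^sub>2"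
    using block(2) unfolding zero_cplx_Tot(2) f(2) by blast
  then interpret twisted_sum c "Tot (shift c X)" "Tot X" "(0, 0)" 0 i\<^sub>1 i\<^sub>2 p\<^sub>1 p\<^sub>2 .
  have "i\<^sub>2 = 0" "p\<^sub>2 = 0" using inj\<^sub>2_unit unit_proj\<^sub>2 by simp_all
  then show "\<exists>i p. twisted_sum c (Tot (shift c X)) (Tot X) (0, 0) 0 i 0 p 0" using sum by blast
qed

section \<open>Krull-Schmidt for complexes\<close>

context fin_dim_algebra
begin

sublocale ks: category_with_ideal "is_complex :: 'a cplx \<Rightarrow> bool" "\<lambda>X Y. cocycles 0 (Tot X) (Tot Y)"
  "\<lambda>X Y. coboundaries 0 (Tot X) (Tot Y)"
  "\<lambda>X. idem (Tot X)"
proof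
  fix X Y W :: "'a cplx" and f g :: "'a fin_mat"
  show "g * f \<in> cocycles 0 (Tot X) (Tot W)"
    if "g \<in> cocycles 0 (Tot Y) (Tot W)" "f \<in> cocycles 0 (Tot X) (Tot Y)"
    using that by (rule cocycles_0_mult)
  show "idem (Tot X) \<in> cocycles 0 (Tot X) (Tot X)" if "is_complex X"
    using tot_complex.idem_cocycle[OF tot_complex_Tot[OF that]] .
  show "idem (Tot Y) * f = f" "f * idem (Tot X) = f" if "f \<in> cocycles 0 (Tot X) (Tot Y)"
    using graded_homD[OF cocyclesD(1)[OF that]] by auto
  show "g * f \<in> coboundaries 0 (Tot X) (Tot W)"
    if "g \<in> cocycles 0 (Tot Y) (Tot W)" "f \<in> coboundaries 0 (Tot X) (Tot Y)"
    using coboundaries_mult_left[OF that] by simp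
  show "g * f \<in> coboundaries 0 (Tot X) (Tot W)"
    if "g \<in> coboundaries 0 (Tot Y) (Tot W)" "f \<in> cocycles 0 (Tot X) (Tot Y)"
    using coboundaries_mult_right[OF that] by simp
qed (auto intro: cocycles_add coboundaries_add coboundaries_uminus)

lemma dsum_biproduct:
  assumes "is_complex X" "is_complex (Y :: 'a cplx)"
  obtains i\<^sub>1 i\<^sub>2 p\<^sub>1 p\<^sub>2 where "ks.biproduct (X \<oplus>\<^sub>K Y) X Y i\<^sub>1 i\<^sub>2 p\<^sub>1 p\<^sub>2"
    "twisted_sum 0 (Tot (X \<oplus>\<^sub>K Y)) (Tot X) (Tot Y) 0 i\<^sub>1 i\<^sub>2 p\<^sub>1 p\<^sub>2"
proof -
  obtain i\<^sub>1 i\<^sub>2 p\<^sub>1 p\<^sub>2 where sum: "twisted_sum 0 (Tot (X \<oplus>\<^sub>K Y)) (Tot X) (Tot Y) 0 i\<^sub>1 i\<^sub>2 p\<^sub>1 p\<^sub>2"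
    using dsum_twisted_sum(2)[OF assms] by blast
  then interpret twisted_sum 0 "Tot (X \<oplus>\<^sub>K Y)" "Tot X" "Tot Y" 0 i\<^sub>1 i\<^sub>2 p\<^sub>1 p\<^sub>2 .
  have "ks.biproduct (X \<oplus>\<^sub>K Y) X Y i\<^sub>1 i\<^sub>2 p\<^sub>1 p\<^sub>2"
    unfolding ks.biproduct_def
    using assms is_complex_dsum[OF assms]
      twisted_sum_cocycles[OF sum tot_complex_Tot tot_complex_Tot] reduce decomposition by auto
  then show thesis using sum by (rule that)
qed

lemma split_idempotent:
  fixes X :: "'a cplx"
  assumes X: "is_complex X" and g: "g \<in> cocycles 0 (Tot X) (Tot X)" "g * g = g"
  obtains Y Z where "ks.biproduct X Y Z g (idem (Tot X) - g) g (idem (Tot X) - g)"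
    "idem (Tot Y) = g" "idem (Tot Z) = idem (Tot X) - g"
proof -
  interpret X: tot_complex "Tot X" by (rule tot_complex_Tot[OF X])
  let ?h = "idem (Tot X) - g"
  have units: "idem (Tot X) * g = g" "g * idem (Tot X) = g"
    using graded_homD[OF cocyclesD(1)[OF g(1)]] by auto
  have h: "?h \<in> cocycles 0 (Tot X) (Tot X)" "?h * ?h = ?h"
    using cocycles_diff[OF X.idem_cocycle g(1)] by (auto simp: algebra_simps X.reduce g(2) units)
  note image = tot_complex_image[OF X.tot_complex_axioms g]
    tot_complex_image[OF X.tot_complex_axioms h]
  obtain Y where Y: "is_complex Y" "Tot Y = (g, g * diff (Tot X))"
    using Tot_surj[OF image(1)] by blast
  obtain Z where Z: "is_complex Z" "Tot Z = (?h, ?h * diff (Tot X))"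
    using Tot_surj[OF image(4)] by blast
  have "ks.biproduct X Y Z g ?h g ?h"
    unfolding ks.biproduct_def using X Y Z image g(2) h(2) by (auto simp: algebra_simps units)
  then show thesis using that Y(2) Z(2) by simp
qed

definition weight :: "'a cplx \<Rightarrow> nat" where
  "weight X = vs.dim (corner (idem (Tot X)) (idem (Tot X)))"

lemma exchange_cocycles:
  fixes X :: "'a cplx"
  assumes X: "is_complex X" and f: "f \<in> cocycles 0 (Tot X) (Tot X)"
  shows "\<exists>e\<in>cocycles 0 (Tot X) (Tot X). \<exists>u\<in>cocycles 0 (Tot X) (Tot X).
      \<exists>v\<in>cocycles 0 (Tot X) (Tot X).
    e * e - e \<in> coboundaries 0 (Tot X) (Tot X) \<and> f * u - e \<in> coboundaries 0 (Tot X) (Tot X) \<and> u * f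
      - e \<in> coboundaries 0 (Tot X) (Tot X) \<and>
    (idem (Tot X) - f) * v - (idem (Tot X) - e) \<in> coboundaries 0 (Tot X) (Tot X) \<and>
    v * (idem (Tot X) - f) - (idem (Tot X) - e) \<in> coboundaries 0 (Tot X) (Tot X)"
proof -
  obtain g u v where "g \<in> cocycles 0 (Tot X) (Tot X)" "u \<in> cocycles 0 (Tot X) (Tot X)"
    "v \<in> cocycles 0 (Tot X) (Tot X)"
    "g * g = g" "f * u = g" "u * f = g" "(idem (Tot X) - f) * v = idem (Tot X) - g"
      "v * (idem (Tot X) - f) = idem (Tot X) - g"
    using fitting_cocycles[OF tot_complex_Tot[OF X] f] .
  then show ?thesis by (intro bexI[of _ g] bexI[of _ u] bexI[of _ v]) simp_all
qed

lemma splitting_cocycles: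
  fixes X :: "'a cplx"
  assumes X: "is_complex X" and f: "f \<in> cocycles 0 (Tot X) (Tot X)"
    "f * f - f \<in> coboundaries 0 (Tot X) (Tot X)"
  shows "\<exists>Y Z i\<^sub>1 i\<^sub>2 p\<^sub>1 p\<^sub>2. ks.biproduct X Y Z i\<^sub>1 i\<^sub>2 p\<^sub>1 p\<^sub>2 \<and> i\<^sub>1 * p\<^sub>1 -
      f \<in> coboundaries 0 (Tot X) (Tot X) \<and>
    (f \<notin> coboundaries 0 (Tot X) (Tot X) \<longrightarrow> idem (Tot X) - f \<notin> coboundaries 0 (Tot X) (Tot X) \<longrightarrow>
      weight Y < weight X \<and> weight Z < weight X)"
proof -
  interpret X: tot_complex "Tot X" by (rule tot_complex_Tot[OF X])
  obtain g where g: "g \<in> cocycles 0 (Tot X) (Tot X)" "g * g = g"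
    and close: "g - f \<in> coboundaries 0 (Tot X) (Tot X)"
    using strict_idempotent[OF X.tot_complex_axioms f] .
  obtain Y Z where sum: "ks.biproduct X Y Z g (idem (Tot X) - g) g (idem (Tot X) - g)"
    and idem_YZ: "idem (Tot Y) = g" "idem (Tot Z) = idem (Tot X) - g"
    using split_idempotent[OF X g] .
  have units: "g \<in> corner (idem (Tot X)) (idem (Tot X))"
    using cocyclesD(1)[OF g(1)] unfolding graded_hom_def by blast
  have "weight Y < weight X \<and> weight Z < weight X"
    if nontrivial: "f \<notin> coboundaries 0 (Tot X) (Tot X)"
      "idem (Tot X) - f \<notin> coboundaries 0 (Tot X) (Tot X)"
  proof -
    have "g \<noteq> 0" using close nontrivial(1) coboundaries_uminus[of "g - f" 0 "Tot X" "Tot X"] by auto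
    moreover have "g \<noteq> idem (Tot X)" using close nontrivial(2) by auto
    moreover have "idem (Tot X) - g \<in> corner (idem (Tot X)) (idem (Tot X))"
      using X.reduce by (intro corner_diff[OF _ units] cornerI)
    ultimately show ?thesis
      unfolding weight_def idem_YZ
      using vs.dim_corner_strict_mono[OF units _ X.idem_idem]
        vs.dim_corner_strict_mono[OF _ _ X.idem_idem] by auto
  qed
  then show ?thesis
    using sum close g(2) by (intro exI[of _ Y] exI[of _ Z] exI[of _ g] exI[of _ "idem (Tot X) - g"])
      simp
qed

sublocale ks: krull_schmidt_category "is_complex :: 'a cplx \<Rightarrow> bool"
  "\<lambda>X Y. cocycles 0 (Tot X) (Tot Y)" "\<lambda>X Y. coboundaries 0 (Tot X) (Tot Y)"
  "\<lambda>X. idem (Tot X)" "(\<oplus>\<^sub>K)" zero_cplx weight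
proof
  fix X Y :: "'a cplx" assume XY: "is_complex X" "is_complex Y"
  show "\<exists>i\<^sub>1 i\<^sub>2 p\<^sub>1 p\<^sub>2. ks.biproduct (X \<oplus>\<^sub>K Y) X Y i\<^sub>1 i\<^sub>2 p\<^sub>1 p\<^sub>2" using dsum_biproduct[OF XY] by metis
qed (rule zero_cplx_Tot(1), simp add: zero_cplx_Tot(2), erule (1) exchange_cocycles,
  erule (2) splitting_cocycles)

lemma iso_iff: "X \<simeq>\<^sub>K Y \<longleftrightarrow> ks.iso X Y"
  unfolding htpy_equiv_iff tot_equiv_def ks.iso_def ..

lemma iso_class_eq: "iso_class X = ks.iso_class_of X"
  unfolding iso_class_def ks.iso_class_of_def iso_iff ..

lemma indec_iff: "indec X \<longleftrightarrow> ks.indec X"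
  unfolding indec_def ks.indec_def iso_iff ..

lemma dsum_list_eq: "dsum_list Xs = ks.biprod_list Xs"
  by (induction Xs) auto

lemma num_summands_eq:
  assumes "is_complex X" shows "num_summands X = card (set_mset (ks.summands X))"
proof -
  have "iso_class ` {Y. indec Y \<and> (\<exists>Z. is_complex Z \<and> X \<simeq>\<^sub>K Y \<oplus>\<^sub>K Z)} =
      set_mset (ks.summands X)" (is "?classes = _")
  proof (rule Set.set_eqI)
    fix c
    have "c \<in> ?classes \<longleftrightarrow> (\<exists>Y. ks.indec Y \<and> c = ks.iso_class_of Y \<and>
        (\<exists>Z. is_complex Z \<and> ks.iso X (Y \<oplus>\<^sub>K Z)))"
      unfolding indec_iff iso_iff iso_class_eq by (auto simp only: image_iff mem_Collect_eq)
    also have "\<dots> \<longleftrightarrow> (\<exists>Y. ks.indec Y \<and> c = ks.iso_class_of Y \<and> c \<in># ks.summands X)"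
      using ks.indec_summand_iff[OF assms] by metis
    also have "\<dots> \<longleftrightarrow> c \<in># ks.summands X" using ks.summands_class_of_indec[OF assms] by metis
    finally show "c \<in> ?classes \<longleftrightarrow> c \<in># ks.summands X" .
  qed
  then show ?thesis unfolding num_summands_def by simp
qed

lemma distinct_iff_count_le_1: "distinct xs \<longleftrightarrow> (\<forall>x. count (mset xs) x \<le> 1)"
proof -
  have "count (mset xs) x = (if x \<in> set xs then 1 else 0) \<longleftrightarrow> count (mset xs) x \<le> 1" for x
  proof (cases "x \<in> set xs")
    case True
    then have "count (mset xs) x > 0" by simp
    then show ?thesis unfolding if_P[OF True] by linarith
  next
    case False
    then have "count (mset xs) x = 0" by (simp add: count_eq_zero_iff)
    then show ?thesis unfolding if_not_P[OF False] by linarith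
  qed
  then show ?thesis unfolding distinct_count_atmost_1 by simp
qed

lemma distinct_iso_classes_iff:
  assumes "\<forall>Y\<in>set Xs. is_complex Y"
  shows "distinct (map ks.iso_class_of Xs) \<longleftrightarrow> (\<forall>i j. i < j \<longrightarrow> j < length Xs \<longrightarrow>
      \<not> ks.iso (Xs ! i) (Xs ! j))"
proof -
  have classes: "ks.iso_class_of (Xs ! i) = ks.iso_class_of (Xs ! j) \<longleftrightarrow> ks.iso (Xs ! i) (Xs ! j)"
    if "i < length Xs" for i j
    using assms that by (simp add: ks.iso_class_of_eq_iff)
  show ?thesis
  proof
    assume "distinct (map ks.iso_class_of Xs)"
    then show "\<forall>i j. i < j \<longrightarrow> j < length Xs \<longrightarrow> \<not> ks.iso (Xs ! i) (Xs ! j)"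
      by (auto simp: distinct_conv_nth classes[symmetric])
  next
    assume non_iso: "\<forall>i j. i < j \<longrightarrow> j < length Xs \<longrightarrow> \<not> ks.iso (Xs ! i) (Xs ! j)"
    have "ks.iso_class_of (Xs ! i) \<noteq> ks.iso_class_of (Xs ! j)"
      if "i < length Xs" "j < length Xs" "i \<noteq> j" for i j
      using that non_iso classes[of i j] classes[of j i] by (cases "i < j") auto
    then show "distinct (map ks.iso_class_of Xs)" by (auto simp: distinct_conv_nth)
  qed
qed

lemma basic_iff_distinct:
  "basic X \<longleftrightarrow> (\<exists>Ts. ks.iso X (ks.biprod_list Ts) \<and> (\<forall>Y\<in>set Ts. ks.indec Y) \<and>
      distinct (map ks.iso_class_of Ts))"
proof -
  have "(\<forall>i j. i < j \<longrightarrow> j < length Ts \<longrightarrow> \<not> ks.iso (Ts ! i) (Ts ! j)) \<longleftrightarrow>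
      distinct (map ks.iso_class_of Ts)"
    if "\<forall>Y\<in>set Ts. ks.indec Y" for Ts
    using distinct_iso_classes_iff[of Ts] that ks.indec_obj by simp
  then show ?thesis unfolding basic_def dsum_list_eq iso_iff indec_iff by (simp cong: conj_cong)
qed

lemma basic_iff: "basic X \<longleftrightarrow> is_complex X \<and> (\<forall>c. count (ks.summands X) c \<le> 1)"
proof
  assume "basic X"
  then obtain Ts where iso: "ks.iso X (ks.biprod_list Ts)"
    and Ts: "\<forall>Y\<in>set Ts. ks.indec Y" "distinct (map ks.iso_class_of Ts)"
    unfolding basic_iff_distinct by blast
  from Ts(2) show "is_complex X \<and> (\<forall>c. count (ks.summands X) c \<le> 1)"
    unfolding distinct_iff_count_le_1 ks.summands_eqI[OF Ts(1) iso] using ks.iso_obj(1)[OF iso]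
    by blast
next
  assume X: "is_complex X \<and> (\<forall>c. count (ks.summands X) c \<le> 1)"
  then obtain Ts where Ts: "\<forall>Y\<in>set Ts. ks.indec Y" "ks.iso X (ks.biprod_list Ts)"
    "ks.summands X = mset (map ks.iso_class_of Ts)"
    using ks.summands_decompose by blast
  have "distinct (map ks.iso_class_of Ts)"
    unfolding distinct_iff_count_le_1 Ts(3)[symmetric] using X by blast
  then show "basic X" unfolding basic_iff_distinct using Ts(1,2) by blast
qed

end

section \<open>Stalk complexes\<close>

lemma alg_cplx_Tot: "is_complex (alg_cplx :: 'a::ring_1 cplx)"
  "Tot (alg_cplx :: 'a cplx) = (matrix_unit (Index 0 0) (Index 0 0), 0)"
proof -
  show alg: "is_complex (alg_cplx :: 'a cplx)"
    unfolding is_complex_def alg_cplx_def proj_obj_def phom_def cobj_def cdif_def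
    by (auto intro!: exI[of _ 0])
  have dims: "dims (alg_cplx :: 'a cplx) i = (if i = 0 then 1 else 0)" for i
    by (simp add: dims_def alg_cplx_def cobj_def)
  have "diff (Tot (alg_cplx :: 'a cplx)) = 0"
    by (rule fin_mat_eqI) (auto simp: Tot_def entry_assemble[OF bounded_cdif[OF alg]] dims)
  moreover have "idem (Tot (alg_cplx :: 'a cplx)) = matrix_unit (Index 0 0) (Index 0 0)"
    unfolding Tot_def fst_conv
    by (rule fin_mat_eqI, unfold entry_assemble[OF bounded_id_cmap[OF alg]] dims)
       (auto simp: entry_matrix_unit id_cmap_def alg_cplx_def cobj_def)
  ultimately show "Tot (alg_cplx :: 'a cplx) = (matrix_unit (Index 0 0) (Index 0 0), 0)"
    by (simp add: prod_eq_iff)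
qed

definition stalk :: "int \<Rightarrow> 'a::ring_1 fin_mat \<Rightarrow> 'a cplx \<Rightarrow> bool" where
  "stalk s P X \<longleftrightarrow> is_complex X \<and> Tot X = (P, 0) \<and> in_block s s P"

lemma stalkD:
  assumes "stalk s P X" shows "is_complex X" "Tot X = (P, 0)" "in_block s s P"
  using assms unfolding stalk_def by auto

lemma stalk_exists:
  assumes "in_block s s P" "P * P = P" obtains X where "stalk s P X"
  using Tot_surj[OF stalk_tot_complex[OF assms]] assms(1) unfolding stalk_def by blast

lemma stalk_alg_cplx: "stalk 0 (matrix_unit (Index 0 0) (Index 0 0)) (alg_cplx :: 'a::ring_1 cplx)"
  unfolding stalk_def using alg_cplx_Tot in_block_matrix_unit by blast

lemma stalk_shift:
  assumes X: "stalk t P X" obtains Q u v where "stalk (t - c) Q (shift c X)" "idem_iso P Q u v"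
proof -
  note X = stalkD[OF X]
  obtain i p where "twisted_sum c (Tot (shift c X)) (P, 0) (0, 0) 0 i 0 p 0"
    using shift_twisted_sum(2)[OF X(1)] unfolding X(2) by blast
  then interpret twisted_sum c "Tot (shift c X)" "(P, 0)" "(0, 0)" 0 i 0 p 0 .
  have Tot: "Tot (shift c X) = (i * p, 0)" using decomposition diff_eq by (simp add: prod_eq_iff)
  have "in_block (t - c) t i"
    using homogeneous_mult_in_block[OF homogeneous_inj\<^sub>1 X(3)] inj\<^sub>1_unit by simp
  moreover have "in_block t (t - c) p"
    using in_block_mult_homogeneous[OF X(3) homogeneous_proj\<^sub>1] unit_proj\<^sub>1 by simp
  ultimately have "stalk (t - c) (i * p) (shift c X)"
    unfolding stalk_def using is_complex_shift[OF X(1)] Tot by (simp add: in_block_mult)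
  moreover have "idem_iso P (i * p) i p"
    unfolding idem_iso_def using inj\<^sub>1_corner proj\<^sub>1_corner proj\<^sub>1_inj\<^sub>1 Tot by simp
  ultimately show thesis by (rule that)
qed

context fin_dim_algebra
begin

lemma stalk_biproduct:
  assumes R: "stalk s b R" and V: "stalk s v V" and W: "stalk s w W"
    and "idem_biproduct b v w i\<^sub>1 i\<^sub>2 p\<^sub>1 p\<^sub>2"
  shows "ks.biproduct R V W i\<^sub>1 i\<^sub>2 p\<^sub>1 p\<^sub>2"
proof -
  interpret idem_biproduct b v w i\<^sub>1 i\<^sub>2 p\<^sub>1 p\<^sub>2 by fact
  note R = stalkD[OF R] and V = stalkD[OF V] and W = stalkD[OF W]
  show ?thesis
    unfolding ks.biproduct_def R(2) V(2) W(2) stalk_coboundaries stalk_cocycles[OF V(3) R(3)]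
      stalk_cocycles[OF W(3) R(3)] stalk_cocycles[OF R(3) V(3)] stalk_cocycles[OF R(3) W(3)]
    using R(1) V(1) W(1) inj\<^sub>1_corner inj\<^sub>2_corner proj\<^sub>1_corner proj\<^sub>2_corner reduce decomposition
    by simp
qed

lemma stalk_summands_eq_iff:
  assumes V: "stalk s P V" and W: "stalk s Q W"
  shows "ks.summands V = ks.summands W \<longleftrightarrow> (\<exists>u v. idem_iso P Q u v)"
proof -
  note V = stalkD[OF V] and W = stalkD[OF W]
  have "ks.summands V = ks.summands W \<longleftrightarrow> tot_equiv (P, 0) (Q, 0)"
    using ks.iso_iff_summands[OF V(1) W(1)] V W htpy_equiv_iff[of V W] unfolding iso_iff by simp
  then show ?thesis unfolding stalk_tot_equiv_iff[OF V(3) W(3)] .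
qed

lemma stalk_dsum:
  assumes V: "stalk s v V" and W: "stalk s w W"
  obtains b i\<^sub>1 i\<^sub>2 p\<^sub>1 p\<^sub>2 where "stalk s b (V \<oplus>\<^sub>K W)" "idem_biproduct b v w i\<^sub>1 i\<^sub>2 p\<^sub>1 p\<^sub>2"
proof -
  note V = stalkD[OF V] and W = stalkD[OF W]
  obtain i\<^sub>1 i\<^sub>2 p\<^sub>1 p\<^sub>2 where "twisted_sum 0 (Tot (V \<oplus>\<^sub>K W)) (v, 0) (w, 0) 0 i\<^sub>1 i\<^sub>2 p\<^sub>1 p\<^sub>2"
    using dsum_twisted_sum(2)[OF V(1) W(1)] unfolding V(2) W(2) by blast
  then interpret twisted_sum 0 "Tot (V \<oplus>\<^sub>K W)" "(v, 0)" "(w, 0)" 0 i\<^sub>1 i\<^sub>2 p\<^sub>1 p\<^sub>2 .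
  have "in_block s s i\<^sub>1" "in_block s s i\<^sub>2"
    using homogeneous_mult_in_block[OF homogeneous_inj\<^sub>1 V(3)]
      homogeneous_mult_in_block[OF homogeneous_inj\<^sub>2 W(3)] inj\<^sub>1_unit inj\<^sub>2_unit
    by simp_all
  moreover have "in_block s s p\<^sub>1" "in_block s s p\<^sub>2"
    using in_block_mult_homogeneous[OF V(3) homogeneous_proj\<^sub>1]
      in_block_mult_homogeneous[OF W(3) homogeneous_proj\<^sub>2] unit_proj\<^sub>1 unit_proj\<^sub>2
    by simp_all
  ultimately have "in_block s s (idem (Tot (V \<oplus>\<^sub>K W)))"
    unfolding decomposition by (intro in_block_add in_block_mult)
  then have "stalk s (idem (Tot (V \<oplus>\<^sub>K W))) (V \<oplus>\<^sub>K W)"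
    unfolding stalk_def using is_complex_dsum[OF V(1) W(1)] diff_eq by (simp add: prod_eq_iff)
  then show thesis by (rule that) (use idem_biproduct_axioms in simp)
qed

lemma block_unit_summands: "stalk 0 (block_unit 0 n) X \<Longrightarrow>
    ks.summands X = repeat_mset n (ks.summands alg_cplx)"
proof (induction n arbitrary: X)
  case 0
  then show ?case using ks.summands_empty_iff stalkD[OF 0] by (simp add: block_unit_0)
next
  case (Suc n)
  let ?u = "matrix_unit (Index 0 n) (Index 0 n) :: 'a fin_mat"
    and ?A = "matrix_unit (Index 0 0) (Index 0 0) :: 'a fin_mat"
  have idem: "?u * ?u = ?u" by (rule matrix_unit_mult)
  obtain D where D: "stalk 0 ?u D" using stalk_exists[OF in_block_matrix_unit idem] .
  obtain Y where Y: "stalk 0 (block_unit 0 n) (Y :: 'a cplx)"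
    using stalk_exists[OF in_block_block_unit block_unit_idem] .
  have "idem_iso ?u ?A (matrix_unit (Index 0 0) (Index 0 n)) (matrix_unit (Index 0 n) (Index 0 0))"
    unfolding idem_iso_def by (simp add: matrix_unit_mult cornerI)
  then have "ks.summands D = ks.summands alg_cplx"
    using stalk_summands_eq_iff[OF D stalk_alg_cplx] by blast
  moreover have "ks.biproduct X D Y ?u (block_unit 0 n) ?u (block_unit 0 n)"
    by (rule stalk_biproduct[OF Suc.prems D Y], unfold block_unit_Suc)
       (rule idem_biproduct_orthogonal[OF idem block_unit_idem matrix_unit_block_unit_orthogonal])
  ultimately show ?case using ks.summands_biproduct Suc.IH[OF Y] by simp
qed

lemma stalk_summands_subset_alg:
  assumes X: "stalk 0 e X" shows "set_mset (ks.summands X) \<subseteq> set_mset (ks.summands alg_cplx)"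
proof -
  note X = stalkD[OF X]
  obtain n where n: "block_unit 0 n * e = e" "e * block_unit 0 n = e"
    using block_unit_covers[OF X(3)] .
  have e: "e * e = e"
    using tot_complex.idem_idem[OF tot_complex_Tot[OF X(1)]] unfolding X(2) by simp
  obtain B where B: "stalk 0 (block_unit 0 n) (B :: 'a cplx)"
    using stalk_exists[OF in_block_block_unit block_unit_idem] .
  note B' = stalkD[OF B]
  have "e \<in> cocycles 0 (Tot X) (Tot B)" "e \<in> cocycles 0 (Tot B) (Tot X)"
    unfolding X(2) B'(2) stalk_cocycles[OF X(3) B'(3)] stalk_cocycles[OF B'(3) X(3)] using n e
    by (auto intro: cornerI)
  then have "ks.summands X \<subseteq># ks.summands B"
    using ks.summands_retract[OF _ _ _ X(1) B'(1)] e X(2) by simp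
  then have "set_mset (ks.summands X) \<subseteq> set_mset (ks.summands B)" by (rule set_mset_mono)
  also have "\<dots> \<subseteq> set_mset (ks.summands alg_cplx)" unfolding block_unit_summands[OF B]
    by (auto simp del: count_greater_zero_iff simp: count_greater_zero_iff[symmetric])
  finally show ?thesis .
qed

text \<open>An idempotent matrix \<open>P\<close> in some diagonal block stands for a projective module; to compare modules
  sitting in different degrees, \<open>P\<close> is moved to degree 0.\<close>

definition degree0_stalk :: "'a fin_mat \<Rightarrow> 'a cplx \<Rightarrow> bool" where
  "degree0_stalk P X \<longleftrightarrow> (\<exists>Q u v. stalk 0 Q X \<and> idem_iso P Q u v)"

definition proj_summands :: "'a fin_mat \<Rightarrow> 'a cplx set multiset" where
  "proj_summands P = ks.summands (SOME X. degree0_stalk P X)"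

lemma degree0_stalk_exists:
  assumes "in_block t t P" "P * P = P" obtains X where "degree0_stalk P X"
proof -
  obtain S where S: "stalk t P S" using stalk_exists[OF assms] .
  obtain Q u v where "stalk (t - t) Q (shift t S)" "idem_iso P Q u v" by (rule stalk_shift[OF S])
  then have "degree0_stalk P (shift t S)" unfolding degree0_stalk_def by auto
  then show thesis by (rule that)
qed

lemma degree0_stalk_summands_eq_iff:
  assumes "degree0_stalk P X" "degree0_stalk Q Y"
  shows "ks.summands X = ks.summands Y \<longleftrightarrow> (\<exists>u v. idem_iso P Q u v)"
proof -
  obtain P' u v Q' w z where P': "stalk 0 P' X" "idem_iso P P' u v"
    and Q': "stalk 0 Q' Y" "idem_iso Q Q' w z"
    using assms unfolding degree0_stalk_def by blast
  have "(\<exists>u v. idem_iso P' Q' u v) \<longleftrightarrow> (\<exists>u v. idem_iso P Q u v)"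
    using P'(2) Q'(2) idem_iso_trans idem_iso_sym by meson
  then show ?thesis unfolding stalk_summands_eq_iff[OF P'(1) Q'(1)] .
qed

lemma proj_summands_eq:
  assumes X: "degree0_stalk P X" shows "proj_summands P = ks.summands X"
proof -
  obtain Q u v where "stalk 0 Q X" "idem_iso P Q u v" using X unfolding degree0_stalk_def by blast
  then have "\<exists>u v. idem_iso P P u v" using idem_iso_trans idem_iso_sym by meson
  then show ?thesis
    unfolding proj_summands_def
    using degree0_stalk_summands_eq_iff[OF someI[of "degree0_stalk P", OF X] X] by blast
qed

lemma proj_summands_eq_iff:
  assumes "in_block s s P" "P * P = P" "in_block t t Q" "Q * Q = Q"
  shows "proj_summands P = proj_summands Q \<longleftrightarrow> (\<exists>u v. idem_iso P Q u v)"
proof -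
  obtain X where X: "degree0_stalk P X" using degree0_stalk_exists[OF assms(1,2)] .
  obtain Y where Y: "degree0_stalk Q Y" using degree0_stalk_exists[OF assms(3,4)] .
  show ?thesis
    unfolding proj_summands_eq[OF X] proj_summands_eq[OF Y]
    by (rule degree0_stalk_summands_eq_iff[OF X Y])
qed

lemma degree0_stalk_dsum:
  assumes "degree0_stalk P X" "degree0_stalk Q Y" and B: "idem_biproduct B P Q i\<^sub>1 i\<^sub>2 p\<^sub>1 p\<^sub>2"
  shows "degree0_stalk B (X \<oplus>\<^sub>K Y)"
proof -
  obtain P' u u' Q' v v' where P': "stalk 0 P' X" "idem_iso P P' u u'"
    and Q': "stalk 0 Q' Y" "idem_iso Q Q' v v'"
    using assms(1,2) unfolding degree0_stalk_def by blast
  obtain C j\<^sub>1 j\<^sub>2 q\<^sub>1 q\<^sub>2 where C: "stalk 0 C (X \<oplus>\<^sub>K Y)" "idem_biproduct C P' Q' j\<^sub>1 j\<^sub>2 q\<^sub>1 q\<^sub>2"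
    using stalk_dsum[OF P'(1) Q'(1)] .
  from idem_biproduct_unique[OF B idem_biproduct_iso_summands[OF C(2) P'(2) Q'(2)]] show ?thesis
    unfolding degree0_stalk_def using C(1) by blast
qed

lemma proj_summands_biproduct:
  assumes "in_block s s P" "P * P = P" "in_block t t Q" "Q * Q = Q"
    "idem_biproduct B P Q i\<^sub>1 i\<^sub>2 p\<^sub>1 p\<^sub>2"
  shows "proj_summands B = proj_summands P + proj_summands Q"
proof -
  obtain X where X: "degree0_stalk P X" using degree0_stalk_exists[OF assms(1,2)] .
  obtain Y where Y: "degree0_stalk Q Y" using degree0_stalk_exists[OF assms(3,4)] .
  have "is_complex X" "is_complex Y" using X Y unfolding degree0_stalk_def stalk_def by blast+
  then show ?thesis
    unfolding proj_summands_eq[OF X] proj_summands_eq[OF Y]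
      proj_summands_eq[OF degree0_stalk_dsum[OF X Y assms(5)]]
    by (rule ks.summands_biprod)
qed

lemma proj_summands_zero: "proj_summands 0 = {#}"
proof -
  have "degree0_stalk 0 zero_cplx"
    unfolding degree0_stalk_def stalk_def idem_iso_def
    by (intro exI[of _ 0]) (simp add: zero_cplx_Tot in_block_zero corner_zero)
  then show ?thesis using proj_summands_eq ks.summands_zero_obj by simp
qed

lemma proj_summands_subset_alg:
  assumes "in_block t t P" "P * P = P"
  shows "set_mset (proj_summands P) \<subseteq> set_mset (ks.summands alg_cplx)"
proof -
  obtain X where X: "degree0_stalk P X" using degree0_stalk_exists[OF assms] .
  then obtain Q where "stalk 0 Q X" unfolding degree0_stalk_def by blast
  then show ?thesis unfolding proj_summands_eq[OF X] by (rule stalk_summands_subset_alg)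
qed

end

section \<open>Two-term complexes and the Bongartz completion\<close>

subsection \<open>Two-term complexes\<close>

definition two_term_tot :: "'a::ring tot_cplx \<Rightarrow> bool" where
  "two_term_tot X \<longleftrightarrow> (\<forall>i a y. entry (idem X) (Index i a) y \<noteq> 0 \<longrightarrow> i \<in> {-1, 0})"

lemma two_term_totD: "two_term_tot X \<Longrightarrow> entry (idem X) (Index i a) y \<noteq> 0 \<Longrightarrow> i \<in> {-1, 0}"
  unfolding two_term_tot_def by blast

lemma term_zero_iff:
  assumes X: "is_complex X"
  shows "snd (cobj X i) = 0\<^sub>m (fst (cobj X i)) (fst (cobj X i)) \<longleftrightarrow>
      (\<forall>a y. entry (idem (Tot X)) (Index i a) y = 0)"
proof -
  note entries = entry_assemble[OF bounded_id_cmap[OF X]]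
  have "id_cmap X i = 0\<^sub>m (dims X i) (dims X i) \<longleftrightarrow> (\<forall>a y. entry (idem (Tot X)) (Index i a) y = 0)"
  proof
    assume zero: "id_cmap X i = 0\<^sub>m (dims X i) (dims X i)"
    have "entry (idem (Tot X)) (Index i a) (Index j b) = 0" for a j b
      unfolding Tot_def fst_conv entries using zero by auto
    then show "\<forall>a y. entry (idem (Tot X)) (Index i a) y = 0" by (metis index.exhaust)
  next
    assume zero: "\<forall>a y. entry (idem (Tot X)) (Index i a) y = 0"
    show "id_cmap X i = 0\<^sub>m (dims X i) (dims X i)"
    proof (rule eq_matI)
      fix a b assume "a < dim_row (0\<^sub>m (dims X i) (dims X i))"
        "b < dim_col (0\<^sub>m (dims X i) (dims X i))"
      then show "id_cmap X i $$ (a, b) = 0\<^sub>m (dims X i) (dims X i) $$ (a, b)"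
        using spec[OF spec[OF zero, of a], of "Index i b"] unfolding Tot_def fst_conv entries
        by simp
    qed (use bounded_familyD[OF bounded_id_cmap[OF X], of i] in auto)
  qed
  then show ?thesis by (simp add: id_cmap_def dims_def)
qed

lemma two_term_iff: "two_term X \<longleftrightarrow> is_complex X \<and> two_term_tot (Tot X)"
  unfolding two_term_def two_term_tot_def by (auto simp: term_zero_iff)

lemma two_term_tot_twisted_sum:
  assumes "twisted_sum 0 B X Y f i\<^sub>1 i\<^sub>2 p\<^sub>1 p\<^sub>2" and X: "two_term_tot X" and Y: "two_term_tot Y"
  shows "two_term_tot B"
proof -
  interpret twisted_sum 0 B X Y f i\<^sub>1 i\<^sub>2 p\<^sub>1 p\<^sub>2 by fact
  have degree: "k \<in> {-1, 0}"
    if h: "homogeneous 0 h" "h * idem W = h" and W: "two_term_tot W"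
      and nonzero: "entry (h * g) (Index k a) y \<noteq> 0"
    for h g k a y and W :: "'a tot_cplx"
  proof -
    obtain j b where "entry h (Index k a) (Index j b) \<noteq> 0"
      using nonzero by (rule entry_mult_nonzeroE)
    then have "entry (h * idem W) (Index k a) (Index j b) \<noteq> 0" using h(2) by simp
    then obtain j' b' where "entry h (Index k a) (Index j' b') \<noteq> 0"
      "entry (idem W) (Index j' b') (Index j b) \<noteq> 0"
      by (rule entry_mult_nonzeroE)
    then show ?thesis using homogeneousD[OF h(1)] two_term_totD[OF W] by fastforce
  qed
  show ?thesis
    unfolding two_term_tot_def
  proof (intro allI impI)
    fix k a y assume "entry (idem B) (Index k a) y \<noteq> 0"
    then have "entry (i\<^sub>1 * p\<^sub>1) (Index k a) y \<noteq> 0 \<or> entry (i\<^sub>2 * p\<^sub>2) (Index k a) y \<noteq> 0"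
      unfolding decomposition by auto
    then show "k \<in> {-1, 0}"
      using degree[OF _ inj\<^sub>1_unit X] degree[OF _ inj\<^sub>2_unit Y] homogeneous_inj\<^sub>1 homogeneous_inj\<^sub>2
      by fastforce
  qed
qed

lemma two_term_dsum: "two_term X \<Longrightarrow> two_term Y \<Longrightarrow> two_term (X \<oplus>\<^sub>K Y)"
  unfolding two_term_iff using dsum_twisted_sum two_term_tot_twisted_sum by metis

lemma two_term_zero_cplx: "two_term (zero_cplx :: 'a::ring_1 cplx)"
  unfolding two_term_iff two_term_tot_def by (simp add: zero_cplx_Tot)

lemma two_term_alg_cplx: "two_term (alg_cplx :: 'a::ring_1 cplx)"
proof -
  have "two_term_tot (Tot (alg_cplx :: 'a cplx))"
    unfolding two_term_tot_def alg_cplx_Tot(2) fst_conv entry_matrix_unit by auto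
  then show ?thesis unfolding two_term_iff using alg_cplx_Tot(1) by blast
qed

lemma graded_hom_nonzero_degrees:
  assumes X: "tot_complex X" and f: "f \<in> graded_hom k X Y" "entry f (Index i a) (Index j b) \<noteq> 0"
  obtains a' y b' y' where "i = j + k" "entry (idem Y) (Index i a') y \<noteq> 0"
    "entry (idem X) (Index j b') y' \<noteq> 0"
proof -
  note f_hom = graded_homD[OF f(1)]
  have "entry (idem Y * f) (Index i a) (Index j b) \<noteq> 0"
    "entry (f * idem X) (Index i a) (Index j b) \<noteq> 0"
    using f(2) f_hom(2,3) by simp_all
  then obtain i' a' j' b' where Y: "entry (idem Y) (Index i a) (Index i' a') \<noteq> 0"
    and X': "entry (idem X) (Index j' b') (Index j b) \<noteq> 0"
    by (elim entry_mult_nonzeroE)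
  have "j' = j" using homogeneousD[OF tot_complex.homogeneous_idem[OF X] X'] by simp
  then show thesis using that[OF homogeneousD[OF f_hom(1) f(2)] Y] X' by blast
qed

lemma two_term_graded_hom_zero:
  assumes X: "tot_complex X" "two_term_tot X" and Y: "two_term_tot Y" and f: "f \<in> graded_hom k X Y"
    and k: "\<bar>k\<bar> \<ge> 2"
  shows "f = 0"
proof (rule fin_mat_eqI, rule ccontr)
  fix i a j b assume "entry f (Index i a) (Index j b) \<noteq> entry 0 (Index i a) (Index j b)"
  then have "entry f (Index i a) (Index j b) \<noteq> 0" by simp
  with X(1) f obtain a' y b' y' where degrees: "i = j + k" "entry (idem Y) (Index i a') y \<noteq> 0"
    "entry (idem X) (Index j b') y' \<noteq> 0"
    by (rule graded_hom_nonzero_degrees)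
  then show False using two_term_totD[OF Y degrees(2)] two_term_totD[OF X(2) degrees(3)] k by auto
qed

lemma degree0_graded_hom_two_term_zero:
  assumes X: "tot_complex X" "in_block 0 0 (idem X)" and Y: "two_term_tot Y"
    and f: "f \<in> graded_hom k X Y" and k: "k > 0"
  shows "f = 0"
proof (rule fin_mat_eqI, rule ccontr)
  fix i a j b assume "entry f (Index i a) (Index j b) \<noteq> entry 0 (Index i a) (Index j b)"
  then have "entry f (Index i a) (Index j b) \<noteq> 0" by simp
  with X(1) f obtain a' y b' j' c where degrees: "i = j + k" "entry (idem Y) (Index i a') y \<noteq> 0"
    "entry (idem X) (Index j b') (Index j' c) \<noteq> 0"
    by (rule graded_hom_nonzero_degrees) (metis index.exhaust)
  then show False using two_term_totD[OF Y degrees(2)] in_blockD[OF X(2) degrees(3)] k by auto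
qed

lemma two_term_cocycles_1:
  assumes X: "tot_complex X" "two_term_tot X" and Y: "tot_complex Y" "two_term_tot Y"
  shows "cocycles 1 X Y = graded_hom 1 X Y"
proof -
  have "f \<in> cocycles 1 X Y" if f: "f \<in> graded_hom 1 X Y" for f
  proof -
    have "diff Y * f = 0" "f * diff X = 0"
      by (rule two_term_graded_hom_zero[OF X Y(2)],
        rule graded_hom_diff_left[OF Y(1) f] graded_hom_diff_right[OF X(1) f], simp)+
    then show ?thesis by (intro cocyclesI f) simp
  qed
  then show ?thesis using cocyclesD(1) by blast
qed

subsection \<open>Vanishing of extensions\<close>

lemma ext_orthogonalD:
  assumes "ext_orthogonal X Y" "(l::int) > 0" "F \<in> cocycles l X Y" shows "F \<in> coboundaries l X Y"
proof -
  obtain n where "n > 0" "l = int n" using zero_less_imp_eq_int[OF assms(2)] by blast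
  then show ?thesis using assms unfolding ext_orthogonal_def by blast
qed

lemma ext_orthogonalI: "(\<And>l F. (l::int) > 0 \<Longrightarrow> F \<in> cocycles l X Y \<Longrightarrow>
    F \<in> coboundaries l X Y) \<Longrightarrow> ext_orthogonal X Y"
  unfolding ext_orthogonal_def by auto

lemma ext_orthogonal_retract:
  assumes f: "f \<in> cocycles 0 X X'" "g \<in> cocycles 0 X' X" "f * g - idem X' \<in> coboundaries 0 X' X'"
    and a: "a \<in> cocycles 0 Y Y'" "b \<in> cocycles 0 Y' Y" "a * b - idem Y' \<in> coboundaries 0 Y' Y'"
    and ext: "ext_orthogonal X Y"
  shows "ext_orthogonal X' Y'"
proof (rule ext_orthogonalI)
  fix l :: int and F assume l: "l > 0" and F: "F \<in> cocycles l X' Y'"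
  have "b * F * f \<in> cocycles l X Y" using cocycles_mult[OF cocycles_mult[OF a(2) F] f(1)] by simp
  then have "b * F * f \<in> coboundaries l X Y" by (rule ext_orthogonalD[OF ext l])
  then have "a * (b * F * f) * g \<in> coboundaries l X' Y'"
    using coboundaries_mult_right[OF coboundaries_mult_left[OF a(1)] f(2)] by simp
  moreover have "(a * b - idem Y') * (F * (f * g)) \<in> coboundaries l X' Y'"
    using coboundaries_mult_right[OF a(3) cocycles_mult[OF F cocycles_mult[OF f(1,2)]]] by simp
  moreover have "F * (f * g - idem X') \<in> coboundaries l X' Y'"
    using coboundaries_mult_left[OF F f(3)] by simp
  ultimately have "a * (b * F * f) * g - (a * b - idem Y') * (F * (f * g)) -
      F * (f * g - idem X') \<in> coboundaries l X' Y'"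
    by (intro coboundaries_diff)
  moreover have "a * (b * F * f) * g - (a * b - idem Y') * (F * (f * g)) - F * (f * g - idem X') =
      idem Y' * F * (f * g) - F * (f * g) + F * idem X'"
    by (simp add: algebra_simps)
  ultimately show "F \<in> coboundaries l X' Y'" using graded_homD(2,3)[OF cocyclesD(1)[OF F]] by simp
qed

lemma coboundaries_subset_cocycles:
  assumes "tot_complex X" "tot_complex Y" shows "coboundaries k X Y \<subseteq> cocycles k X Y"
proof
  interpret X: tot_complex X by fact
  interpret Y: tot_complex Y by fact
  fix f assume "f \<in> coboundaries k X Y"
  then obtain h where h: "h \<in> graded_hom (k - 1) X Y" "f = koszul_sign k (diff Y * h) + h * diff X"
    by (rule coboundariesE)
  have "f \<in> graded_hom k X Y"
    unfolding h(2) using graded_hom_diff_left[OF assms(2) h(1)]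
      graded_hom_diff_right[OF assms(1) h(1)]
    by (simp add: graded_hom_add graded_hom_koszul_sign)
  then show "f \<in> cocycles k X Y"
    by (rule cocyclesI)
       (simp add: h(2) distrib_left distrib_right koszul_sign_add koszul_sign_mult_left
         koszul_sign_mult_right
         koszul_sign_koszul_sign mult.assoc X.reduce Y.reduce_assoc)
qed

context
  fixes U X Y :: "'a::ring tot_cplx" and F i\<^sub>1 i\<^sub>2 p\<^sub>1 p\<^sub>2
  assumes sum: "twisted_sum 0 U X Y F i\<^sub>1 i\<^sub>2 p\<^sub>1 p\<^sub>2" and X: "tot_complex X" and Y: "tot_complex Y"
    and F: "F \<in> cocycles 1 X Y"
begin

interpretation twisted_sum 0 U X Y F i\<^sub>1 i\<^sub>2 p\<^sub>1 p\<^sub>2 by (rule sum)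
interpretation X: tot_complex X by (rule X)
interpretation Y: tot_complex Y by (rule Y)

lemma extension_graded_hom:
  "i\<^sub>1 \<in> graded_hom 0 X U" "i\<^sub>2 \<in> graded_hom 0 Y U" "p\<^sub>1 \<in> graded_hom 0 U X" "p\<^sub>2 \<in> graded_hom 0 U Y"
  using homogeneous_inj\<^sub>1 homogeneous_inj\<^sub>2 homogeneous_proj\<^sub>1 homogeneous_proj\<^sub>2
  by (auto intro!: graded_homI simp: reduce)

lemmas extension_inj\<^sub>2_cocycle = twisted_sum_cocycles(1)[OF sum X Y]
  and extension_proj\<^sub>1_cocycle = twisted_sum_cocycles(2)[OF sum X Y]

lemma extension_diff_inj\<^sub>1: "diff U * i\<^sub>1 = i\<^sub>1 * diff X + i\<^sub>2 * F"
  using graded_homD(3)[OF cocyclesD(1)[OF F]]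
  by (simp add: diff_eq distrib_right mult.assoc reduce X.reduce)

lemma extension_diff_inj\<^sub>1_mult: "diff U * (i\<^sub>1 * h) = i\<^sub>1 * (diff X * h) + i\<^sub>2 * (F * h)"
  using arg_cong[OF extension_diff_inj\<^sub>1, of "\<lambda>x. x * h"] by (simp add: distrib_right mult.assoc)

lemma extension_connecting_coboundary:
  assumes c: "c \<in> cocycles (l - 1) T X" shows "i\<^sub>2 * (F * c) \<in> coboundaries l T U"
proof -
  have "koszul_sign (l - 1) (i\<^sub>1 * (diff X * c)) = i\<^sub>1 * c * diff T"
    using arg_cong[OF cocyclesD(2)[OF c], of "(*) i\<^sub>1"]
    by (simp add: koszul_sign_mult_right mult.assoc)
  then have "i\<^sub>1 * c * diff T = - koszul_sign l (i\<^sub>1 * (diff X * c))"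
    unfolding koszul_sign_def by auto
  then have "koszul_sign l (i\<^sub>2 * (F * c)) = koszul_sign l (diff U * (i\<^sub>1 * c)) + i\<^sub>1 * c * diff T"
    by (simp add: extension_diff_inj\<^sub>1_mult koszul_sign_add)
  moreover have "i\<^sub>1 * c \<in> graded_hom (l - 1) T U"
    by (rule graded_hom_mult[OF extension_graded_hom(1) cocyclesD(1)[OF c]]) simp
  ultimately have "koszul_sign l (i\<^sub>2 * (F * c)) \<in> coboundaries l T U"
    unfolding coboundaries_def by blast
  then show ?thesis
    using coboundaries_uminus[of "koszul_sign l (i\<^sub>2 * (F * c))" l T U] unfolding koszul_sign_def
    by (auto split: if_splits)
qed

lemma extension_inj\<^sub>2_reflects_cocycles:
  assumes K: "K \<in> graded_hom l T Y" and inj\<^sub>2_K: "i\<^sub>2 * K \<in> cocycles l T U" shows "K \<in> cocycles l T Y"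
proof (rule cocyclesI[OF K])
  have "i\<^sub>2 * koszul_sign l (diff Y * K) = koszul_sign l (diff U * (i\<^sub>2 * K))"
    using cocycles_0D[OF extension_inj\<^sub>2_cocycle]
    by (simp add: koszul_sign_mult_right mult.assoc[symmetric])
  also have "\<dots> = i\<^sub>2 * (K * diff T)" using cocyclesD(2)[OF inj\<^sub>2_K] by (simp add: mult.assoc)
  finally have "p\<^sub>2 * (i\<^sub>2 * koszul_sign l (diff Y * K)) = p\<^sub>2 * (i\<^sub>2 * (K * diff T))" by simp
  then have "idem Y * koszul_sign l (diff Y * K) = idem Y * K * diff T"
    by (simp add: reduce_assoc mult.assoc)
  then show "koszul_sign l (diff Y * K) = K * diff T"
    using graded_homD(2)[OF K] by (simp add: koszul_sign_mult_right Y.reduce_assoc)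
qed

lemma extension_ext_orthogonal:
  assumes Y_zero: "\<And>l g. l > 0 \<Longrightarrow> g \<in> graded_hom l Y Z \<Longrightarrow> g = 0" and ext: "ext_orthogonal X Z"
  shows "ext_orthogonal U Z"
proof (rule ext_orthogonalI)
  fix l :: int and G assume l: "l > 0" and G: "G \<in> cocycles l U Z"
  note G_hom = cocyclesD(1)[OF G]
  have G_inj\<^sub>2: "G * i\<^sub>2 = 0"
    by (rule Y_zero[OF l], rule graded_hom_mult[OF G_hom extension_graded_hom(2)]) simp
  have "G * i\<^sub>1 \<in> cocycles l X Z"
  proof (rule cocyclesI)
    have "G * i\<^sub>1 * diff X = G * diff U * i\<^sub>1 - G * i\<^sub>2 * F"
      using extension_diff_inj\<^sub>1 by (simp add: algebra_simps)
    also have "\<dots> = koszul_sign l (diff Z * (G * i\<^sub>1))"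
      unfolding G_inj\<^sub>2 cocyclesD(2)[OF G, symmetric] by (simp add: koszul_sign_mult_left mult.assoc)
    finally show "koszul_sign l (diff Z * (G * i\<^sub>1)) = G * i\<^sub>1 * diff X" ..
  qed (rule graded_hom_mult[OF G_hom extension_graded_hom(1)], simp)
  then have "G * i\<^sub>1 \<in> coboundaries l X Z" by (rule ext_orthogonalD[OF ext l])
  then have "G * i\<^sub>1 * p\<^sub>1 \<in> coboundaries l U Z"
    using coboundaries_mult_right extension_proj\<^sub>1_cocycle by fastforce
  moreover have "G = G * i\<^sub>1 * p\<^sub>1 + G * i\<^sub>2 * p\<^sub>2"
    using graded_homD(3)[OF G_hom] decomposition by (simp add: distrib_left mult.assoc)
  ultimately show "G \<in> coboundaries l U Z" unfolding G_inj\<^sub>2 by simp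
qed

lemma universal_extension_ext_orthogonal:
  assumes T: "tot_complex T" and ext: "ext_orthogonal T X"
    and universal: "\<And>l G. l > 0 \<Longrightarrow> G \<in> cocycles l T Y \<Longrightarrow> \<exists>c\<in>cocycles (l - 1) T X. G = F * c"
  shows "ext_orthogonal T U"
proof (rule ext_orthogonalI)
  fix l :: int and G assume l: "l > 0" and G: "G \<in> cocycles l T U"
  have "p\<^sub>1 * G \<in> cocycles l T X" using cocycles_mult[OF extension_proj\<^sub>1_cocycle G] by simp
  then have "p\<^sub>1 * G \<in> coboundaries l T X" by (rule ext_orthogonalD[OF ext l])
  then obtain h where h: "h \<in> graded_hom (l - 1) T X"
    "p\<^sub>1 * G = koszul_sign l (diff X * h) + h * diff T"
    by (rule coboundariesE)
  define K where "K = p\<^sub>2 * G - koszul_sign l (F * h)"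
  have "i\<^sub>1 * h \<in> graded_hom (l - 1) T U"
    by (rule graded_hom_mult[OF extension_graded_hom(1) h(1)]) simp
  then have boundary: "koszul_sign l (diff U * (i\<^sub>1 * h)) +
      i\<^sub>1 * h * diff T \<in> coboundaries l T U" (is "?d \<in> _")
    unfolding coboundaries_def by blast
  have "?d + i\<^sub>2 * K = i\<^sub>1 * (p\<^sub>1 * G) + i\<^sub>2 * (p\<^sub>2 * G)"
    unfolding h(2) K_def by (simp add: algebra_simps koszul_sign_add koszul_sign_mult_right
      extension_diff_inj\<^sub>1_mult)
  also have "\<dots> = G"
    using graded_homD(2)[OF cocyclesD(1)[OF G]] decomposition
    by (simp add: distrib_right mult.assoc)
  finally have G_eq: "G = ?d + i\<^sub>2 * K" ..
  have "K \<in> graded_hom l T Y"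
    unfolding K_def
    by (intro graded_hom_diff graded_hom_koszul_sign graded_hom_mult[OF
      extension_graded_hom(4) cocyclesD(1)[OF G]]
        graded_hom_mult[OF cocyclesD(1)[OF F] h(1)]) simp_all
  moreover have "?d \<in> cocycles l T U"
    using boundary coboundaries_subset_cocycles[OF T tot_complex_twisted_sum[OF sum X Y]] F
    by (auto simp del: koszul_sign_0)
  then have "i\<^sub>2 * K \<in> cocycles l T U" using cocycles_diff[OF G, of ?d] unfolding G_eq by simp
  ultimately have "K \<in> cocycles l T Y" by (rule extension_inj\<^sub>2_reflects_cocycles)
  then obtain c where "c \<in> cocycles (l - 1) T X" "K = F * c" using universal[OF l] by blast
  then have "i\<^sub>2 * K \<in> coboundaries l T U" using extension_connecting_coboundary by simp
  then show "G \<in> coboundaries l T U" unfolding G_eq by (rule coboundaries_add[OF boundary])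
qed

lemma universal_extension_two_term_ext_orthogonal:
  assumes T: "tot_complex T" "two_term_tot T" and two_term: "two_term_tot Y"
    and ext: "ext_orthogonal T X"
    and universal: "\<And>G. G \<in> cocycles 1 T Y \<Longrightarrow> \<exists>c\<in>cocycles 0 T X. G = F * c"
  shows "ext_orthogonal T U"
proof (rule universal_extension_ext_orthogonal[OF T(1) ext])
  fix l :: int and G assume l: "l > 0" and G: "G \<in> cocycles l T Y"
  show "\<exists>c\<in>cocycles (l - 1) T X. G = F * c"
  proof (cases "l = 1")
    case False
    then have "G = 0" using two_term_graded_hom_zero[OF T two_term cocyclesD(1)[OF G]] l by simp
    then show ?thesis by (intro bexI[of _ 0]) simp_all
  qed (use universal G in simp)
qed

end

lemma extension_exists:
  assumes X: "is_complex X" and Y: "is_complex Y" and F: "F \<in> cocycles 1 (Tot X) (Tot Y)"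
  obtains U i\<^sub>1 i\<^sub>2 p\<^sub>1 p\<^sub>2 where "is_complex U" "twisted_sum 0 (Tot U) (Tot X) (Tot Y) F i\<^sub>1 i\<^sub>2 p\<^sub>1 p\<^sub>2"
proof -
  obtain f where f: "chain_map X (shift 1 Y) f" "Tot_map 1 X Y f = F"
    using chain_map_surj[OF X Y F] .
  define U where "U = ((\<lambda>i. pobj_sum (cobj X i) (cobj Y i)),
    (\<lambda>i. four_block_mat (cdif X i) (0\<^sub>m (dims X (i + 1)) (dims Y i)) (f i) (cdif Y i)))"
  have "cobj U i = pobj_sum (cobj X (i + 0)) (cobj Y i)"
    "cdif U i =
        four_block_mat (cdif (shift 0 X) i) (0\<^sub>m (dims X (i + 1 + 0)) (dims Y i))
          (f (i + 0)) (cdif Y i)" for i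
    by (simp_all add: U_def cobj_def cdif_def)
  from block_twisted_sum[OF X Y _ this]
  have "is_complex U" "\<exists>i\<^sub>1 i\<^sub>2 p\<^sub>1 p\<^sub>2. twisted_sum 0 (Tot U) (Tot X) (Tot Y) F i\<^sub>1 i\<^sub>2 p\<^sub>1 p\<^sub>2"
    using f by simp_all
  then show thesis using that by blast
qed

context fin_dim_algebra
begin

lemma ext_orthogonal_iso:
  assumes "ks.iso X X'" "ks.iso Y Y'" "ext_orthogonal (Tot X) (Tot Y)"
  shows "ext_orthogonal (Tot X') (Tot Y')"
proof -
  obtain f g where "f \<in> cocycles 0 (Tot X) (Tot X')" "g \<in> cocycles 0 (Tot X') (Tot X)"
    "f * g - idem (Tot X') \<in> coboundaries 0 (Tot X') (Tot X')"
    using assms(1) unfolding ks.iso_def by blast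
  moreover obtain a b where "a \<in> cocycles 0 (Tot Y) (Tot Y')" "b \<in> cocycles 0 (Tot Y') (Tot Y)"
    "a * b - idem (Tot Y') \<in> coboundaries 0 (Tot Y') (Tot Y')"
    using assms(2) unfolding ks.iso_def by blast
  ultimately show ?thesis using assms(3) by (rule ext_orthogonal_retract)
qed

lemma ext_orthogonal_biproduct_left:
  assumes sum: "ks.biproduct B X Y i\<^sub>1 i\<^sub>2 p\<^sub>1 p\<^sub>2" and Z: "is_complex Z"
  shows "ext_orthogonal (Tot B) (Tot Z) \<longleftrightarrow>
    ext_orthogonal (Tot X) (Tot Z) \<and> ext_orthogonal (Tot Y) (Tot Z)"
proof -
  interpret Z: tot_complex "Tot Z" by (rule tot_complex_Tot[OF Z])
  note homs = ks.biproduct_hom[OF sum]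
  have "ext_orthogonal (Tot B) (Tot Z)"
    if ext: "ext_orthogonal (Tot X) (Tot Z)" "ext_orthogonal (Tot Y) (Tot Z)"
  proof (rule ext_orthogonalI)
    fix l :: int and F assume l: "l > 0" and F: "F \<in> cocycles l (Tot B) (Tot Z)"
    have "F * i\<^sub>1 \<in> coboundaries l (Tot X) (Tot Z)" "F * i\<^sub>2 \<in> coboundaries l (Tot Y) (Tot Z)"
      using ext_orthogonalD[OF ext(1) l] ext_orthogonalD[OF ext(2) l] cocycles_mult[OF F homs(1)]
        cocycles_mult[OF F homs(2)] by simp_all
    then have "F * i\<^sub>1 * p\<^sub>1 + F * i\<^sub>2 * p\<^sub>2 - F * (i\<^sub>1 * p\<^sub>1 + i\<^sub>2 * p\<^sub>2 - idem (Tot B))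
        \<in> coboundaries l (Tot B) (Tot Z)"
      using coboundaries_mult_right[OF _ homs(3)] coboundaries_mult_right[OF _ homs(4)]
        coboundaries_mult_left[OF F ks.inj_proj_sum[OF sum]]
      by (intro coboundaries_diff coboundaries_add) fastforce+
    then show "F \<in> coboundaries l (Tot B) (Tot Z)"
      using graded_homD(3)[OF cocyclesD(1)[OF F]] by (simp add: algebra_simps)
  qed
  moreover have "idem (Tot Z) * idem (Tot Z) - idem (Tot Z) \<in> coboundaries 0 (Tot Z) (Tot Z)"
    by (simp add: Z.reduce)
  note retract = ext_orthogonal_retract[OF _ _ _ Z.idem_cocycle Z.idem_cocycle this]
  have "ext_orthogonal (Tot X) (Tot Z)" "ext_orthogonal (Tot Y) (Tot Z)"
    if "ext_orthogonal (Tot B) (Tot Z)"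
    using retract[OF homs(3,1) ks.proj\<^sub>1_inj\<^sub>1[OF sum] that]
      retract[OF homs(4,2) ks.proj\<^sub>2_inj\<^sub>2[OF sum] that] .
  ultimately show ?thesis by blast
qed

lemma ext_orthogonal_biproduct_right:
  assumes sum: "ks.biproduct B X Y i\<^sub>1 i\<^sub>2 p\<^sub>1 p\<^sub>2" and Z: "is_complex Z"
  shows "ext_orthogonal (Tot Z) (Tot B) \<longleftrightarrow>
    ext_orthogonal (Tot Z) (Tot X) \<and> ext_orthogonal (Tot Z) (Tot Y)"
proof -
  interpret Z: tot_complex "Tot Z" by (rule tot_complex_Tot[OF Z])
  note homs = ks.biproduct_hom[OF sum]
  have "ext_orthogonal (Tot Z) (Tot B)"
    if ext: "ext_orthogonal (Tot Z) (Tot X)" "ext_orthogonal (Tot Z) (Tot Y)"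
  proof (rule ext_orthogonalI)
    fix l :: int and F assume l: "l > 0" and F: "F \<in> cocycles l (Tot Z) (Tot B)"
    have "p\<^sub>1 * F \<in> coboundaries l (Tot Z) (Tot X)" "p\<^sub>2 * F \<in> coboundaries l (Tot Z) (Tot Y)"
      using ext_orthogonalD[OF ext(1) l] ext_orthogonalD[OF ext(2) l] cocycles_mult[OF homs(3) F]
        cocycles_mult[OF homs(4) F] by simp_all
    then have "i\<^sub>1 * (p\<^sub>1 * F) + i\<^sub>2 * (p\<^sub>2 * F) - (i\<^sub>1 * p\<^sub>1 + i\<^sub>2 * p\<^sub>2 - idem (Tot B)) * F
        \<in> coboundaries l (Tot Z) (Tot B)"
      using coboundaries_mult_left[OF homs(1)] coboundaries_mult_left[OF homs(2)]
        coboundaries_mult_right[OF ks.inj_proj_sum[OF sum] F]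
      by (intro coboundaries_diff coboundaries_add) fastforce+
    then show "F \<in> coboundaries l (Tot Z) (Tot B)"
      using graded_homD(2)[OF cocyclesD(1)[OF F]] by (simp add: algebra_simps)
  qed
  moreover have "idem (Tot Z) * idem (Tot Z) - idem (Tot Z) \<in> coboundaries 0 (Tot Z) (Tot Z)"
    by (simp add: Z.reduce)
  note retract = ext_orthogonal_retract[OF Z.idem_cocycle Z.idem_cocycle this]
  have "ext_orthogonal (Tot Z) (Tot X)" "ext_orthogonal (Tot Z) (Tot Y)"
    if "ext_orthogonal (Tot Z) (Tot B)"
    using retract[OF homs(3,1) ks.proj\<^sub>1_inj\<^sub>1[OF sum] that]
      retract[OF homs(4,2) ks.proj\<^sub>2_inj\<^sub>2[OF sum] that] .
  ultimately show ?thesis by blast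
qed

lemmas ext_orthogonal_biproduct = ext_orthogonal_biproduct_left ext_orthogonal_biproduct_right

lemma ext_orthogonal_zero_cplx: "ext_orthogonal (Tot zero_cplx) Z"
  "ext_orthogonal Z (Tot zero_cplx)" for Z :: "'a tot_cplx"
proof -
  have "F = 0" if "F \<in> cocycles k (Tot zero_cplx) Z \<or> F \<in> cocycles k Z (Tot zero_cplx)"
    for k and F :: "'a fin_mat"
    using that by (auto dest!: cocyclesD(1) dest: graded_homD(2) graded_homD(3)
      simp: zero_cplx_Tot(2))
  then show "ext_orthogonal (Tot zero_cplx) Z" "ext_orthogonal Z (Tot zero_cplx)"
    using coboundaries_zero by (intro ext_orthogonalI; blast)+
qed

lemma ext_orthogonal_biprod_list:
  assumes Z: "is_complex Z" and Xs: "\<forall>X\<in>set Xs. is_complex X"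
  shows "ext_orthogonal (Tot (ks.biprod_list Xs)) (Tot Z) \<longleftrightarrow>
      (\<forall>X\<in>set Xs. ext_orthogonal (Tot X) (Tot Z))"
    and "ext_orthogonal (Tot Z) (Tot (ks.biprod_list Xs)) \<longleftrightarrow>
        (\<forall>X\<in>set Xs. ext_orthogonal (Tot Z) (Tot X))"
  using Xs
proof (induction Xs)
  case Nil
  case 1 then show ?case using ext_orthogonal_zero_cplx by simp
  case 2 then show ?case using ext_orthogonal_zero_cplx by simp
next
  case (Cons X Xs)
  have step: "(ext_orthogonal (Tot (X \<oplus>\<^sub>K ks.biprod_list Xs)) (Tot Z) \<longleftrightarrow>
        ext_orthogonal (Tot X) (Tot Z) \<and> ext_orthogonal (Tot (ks.biprod_list Xs)) (Tot Z)) \<and>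
      (ext_orthogonal (Tot Z) (Tot (X \<oplus>\<^sub>K ks.biprod_list Xs)) \<longleftrightarrow>
        ext_orthogonal (Tot Z) (Tot X) \<and> ext_orthogonal (Tot Z) (Tot (ks.biprod_list Xs)))"
    if "\<forall>X\<in>set (X # Xs). is_complex X"
  proof -
    have "is_complex X" "is_complex (ks.biprod_list Xs)"
      using that ks.obj_biprod_list[of Xs] by auto
    then obtain i\<^sub>1 i\<^sub>2 p\<^sub>1 p\<^sub>2
      where "ks.biproduct (X \<oplus>\<^sub>K ks.biprod_list Xs) X (ks.biprod_list Xs) i\<^sub>1 i\<^sub>2 p\<^sub>1 p\<^sub>2"
      by (rule ks.biproduct_biprod)
    from ext_orthogonal_biproduct[OF this Z] show ?thesis by (rule conjI)
  qed
  case 1 then show ?case using Cons.IH(1) step[OF 1] by simp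
  case 2 then show ?case using Cons.IH(2) step[OF 2] by simp
qed

definition ext_orthogonal_classes :: "'a cplx set \<Rightarrow> 'a cplx set \<Rightarrow> bool" where
  "ext_orthogonal_classes c d \<longleftrightarrow> (\<exists>X\<in>c. \<exists>Y\<in>d. ext_orthogonal (Tot X) (Tot Y))"

lemma ext_orthogonal_classes_iso_class_of:
  assumes "is_complex X" "is_complex Y"
  shows "ext_orthogonal_classes (ks.iso_class_of X) (ks.iso_class_of Y) \<longleftrightarrow>
      ext_orthogonal (Tot X) (Tot Y)"
proof
  assume "ext_orthogonal_classes (ks.iso_class_of X) (ks.iso_class_of Y)"
  then obtain X' Y' where "ks.iso X' X" "ks.iso Y' Y" "ext_orthogonal (Tot X') (Tot Y')"
    unfolding ext_orthogonal_classes_def ks.iso_class_of_def by blast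
  then show "ext_orthogonal (Tot X) (Tot Y)" by (rule ext_orthogonal_iso)
next
  assume "ext_orthogonal (Tot X) (Tot Y)"
  then show "ext_orthogonal_classes (ks.iso_class_of X) (ks.iso_class_of Y)"
    unfolding ext_orthogonal_classes_def ks.iso_class_of_def using ks.iso_refl[OF assms(1)]
      ks.iso_refl[OF assms(2)] by blast
qed

lemma ext_orthogonal_iff_summands:
  assumes "is_complex X" "is_complex Y"
  shows "ext_orthogonal (Tot X) (Tot Y) \<longleftrightarrow>
      (\<forall>c\<in>#ks.summands X. \<forall>d\<in>#ks.summands Y. ext_orthogonal_classes c d)"
proof -
  obtain Xs where X: "\<forall>Y\<in>set Xs. ks.indec Y" "ks.iso X (ks.biprod_list Xs)"
    "ks.summands X = mset (map ks.iso_class_of Xs)"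
    using ks.summands_decompose[OF assms(1)] .
  obtain Ys where Y: "\<forall>Y\<in>set Ys. ks.indec Y" "ks.iso Y (ks.biprod_list Ys)"
    "ks.summands Y = mset (map ks.iso_class_of Ys)"
    using ks.summands_decompose[OF assms(2)] .
  have objs: "\<forall>X\<in>set Xs. is_complex X" "\<forall>X\<in>set Ys. is_complex X"
    using X(1) Y(1) ks.indec_obj by blast+
  have "ext_orthogonal (Tot X) (Tot Y) \<longleftrightarrow>
      ext_orthogonal (Tot (ks.biprod_list Xs)) (Tot (ks.biprod_list Ys))"
    using ext_orthogonal_iso[OF X(2) Y(2)]
      ext_orthogonal_iso[OF ks.iso_sym[OF X(2)] ks.iso_sym[OF Y(2)]] by blast
  also have "\<dots> \<longleftrightarrow> (\<forall>X\<in>set Xs. ext_orthogonal (Tot X) (Tot (ks.biprod_list Ys)))"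
    by (rule ext_orthogonal_biprod_list(1)[OF ks.obj_biprod_list[OF objs(2)] objs(1)])
  also have "\<dots> \<longleftrightarrow> (\<forall>X\<in>set Xs. \<forall>Y\<in>set Ys. ext_orthogonal (Tot X) (Tot Y))"
    by (rule ball_cong[OF refl]) (use ext_orthogonal_biprod_list(2)[OF _ objs(2)] objs(1) in blast)
  also have "\<dots> \<longleftrightarrow>
      (\<forall>X\<in>set Xs. \<forall>Y\<in>set Ys. ext_orthogonal_classes (ks.iso_class_of X) (ks.iso_class_of Y))"
    by (intro ball_cong refl) (use ext_orthogonal_classes_iso_class_of objs in blast)
  also have "\<dots> \<longleftrightarrow> (\<forall>c\<in>#ks.summands X. \<forall>d\<in>#ks.summands Y. ext_orthogonal_classes c d)"
    unfolding X(3) Y(3) by simp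
  finally show ?thesis .
qed

definition two_term_class :: "'a cplx set \<Rightarrow> bool" where "two_term_class c \<longleftrightarrow> (\<exists>X\<in>c. two_term X)"

lemma two_term_class_iff: "two_term_class (ks.iso_class_of X) \<longleftrightarrow> (\<exists>T. two_term T \<and> ks.iso T X)"
  unfolding two_term_class_def ks.iso_class_of_def by blast

lemma two_term_summand:
  assumes T: "two_term T" and YZ: "is_complex Y" "is_complex Z" and iso: "ks.iso T (Y \<oplus>\<^sub>K Z)"
  shows "two_term_class (ks.iso_class_of Y)"
proof -
  have T': "is_complex T" "two_term_tot (Tot T)" using T unfolding two_term_iff by blast+
  obtain i\<^sub>1 i\<^sub>2 p\<^sub>1 p\<^sub>2 where sum: "ks.biproduct T Y Z i\<^sub>1 i\<^sub>2 p\<^sub>1 p\<^sub>2"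
    using ks.iso_imp_biproduct[OF iso YZ] .
  note homs = ks.biproduct_hom[OF sum]
  obtain g where g: "g \<in> cocycles 0 (Tot T) (Tot T)" "g * g = g"
    "g - i\<^sub>1 * p\<^sub>1 \<in> coboundaries 0 (Tot T) (Tot T)"
    using strict_idempotent[OF tot_complex_Tot[OF T'(1)] ks.hom_mult[OF homs(1,3)]
      ks.null_idempotent[OF homs(1,3) ks.proj\<^sub>1_inj\<^sub>1[OF sum]]] .
  obtain Y' Z' where sum': "ks.biproduct T Y' Z' g (idem (Tot T) - g) g (idem (Tot T) - g)"
    and Y': "idem (Tot Y') = g"
    using split_idempotent[OF T'(1) g(1,2)] .
  have "two_term_tot (Tot Y')"
    unfolding two_term_tot_def Y'
  proof (intro allI impI)
    fix k a y assume "entry g (Index k a) y \<noteq> 0"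
    then have "entry (idem (Tot T) * g) (Index k a) y \<noteq> 0"
      using graded_homD(2)[OF cocyclesD(1)[OF g(1)]] by simp
    then show "k \<in> {-1, 0}" by (rule entry_mult_nonzeroE) (rule two_term_totD[OF T'(2)])
  qed
  then have "two_term Y'" unfolding two_term_iff using ks.biproduct_obj[OF sum'] by blast
  moreover have "ks.iso Y Y'" using g by (intro ks.idempotent_summand_unique[OF sum sum']) simp
  ultimately show ?thesis unfolding two_term_class_iff using ks.iso_sym by blast
qed

lemma two_term_biprod_list:
  "\<forall>Y\<in>set Xs. two_term_class (ks.iso_class_of Y) \<Longrightarrow>
      two_term_class (ks.iso_class_of (ks.biprod_list Xs))"
proof (induction Xs)
  case Nil
  then show ?case
    unfolding two_term_class_iff using two_term_zero_cplx ks.iso_refl[OF ks.obj_zero_obj]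
    by (intro exI[of _ zero_cplx]) simp
next
  case (Cons Y Ys)
  then obtain T T' where "two_term T" "ks.iso T (ks.biprod_list Ys)" "two_term T'" "ks.iso T' Y"
    unfolding two_term_class_iff by auto
  then show ?case
    unfolding two_term_class_iff using two_term_dsum[of T' T]
      ks.biprod_cong[of T' Y T "ks.biprod_list Ys"]
    by (intro exI[of _ "T' \<oplus>\<^sub>K T"]) simp
qed

lemma two_term_class_iff_summands:
  assumes X: "is_complex X"
  shows "two_term_class (ks.iso_class_of X) \<longleftrightarrow> (\<forall>c\<in>#ks.summands X. two_term_class c)"
proof
  assume "two_term_class (ks.iso_class_of X)"
  then obtain T where T: "two_term T" "ks.iso T X" unfolding two_term_class_iff by blast
  show "\<forall>c\<in>#ks.summands X. two_term_class c"
  proof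
    fix c assume c: "c \<in># ks.summands X"
    obtain Y where Y: "ks.indec Y" "c = ks.iso_class_of Y"
      using ks.summands_class_of_indec[OF X c] by blast
    obtain Z where Z: "is_complex Z" "ks.iso X (Y \<oplus>\<^sub>K Z)"
      using ks.indec_summand_iff[OF X Y(1)] c Y(2) by blast
    show "two_term_class c" unfolding Y(2)
      by (rule two_term_summand[OF T(1) ks.indec_obj[OF Y(1)] Z(1) ks.iso_trans[OF T(2) Z(2)]])
  qed
next
  assume classes: "\<forall>c\<in>#ks.summands X. two_term_class c"
  obtain Xs where Xs: "\<forall>Y\<in>set Xs. ks.indec Y" "ks.iso X (ks.biprod_list Xs)"
    "ks.summands X = mset (map ks.iso_class_of Xs)"
    using ks.summands_decompose[OF X] .
  have "two_term_class (ks.iso_class_of (ks.biprod_list Xs))"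
    using two_term_biprod_list classes Xs(3) by simp
  then show "two_term_class (ks.iso_class_of X)"
    using ks.iso_class_of_eq_iff[OF X, of "ks.biprod_list Xs"] Xs(2) by simp
qed

subsection \<open>The Bongartz completion\<close>

lemma common_factor_class:
  assumes T: "is_complex T" and A: "is_complex A"
  shows "set L \<subseteq> cocycles 1 (Tot T) (Tot A) \<Longrightarrow>
    \<exists>F\<in>cocycles 1 (Tot (ks.biprod_list (replicate (length L) T))) (Tot A). \<forall>G\<in>set L.
      \<exists>c\<in>cocycles 0 (Tot T) (Tot (ks.biprod_list (replicate (length L) T))). G = F * c"
proof (induction L)
  case Nil
  show ?case by (rule bexI[of _ 0]) simp_all
next
  case (Cons G L)
  let ?S = "ks.biprod_list (replicate (length L) T)"
  have S: "is_complex ?S" using T by (intro ks.obj_biprod_list) simp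
  from Cons obtain F where F: "F \<in> cocycles 1 (Tot ?S) (Tot A)"
    "\<And>G. G \<in> set L \<Longrightarrow> \<exists>c\<in>cocycles 0 (Tot T) (Tot ?S). G = F * c" by auto
  obtain i\<^sub>1 i\<^sub>2 p\<^sub>1 p\<^sub>2 where sum: "ks.biproduct (T \<oplus>\<^sub>K ?S) T ?S i\<^sub>1 i\<^sub>2 p\<^sub>1 p\<^sub>2"
    and "twisted_sum 0 (Tot (T \<oplus>\<^sub>K ?S)) (Tot T) (Tot ?S) 0 i\<^sub>1 i\<^sub>2 p\<^sub>1 p\<^sub>2"
    using dsum_biproduct[OF T S] .
  interpret twisted_sum 0 "Tot (T \<oplus>\<^sub>K ?S)" "Tot T" "Tot ?S" 0 i\<^sub>1 i\<^sub>2 p\<^sub>1 p\<^sub>2 by fact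
  note homs = ks.biproduct_hom[OF sum]
  have G: "G \<in> cocycles 1 (Tot T) (Tot A)" using Cons.prems by simp
  define F' where "F' = G * p\<^sub>1 + F * p\<^sub>2"
  have "F' \<in> cocycles 1 (Tot (T \<oplus>\<^sub>K ?S)) (Tot A)"
    unfolding F'_def using
      cocycles_add[OF cocycles_mult[OF G homs(3)] cocycles_mult[OF F(1) homs(4)]] by simp
  moreover have "G = F' * i\<^sub>1"
    unfolding F'_def using graded_homD(3)[OF cocyclesD(1)[OF G]]
    by (simp add: distrib_right mult.assoc reduce)
  moreover have "\<exists>c\<in>cocycles 0 (Tot T) (Tot (T \<oplus>\<^sub>K ?S)). G' = F' * c" if "G' \<in> set L" for G'
  proof -
    obtain c where c: "c \<in> cocycles 0 (Tot T) (Tot ?S)" "G' = F * c"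
      using F(2)[OF \<open>G' \<in> set L\<close>] by blast
    have "F' * (i\<^sub>2 * c) = G'"
      unfolding F'_def c(2) using graded_homD(2)[OF cocyclesD(1)[OF c(1)]]
      by (simp add: distrib_right mult.assoc reduce_assoc)
    then show ?thesis using cocycles_0_mult[OF homs(2) c(1)] by blast
  qed
  ultimately show ?case using homs(1) by (intro bexI[of _ F']) auto
qed

lemma universal_class_exists:
  assumes T: "is_complex T" and A: "is_complex A"
  obtains r F where "F \<in> cocycles 1 (Tot (ks.biprod_list (replicate r T))) (Tot A)"
    "\<And>G. G \<in> cocycles 1 (Tot T) (Tot A) \<Longrightarrow>
        \<exists>c\<in>cocycles 0 (Tot T) (Tot (ks.biprod_list (replicate r T))). G = F * c"
proof -
  let ?V = "cocycles 1 (Tot T) (Tot A)"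
  obtain B where B: "finite B" "corner (idem (Tot T)) (idem (Tot A)) \<subseteq> vs.span B"
    using vs.corner_finitely_spanned by blast
  have "?V \<subseteq> vs.span B" using B(2) cocyclesD(1) unfolding graded_hom_def by blast
  then obtain C where C: "C \<subseteq> ?V" "?V \<subseteq> vs.span C" "finite C"
    using vs.finite_basis_exists[OF _ B(1)] by metis
  obtain L where L: "set L = C" using finite_list[OF C(3)] by blast
  let ?S = "ks.biprod_list (replicate (length L) T)"
  obtain F where F: "F \<in> cocycles 1 (Tot ?S) (Tot A)"
    "\<And>G. G \<in> C \<Longrightarrow> \<exists>c\<in>cocycles 0 (Tot T) (Tot ?S). G = F * c"
    using common_factor_class[OF T A, of L] C(1) L by blast
  have "\<exists>c\<in>cocycles 0 (Tot T) (Tot ?S). G = F * c" if "G \<in> vs.span C" for G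
    using that
  proof (induction rule: vs.span_induct_alt)
    case base
    show ?case by (intro bexI[of _ 0]) auto
  next
    case (step s x y)
    then obtain a b where "a \<in> cocycles 0 (Tot T) (Tot ?S)" "x = F * a"
      "b \<in> cocycles 0 (Tot T) (Tot ?S)" "y = F * b"
      using F(2) by blast
    then show ?case
      using vs.subspace_add[OF subspace_cocycles vs.subspace_scale[OF subspace_cocycles]]
      by (intro bexI[of _ "scale_mat s a + b"]) (auto simp: distrib_left scale_mat_mult)
  qed
  then show thesis using that F(1) C(2) by blast
qed

lemma two_term_replicate: "two_term T \<Longrightarrow> two_term (ks.biprod_list (replicate r T))"
  by (induction r) (auto simp: two_term_zero_cplx two_term_dsum)

lemma bongartz_completion:
  assumes T: "two_term T" "presilting T"
  obtains U r F i\<^sub>1 i\<^sub>2 p\<^sub>1 p\<^sub>2 where "two_term U" "presilting (T \<oplus>\<^sub>K U)"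
    "twisted_sum 0 (Tot U) (Tot (ks.biprod_list (replicate r T))) (Tot alg_cplx) F i\<^sub>1 i\<^sub>2 p\<^sub>1 p\<^sub>2"
    "F \<in> cocycles 1 (Tot (ks.biprod_list (replicate r T))) (Tot alg_cplx)"
proof -
  have T': "is_complex T" "two_term_tot (Tot T)" using T(1) unfolding two_term_iff by blast+
  have A: "is_complex (alg_cplx :: 'a cplx)" "two_term_tot (Tot (alg_cplx :: 'a cplx))"
    using two_term_alg_cplx unfolding two_term_iff by blast+
  have TT: "ext_orthogonal (Tot T) (Tot T)" using T(2) unfolding presilting_iff by blast
  obtain r F where F: "F \<in> cocycles 1 (Tot (ks.biprod_list (replicate r T))) (Tot alg_cplx)"
    and universal:
    "\<And>G. G \<in> cocycles 1 (Tot T) (Tot alg_cplx) \<Longrightarrow>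
        \<exists>c\<in>cocycles 0 (Tot T) (Tot (ks.biprod_list (replicate r T))). G = F * c"
    by (rule universal_class_exists[OF T'(1) A(1)]) blast
  let ?S = "ks.biprod_list (replicate r T)"
  have S: "two_term ?S" "is_complex ?S" "two_term_tot (Tot ?S)"
    using two_term_replicate[OF T(1)] unfolding two_term_iff by blast+
  obtain U i\<^sub>1 i\<^sub>2 p\<^sub>1 p\<^sub>2 where U: "is_complex U"
    and sum: "twisted_sum 0 (Tot U) (Tot ?S) (Tot alg_cplx) F i\<^sub>1 i\<^sub>2 p\<^sub>1 p\<^sub>2"
    using extension_exists[OF S(2) A(1) F] .
  have two_term_U: "two_term_tot (Tot U)" using two_term_tot_twisted_sum[OF sum S(3) A(2)] .
  note tot = tot_complex_Tot[OF T'(1)] tot_complex_Tot[OF S(2)] tot_complex_Tot[OF A(1)]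
  have S_iff: "ext_orthogonal (Tot ?S) (Tot Z) \<longleftrightarrow> r = 0 \<or> ext_orthogonal (Tot T) (Tot Z)"
    "ext_orthogonal (Tot Z) (Tot ?S) \<longleftrightarrow> r = 0 \<or> ext_orthogonal (Tot Z) (Tot T)"
      if "is_complex Z" for Z
    using ext_orthogonal_biprod_list[OF that, of "replicate r T"] T'(1) by auto
  have "ext_orthogonal (Tot T) (Tot ?S)" using S_iff(2)[OF T'(1)] TT by blast
  then have TU: "ext_orthogonal (Tot T) (Tot U)"
    by (rule universal_extension_two_term_ext_orthogonal[OF sum tot(2,3) F tot(1) T'(2) A(2)])
      (rule universal)
  have degree0: "in_block 0 0 (idem (Tot (alg_cplx :: 'a cplx)))"
    by (simp add: alg_cplx_Tot(2) in_block_matrix_unit)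
  have "g = 0" if "l > 0" "g \<in> graded_hom l (Tot alg_cplx) Z" "two_term_tot Z"
    for l g and Z :: "'a tot_cplx"
    using degree0_graded_hom_two_term_zero[OF tot(3) degree0 that(3,2,1)] .
  then have "ext_orthogonal (Tot U) (Tot U)" "ext_orthogonal (Tot U) (Tot T)"
    using extension_ext_orthogonal[OF sum tot(2,3) F] two_term_U T'(2) S_iff(1)[OF U]
      S_iff(1)[OF T'(1)] TU TT by blast+
  then have "presilting (T \<oplus>\<^sub>K U)"
    unfolding presilting_iff using TT TU dsum_biproduct[OF T'(1) U] is_complex_dsum[OF T'(1) U]
      ext_orthogonal_biproduct T'(1) U by metis
  then show thesis using that two_term_U U sum F unfolding two_term_iff by blast
qed

end

section \<open>Thick subcategories\<close>

lemma twisted_sum_map: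
  assumes B: "twisted_sum c B X Y F i\<^sub>1 i\<^sub>2 p\<^sub>1 p\<^sub>2" and B': "twisted_sum c' B' X' Y' F' j\<^sub>1 j\<^sub>2 q\<^sub>1 q\<^sub>2"
    and u: "u \<in> cocycles (c' - c) X X'" and v: "v \<in> cocycles 0 Y Y'" and square: "F' * u = v * F"
  shows "j\<^sub>1 * u * p\<^sub>1 + j\<^sub>2 * v * p\<^sub>2 \<in> cocycles 0 B B'"
proof (rule cocyclesI)
  interpret B: twisted_sum c B X Y F i\<^sub>1 i\<^sub>2 p\<^sub>1 p\<^sub>2 by (rule B)
  interpret B': twisted_sum c' B' X' Y' F' j\<^sub>1 j\<^sub>2 q\<^sub>1 q\<^sub>2 by (rule B')
  note u_hom = graded_homD[OF cocyclesD(1)[OF u]] and v_hom = graded_homD[OF cocyclesD(1)[OF v]]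
  have assoc: "idem X' * (u * y) = u * y" "u * (idem X * y) = u * y" "idem Y' * (v * y) = v * y"
    "v * (idem Y * y) = v * y" for y
    using u_hom v_hom by (simp_all add: mult.assoc[symmetric])
  have square_assoc: "F' * (u * y) = v * (F * y)" for y
    using square by (simp add: mult.assoc[symmetric])
  have u_diff: "u * (diff X * y) = koszul_sign (c' - c) (diff X' * (u * y))" for y
    using arg_cong[OF cocyclesD(2)[OF u], of "\<lambda>x. x * y"]
    by (simp add: koszul_sign_mult_left mult.assoc)
  have v_diff: "v * (diff Y * y) = diff Y' * (v * y)" for y
    using cocycles_0D[OF v] by (simp add: mult.assoc[symmetric])
  note reduce = B.reduce B.reduce_assoc B'.reduce B'.reduce_assoc assoc
  have "homogeneous 0 (j\<^sub>1 * u * p\<^sub>1)" "homogeneous 0 (j\<^sub>2 * v * p\<^sub>2)"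
    using homogeneous_mult[OF homogeneous_mult[OF B'.homogeneous_inj\<^sub>1 u_hom(1) refl]
      B.homogeneous_proj\<^sub>1]
      homogeneous_mult[OF homogeneous_mult[OF B'.homogeneous_inj\<^sub>2 v_hom(1) refl]
        B.homogeneous_proj\<^sub>2] by simp_all
  then show "j\<^sub>1 * u * p\<^sub>1 + j\<^sub>2 * v * p\<^sub>2 \<in> graded_hom 0 B B'"
    by (intro graded_homI homogeneous_add)
      (simp_all add: distrib_left distrib_right mult.assoc reduce)
  show "koszul_sign 0 (diff B' * (j\<^sub>1 * u * p\<^sub>1 + j\<^sub>2 * v * p\<^sub>2)) =
      (j\<^sub>1 * u * p\<^sub>1 + j\<^sub>2 * v * p\<^sub>2) * diff B"
    by (simp add: B.diff_eq B'.diff_eq distrib_left distrib_right mult.assoc reduce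
      square_assoc u_diff v_diff
        koszul_sign_mult_left koszul_sign_mult_right koszul_sign_koszul_sign)
qed

lemma twisted_sum_lift:
  assumes B: "twisted_sum c B X Y F i\<^sub>1 i\<^sub>2 p\<^sub>1 p\<^sub>2" and X: "tot_complex X"
    and a: "a \<in> cocycles k Z X" "F * a = 0"
  shows "i\<^sub>1 * a \<in> cocycles (k - c) Z B"
proof (rule cocyclesI)
  interpret twisted_sum c B X Y F i\<^sub>1 i\<^sub>2 p\<^sub>1 p\<^sub>2 by (rule B)
  interpret X: tot_complex X by (rule X)
  note a_hom = graded_homD[OF cocyclesD(1)[OF a(1)]]
  have a_diff: "a * diff Z = koszul_sign k (diff X * a)" using cocyclesD(2)[OF a(1)] by simp
  have "homogeneous (k - c) (i\<^sub>1 * a)" by (rule homogeneous_mult[OF homogeneous_inj\<^sub>1 a_hom(1)]) simp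
  then show "i\<^sub>1 * a \<in> graded_hom (k - c) Z B"
    by (rule graded_homI) (simp_all add: mult.assoc a_hom(3) reduce_assoc)
  show "koszul_sign (k - c) (diff B * (i\<^sub>1 * a)) = i\<^sub>1 * a * diff Z"
    by (simp add: diff_eq distrib_right mult.assoc reduce reduce_assoc a(2) a_diff
      a_hom(2) X.reduce_assoc
        koszul_sign_mult_left koszul_sign_mult_right koszul_sign_koszul_sign koszul_sign_add)
qed

lemma twisted_sum_descend:
  assumes B: "twisted_sum c B X Y F i\<^sub>1 i\<^sub>2 p\<^sub>1 p\<^sub>2"
    and u: "u \<in> graded_hom (k - c) X Z" and v: "v \<in> cocycles k Y Z"
    and boundary: "koszul_sign k (diff Z * u) = koszul_sign c (u * diff X) + v * F"
  shows "u * p\<^sub>1 + v * p\<^sub>2 \<in> cocycles k B Z"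
proof (rule cocyclesI)
  interpret twisted_sum c B X Y F i\<^sub>1 i\<^sub>2 p\<^sub>1 p\<^sub>2 by (rule B)
  note u_hom = graded_homD[OF u] and v_hom = graded_homD[OF cocyclesD(1)[OF v]]
  have assoc: "idem Z * (u * y) = u * y" "u * (idem X * y) = u * y" "idem Z * (v * y) = v * y"
    "v * (idem Y * y) = v * y" for y
    using u_hom v_hom by (simp_all add: mult.assoc[symmetric])
  have "homogeneous k (u * p\<^sub>1)" "homogeneous k (v * p\<^sub>2)"
    using homogeneous_mult[OF u_hom(1) homogeneous_proj\<^sub>1]
      homogeneous_mult[OF v_hom(1) homogeneous_proj\<^sub>2] by simp_all
  then show "u * p\<^sub>1 + v * p\<^sub>2 \<in> graded_hom k B Z"
    by (intro graded_homI homogeneous_add)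
      (simp_all add: distrib_left distrib_right mult.assoc assoc reduce)
  have "koszul_sign k (diff Z * (u * p\<^sub>1 + v * p\<^sub>2)) = koszul_sign k (diff Z * u) * p\<^sub>1 +
      koszul_sign k (diff Z * v) * p\<^sub>2"
    by (simp add: distrib_left mult.assoc koszul_sign_add koszul_sign_mult_left)
  also have "\<dots> = (u * p\<^sub>1 + v * p\<^sub>2) * diff B"
    unfolding boundary cocyclesD(2)[OF v]
    by (simp add: diff_eq distrib_left distrib_right mult.assoc reduce_assoc assoc
      koszul_sign_mult_left koszul_sign_mult_right)
  finally show "koszul_sign k (diff Z * (u * p\<^sub>1 + v * p\<^sub>2)) = (u * p\<^sub>1 + v * p\<^sub>2) * diff B" .
qed

lemma subcomplex_extension:
  assumes X: "tot_complex X" and g: "homogeneous 0 g" "g * g = g" "g \<in> corner (idem X) (idem X)"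
    and sub: "g * diff X * g = diff X * g"
  defines "h \<equiv> idem X - g" and "F \<equiv> g * diff X - diff X * g"
  shows "tot_complex (h, h * diff X)" "F \<in> cocycles 1 (h, h * diff X) (g, diff X * g)"
    "twisted_sum 0 X (h, h * diff X) (g, diff X * g) F h g h g"
proof -
  interpret X: tot_complex X by (rule X)
  have unit: "idem X * g = g" "g * idem X = g" using cornerD[OF g(3)] by auto
  have assoc: "idem X * (g * y) = g * y" "g * (idem X * y) = g * y" "g * (g * y) = g * y"
    "g * (diff X * (g * y)) = diff X * (g * y)" for y
    using unit g(2) sub by (simp_all add: mult.assoc[symmetric])
  note reduce = X.reduce X.reduce_assoc unit g(2) assoc sub[unfolded mult.assoc]
  have h: "homogeneous 0 h" unfolding h_def using X.homogeneous_idem g(1) by (rule homogeneous_diff)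
  have "homogeneous 1 (h * diff X)" by (rule homogeneous_mult[OF h X.homogeneous_diff]) simp
  then show "tot_complex (h, h * diff X)"
    by unfold_locales (simp_all add: h, simp_all add: h_def algebra_simps reduce)
  have "homogeneous 1 F" unfolding F_def
    by (intro homogeneous_diff; rule homogeneous_mult[OF g(1) X.homogeneous_diff]
      homogeneous_mult[OF X.homogeneous_diff g(1)]) simp_all
  then have "F \<in> graded_hom 1 (h, h * diff X) (g, diff X * g)"
    by (rule graded_homI) (simp_all add: F_def h_def algebra_simps reduce)
  then show "F \<in> cocycles 1 (h, h * diff X) (g, diff X * g)"
    by (rule cocyclesI) (simp add: F_def h_def algebra_simps reduce)
  show "twisted_sum 0 X (h, h * diff X) (g, diff X * g) F h g h g"
    by unfold_locales (simp_all add: g h, simp_all add: F_def h_def algebra_simps reduce)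
qed

lemma thick_is_complex: "X \<in> thick S \<Longrightarrow> is_complex X"
proof (induction rule: thick.induct)
  case (iso X Y)
  then show ?case unfolding htpy_equiv_def by blast
qed (auto intro: zero_cplx_Tot(1) is_complex_shift is_complex_cone)

lemma thick_cone:
  assumes X: "X \<in> thick S" and Y: "Y \<in> thick S" and F: "F \<in> cocycles 0 (Tot X) (Tot Y)"
  obtains C i\<^sub>1 i\<^sub>2 p\<^sub>1 p\<^sub>2 where "C \<in> thick S" "twisted_sum 1 (Tot C) (Tot X) (Tot Y) F i\<^sub>1 i\<^sub>2 p\<^sub>1 p\<^sub>2"
proof -
  note complexes = thick_is_complex[OF X] thick_is_complex[OF Y]
  obtain f where "chain_map X (shift 0 Y) f" "Tot_map 0 X Y f = F"
    by (rule chain_map_surj[OF complexes F])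
  then have f: "chain_map X Y f" "Tot_map 0 X Y f = F" by (simp_all add: shift_0)
  then show thesis using that thick.cne[OF X Y f(1)] cone_twisted_sum(2)[OF complexes f(1)] by blast
qed

context fin_dim_algebra
begin

lemma thick_retract:
  fixes B X :: "'a cplx"
  assumes B: "B \<in> thick S" and X: "is_complex X"
    and f: "f \<in> cocycles 0 (Tot X) (Tot B)" "g \<in> cocycles 0 (Tot B) (Tot X)" "g * f = idem (Tot X)"
  shows "X \<in> thick S"
proof -
  obtain W i p where sum: "ks.biproduct B X W f i g p"
    by (rule ks.split_retract[OF f(1,2) _ X thick_is_complex[OF B]]) (simp add: f(3))
  have "B \<simeq>\<^sub>K X \<oplus>\<^sub>K W" using ks.biproduct_imp_iso[OF sum] iso_iff by simp
  from thick.iso[OF B this] show ?thesis by (rule thick.summand[OF _ X ks.biproduct_obj(3)[OF sum]])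
qed

text \<open>An extension of \<open>X\<close> by \<open>Y\<close> is the cone of a chain map from the desuspension of \<open>X\<close> to \<open>Y\<close>.\<close>

lemma thick_extension:
  fixes X Y :: "'a cplx"
  assumes X: "X \<in> thick S" and Y: "Y \<in> thick S" and U: "is_complex U"
    and F: "F \<in> cocycles 1 (Tot X) (Tot Y)"
    and sum: "twisted_sum 0 (Tot U) (Tot X) (Tot Y) F i\<^sub>1 i\<^sub>2 p\<^sub>1 p\<^sub>2"
  shows "U \<in> thick S"
proof -
  interpret U: twisted_sum 0 "Tot U" "Tot X" "Tot Y" F i\<^sub>1 i\<^sub>2 p\<^sub>1 p\<^sub>2 by (rule sum)
  note complexes = thick_is_complex[OF X] thick_is_complex[OF Y]
  interpret X: tot_complex "Tot X" by (rule tot_complex_Tot[OF complexes(1)])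
  interpret Y: tot_complex "Tot Y" by (rule tot_complex_Tot[OF complexes(2)])
  let ?X = "shift (- 1) X"
  have zero: "tot_complex (0, 0 :: 'a fin_mat)" by (rule tot_complex_zero_diff) simp_all
  obtain i p where shift: "twisted_sum (- 1) (Tot ?X) (Tot X) (0, 0) 0 i 0 p 0"
    using shift_twisted_sum(2)[OF complexes(1)] by blast
  then interpret sX: twisted_sum "- 1" "Tot ?X" "Tot X" "(0, 0)" 0 i 0 p 0 .
  have i: "i \<in> cocycles 1 (Tot X) (Tot ?X)" and p: "p \<in> cocycles (- 1) (Tot ?X) (Tot X)"
    using twisted_sum_cocycles[OF shift X.tot_complex_axioms zero] by simp_all
  have Fp: "F * p \<in> cocycles 0 (Tot ?X) (Tot Y)" using cocycles_mult[OF F p] by simp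
  obtain C j\<^sub>1 j\<^sub>2 q\<^sub>1 q\<^sub>2 where C: "C \<in> thick S"
    and cone: "twisted_sum 1 (Tot C) (Tot ?X) (Tot Y) (F * p) j\<^sub>1 j\<^sub>2 q\<^sub>1 q\<^sub>2"
    using thick_cone[OF thick.shft[OF X] Y Fp] .
  interpret C: twisted_sum 1 "Tot C" "Tot ?X" "Tot Y" "F * p" j\<^sub>1 j\<^sub>2 q\<^sub>1 q\<^sub>2 by (rule cone)
  have F_unit: "F * idem (Tot X) = F" "idem (Tot Y) * F = F"
    using graded_homD(2,3)[OF cocyclesD(1)[OF F]] by simp_all
  have "j\<^sub>1 * i * p\<^sub>1 + j\<^sub>2 * idem (Tot Y) * p\<^sub>2 \<in> cocycles 0 (Tot U) (Tot C)"
    by (rule twisted_sum_map[OF sum cone _ Y.idem_cocycle])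
      (simp_all add: i mult.assoc sX.reduce F_unit)
  moreover have "i\<^sub>1 * p * q\<^sub>1 + i\<^sub>2 * idem (Tot Y) * q\<^sub>2 \<in> cocycles 0 (Tot C) (Tot U)"
    by (rule twisted_sum_map[OF cone sum _ Y.idem_cocycle])
      (simp_all add: p mult.assoc[symmetric] F_unit)
  moreover have "(i\<^sub>1 * p * q\<^sub>1 + i\<^sub>2 * idem (Tot Y) * q\<^sub>2) * (j\<^sub>1 * i * p\<^sub>1 +
      j\<^sub>2 * idem (Tot Y) * p\<^sub>2) = idem (Tot U)"
    using U.decomposition by (simp add: algebra_simps C.reduce C.reduce_assoc U.reduce
      U.reduce_assoc sX.reduce sX.reduce_assoc)
  ultimately show ?thesis by (rule thick_retract[OF C U])
qed

text \<open>In the triangle with terms \<open>Y\<close>, \<open>U\<close>, \<open>X\<close>, the suspension of \<open>Y\<close> is a retract of the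
  cone of \<open>p\<^sub>1\<close> from \<open>U\<close> to \<open>X\<close>.\<close>

lemma thick_kernel:
  fixes X Y U :: "'a cplx"
  assumes U: "U \<in> thick S" and X: "X \<in> thick S" and Y: "is_complex Y"
    and F: "F \<in> cocycles 1 (Tot X) (Tot Y)"
    and sum: "twisted_sum 0 (Tot U) (Tot X) (Tot Y) F i\<^sub>1 i\<^sub>2 p\<^sub>1 p\<^sub>2"
  shows "Y \<in> thick S"
proof -
  interpret U: twisted_sum 0 "Tot U" "Tot X" "Tot Y" F i\<^sub>1 i\<^sub>2 p\<^sub>1 p\<^sub>2 by (rule sum)
  interpret X: tot_complex "Tot X" by (rule tot_complex_Tot[OF thick_is_complex[OF X]])
  interpret Y: tot_complex "Tot Y" by (rule tot_complex_Tot[OF Y])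
  note maps = twisted_sum_cocycles[OF sum X.tot_complex_axioms Y.tot_complex_axioms]
  obtain C j\<^sub>1 j\<^sub>2 q\<^sub>1 q\<^sub>2 where C: "C \<in> thick S"
    and cone: "twisted_sum 1 (Tot C) (Tot U) (Tot X) p\<^sub>1 j\<^sub>1 j\<^sub>2 q\<^sub>1 q\<^sub>2"
    using thick_cone[OF U X maps(2)] .
  interpret C: twisted_sum 1 "Tot C" "Tot U" "Tot X" p\<^sub>1 j\<^sub>1 j\<^sub>2 q\<^sub>1 q\<^sub>2 by (rule cone)
  have lift: "j\<^sub>1 * i\<^sub>2 \<in> cocycles (- 1) (Tot Y) (Tot C)"
    using twisted_sum_lift[OF cone tot_complex_Tot[OF thick_is_complex[OF U]] maps(1) U.proj\<^sub>1_inj\<^sub>2]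
    by simp
  have "p\<^sub>2 * diff (Tot U) = F * p\<^sub>1 + diff (Tot Y) * p\<^sub>2"
    using graded_homD(2)[OF cocyclesD(1)[OF F]]
    by (simp add: U.diff_eq distrib_left mult.assoc[symmetric] U.reduce Y.reduce)
  then have descend: "p\<^sub>2 * q\<^sub>1 + F * q\<^sub>2 \<in> cocycles 1 (Tot C) (Tot Y)"
    using U.homogeneous_proj\<^sub>2 by (intro twisted_sum_descend[OF cone _ F] graded_homI)
      (simp_all add: U.reduce)
  let ?Y = "shift 1 Y"
  obtain i p where shift: "twisted_sum 1 (Tot ?Y) (Tot Y) (0, 0) 0 i 0 p 0"
    using shift_twisted_sum(2)[OF Y] by blast
  interpret sY: twisted_sum 1 "Tot ?Y" "Tot Y" "(0, 0)" 0 i 0 p 0 by (rule shift)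
  have zero: "tot_complex (0, 0 :: 'a fin_mat)" by (rule tot_complex_zero_diff) simp_all
  have i: "i \<in> cocycles (- 1) (Tot Y) (Tot ?Y)" and p: "p \<in> cocycles 1 (Tot ?Y) (Tot Y)"
    using twisted_sum_cocycles[OF shift Y.tot_complex_axioms zero] by simp_all
  have "?Y \<in> thick S"
  proof (rule thick_retract[OF C is_complex_shift[OF Y]])
    show "j\<^sub>1 * i\<^sub>2 * p \<in> cocycles 0 (Tot ?Y) (Tot C)"
      "i * (p\<^sub>2 * q\<^sub>1 + F * q\<^sub>2) \<in> cocycles 0 (Tot C) (Tot ?Y)"
      using cocycles_mult[OF lift p] cocycles_mult[OF i descend] by simp_all
    show "i * (p\<^sub>2 * q\<^sub>1 + F * q\<^sub>2) * (j\<^sub>1 * i\<^sub>2 * p) = idem (Tot ?Y)"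
      using sY.decomposition
      by (simp add: distrib_left distrib_right mult.assoc C.reduce_assoc U.reduce_assoc U.reduce
        sY.reduce_assoc U.unit_inj\<^sub>2)
  qed
  then show ?thesis using thick.shft[of ?Y S "- 1"] shift_shift_uminus[of 1 Y] by simp
qed

lemma thick_dsum:
  fixes X Y :: "'a cplx"
  assumes "X \<in> thick S" "Y \<in> thick S" shows "X \<oplus>\<^sub>K Y \<in> thick S"
proof -
  note complexes = thick_is_complex[OF assms(1)] thick_is_complex[OF assms(2)]
  obtain i\<^sub>1 i\<^sub>2 p\<^sub>1 p\<^sub>2 where "twisted_sum 0 (Tot (X \<oplus>\<^sub>K Y)) (Tot X) (Tot Y) 0 i\<^sub>1 i\<^sub>2 p\<^sub>1 p\<^sub>2"
    using dsum_twisted_sum(2)[OF complexes] by blast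
  then show ?thesis by (rule thick_extension[OF assms is_complex_dsum[OF complexes] cocycles_zero])
qed

lemma thick_summands:
  assumes A: "A \<in> thick S" and X: "is_complex X"
    "set_mset (ks.summands X) \<subseteq> set_mset (ks.summands A)"
  shows "X \<in> thick S"
proof -
  obtain Xs where Xs: "\<forall>Y\<in>set Xs. ks.indec Y" "ks.iso X (ks.biprod_list Xs)"
    "ks.summands X = mset (map ks.iso_class_of Xs)"
    using ks.summands_decompose[OF X(1)] .
  have "Y \<in> thick S" if "Y \<in> set Xs" for Y
  proof -
    have Y: "ks.indec Y" and "ks.iso_class_of Y \<in># ks.summands A" using that Xs X(2) by auto
    then obtain Z where Z: "is_complex Z" "A \<simeq>\<^sub>K Y \<oplus>\<^sub>K Z"
      using ks.indec_summand_iff[OF thick_is_complex[OF A] Y] unfolding iso_iff by blast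
    show ?thesis using thick.summand[OF thick.iso[OF A Z(2)] ks.indec_obj[OF Y] Z(1)] .
  qed
  then have "ks.biprod_list Xs \<in> thick S"
    by (induction Xs) (simp_all add: thick.zero thick_dsum)
  then show ?thesis by (rule thick.iso) (simp add: iso_iff ks.iso_sym[OF Xs(2)])
qed

lemma thick_stalk:
  assumes A: "(alg_cplx :: 'a cplx) \<in> thick S" and X: "stalk t P X" shows "X \<in> thick S"
proof -
  obtain Q u v where "stalk (t - t) Q (shift t X)" "idem_iso P Q u v" by (rule stalk_shift[OF X])
  then have "stalk 0 Q (shift t X)" by simp
  then have "shift t X \<in> thick S"
    using thick_summands[OF A] stalk_summands_subset_alg stalkD(1) by blast
  from thick.shft[OF this, of "- t"] show ?thesis by (simp add: shift_shift_uminus)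
qed

lemma diff_mult_top_block_zero:
  assumes X: "tot_complex X" and g: "in_block t t g"
    and top: "\<And>i a w. entry (idem X) (Index i a) w \<noteq> 0 \<Longrightarrow> i \<le> t"
  shows "diff X * g = 0"
proof (rule fin_mat_eqI, rule ccontr)
  interpret X: tot_complex X by (rule X)
  fix i a j c assume "entry (diff X * g) (Index i a) (Index j c) \<noteq> entry 0 (Index i a) (Index j c)"
  then have nonzero: "entry (diff X * g) (Index i a) (Index j c) \<noteq> 0" by simp
  moreover have "in_block (t + 1) t (diff X * g)"
    by (rule homogeneous_mult_in_block[OF X.homogeneous_diff g]) simp
  ultimately have "i = t + 1" using in_blockD by blast
  from nonzero have "entry (idem X * (diff X * g)) (Index i a) (Index j c) \<noteq> 0"
    by (simp add: X.reduce_assoc)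
  then obtain i' a' where "entry (idem X) (Index i a) (Index i' a') \<noteq> 0" by (rule entry_mult_nonzeroE)
  then show False using top \<open>i = t + 1\<close> by fastforce
qed

lemma thick_degree_window:
  assumes A: "(alg_cplx :: 'a cplx) \<in> thick S"
  shows "is_complex X \<Longrightarrow> (\<And>i a w. entry (idem (Tot X)) (Index i a) w \<noteq> 0 \<Longrightarrow>
      b \<le> i \<and> i < b + int k) \<Longrightarrow> X \<in> thick S"
proof (induction k arbitrary: X)
  case 0
  have "idem (Tot X) = 0"
    by (rule fin_mat_eqI, rule ccontr) (use 0(2) in fastforce)
  then have "zero_cplx \<simeq>\<^sub>K X" using ks.iso_zero_obj_iff[OF 0(1)] ks.iso_sym unfolding iso_iff by simp
  then show ?case by (rule thick.iso[OF thick.zero])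
next
  case (Suc k)
  interpret X: tot_complex "Tot X" by (rule tot_complex_Tot[OF Suc.prems(1)])
  let ?e = "idem (Tot X)" and ?d = "diff (Tot X)" and ?t = "b + int k"
  obtain g where g: "in_block ?t ?t g" "g * g = g" "g \<in> corner ?e ?e"
    and entries: "\<And>i a j c. entry g (Index i a) (Index j c) =
        (if i = ?t then entry ?e (Index i a) (Index j c) else 0)"
    by (rule idempotent_block_part[OF X.homogeneous_idem X.idem_idem, where t = ?t]) (rule that)
  have top: "?d * g = 0"
    using Suc.prems(2) by (intro diff_mult_top_block_zero[OF X.tot_complex_axioms g(1)]) fastforce
  have "homogeneous 0 g" using in_block_homogeneous[OF g(1)] by simp
  note extension = subcomplex_extension[OF X.tot_complex_axioms this g(2,3),
    unfolded mult.assoc top, simplified]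
  obtain Q where Q: "is_complex Q" "Tot Q = (?e - g, (?e - g) * ?d)"
    using Tot_surj[OF extension(1)] .
  obtain P where P: "stalk ?t g P" using stalk_exists[OF g(1,2)] .
  have "Q \<in> thick S"
  proof (rule Suc.IH[OF Q(1)])
    fix i a w assume nonzero: "entry (idem (Tot Q)) (Index i a) w \<noteq> 0"
    then have "entry ?e (Index i a) w \<noteq> 0" "i \<noteq> ?t"
      unfolding Q(2) by (cases w; auto simp: entries split: if_splits)+
    then show "b \<le> i \<and> i < b + int k" using Suc.prems(2)[of i a w] by simp
  qed
  moreover have "P \<in> thick S" by (rule thick_stalk[OF A P])
  ultimately show ?case
    using thick_extension[of Q S P X] Suc.prems(1) extension(2,3) unfolding Q(2) stalkD(2)[OF P]
    by simp
qed

lemma thick_all: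
  assumes A: "(alg_cplx :: 'a cplx) \<in> thick S" and X: "is_complex X" shows "X \<in> thick S"
proof -
  obtain N n where N: "sized N (\<lambda>_. n) (\<lambda>_. n) (idem (Tot X))"
    using common_size[of "{idem (Tot X)}"] by auto
  show ?thesis
  proof (rule thick_degree_window[OF A X, of "- \<bar>N\<bar>" "nat (2 * \<bar>N\<bar> + 1)"])
    fix i a w assume "entry (idem (Tot X)) (Index i a) w \<noteq> 0"
    then have "\<bar>i\<bar> \<le> N" using sizedD[OF N] by (cases w) (meson not_less)
    then show "- \<bar>N\<bar> \<le> i \<and> i < - \<bar>N\<bar> + int (nat (2 * \<bar>N\<bar> + 1))" by (auto simp: abs_le_iff)
  qed
qed

end

section \<open>The faces of the presilting complex\<close>

lemma bij_betw_images:
  assumes "\<And>x y. x \<in> S \<Longrightarrow> y \<in> S \<Longrightarrow> f x = f y \<longleftrightarrow> g x = g y"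
  obtains h where "bij_betw h (f ` S) (g ` S)"
proof -
  have "g (inv_into S f (f x)) = g x" if "x \<in> S" for x
    using assms[OF inv_into_into[of "f x" f S] that] f_inv_into_f[of "f x" f S] that by blast
  then have "bij_betw (\<lambda>c. g (inv_into S f c)) (f ` S) (g ` S)"
    unfolding bij_betw_def inj_on_def using assms by (auto simp: image_image)
  then show thesis by (rule that)
qed

context fin_dim_algebra
begin

lemma iso_classes_bij_betw_summands:
  assumes "\<And>X. X \<in> S \<Longrightarrow> is_complex X"
  obtains h where "bij_betw h (iso_class ` S) (ks.summands ` S)"
  by (rule bij_betw_images[of S iso_class ks.summands])
    (use assms in \<open>simp_all add: iso_class_eq ks.iso_class_of_eq_iff ks.iso_iff_summands\<close>)

definition face :: "'a cplx set set \<Rightarrow> bool" where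
  "face C \<longleftrightarrow> finite C \<and> (\<forall>c\<in>C. (\<exists>Y. ks.indec Y \<and> c = ks.iso_class_of Y) \<and> two_term_class c \<and>
    (\<forall>d\<in>C. ext_orthogonal_classes c d))"

lemma two_term_is_complex: "two_term X \<Longrightarrow> is_complex X"
  unfolding two_term_def by blast

lemma two_term_presilting_face:
  assumes "two_term T" "presilting T" shows "face (set_mset (ks.summands T))"
proof -
  note T = two_term_is_complex[OF assms(1)]
  have "two_term_class (ks.iso_class_of T)"
    unfolding two_term_class_iff using assms(1) ks.iso_refl[OF T] by blast
  then have "\<forall>c\<in>#ks.summands T. two_term_class c" using two_term_class_iff_summands[OF T] by simp
  moreover have "\<forall>c\<in>#ks.summands T. \<forall>d\<in>#ks.summands T. ext_orthogonal_classes c d"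
    using assms(2) ext_orthogonal_iff_summands[OF T T] unfolding presilting_iff by simp
  ultimately show ?thesis unfolding face_def using ks.summands_class_of_indec[OF T] by simp
qed

lemma face_two_term_presilting:
  assumes face: "face (set_mset M)" obtains T where "two_term T" "presilting T" "ks.summands T = M"
proof -
  obtain X where X: "is_complex X" "ks.summands X = M"
    using ks.summands_surj[of M] face unfolding face_def by blast
  have "two_term_class (ks.iso_class_of X)"
    using face unfolding two_term_class_iff_summands[OF X(1)] X(2) face_def by blast
  then obtain T where T: "two_term T" "ks.iso T X" unfolding two_term_class_iff by blast
  have summands: "ks.summands T = M" using ks.summands_iso[OF T(2)] X(2) by simp
  note complex = two_term_is_complex[OF T(1)]
  have "presilting T"
    using face complex unfolding presilting_iff ext_orthogonal_iff_summands[OF complex complex]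
      summands face_def by blast
  then show thesis using that T(1) summands by blast
qed

lemma face_silting:
  assumes "face C"
  obtains S where "two_term S" "silting S" "basic S" "C \<subseteq> set_mset (ks.summands S)"
proof -
  have "finite C" using assms unfolding face_def by blast
  then have "face (set_mset (mset_set C))" using assms by simp
  then obtain T where T: "two_term T" "presilting T" and summands_T: "ks.summands T = mset_set C"
    by (rule face_two_term_presilting)
  obtain U r F i\<^sub>1 i\<^sub>2 p\<^sub>1 p\<^sub>2 where U: "two_term U" "presilting (T \<oplus>\<^sub>K U)"
    and sum:
      "twisted_sum 0 (Tot U) (Tot (ks.biprod_list (replicate r T))) (Tot alg_cplx) F i\<^sub>1 i\<^sub>2 p\<^sub>1 p\<^sub>2"
    and F: "F \<in> cocycles 1 (Tot (ks.biprod_list (replicate r T))) (Tot alg_cplx)"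
    by (rule bongartz_completion[OF T])
  let ?D = "set_mset (ks.summands (T \<oplus>\<^sub>K U))"
  note complexes = two_term_is_complex[OF T(1)] two_term_is_complex[OF U(1)]
  have D: "?D = set_mset (ks.summands T) \<union> set_mset (ks.summands U)"
    using ks.summands_biprod[OF complexes] by simp
  have "face ?D" by (rule two_term_presilting_face[OF two_term_dsum[OF T(1) U(1)] U(2)])
  then have "face (set_mset (mset_set ?D))" by simp
  then obtain S where S: "two_term S" "presilting S" and summands_S: "ks.summands S = mset_set ?D"
    by (rule face_two_term_presilting)
  have S_complex: "is_complex S" by (rule two_term_is_complex[OF S(1)])
  have set_S: "set_mset (ks.summands S) = ?D" using summands_S by simp
  have "S \<in> thick {S}" by (rule thick.base) (simp_all add: S_complex)
  note in_thick = thick_summands[OF this, unfolded set_S D]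
  have "T \<in> thick {S}" "U \<in> thick {S}" using in_thick complexes by simp_all
  moreover from this(1) have "ks.biprod_list (replicate r T) \<in> thick {S}"
    by (induction r) (simp_all add: thick.zero thick_dsum)
  ultimately have "(alg_cplx :: 'a cplx) \<in> thick {S}"
    by (intro thick_kernel[OF _ _ alg_cplx_Tot(1) F sum])
  then have "silting S" unfolding silting_def using S(2) thick_all by blast
  moreover have "basic S"
    unfolding basic_iff using S_complex summands_S by (simp add: count_mset_set')
  moreover have "C \<subseteq> set_mset (ks.summands S)" unfolding set_S D summands_T using \<open>finite C\<close> by simp
  ultimately show thesis using that S(1) by blast
qed

lemma finite_faces:
  assumes "g_finite TYPE('a)" shows "finite {C. face C}"
proof (rule finite_subset)
  let ?Q = "{S :: 'a cplx. two_term S \<and> silting S \<and> basic S}"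
  obtain h where "bij_betw h (iso_class ` ?Q) (ks.summands ` ?Q)"
    by (rule iso_classes_bij_betw_summands[of ?Q]) (simp_all add: two_term_is_complex)
  then have "finite (ks.summands ` ?Q)" using assms bij_betw_finite unfolding g_finite_def by blast
  then show "finite (\<Union>M\<in>ks.summands ` ?Q. Pow (set_mset M))" by (rule finite_UN_I) simp
  show "{C. face C} \<subseteq> (\<Union>M\<in>ks.summands ` ?Q. Pow (set_mset M))"
  proof
    fix C assume "C \<in> {C. face C}"
    then obtain S where "two_term S" "silting S" "basic S" "C \<subseteq> set_mset (ks.summands S)"
      using face_silting by blast
    then show "C \<in> (\<Union>M\<in>ks.summands ` ?Q. Pow (set_mset M))" by blast
  qed
qed

end

section \<open>Bounding the number of summands\<close>

subsection \<open>Endomorphisms factoring through disjoint summands\<close>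

context krull_schmidt_category
begin

definition factors_through :: "'o \<Rightarrow> 'o \<Rightarrow> 'm \<Rightarrow> bool" where
  "factors_through Y X a \<longleftrightarrow> (\<exists>W. obj W \<and> set_mset (summands W) \<subseteq> set_mset (summands Y) \<and>
    (\<exists>F\<in>hom W X. \<exists>G\<in>hom X W. a - F * G \<in> null X X))"

lemma factors_through_mult:
  assumes "obj Y" "f \<in> hom Y X" "g \<in> hom X Y" shows "factors_through Y X (f * g)"
  unfolding factors_through_def using assms null_zero
  by (intro exI[of _ Y] conjI bexI[of _ f] bexI[of _ g]) simp_all

lemma factors_through_zero: "obj Y \<Longrightarrow> factors_through Y X 0"
  using factors_through_mult[OF _ hom_zero hom_zero, of Y X] by simp

lemma factors_through_add:
  assumes "factors_through Y X a" "factors_through Y X b" shows "factors_through Y X (a + b)"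
proof -
  obtain W F G where W: "obj W" "set_mset (summands W) \<subseteq> set_mset (summands Y)"
    and FG: "F \<in> hom W X" "G \<in> hom X W" "a - F * G \<in> null X X"
    using assms(1) unfolding factors_through_def by blast
  obtain V H K where V: "obj V" "set_mset (summands V) \<subseteq> set_mset (summands Y)"
    and HK: "H \<in> hom V X" "K \<in> hom X V" "b - H * K \<in> null X X"
    using assms(2) unfolding factors_through_def by blast
  obtain i\<^sub>1 i\<^sub>2 p\<^sub>1 p\<^sub>2 where sum: "biproduct (biprod W V) W V i\<^sub>1 i\<^sub>2 p\<^sub>1 p\<^sub>2"
    using W(1) V(1) by (rule biproduct_biprod)
  note homs = biproduct_hom[OF sum]
  let ?L = "F * p\<^sub>1 + H * p\<^sub>2" and ?R = "i\<^sub>1 * G + i\<^sub>2 * K"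
  have "a + b - ?L * ?R = (a - F * G) + (b - H * K) - (F * (p\<^sub>1 * i\<^sub>1) * G - F * G) -
      (H * (p\<^sub>2 * i\<^sub>2) * K - H * K)
      - F * (p\<^sub>1 * i\<^sub>2) * K - H * (p\<^sub>2 * i\<^sub>1) * G"
    by (simp add: algebra_simps)
  also have "\<dots> \<in> null X X"
    by (intro null_add null_diff FG(3) HK(3) null_collapse[OF proj\<^sub>1_inj\<^sub>1[OF sum] FG(1,2)]
      null_collapse[OF proj\<^sub>2_inj\<^sub>2[OF sum] HK(1,2)]
        null_sandwich[OF proj\<^sub>1_inj\<^sub>2[OF sum] FG(1) HK(2)]
          null_sandwich[OF proj\<^sub>2_inj\<^sub>1[OF sum] HK(1) FG(2)])
  finally have "a + b - ?L * ?R \<in> null X X" .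
  moreover have "?L \<in> hom (biprod W V) X" "?R \<in> hom X (biprod W V)"
    by (intro hom_add hom_mult[OF FG(1) homs(3)] hom_mult[OF HK(1) homs(4)]
      hom_mult[OF homs(1) FG(2)] hom_mult[OF homs(2) HK(2)])+
  ultimately show ?thesis
    unfolding factors_through_def using W V summands_biprod[OF W(1) V(1)] biproduct_obj(1)[OF sum]
    by (intro exI[of _ "biprod W V"]) auto
qed

lemma factors_through_quasi_inverse:
  assumes X: "obj X" and disjoint: "set_mset (summands X) \<inter> set_mset (summands Y) = {}"
    and a: "factors_through Y X a"
  obtains v where "v \<in> hom X X" "v * (ident X - a) - ident X \<in> null X X"
proof -
  obtain W F G where W: "obj W" "set_mset (summands W) \<subseteq> set_mset (summands Y)"
    and FG: "F \<in> hom W X" "G \<in> hom X W" "a - F * G \<in> null X X"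
    using a unfolding factors_through_def by blast
  have "set_mset (summands X) \<inter> set_mset (summands W) = {}" using disjoint W(2) by blast
  then obtain v where v: "v \<in> hom X X" "v * (ident X - F * G) - ident X \<in> null X X"
    using disjoint_summands_quasi_inverse[OF X W(1) _ FG(1,2)] by blast
  have "v * (ident X - a) - ident X = (v * (ident X - F * G) - ident X) - v * (a - F * G)"
    by (simp add: algebra_simps)
  also have "\<dots> \<in> null X X" by (intro null_diff v(2) null_left[OF v(1) FG(3)])
  finally show thesis using that v(1) by blast
qed

end

subsection \<open>Two-term complexes as maps of idempotents\<close>

definition two_term_idems :: "'a::ring fin_mat \<Rightarrow> 'a fin_mat \<Rightarrow> bool" where
  "two_term_idems P Q \<longleftrightarrow> in_block (-1) (-1) P \<and> in_block 0 0 Q \<and> P * P = P \<and> Q * Q = Q"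

lemma two_term_idemsD:
  assumes "two_term_idems P Q"
  shows "in_block (-1) (-1) P" "in_block 0 0 Q" "P * P = P" "Q * Q = Q" "P * Q = 0" "Q * P = 0"
proof -
  show blocks: "in_block (-1) (-1) P" "in_block 0 0 Q" "P * P = P" "Q * Q = Q"
    using assms unfolding two_term_idems_def by auto
  show "P * Q = 0" "Q * P = 0"
    using in_block_mult_zero[OF blocks(1,2)] in_block_mult_zero[OF blocks(2,1)] by simp_all
qed

lemma corner_graded_hom:
  assumes x: "x \<in> corner A B" "homogeneous k x" and units: "A * idem X = A" "idem Y * B = B"
  shows "x \<in> graded_hom k X Y"
proof (rule graded_homI[OF x(2)])
  have "idem Y * (B * x) = B * x" "x * A * idem X = x * A"
    by (simp add: mult.assoc[symmetric] units, simp add: mult.assoc units)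
  then show "idem Y * x = x" "x * idem X = x" unfolding cornerD[OF x(1)] .
qed

context
  fixes P Q P' Q' :: "'a::ring fin_mat"
  assumes idems: "two_term_idems P Q" and idems': "two_term_idems P' Q'"
begin

lemma two_term_graded_hom_decomposition:
  assumes f: "f \<in> graded_hom k (P + Q, d) (P' + Q', d')"
  shows "f = P' * f * P + P' * f * Q + Q' * f * P + Q' * f * Q"
    and "k \<noteq> 0 \<Longrightarrow> P' * f * P = 0" "k \<noteq> 0 \<Longrightarrow> Q' * f * Q = 0" "k \<noteq> - 1 \<Longrightarrow> P' * f * Q = 0"
      "k \<noteq> 1 \<Longrightarrow> Q' * f * P = 0"
proof -
  have "f = (P' + Q') * f * (P + Q)" using graded_homD(2,3)[OF f] by simp
  then show "f = P' * f * P + P' * f * Q + Q' * f * P + Q' * f * Q"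
    by (metis (no_types, lifting) add.assoc distrib_left distrib_right)
  note vanish = in_block_homogeneous_sandwich_zero[OF _ _ graded_homD(1)[OF f]]
  note blocks = two_term_idemsD(1,2)[OF idems] two_term_idemsD(1,2)[OF idems']
  show "k \<noteq> 0 \<Longrightarrow> P' * f * P = 0" "k \<noteq> 0 \<Longrightarrow> Q' * f * Q = 0" "k \<noteq> - 1 \<Longrightarrow> P' * f * Q = 0"
    "k \<noteq> 1 \<Longrightarrow> Q' * f * P = 0"
    using vanish[OF blocks(3,1)] vanish[OF blocks(4,2)] vanish[OF blocks(3,2)]
      vanish[OF blocks(4,1)] by simp_all
qed

lemma two_term_corner_graded_hom:
  assumes "A \<in> {P, Q}" "in_block s s A" "B \<in> {P', Q'}" "in_block t t B" and x: "x \<in> corner A B"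
  shows "x \<in> graded_hom (t - s) (P + Q, d) (P' + Q', d')"
proof (rule corner_graded_hom[OF x])
  show "homogeneous (t - s) x"
    by (rule in_block_homogeneous[OF in_block_corner[OF assms(2,4) x]]) simp
  show "A * idem (P + Q, d) = A"
    using assms(1) two_term_idemsD[OF idems] by (auto simp: distrib_left)
  show "idem (P' + Q', d') * B = B"
    using assms(3) two_term_idemsD[OF idems'] by (auto simp: distrib_right)
qed

lemma two_term_graded_hom:
  "graded_hom 0 (P + Q, d) (P' + Q', d') = {\<phi> + \<rho> | \<phi> \<rho>. \<phi> \<in> corner Q Q' \<and> \<rho> \<in> corner P P'}"
    (is "?hom 0 = ?sums")
  "graded_hom 1 (P + Q, d) (P' + Q', d') = corner P Q'"
  "graded_hom (- 1) (P + Q, d) (P' + Q', d') = corner Q P'"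
proof -
  note PQ = two_term_idemsD[OF idems] and PQ' = two_term_idemsD[OF idems']
  note corner_hom = two_term_corner_graded_hom[of _ _ _ _ _ d d']
  have sandwich: "P' * f * P \<in> corner P P'" "P' * f * Q \<in> corner Q P'" "Q' * f * P \<in> corner P Q'"
    "Q' * f * Q \<in> corner Q Q'" for f
    by (intro corner_sandwich PQ PQ')+
  have "f = Q' * f * Q + P' * f * P" if "f \<in> ?hom 0" for f
    using two_term_graded_hom_decomposition[OF that] by (simp add: add.commute)
  then have "?hom 0 \<subseteq> ?sums" using sandwich(1,4) by blast
  moreover have "?sums \<subseteq> ?hom 0"
    using corner_hom[of Q 0 Q' 0] corner_hom[of P "- 1" P' "- 1"] PQ PQ'
    by (auto intro!: graded_hom_add)
  ultimately show "?hom 0 = ?sums" by (rule equalityI)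
  have "f = Q' * f * P" if "f \<in> ?hom 1" for f
    using two_term_graded_hom_decomposition[OF that] by simp
  then have "?hom 1 \<subseteq> corner P Q'" using sandwich(3) by (metis subsetI)
  then show "?hom 1 = corner P Q'" using corner_hom[of P "- 1" Q' 0] PQ PQ' by auto
  have "f = P' * f * Q" if "f \<in> ?hom (- 1)" for f
    using two_term_graded_hom_decomposition[OF that] by simp
  then have "?hom (- 1) \<subseteq> corner Q P'" using sandwich(2) by (metis subsetI)
  then show "?hom (- 1) = corner Q P'" using corner_hom[of Q 0 P' "- 1"] PQ PQ' by auto
qed

lemma two_term_cocycles_0_iff:
  assumes d: "d \<in> corner P Q" "d' \<in> corner P' Q'" and "\<phi> \<in> corner Q Q'" "\<rho> \<in> corner P P'"
  shows "\<phi> + \<rho> \<in> cocycles 0 (P + Q, d) (P' + Q', d') \<longleftrightarrow> \<phi> * d = d' * \<rho>"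
proof -
  have "d' * \<phi> = 0" "\<rho> * d = 0"
    using corner_orthogonal[OF d(2) assms(3)] corner_orthogonal[OF assms(4) d(1)]
      two_term_idemsD[OF idems] two_term_idemsD[OF idems'] by simp_all
  moreover have "\<phi> + \<rho> \<in> graded_hom 0 (P + Q, d) (P' + Q', d')"
    unfolding two_term_graded_hom using assms by blast
  ultimately show ?thesis unfolding cocycles_def by (auto simp: distrib_left distrib_right)
qed

lemma two_term_cocycles_0E:
  assumes d: "d \<in> corner P Q" "d' \<in> corner P' Q'" and f: "f \<in> cocycles 0 (P + Q, d) (P' + Q', d')"
  obtains \<phi> \<rho> where "f = \<phi> + \<rho>" "\<phi> \<in> corner Q Q'" "\<rho> \<in> corner P P'" "\<phi> * d = d' * \<rho>"
proof -
  obtain \<phi> \<rho> where "f = \<phi> + \<rho>" "\<phi> \<in> corner Q Q'" "\<rho> \<in> corner P P'"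
    using cocyclesD(1)[OF f] unfolding two_term_graded_hom by blast
  then show thesis using that f two_term_cocycles_0_iff[OF d] by blast
qed

lemma two_term_coboundaries_0:
  "coboundaries 0 (P + Q, d) (P' + Q', d') = {d' * h + h * d | h. h \<in> corner Q P'}"
  unfolding coboundaries_def using two_term_graded_hom(3)[of d d'] by simp

lemma two_term_coboundaries_1E:
  assumes d: "d \<in> corner P Q" "d' \<in> corner P' Q'"
    and b: "b \<in> coboundaries 1 (P + Q, d) (P' + Q', d')"
  obtains \<phi> \<rho> where "\<phi> \<in> corner Q Q'" "\<rho> \<in> corner P P'" "b = \<phi> * d + d' * \<rho>"
proof -
  obtain h where h: "h \<in> graded_hom 0 (P + Q, d) (P' + Q', d')" "b = - (d' * h) + h * d"
    using b by (rule coboundariesE) simp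
  then obtain \<phi> \<rho> where split: "h = \<phi> + \<rho>" "\<phi> \<in> corner Q Q'" "\<rho> \<in> corner P P'"
    unfolding two_term_graded_hom by blast
  have "d' * \<phi> = 0" "\<rho> * d = 0"
    using corner_orthogonal[OF d(2) split(2)] corner_orthogonal[OF split(3) d(1)]
      two_term_idemsD[OF idems] two_term_idemsD[OF idems'] by simp_all
  then have "b = \<phi> * d + d' * (- \<rho>)" using h(2) split(1) by (simp add: distrib_left distrib_right)
  then show thesis using that split(2) corner_uminus[OF split(3)] by blast
qed

end

lemma two_term_idems_tot_complex:
  assumes idems: "two_term_idems P Q" and d: "d \<in> corner P Q"
  shows "tot_complex (P + Q, d)" "two_term_tot (P + Q, d :: 'a::ring fin_mat)"
proof -
  note PQ = two_term_idemsD[OF idems]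
  have "d \<in> graded_hom 1 (P + Q, d) (P + Q, d)"
    using d two_term_graded_hom(2)[OF idems idems] by blast
  note d_hom = graded_homD[OF this, unfolded fst_conv]
  have "(P + Q) * (P + Q) = P + Q" by (simp add: distrib_left distrib_right PQ)
  moreover have "homogeneous 0 (P + Q)"
    using in_block_homogeneous[OF PQ(1)] in_block_homogeneous[OF PQ(2)]
    by (intro homogeneous_add) simp_all
  ultimately show "tot_complex (P + Q, d)"
    unfolding tot_complex_def fst_conv snd_conv using d_hom corner_orthogonal[OF d d PQ(5)]
    by (intro conjI)
  show "two_term_tot (P + Q, d)" unfolding two_term_tot_def
  proof (intro allI impI)
    fix i a y assume "entry (idem (P + Q, d)) (Index i a) y \<noteq> 0"
    moreover obtain j b where "y = Index j b" by (cases y)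
    ultimately have "entry P (Index i a) (Index j b) \<noteq> 0 \<or> entry Q (Index i a) (Index j b) \<noteq> 0"
      by auto
    then show "i \<in> {-1, 0}" using in_blockD[OF PQ(1)] in_blockD[OF PQ(2)] by blast
  qed
qed

lemma two_term_ext1_zero:
  assumes idems: "two_term_idems P Q" and d: "d \<in> corner P Q" "d' \<in> corner P Q"
    and ext: "ext_orthogonal (P + Q, d) (P + Q, d' :: 'a::ring fin_mat)"
  shows "ext1_zero P Q d d'"
  unfolding ext1_zero_def
proof
  fix b assume "b \<in> corner P Q"
  then have "b \<in> graded_hom 1 (P + Q, d) (P + Q, d')"
    using two_term_graded_hom(2)[OF idems idems] by blast
  then have "b \<in> cocycles 1 (P + Q, d) (P + Q, d')"
    using two_term_cocycles_1 two_term_idems_tot_complex[OF idems] d by blast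
  then have "b \<in> coboundaries 1 (P + Q, d) (P + Q, d')" by (intro ext_orthogonalD[OF ext]) simp_all
  then obtain \<phi> \<rho> where "\<phi> \<in> corner Q Q" "\<rho> \<in> corner P P" "b = \<phi> * d + d' * \<rho>"
    by (rule two_term_coboundaries_1E[OF idems idems d])
  then show "\<exists>h\<in>corner P P. \<exists>k\<in>corner Q Q. b = k * d + d' * h" by blast
qed

lemma add_contractible_summand:
  assumes idems: "two_term_idems P Q" "two_term_idems P' Q'" and d: "d \<in> corner P Q"
    and P: "idem_biproduct P' P R k\<^sub>1 k\<^sub>2 r\<^sub>1 r\<^sub>2" and Q: "idem_biproduct Q' Q R i\<^sub>1 i\<^sub>2 p\<^sub>1 p\<^sub>2"
  shows "i\<^sub>1 * d * r\<^sub>1 + i\<^sub>2 * r\<^sub>2 \<in> corner P' Q'"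
    (is "?D \<in> _") "tot_equiv (P + Q, d) (P' + Q', i\<^sub>1 * d * r\<^sub>1 + i\<^sub>2 * r\<^sub>2 :: 'a::ring fin_mat)"
proof -
  interpret P: idem_biproduct P' P R k\<^sub>1 k\<^sub>2 r\<^sub>1 r\<^sub>2 by (rule P)
  interpret Q: idem_biproduct Q' Q R i\<^sub>1 i\<^sub>2 p\<^sub>1 p\<^sub>2 by (rule Q)
  note PQ = two_term_idemsD[OF idems(1)] and PQ' = two_term_idemsD[OF idems(2)]
  show D: "?D \<in> corner P' Q'"
    by (intro corner_add corner_mult[OF Q.inj\<^sub>2_corner P.proj\<^sub>2_corner]
      corner_mult[OF corner_mult[OF Q.inj\<^sub>1_corner d] P.proj\<^sub>1_corner])
  have reduce: "?D * k\<^sub>1 = i\<^sub>1 * d" "?D * k\<^sub>2 = i\<^sub>2" "p\<^sub>1 * ?D = d * r\<^sub>1" "p\<^sub>2 * ?D = r\<^sub>2"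
    using cornerD[OF d] P.unit_proj\<^sub>2 Q.inj\<^sub>2_unit
    by (simp_all add: distrib_left distrib_right mult.assoc P.reduce Q.reduce Q.reduce_assoc)
      (simp add: mult.assoc[symmetric])
  have f: "i\<^sub>1 + k\<^sub>1 \<in> cocycles 0 (P + Q, d) (P' + Q', ?D)"
    unfolding two_term_cocycles_0_iff[OF idems d D Q.inj\<^sub>1_corner P.inj\<^sub>1_corner] reduce ..
  have g: "p\<^sub>1 + r\<^sub>1 \<in> cocycles 0 (P' + Q', ?D) (P + Q, d)"
    unfolding two_term_cocycles_0_iff[OF idems(2,1) D d Q.proj\<^sub>1_corner P.proj\<^sub>1_corner] reduce ..
  have "p\<^sub>1 * k\<^sub>1 = 0" "r\<^sub>1 * i\<^sub>1 = 0" "i\<^sub>1 * r\<^sub>1 = 0" "k\<^sub>1 * p\<^sub>1 = 0"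
    using corner_orthogonal[OF Q.proj\<^sub>1_corner P.inj\<^sub>1_corner PQ'(6)]
      corner_orthogonal[OF P.proj\<^sub>1_corner Q.inj\<^sub>1_corner PQ'(5)]
      corner_orthogonal[OF Q.inj\<^sub>1_corner P.proj\<^sub>1_corner PQ(6)]
      corner_orthogonal[OF P.inj\<^sub>1_corner Q.proj\<^sub>1_corner PQ(5)] by simp_all
  then have left_inverse: "(p\<^sub>1 + r\<^sub>1) * (i\<^sub>1 + k\<^sub>1) = P + Q"
    and "(i\<^sub>1 + k\<^sub>1) * (p\<^sub>1 + r\<^sub>1) - (P' + Q') = - (i\<^sub>2 * p\<^sub>2) - k\<^sub>2 * r\<^sub>2"
    using P.decomposition Q.decomposition
    by (simp_all add: distrib_left distrib_right P.reduce Q.reduce)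
  note this(2)
  also have "- (i\<^sub>2 * p\<^sub>2) - k\<^sub>2 * r\<^sub>2 = ?D * (- (k\<^sub>2 * p\<^sub>2)) + - (k\<^sub>2 * p\<^sub>2) * ?D"
    by (simp only: mult_minus_left mult_minus_right mult.assoc reduce)
      (simp only: mult.assoc[symmetric] reduce diff_conv_add_uminus)
  finally have "(i\<^sub>1 + k\<^sub>1) * (p\<^sub>1 + r\<^sub>1) - (P' + Q') \<in> coboundaries 0 (P' + Q', ?D) (P' + Q', ?D)"
    unfolding two_term_coboundaries_0[OF idems(2,2)]
    using corner_uminus[OF corner_mult[OF P.inj\<^sub>2_corner Q.proj\<^sub>2_corner]] by blast
  then show "tot_equiv (P + Q, d) (P' + Q', ?D)"
    unfolding tot_equiv_def using left_inverse by (intro bexI[OF _ f] bexI[OF _ g]) simp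
qed

lemma split_surjection_stalk:
  assumes idems: "two_term_idems P Q" and d: "d \<in> corner P Q" and c: "c \<in> corner Q P" "d * c = Q"
  defines "w \<equiv> P - c * d"
  shows "in_block (- 1) (- 1) w" "idem_biproduct P w Q w c w d"
    "tot_equiv (w, 0) (P + Q, d :: 'a::ring fin_mat)"
proof -
  note PQ = two_term_idemsD[OF idems] and units = cornerD[OF c(1)] cornerD[OF d]
  have split: "d * (c * y) = Q * y" for y using c(2) by (simp add: mult.assoc[symmetric])
  have assoc: "c * (Q * y) = c * y" "P * (c * y) = c * y" for y
    using units by (simp_all add: mult.assoc[symmetric])
  have "w \<in> corner P P"
    unfolding w_def by (intro cornerI) (simp_all add: algebra_simps units PQ assoc)
  then show block: "in_block (- 1) (- 1) w" by (rule in_block_corner[OF PQ(1,1)])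
  show P: "idem_biproduct P w Q w c w d"
    unfolding w_def by unfold_locales (simp_all add: algebra_simps c(2) units PQ split assoc)
  have "two_term_idems w 0"
    unfolding two_term_idems_def using block idem_biproduct.idem\<^sub>1[OF P] in_block_zero by simp
  moreover have "idem_biproduct Q 0 Q 0 Q 0 Q" by unfold_locales (simp_all add: PQ)
  ultimately have "tot_equiv (w + 0, 0) (P + Q, 0 * 0 * w + Q * d)"
    by (intro add_contractible_summand[OF _ idems _ P] corner_zero)
  then show "tot_equiv (w, 0) (P + Q, d)" using units by simp
qed

context fin_dim_algebra
begin

lemma product_of_target_maps_factors_through:
  assumes idems: "two_term_idems P Q" and d: "d \<in> corner P Q" "d' \<in> corner P Q"
    and X: "Tot X = (P + Q, d)" and Y: "is_complex Y" "Tot Y = (P + Q, d')"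
    and a: "a \<in> vs.product_span (target_maps P Q d' d) (target_maps P Q d d')"
  shows "\<exists>\<rho>\<in>corner P P. ks.factors_through Y X (a + \<rho>)"
  using a vs.subspace_target_maps
proof (induction rule: vs.product_span_induct)
  case zero
  then show ?case using ks.factors_through_zero[OF Y(1)] by (intro bexI[OF _ corner_zero]) simp
next
  case (add a b y)
  obtain \<rho> where \<rho>: "\<rho> \<in> corner P P" "ks.factors_through Y X (y + \<rho>)" using add.IH by blast
  obtain \<alpha> where \<alpha>: "a \<in> corner Q Q" "\<alpha> \<in> corner P P" "a * d' = d * \<alpha>"
    using add.hyps(1) by (rule target_mapsE)
  obtain \<beta> where \<beta>: "b \<in> corner Q Q" "\<beta> \<in> corner P P" "b * d = d' * \<beta>"
    using add.hyps(2) by (rule target_mapsE)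
  have "a + \<alpha> \<in> cocycles 0 (Tot Y) (Tot X)" "b + \<beta> \<in> cocycles 0 (Tot X) (Tot Y)"
    unfolding X Y two_term_cocycles_0_iff[OF idems idems d(2,1) \<alpha>(1,2)]
      two_term_cocycles_0_iff[OF idems idems d \<beta>(1,2)] by fact+
  then have "ks.factors_through Y X ((a + \<alpha>) * (b + \<beta>) + (y + \<rho>))"
    by (intro ks.factors_through_add[OF ks.factors_through_mult[OF Y(1)] \<rho>(2)])
  moreover have "a * \<beta> = 0" "\<alpha> * b = 0"
    using corner_orthogonal[OF \<alpha>(1) \<beta>(2)] corner_orthogonal[OF \<alpha>(2) \<beta>(1)] two_term_idemsD[OF idems]
    by simp_all
  ultimately have "ks.factors_through Y X (a * b + y + (\<alpha> * \<beta> + \<rho>))" by (simp add: algebra_simps)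
  then show ?case using corner_add[OF corner_mult[OF \<alpha>(2) \<beta>(2)] \<rho>(1)] by blast
qed

lemma target_maps_quasi_inverse:
  assumes idems: "two_term_idems P Q" and d: "d \<in> corner P Q" "d' \<in> corner P Q"
    and X: "is_complex X" "Tot X = (P + Q, d)" and Y: "is_complex Y" "Tot Y = (P + Q, d')"
    and disjoint: "set_mset (ks.summands X) \<inter> set_mset (ks.summands Y) = {}"
    and a: "a \<in> vs.product_span (target_maps P Q d' d) (target_maps P Q d d')"
  shows "\<exists>v\<in>target_maps P Q d d. \<exists>c\<in>corner Q P. v * (Q - a) - Q = d * c"
proof -
  note PQ = two_term_idemsD[OF idems]
  obtain \<rho> where \<rho>: "\<rho> \<in> corner P P" "ks.factors_through Y X (a + \<rho>)"
    using product_of_target_maps_factors_through[OF idems d X(2) Y a] by blast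
  obtain v where v: "v \<in> cocycles 0 (P + Q, d) (P + Q, d)"
      "v * (P + Q - (a + \<rho>)) - (P + Q) \<in> coboundaries 0 (P + Q, d) (P + Q, d)"
    using ks.factors_through_quasi_inverse[OF X(1) disjoint \<rho>(2)] unfolding X(2) by auto
  obtain \<phi> \<sigma> where split: "v = \<phi> + \<sigma>" "\<phi> \<in> corner Q Q" "\<sigma> \<in> corner P P" "\<phi> * d = d * \<sigma>"
    using two_term_cocycles_0E[OF idems idems d(1,1) v(1)] .
  obtain h where h: "h \<in> corner Q P" "v * (P + Q - (a + \<rho>)) - (P + Q) = d * h + h * d"
    using v(2) unfolding two_term_coboundaries_0[OF idems idems] by blast
  have "vs.product_span (target_maps P Q d' d) (target_maps P Q d d') \<subseteq> target_maps P Q d d"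
    by (intro vs.product_span_subset vs.subspace_target_maps target_maps_mult)
  then have "a \<in> corner Q Q" using a target_maps_corner by blast
  moreover have unit: "Q \<in> corner Q Q" "P \<in> corner P P" using PQ by (auto intro: cornerI)
  ultimately have diffs: "Q - a \<in> corner Q Q" "P - \<rho> \<in> corner P P"
    using \<rho>(1) by (simp_all add: corner_diff)
  then have "\<phi> * (P - \<rho>) = 0" "\<sigma> * (Q - a) = 0"
    using corner_orthogonal[OF split(2) diffs(2) PQ(6)]
      corner_orthogonal[OF split(3) diffs(1) PQ(5)] by simp_all
  then have "(\<phi> * (Q - a) - Q) + (\<sigma> * (P - \<rho>) - P) = v * (P + Q - (a + \<rho>)) - (P + Q)"
    unfolding split(1) by (simp add: algebra_simps)
  moreover have "\<phi> * (Q - a) - Q \<in> corner Q Q" "\<sigma> * (P - \<rho>) - P \<in> corner P P"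
    by (rule corner_diff[OF corner_mult[OF split(2) diffs(1)] unit(1)],
      rule corner_diff[OF corner_mult[OF split(3) diffs(2)] unit(2)])
  moreover have "d * h \<in> corner Q Q" "h * d \<in> corner P P"
    using corner_mult[OF d(1) h(1)] corner_mult[OF h(1) d(1)] .
  ultimately have "\<phi> * (Q - a) - Q = d * h" using corner_sum_cancel[OF _ _ _ _ PQ(6)] h(2) by metis
  then show ?thesis using target_mapsI[OF split(2,3,4)] h(1) by blast
qed

text \<open>A two-term presilting complex is determined by its terms: two such complexes without common
  summands are split surjections by Nakayama's lemma, and then isomorphic to their kernels.\<close>

lemma ext_orthogonal_equal_terms_zero:
  assumes idems: "two_term_idems P Q" and d: "d \<in> corner P Q" "d' \<in> corner P Q"
    and X: "is_complex X" "Tot X = (P + Q, d)" "ext_orthogonal (Tot X) (Tot X)"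
    and Y: "is_complex Y" "Tot Y = (P + Q, d')" "ext_orthogonal (Tot Y) (Tot Y)"
    and disjoint: "set_mset (ks.summands X) \<inter> set_mset (ks.summands Y) = {}"
  shows "ks.summands X = {#}" "ks.summands Y = {#}"
proof -
  note PQ = two_term_idemsD[OF idems]
  have ext: "ext1_zero P Q d d" "ext1_zero P Q d' d'"
    using two_term_ext1_zero[OF idems d(1,1)] two_term_ext1_zero[OF idems d(2,2)] X(2,3) Y(2,3)
    by simp_all
  have kernel: "\<exists>w V i. stalk (- 1) w V \<and> ks.iso V X \<and> idem_biproduct P w Q w i w d"
    if split: "i \<in> corner Q P" "Q = d * i" and d: "d \<in> corner P Q"
      and X: "is_complex X" "Tot X = (P + Q, d)" for d i and X :: "'a cplx"
  proof -
    note w = split_surjection_stalk[OF idems d split(1) split(2)[symmetric]]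
    obtain V where V: "stalk (- 1) (P - i * d) V"
      using stalk_exists[OF w(1) idem_biproduct.idem\<^sub>1[OF w(2)]] .
    then have "ks.iso V X"
      using w(3) X unfolding iso_iff[symmetric] htpy_equiv_iff stalk_def by simp
    then show ?thesis using V w(2) by blast
  qed
  obtain i where i: "i \<in> corner Q P" "Q = d * i"
    using vs.split_surjection[OF PQ(3,4) d ext target_maps_quasi_inverse[OF idems d
      X(1,2) Y(1,2) disjoint]] .
  obtain i' where i': "i' \<in> corner Q P" "Q = d' * i'"
    using vs.split_surjection[OF PQ(3,4) d(2,1) ext(2,1) target_maps_quasi_inverse[OF idems d(2,1)
      Y(1,2) X(1,2)]] disjoint by blast
  obtain w V j where V: "stalk (- 1) w V" "ks.iso V X" "idem_biproduct P w Q w j w d"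
    using kernel[OF i d(1) X(1,2)] by blast
  obtain w' V' j' where V': "stalk (- 1) w' V'" "ks.iso V' Y" "idem_biproduct P w' Q w' j' w' d'"
    using kernel[OF i' d(2) Y(1,2)] by blast
  note w = stalkD(3)[OF V(1)] idem_biproduct.idem\<^sub>1[OF V(3)]
    and w' = stalkD(3)[OF V'(1)] idem_biproduct.idem\<^sub>1[OF V'(3)]
  have "proj_summands w = proj_summands w'"
    using proj_summands_biproduct[OF w PQ(2,4) V(3)] proj_summands_biproduct[OF w' PQ(2,4) V'(3)]
    by simp
  then have "ks.summands V = ks.summands V'"
    unfolding stalk_summands_eq_iff[OF V(1) V'(1)] proj_summands_eq_iff[OF w w'] .
  then have "ks.summands X = ks.summands Y"
    using ks.summands_iso[OF V(2)] ks.summands_iso[OF V'(2)] by simp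
  then show "ks.summands X = {#}" "ks.summands Y = {#}" using disjoint by simp_all
qed

end

subsection \<open>Terms of two-term complexes\<close>

lemma in_block_conjugate:
  assumes "homogeneous 0 i" "homogeneous 0 p" "in_block s s y"
  shows "in_block s s (i * y * p :: 'a::ring fin_mat)"
  using in_block_mult_homogeneous[OF homogeneous_mult_in_block[OF assms(1,3)] assms(2)] by simp

context fin_dim_algebra
begin

lemma in_block_biproduct_exists:
  fixes P Q :: "'a fin_mat"
  assumes "in_block s s P" "P * P = P" "in_block t t Q" "Q * Q = Q"
  obtains B i\<^sub>1 i\<^sub>2 p\<^sub>1 p\<^sub>2 where "in_block r r B" "B * B = B" "idem_biproduct B P Q i\<^sub>1 i\<^sub>2 p\<^sub>1 p\<^sub>2"
proof -
  obtain X where X: "stalk s P X" using stalk_exists[OF assms(1,2)] .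
  obtain P' u u' where P': "stalk (s - (s - r)) P' (shift (s - r) X)" "idem_iso P P' u u'"
    by (rule stalk_shift[OF X])
  obtain Y where Y: "stalk t Q Y" using stalk_exists[OF assms(3,4)] .
  obtain Q' v v' where Q': "stalk (t - (t - r)) Q' (shift (t - r) Y)" "idem_iso Q Q' v v'"
    by (rule stalk_shift[OF Y])
  have "stalk r P' (shift (s - r) X)" "stalk r Q' (shift (t - r) Y)" using P'(1) Q'(1) by simp_all
  then obtain B j\<^sub>1 j\<^sub>2 q\<^sub>1 q\<^sub>2 where B: "stalk r B (shift (s - r) X \<oplus>\<^sub>K shift (t - r) Y)"
    "idem_biproduct B P' Q' j\<^sub>1 j\<^sub>2 q\<^sub>1 q\<^sub>2"
    by (rule stalk_dsum)
  show thesis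
    by (rule that[OF stalkD(3)[OF B(1)] idem_biproduct.idem[OF B(2)]
      idem_biproduct_iso_summands[OF B(2) P'(2) Q'(2)]])
qed

definition has_terms :: "'a cplx \<Rightarrow> 'a cplx set multiset \<Rightarrow> 'a cplx set multiset \<Rightarrow> bool" where
  "has_terms X A B \<longleftrightarrow> is_complex X \<and>
     (\<exists>P Q. two_term_idems P Q \<and> idem (Tot X) = P + Q \<and> proj_summands Q = A \<and> proj_summands P = B)"

lemma has_termsE:
  assumes "has_terms X A B"
  obtains P Q d where "is_complex X" "two_term_idems P Q" "d \<in> corner P Q" "Tot X = (P + Q, d)"
    "proj_summands Q = A" "proj_summands P = B"
proof -
  obtain P Q where X: "is_complex X" and PQ: "two_term_idems P Q" and Tot: "idem (Tot X) = P + Q"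
    and terms: "proj_summands Q = A" "proj_summands P = B"
      using assms unfolding has_terms_def by blast
  interpret X: tot_complex "Tot X" by (rule tot_complex_Tot[OF X])
  have Tot_X: "Tot X = (P + Q, diff (Tot X))" using Tot by (simp add: prod_eq_iff)
  have "diff (Tot X) \<in> graded_hom 1 (Tot X) (Tot X)"
    by (intro graded_homI X.homogeneous_diff X.reduce)
  then have "diff (Tot X) \<in> corner P Q"
    using two_term_graded_hom(2)[OF PQ PQ, of "diff (Tot X)" "diff (Tot X)"] Tot_X by simp
  then show thesis using that X PQ Tot_X terms by blast
qed

lemma has_terms_exists: assumes "two_term X" shows "\<exists>A B. has_terms X A B"
proof -
  have X: "is_complex X" "two_term_tot (Tot X)" using assms unfolding two_term_iff by blast+
  interpret X: tot_complex "Tot X" by (rule tot_complex_Tot[OF X(1)])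
  let ?part = "\<lambda>t x. in_block t t x \<and> x * x = x \<and>
    (\<forall>i a j b. entry x (Index i a) (Index j b) = (if i = t then entry (idem (Tot X)) (Index i a)
      (Index j b) else 0))"
  have part: "\<exists>x. ?part t x" for t
    by (rule idempotent_block_part[OF X.homogeneous_idem X.idem_idem, where t = t]) blast
  obtain P where P: "?part (- 1) P" using part by blast
  obtain Q where Q: "?part 0 Q" using part by blast
  have "idem (Tot X) = P + Q"
  proof (rule fin_mat_eqI)
    fix i a j b
    show "entry (idem (Tot X)) (Index i a) (Index j b) = entry (P + Q) (Index i a) (Index j b)"
      using two_term_totD[OF X(2), of i a "Index j b"] P Q by (cases "i \<in> {-1, 0}") auto
  qed
  moreover have "two_term_idems P Q" unfolding two_term_idems_def using P Q by blast
  ultimately show ?thesis unfolding has_terms_def using X(1) by blast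
qed

lemma has_terms_subset_alg:
  assumes "has_terms X A B"
  shows "set_mset A \<subseteq> set_mset (ks.summands alg_cplx)"
    "set_mset B \<subseteq> set_mset (ks.summands alg_cplx)"
  using assms proj_summands_subset_alg unfolding has_terms_def two_term_idems_def by blast+

lemma has_terms_zero: "has_terms zero_cplx {#} {#}"
  unfolding has_terms_def two_term_idems_def
  by (intro conjI exI[of _ 0]) (simp_all add: zero_cplx_Tot proj_summands_zero in_block_zero)

lemma has_terms_dsum:
  assumes "has_terms X A B" "has_terms Y A' B'" shows "has_terms (X \<oplus>\<^sub>K Y) (A + A') (B + B')"
proof -
  obtain P Q d where X: "is_complex X" "two_term_idems P Q" "d \<in> corner P Q" "Tot X = (P + Q, d)"
    "proj_summands Q = A" "proj_summands P = B"
    using assms(1) by (rule has_termsE)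
  obtain P' Q' d' where Y: "is_complex Y" "two_term_idems P' Q'" "d' \<in> corner P' Q'"
    "Tot Y = (P' + Q', d')" "proj_summands Q' = A'" "proj_summands P' = B'"
    using assms(2) by (rule has_termsE)
  obtain i\<^sub>1 i\<^sub>2 p\<^sub>1 p\<^sub>2 where "twisted_sum 0 (Tot (X \<oplus>\<^sub>K Y)) (P + Q, d) (P' + Q', d') 0 i\<^sub>1 i\<^sub>2 p\<^sub>1 p\<^sub>2"
    using dsum_twisted_sum(2)[OF X(1) Y(1)] unfolding X(4) Y(4) by blast
  then interpret sum: twisted_sum 0 "Tot (X \<oplus>\<^sub>K Y)" "(P + Q, d)" "(P' + Q', d')" 0 i\<^sub>1 i\<^sub>2 p\<^sub>1 p\<^sub>2 .
  note PQ = two_term_idemsD[OF X(2)] and PQ' = two_term_idemsD[OF Y(2)]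
  have corners: "P \<in> corner (P + Q) (P + Q)" "Q \<in> corner (P + Q) (P + Q)"
    "P' \<in> corner (P' + Q') (P' + Q')" "Q' \<in> corner (P' + Q') (P' + Q')"
    by (auto intro!: cornerI simp: distrib_left distrib_right PQ PQ')
  let ?P = "i\<^sub>1 * P * p\<^sub>1 + i\<^sub>2 * P' * p\<^sub>2" and ?Q = "i\<^sub>1 * Q * p\<^sub>1 + i\<^sub>2 * Q' * p\<^sub>2"
  note restrict = idem_biproduct_restrict[OF sum.idem_biproduct_axioms, unfolded fst_conv]
  note biprod_P = restrict[OF corners(1) PQ(3) corners(3) PQ'(3)]
    and biprod_Q = restrict[OF corners(2) PQ(4) corners(4) PQ'(4)]
  have "in_block s s (i\<^sub>1 * y * p\<^sub>1 + i\<^sub>2 * z * p\<^sub>2)" if "in_block s s y" "in_block s s z" for s y z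
    using sum.homogeneous_inj\<^sub>1 sum.homogeneous_inj\<^sub>2 sum.homogeneous_proj\<^sub>1 sum.homogeneous_proj\<^sub>2 that
    by (intro in_block_add in_block_conjugate) simp_all
  then have "two_term_idems ?P ?Q"
    unfolding two_term_idems_def using PQ PQ' idem_biproduct.idem[OF biprod_P]
      idem_biproduct.idem[OF biprod_Q] by blast
  moreover have "idem (Tot (X \<oplus>\<^sub>K Y)) = i\<^sub>1 * (P + Q) * p\<^sub>1 + i\<^sub>2 * (P' + Q') * p\<^sub>2"
    using sum.decomposition sum.inj\<^sub>1_unit sum.inj\<^sub>2_unit by simp
  then have "idem (Tot (X \<oplus>\<^sub>K Y)) = ?P + ?Q" by (simp add: distrib_left distrib_right algebra_simps)
  moreover have "proj_summands ?Q = A + A'" "proj_summands ?P = B + B'"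
    using proj_summands_biproduct[OF PQ(2,4) PQ'(2,4) biprod_Q]
      proj_summands_biproduct[OF PQ(1,3) PQ'(1,3) biprod_P] X(5,6) Y(5,6) by simp_all
  ultimately show ?thesis unfolding has_terms_def using is_complex_dsum[OF X(1) Y(1)] by blast
qed

lemma has_terms_multiset:
  assumes "\<And>c. c \<in> C \<Longrightarrow> ks.summands (T c) = {#c#} \<and> has_terms (T c) (A c) (B c)"
  shows "set_mset M \<subseteq> C \<Longrightarrow> \<exists>X. ks.summands X = M \<and> has_terms X (\<Sum>c\<in>#M. A c) (\<Sum>c\<in>#M. B c)"
proof (induction M)
  case empty
  show ?case using ks.summands_zero_obj has_terms_zero by (intro exI[of _ zero_cplx]) simp
next
  case (add c M)
  then obtain X where X: "ks.summands X = M" "has_terms X (\<Sum>c\<in>#M. A c) (\<Sum>c\<in>#M. B c)" by auto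
  have T: "ks.summands (T c) = {#c#}" "has_terms (T c) (A c) (B c)"
    using assms[of c] add.prems by auto
  have "ks.summands (T c \<oplus>\<^sub>K X) = {#c#} + M"
    using ks.summands_biprod[of "T c" X] T X unfolding has_terms_def by simp
  then show ?case using has_terms_dsum[OF T(2) X(2)] by (intro exI[of _ "T c \<oplus>\<^sub>K X"]) simp
qed

text \<open>Complexes with the same class in the Grothendieck group become maps between the same two
  projectives after adding contractible summands.\<close>

lemma enlarge_terms:
  assumes X: "is_complex X" "Tot X = (P + Q, d)" and idems: "two_term_idems P Q"
    "two_term_idems P' Q'" and d: "d \<in> corner P Q"
    and biprods: "idem_biproduct P' P R k\<^sub>1 k\<^sub>2 r\<^sub>1 r\<^sub>2" "idem_biproduct Q' Q R i\<^sub>1 i\<^sub>2 p\<^sub>1 p\<^sub>2"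
  obtains V d' where "is_complex V" "d' \<in> corner P' Q'" "Tot V = (P' + Q', d')" "ks.iso X V"
proof -
  note contractible = add_contractible_summand[OF idems d biprods]
  obtain V where V: "is_complex V" "Tot V = (P' + Q', i\<^sub>1 * d * r\<^sub>1 + i\<^sub>2 * r\<^sub>2)"
    using Tot_surj[OF two_term_idems_tot_complex(1)[OF idems(2) contractible(1)]] .
  then have "ks.iso X V" using contractible(2) X unfolding iso_iff[symmetric] htpy_equiv_iff by simp
  then show thesis using that V contractible(1) by blast
qed

lemma ext_orthogonal_same_class_zero:
  assumes X: "has_terms X A B" "ext_orthogonal (Tot X) (Tot X)"
    and Y: "has_terms Y A' B'" "ext_orthogonal (Tot Y) (Tot Y)"
    and same_class: "A + B' = A' + B"
    and disjoint: "set_mset (ks.summands X) \<inter> set_mset (ks.summands Y) = {}"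
  shows "ks.summands X = {#}" "ks.summands Y = {#}"
proof -
  obtain P Q d where x: "is_complex X" "two_term_idems P Q" "d \<in> corner P Q" "Tot X = (P + Q, d)"
    "proj_summands Q = A" "proj_summands P = B"
    using X(1) by (rule has_termsE)
  obtain P' Q' d' where y: "is_complex Y" "two_term_idems P' Q'" "d' \<in> corner P' Q'"
    "Tot Y = (P' + Q', d')" "proj_summands Q' = A'" "proj_summands P' = B'"
    using Y(1) by (rule has_termsE)
  note PQ = two_term_idemsD[OF x(2)] and PQ' = two_term_idemsD[OF y(2)]
  obtain p k\<^sub>1 k\<^sub>2 r\<^sub>1 r\<^sub>2 where p: "in_block (- 1) (- 1) p" "p * p = p"
    "idem_biproduct p P P' k\<^sub>1 k\<^sub>2 r\<^sub>1 r\<^sub>2"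
    using in_block_biproduct_exists[OF PQ(1,3) PQ'(1,3)] .
  obtain q i\<^sub>1 i\<^sub>2 p\<^sub>1 p\<^sub>2 where q: "in_block 0 0 q" "q * q = q" "idem_biproduct q Q P' i\<^sub>1 i\<^sub>2 p\<^sub>1 p\<^sub>2"
    using in_block_biproduct_exists[OF PQ(2,4) PQ'(1,3)] .
  obtain q' j\<^sub>1 j\<^sub>2 s\<^sub>1 s\<^sub>2 where q': "in_block 0 0 q'" "q' * q' = q'"
    "idem_biproduct q' Q' P j\<^sub>1 j\<^sub>2 s\<^sub>1 s\<^sub>2"
    using in_block_biproduct_exists[OF PQ'(2,4) PQ(1,3)] .
  have "proj_summands q' = proj_summands q"
    using proj_summands_biproduct[OF PQ(2,4) PQ'(1,3) q(3)]
      proj_summands_biproduct[OF PQ'(2,4) PQ(1,3) q'(3)] x(5,6) y(5,6) same_class by simp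
  then obtain u u' where u: "idem_iso q' q u u'"
    using proj_summands_eq_iff[OF q'(1,2) q(1,2)] by blast
  have idems: "two_term_idems p q" unfolding two_term_idems_def using p q by blast
  obtain V a where V: "is_complex V" "a \<in> corner p q" "Tot V = (p + q, a)" "ks.iso X V"
    using enlarge_terms[OF x(1,4,2) idems x(3) p(3) q(3)] .
  obtain W b where W: "is_complex W" "b \<in> corner p q" "Tot W = (p + q, b)" "ks.iso Y W"
    using enlarge_terms[OF y(1,4,2) idems y(3) idem_biproduct_swap[OF p(3)]
      idem_biproduct_iso_whole[OF q'(3) u]] .
  have summands: "ks.summands V = ks.summands X" "ks.summands W = ks.summands Y"
    using ks.summands_iso[OF V(4)] ks.summands_iso[OF W(4)] by simp_all
  have "set_mset (ks.summands V) \<inter> set_mset (ks.summands W) = {}"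
    using disjoint unfolding summands .
  from ext_orthogonal_equal_terms_zero[OF idems V(2) W(2) V(1,3) ext_orthogonal_iso[OF V(4,4) X(2)]
      W(1,3) ext_orthogonal_iso[OF W(4,4) Y(2)] this]
  show "ks.summands X = {#}" "ks.summands Y = {#}" unfolding summands .
qed

end

subsection \<open>The dimension of a face\<close>

lemma integer_relation:
  fixes v :: "'c \<Rightarrow> 's \<Rightarrow> int"
  assumes "finite S" "finite C" "card S < card C"
  shows "\<exists>a. (\<exists>c\<in>C. a c \<noteq> 0) \<and> (\<forall>s\<in>S. (\<Sum>c\<in>C. a c * v c s) = 0)"
  using assms
proof (induction S arbitrary: C v rule: finite_induct)
  case empty
  then have "C \<noteq> {}" by auto
  then show ?case by (intro exI[of _ "\<lambda>_. 1"]) auto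
next
  case (insert s S)
  show ?case
  proof (cases "\<forall>c\<in>C. v c s = 0")
    case True
    then show ?thesis using insert.IH[of C v] insert.hyps insert.prems by auto
  next
    case False
    then obtain e where e: "e \<in> C" "v e s \<noteq> 0" by blast
    define D where "D = C - {e}"
    have D: "finite D" "card S < card D" "C = insert e D" "e \<notin> D"
      unfolding D_def using e(1) insert.prems insert.hyps by auto
    let ?v = "\<lambda>c t. v e s * v c t - v c s * v e t"
    obtain a where a: "\<exists>c\<in>D. a c \<noteq> 0" "\<forall>t\<in>S. (\<Sum>c\<in>D. a c * ?v c t) = 0"
      using insert.IH[OF D(1,2), of ?v] by blast
    let ?b = "\<lambda>c. if c = e then - (\<Sum>c\<in>D. a c * v c s) else v e s * a c"
    have "(\<Sum>c\<in>C. ?b c * v c t) = (\<Sum>c\<in>D. a c * ?v c t)" for t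
    proof -
      have "(\<Sum>c\<in>D. ?b c * v c t) = (\<Sum>c\<in>D. v e s * a c * v c t)" using D(4) by (intro sum.cong) auto
      then show ?thesis
        unfolding D(3) using D(1,4) by (simp add: sum_distrib_left sum_subtractf algebra_simps)
    qed
    moreover have "?v c s = 0" for c by simp
    moreover have "\<exists>c\<in>C. ?b c \<noteq> 0" using a(1) e(2) D(3,4) by auto
    ultimately show ?thesis using a(2) by (intro exI[of _ ?b]) simp
  qed
qed

lemma count_sum_replicate_mset:
  assumes "finite C"
  shows "count (\<Sum>x\<in>#(\<Sum>c\<in>C. replicate_mset (n c) c). f x) s = (\<Sum>c\<in>C. n c * count (f c) s)"
proof -
  have replicate: "count (\<Sum>x\<in>#replicate_mset k c. f x) s = k * count (f c) s" for k c
    by (induction k) simp_all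
  show ?thesis
    using assms by (induction C rule: finite_induct)
      (simp_all add: replicate del: image_replicate_mset)
qed

lemma multiset_relation_of_integers:
  fixes A B :: "'c \<Rightarrow> 's multiset" and a :: "'c \<Rightarrow> int"
  assumes C: "finite C" and support: "\<And>c. c \<in> C \<Longrightarrow> set_mset (A c) \<subseteq> S \<and> set_mset (B c) \<subseteq> S"
    and a: "\<forall>s\<in>S. (\<Sum>c\<in>C. a c * (int (count (A c) s) - int (count (B c) s))) = 0"
  defines "M \<equiv> \<Sum>c\<in>C. replicate_mset (nat (a c)) c" and "N \<equiv> \<Sum>c\<in>C. replicate_mset (nat (- a c)) c"
  shows "(\<Sum>c\<in>#M. A c) + (\<Sum>c\<in>#N. B c) = (\<Sum>c\<in>#N. A c) + (\<Sum>c\<in>#M. B c)" (is "?L = ?R")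
proof (rule multiset_eqI)
  fix s
  note counts = count_sum_replicate_mset[OF C]
  show "count ?L s = count ?R s"
  proof (cases "s \<in> S")
    case True
    have "int (count ?L s) - int (count ?R s) =
        (\<Sum>c\<in>C. (int (nat (a c)) - int (nat (- a c))) * (int (count (A c) s) - int (count (B c) s)))"
      by (simp add: M_def N_def counts sum.distrib[symmetric] sum_subtractf[symmetric] algebra_simps)
    also have "\<dots> = (\<Sum>c\<in>C. a c * (int (count (A c) s) - int (count (B c) s)))"
      by (intro sum.cong) auto
    also have "\<dots> = 0" using a True by blast
    finally show ?thesis by simp
  next
    case False
    then have "count (A c) s = 0" "count (B c) s = 0" if "c \<in> C" for c
      using support[OF that] by (meson count_inI subset_iff)+
    then show ?thesis by (simp add: M_def N_def counts)
  qed
qed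

lemma multiset_relation:
  fixes A B :: "'c \<Rightarrow> 's multiset"
  assumes fin: "finite S" "finite C" "card S < card C"
    and support: "\<And>c. c \<in> C \<Longrightarrow> set_mset (A c) \<subseteq> S \<and> set_mset (B c) \<subseteq> S"
  obtains M N where "set_mset M \<subseteq> C" "set_mset N \<subseteq> C" "set_mset M \<inter> set_mset N = {}" "M + N \<noteq> {#}"
    "(\<Sum>c\<in>#M. A c) + (\<Sum>c\<in>#N. B c) = (\<Sum>c\<in>#N. A c) + (\<Sum>c\<in>#M. B c)"
proof -
  obtain a :: "'c \<Rightarrow> int" where a: "\<exists>c\<in>C. a c \<noteq> 0"
    "\<forall>s\<in>S. (\<Sum>c\<in>C. a c * (int (count (A c) s) - int (count (B c) s))) = 0"
    using integer_relation[OF fin, of "\<lambda>c s. int (count (A c) s) - int (count (B c) s)"] by blast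
  let ?M = "\<Sum>c\<in>C. replicate_mset (nat (a c)) c" and ?N = "\<Sum>c\<in>C. replicate_mset (nat (- a c)) c"
  have "count ?M c = (if c \<in> C then nat (a c) else 0)"
    "count ?N c = (if c \<in> C then nat (- a c) else 0)" for c
    unfolding count_sum using fin(2) by auto
  note counts = this
  have members: "set_mset ?M = {c \<in> C. a c > 0}" "set_mset ?N = {c \<in> C. a c < 0}"
    by (simp_all only: set_mset_def counts) auto
  have "(\<Sum>c\<in>#?M. A c) + (\<Sum>c\<in>#?N. B c) = (\<Sum>c\<in>#?N. A c) + (\<Sum>c\<in>#?M. B c)"
    by (rule multiset_relation_of_integers[OF fin(2) support a(2)])
  moreover have "?M + ?N \<noteq> {#}"
  proof -
    have "set_mset (?M + ?N) \<noteq> {}" using a(1) unfolding set_mset_union members by fastforce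
    then show ?thesis by auto
  qed
  moreover have "set_mset ?M \<subseteq> C" "set_mset ?N \<subseteq> C" "set_mset ?M \<inter> set_mset ?N = {}"
    unfolding members by auto
  ultimately show thesis by (intro that[of ?M ?N])
qed

context fin_dim_algebra
begin

lemma face_member_terms:
  assumes "face C" "c \<in> C" shows "\<exists>T A B. ks.summands T = {#c#} \<and> has_terms T A B"
proof -
  obtain Y where Y: "ks.indec Y" "c = ks.iso_class_of Y" and "two_term_class c"
    using assms unfolding face_def by blast
  then obtain T where T: "two_term T" "ks.iso T Y" unfolding two_term_class_iff Y(2) by blast
  then have "ks.summands T = {#c#}"
    using ks.summands_iso[OF T(2)] ks.summands_indec[OF Y(1)] Y(2) by simp
  then show ?thesis using has_terms_exists[OF T(1)] by blast
qed

lemma face_terms: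
  assumes "face C"
  obtains T A B where "\<And>c. c \<in> C \<Longrightarrow> ks.summands (T c) = {#c#} \<and> has_terms (T c) (A c) (B c)"
proof -
  have "\<forall>c\<in>C. \<exists>T A B. ks.summands T = {#c#} \<and> has_terms T A B"
    by (rule ballI, rule face_member_terms[OF assms])
  from bchoice[OF this] obtain T where "\<forall>c\<in>C. \<exists>A B. ks.summands (T c) = {#c#} \<and>
      has_terms (T c) A B" ..
  from bchoice[OF this] obtain A where "\<forall>c\<in>C. \<exists>B. ks.summands (T c) = {#c#} \<and>
      has_terms (T c) (A c) B" ..
  from bchoice[OF this] obtain B where "\<forall>c\<in>C. ks.summands (T c) = {#c#} \<and>
      has_terms (T c) (A c) (B c)" ..
  then show thesis by (intro that) (rule bspec)
qed

lemma face_ext_orthogonal: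
  assumes "face C" "is_complex X" "set_mset (ks.summands X) \<subseteq> C"
  shows "ext_orthogonal (Tot X) (Tot X)"
  unfolding ext_orthogonal_iff_summands[OF assms(2,2)] using assms(1,3) unfolding face_def by blast

lemma face_card:
  assumes face: "face C" shows "card C \<le> num_summands (alg_cplx :: 'a cplx)"
proof (rule ccontr)
  let ?S = "set_mset (ks.summands (alg_cplx :: 'a cplx))"
  assume "\<not> card C \<le> num_summands (alg_cplx :: 'a cplx)"
  then have less: "card ?S < card C" using num_summands_eq[OF alg_cplx_Tot(1)] by simp
  obtain T A B where terms: "\<And>c. c \<in> C \<Longrightarrow> ks.summands (T c) = {#c#} \<and> has_terms (T c) (A c) (B c)"
    by (rule face_terms[OF face]) (rule that)
  have support: "set_mset (A c) \<subseteq> ?S \<and> set_mset (B c) \<subseteq> ?S" if "c \<in> C" for c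
    using has_terms_subset_alg terms[OF that] by blast
  have "finite C" using face unfolding face_def by blast
  then obtain M N where MN: "set_mset M \<subseteq> C" "set_mset N \<subseteq> C"
    and disjoint: "set_mset M \<inter> set_mset N = {}" and nonempty: "M + N \<noteq> {#}"
    and relation: "(\<Sum>c\<in>#M. A c) + (\<Sum>c\<in>#N. B c) = (\<Sum>c\<in>#N. A c) + (\<Sum>c\<in>#M. B c)"
    by (rule multiset_relation[OF finite_set_mset _ less support])
  obtain X where X: "ks.summands X = M" "has_terms X (\<Sum>c\<in>#M. A c) (\<Sum>c\<in>#M. B c)"
    using has_terms_multiset[OF terms MN(1)] by blast
  obtain Y where Y: "ks.summands Y = N" "has_terms Y (\<Sum>c\<in>#N. A c) (\<Sum>c\<in>#N. B c)"
    using has_terms_multiset[OF terms MN(2)] by blast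
  have "is_complex X" "is_complex Y" using X(2) Y(2) unfolding has_terms_def by blast+
  then have "ext_orthogonal (Tot X) (Tot X)" "ext_orthogonal (Tot Y) (Tot Y)"
    using face_ext_orthogonal[OF face] X(1) Y(1) MN by simp_all
  from ext_orthogonal_same_class_zero[OF X(2) this(1) Y(2) this(2) relation]
    have "M = {#}" "N = {#}"
    using disjoint unfolding X(1) Y(1) by blast+
  then show False using nonempty by simp
qed

end

section \<open>Counting\<close>

lemma multisets_of_support_Suc:
  assumes "s \<in> S"
  shows "{M. set_mset M = S \<and> size M \<le> Suc l} =
    add_mset s ` ({M. set_mset M = S \<and> size M \<le> l} \<union> {M. set_mset M = S - {s} \<and> size M \<le>
      l})" (is "?A = add_mset s ` ?B")
proof (intro equalityI subsetI)
  fix M assume M: "M \<in> ?A"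
  then have "s \<in># M" using assms by simp
  then obtain K where K: "M = add_mset s K" by (rule mset_add)
  then have "set_mset K = S \<or> set_mset K = S - {s}" "size K \<le> l" using M by auto
  then show "M \<in> add_mset s ` ?B" unfolding K by blast
next
  fix M assume "M \<in> add_mset s ` ?B"
  then obtain K where "M = add_mset s K" "set_mset K = S \<or> set_mset K = S - {s}" "size K \<le> l"
    by blast
  then show "M \<in> ?A" using assms by auto
qed

lemma multisets_of_support:
  assumes "finite S"
  shows "finite {M. set_mset M = S \<and> size M \<le> l} \<and>
      card {M. set_mset M = S \<and> size M \<le> l} = l choose card S"
  using assms
proof (induction l arbitrary: S)
  case 0
  have "{M. set_mset M = S \<and> size M \<le> 0} = (if S = {} then {{#}} else {})" by auto
  then show ?case using 0 by (auto simp: card_gt_0_iff)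
next
  case (Suc l)
  show ?case
  proof (cases "S = {}")
    case True
    then have "{M. set_mset M = S \<and> size M \<le> Suc l} = {{#}}" by auto
    then show ?thesis using True by simp
  next
    case False
    then obtain s where s: "s \<in> S" by blast
    let ?F = "\<lambda>S. {M. set_mset M = S \<and> size M \<le> l}"
    have "S \<noteq> S - {s}" using s by blast
    then have "?F S \<inter> ?F (S - {s}) = {}" unfolding disjoint_iff mem_Collect_eq by metis
    moreover have "inj_on (add_mset s) (?F S \<union> ?F (S - {s}))"
      by (rule inj_onI) (rule add_mset_add_mset_same_iff[THEN iffD1])
    moreover have "card S = Suc (card (S - {s}))" by (rule card.remove[OF Suc.prems s])
    ultimately show ?thesis
      unfolding multisets_of_support_Suc[OF s]
      using Suc.IH[OF Suc.prems] Suc.IH[of "S - {s}"] Suc.prems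
      by (simp add: card_image card_Un_disjoint)
  qed
qed

lemma alternating_binomial_Suc:
  fixes g :: "nat \<Rightarrow> int"
  shows "(\<Sum>k\<le>Suc m. (-1) ^ k * int (Suc m choose k) * g k) =
    (\<Sum>k\<le>m. (-1) ^ k * int (m choose k) * (g k - g (Suc k)))"
proof -
  let ?b = "\<lambda>k. (-1) ^ k * int (m choose k)"
  have "(\<Sum>k\<le>m. ?b k * g k) = (\<Sum>k\<le>Suc m. ?b k * g k)" by simp
  then have shifted: "(\<Sum>k\<le>m. ?b k * g k) = g 0 + (\<Sum>k\<le>m. ?b (Suc k) * g (Suc k))"
    by (simp only: sum.atMost_Suc_shift) simp
  have "(\<Sum>k\<le>Suc m. (-1) ^ k * int (Suc m choose k) * g k) =
    g 0 + (\<Sum>k\<le>m. (-1) ^ Suc k * int (Suc m choose Suc k) * g (Suc k))"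
    by (simp only: sum.atMost_Suc_shift) simp
  also have "(\<Sum>k\<le>m. (-1) ^ Suc k * int (Suc m choose Suc k) * g (Suc k)) =
      (\<Sum>k\<le>m. ?b (Suc k) * g (Suc k) - ?b k * g (Suc k))"
    by (intro sum.cong) (auto simp: algebra_simps)
  also have "g 0 + \<dots> = (\<Sum>k\<le>m. ?b k * g k) - (\<Sum>k\<le>m. ?b k * g (Suc k))"
    unfolding shifted sum_subtractf by simp
  also have "\<dots> = (\<Sum>k\<le>m. ?b k * (g k - g (Suc k)))"
    by (simp add: sum_subtractf[symmetric] right_diff_distrib)
  finally show ?thesis .
qed

lemma alternating_binomial_sum:
  "(\<Sum>k\<le>m. (-1) ^ k * int (m choose k) * int ((N + m - k) choose (r + m))) = int (N choose r)"
proof (induction m)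
  case (Suc m)
  have "(\<Sum>k\<le>Suc m. (-1) ^ k * int (Suc m choose k) * int ((N + Suc m - k) choose (r + Suc m))) =
    (\<Sum>k\<le>m. (-1) ^ k * int (m choose k) *
      (int ((N + Suc m - k) choose (r + Suc m)) - int ((N + Suc m - Suc k) choose (r + Suc m))))"
    by (rule alternating_binomial_Suc)
  also have "\<dots> = (\<Sum>k\<le>m. (-1) ^ k * int (m choose k) * int ((N + m - k) choose (r + m)))"
    by (intro sum.cong) (auto simp: Suc_diff_le)
  finally show ?case using Suc by simp
qed simp

lemma h_vector_transform:
  fixes f :: "nat \<Rightarrow> int"
  shows "(\<Sum>j = 0..n. int ((n + l - j) choose n) *
      (\<Sum>i = 0..j. (-1) ^ (j - i) * int ((n - i) choose (j - i)) * f i)) =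
    (\<Sum>i = 0..n. int (l choose i) * f i)"
proof -
  let ?t = "\<lambda>j i. int ((n + l - j) choose n) *
    ((-1) ^ (j - i) * int ((n - i) choose (j - i)) * f i)"
  have "(\<Sum>j = 0..n. int ((n + l - j) choose n) *
      (\<Sum>i = 0..j. (-1) ^ (j - i) * int ((n - i) choose (j - i)) * f i)) =
    (\<Sum>j = 0..n. \<Sum>i | i \<in> {0..n} \<and> i \<le> j. ?t j i)"
    unfolding sum_distrib_left by (intro sum.cong) auto
  also have "\<dots> = (\<Sum>i = 0..n. \<Sum>j | j \<in> {0..n} \<and> i \<le> j. ?t j i)" by (rule sum.swap_restrict) simp_all
  also have "\<dots> = (\<Sum>i = 0..n. int (l choose i) * f i)"
  proof (intro sum.cong refl)
    fix i assume "i \<in> {0..n}"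
    then obtain m where m: "n = i + m" using le_Suc_ex by auto
    then have "{j. j \<in> {0..n} \<and> i \<le> j} = {0 + i..m + i}" by auto
    then have "(\<Sum>j | j \<in> {0..n} \<and> i \<le> j. ?t j i) = (\<Sum>k = 0..m. ?t (k + i) i)"
      by (simp only: sum.shift_bounds_cl_nat_ivl)
    also have "\<dots> = (\<Sum>k\<le>m. (-1) ^ k * int (m choose k) * int ((l + m - k) choose (i + m))) * f i"
      unfolding sum_distrib_right atMost_atLeast0 by (intro sum.cong) (auto simp: m algebra_simps)
    also have "\<dots> = int (l choose i) * f i" by (simp only: alternating_binomial_sum)
    finally show "(\<Sum>j | j \<in> {0..n} \<and> i \<le> j. ?t j i) = int (l choose i) * f i" .
  qed
  finally show ?thesis .
qed

context fin_dim_algebra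
begin

lemma card_iso_classes:
  assumes "\<And>X. X \<in> S \<Longrightarrow> is_complex X" shows "card (iso_class ` S) = card (ks.summands ` S)"
proof -
  obtain h where "bij_betw h (iso_class ` S) (ks.summands ` S)"
    using iso_classes_bij_betw_summands[OF assms] .
  then show ?thesis by (rule bij_betw_same_card)
qed

lemma basic_summands:
  assumes "is_complex X" shows "basic X \<longleftrightarrow> ks.summands X = mset_set (set_mset (ks.summands X))"
proof
  assume "basic X"
  show "ks.summands X = mset_set (set_mset (ks.summands X))"
  proof (rule multiset_eqI)
    fix c
    have at_most_1: "count (ks.summands X) c \<le> 1" using \<open>basic X\<close> unfolding basic_iff by blast
    have "count (ks.summands X) c = 1" if "c \<in># ks.summands X"
      by (rule antisym[OF at_most_1]) (use that in simp)
    then show "count (ks.summands X) c = count (mset_set (set_mset (ks.summands X))) c"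
      by (simp add: count_mset_set' not_in_iff)
  qed
next
  assume "ks.summands X = mset_set (set_mset (ks.summands X))"
  then have "count (ks.summands X) c \<le> 1" for c by (metis count_mset_set' le_refl zero_le_one)
  then show "basic X" unfolding basic_iff using assms by blast
qed

lemma psilt_count_eq: "psilt_count TYPE('a) j = card {C. face C \<and> card C = j}"
proof -
  let ?S = "{T :: 'a cplx. two_term T \<and> presilting T \<and> basic T \<and> num_summands T = j}"
  let ?F = "{C. face C \<and> card C = j}"
  have "ks.summands ` ?S = mset_set ` ?F"
  proof (intro equalityI subsetI; elim imageE)
    fix M T assume "M = ks.summands T" "T \<in> ?S"
    then have T: "M = ks.summands T" "two_term T" "presilting T" "basic T" "num_summands T = j"
      by simp_all
    have "M = mset_set (set_mset M)"
      using basic_summands[OF two_term_is_complex[OF T(2)]] T(1,4) by simp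
    moreover have "set_mset M \<in> ?F"
      using two_term_presilting_face[OF T(2,3)] num_summands_eq[OF two_term_is_complex[OF T(2)]]
        T(1,5) by simp
    ultimately show "M \<in> mset_set ` ?F" by (rule image_eqI)
  next
    fix M C assume M: "M = mset_set C" and "C \<in> ?F"
    then have C: "face C" "finite C" "card C = j" unfolding face_def by simp_all
    then have "face (set_mset M)" unfolding M by simp
    then obtain T where T: "two_term T" "presilting T" "ks.summands T = M"
      by (rule face_two_term_presilting)
    have "basic T"
      unfolding basic_summands[OF two_term_is_complex[OF T(1)]] T(3) M using C(2) by simp
    moreover have "num_summands T = j"
      using num_summands_eq[OF two_term_is_complex[OF T(1)]] T(3) M C by simp
    ultimately have "T \<in> ?S" using T(1,2) by simp
    then show "M \<in> ks.summands ` ?S" unfolding T(3)[symmetric] by (rule imageI)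
  qed
  moreover have "inj_on mset_set ?F" by (rule inj_on_inverseI[of _ set_mset]) (simp add: face_def)
  ultimately have "card (ks.summands ` ?S) = card ?F" by (simp add: card_image)
  then show ?thesis
    unfolding psilt_count_def by (subst card_iso_classes) (simp_all add: two_term_is_complex)
qed

lemma summands_size_le_iff:
  assumes "is_complex T"
  shows "size (ks.summands T) \<le> l \<longleftrightarrow> (\<exists>Ts. length Ts \<le> l \<and> (\<forall>Y\<in>set Ts. indec Y) \<and> T \<simeq>\<^sub>K dsum_list Ts)"
  unfolding indec_iff iso_iff dsum_list_eq
proof
  assume size: "size (ks.summands T) \<le> l"
  obtain Ts where "\<forall>Y\<in>set Ts. ks.indec Y" "ks.iso T (ks.biprod_list Ts)"
    "ks.summands T = mset (map ks.iso_class_of Ts)"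
    using ks.summands_decompose[OF assms] .
  then show "\<exists>Ts. length Ts \<le> l \<and> (\<forall>Y\<in>set Ts. ks.indec Y) \<and> ks.iso T (ks.biprod_list Ts)"
    using size by (intro exI[of _ Ts]) simp
next
  assume "\<exists>Ts. length Ts \<le> l \<and> (\<forall>Y\<in>set Ts. ks.indec Y) \<and> ks.iso T (ks.biprod_list Ts)"
  then obtain Ts where "length Ts \<le> l" "\<forall>Y\<in>set Ts. ks.indec Y" "ks.iso T (ks.biprod_list Ts)"
    by blast
  then show "size (ks.summands T) \<le> l" using ks.summands_eqI[of Ts T] by simp
qed

lemma psilt_oplus_le_count_eq: "psilt_oplus_le_count TYPE('a) l =
    card {M. face (set_mset M) \<and> size M \<le> l}"
proof -
  let ?S = "{T :: 'a cplx. two_term T \<and> presilting T \<and>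
      (\<exists>Ts. length Ts \<le> l \<and> (\<forall>Y\<in>set Ts. indec Y) \<and> T \<simeq>\<^sub>K dsum_list Ts)}"
  have S: "?S = {T. two_term T \<and> presilting T \<and> size (ks.summands T) \<le> l}"
    using summands_size_le_iff two_term_is_complex by blast
  have "ks.summands ` ?S = {M. face (set_mset M) \<and> size M \<le> l}"
  proof (intro equalityI subsetI)
    show "M \<in> {M. face (set_mset M) \<and> size M \<le> l}" if "M \<in> ks.summands ` ?S" for M
      using that two_term_presilting_face unfolding S by auto
    fix M assume "M \<in> {M. face (set_mset M) \<and> size M \<le> l}"
    then have M: "face (set_mset M)" "size M \<le> l" by simp_all
    obtain T where "two_term T" "presilting T" "ks.summands T = M"
      by (rule face_two_term_presilting[OF M(1)])
    then show "M \<in> ks.summands ` ?S" unfolding S using M(2) by (intro image_eqI[of _ _ T]) simp_all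
  qed
  then show ?thesis
    unfolding psilt_oplus_le_count_def by (subst card_iso_classes)
      (simp_all add: two_term_is_complex)
qed

lemma fvec_eq: "fvec TYPE('a) i = int (card {C. face C \<and> card C = i})"
proof -
  have "{C. face C \<and> card C = 0} = {{}}" unfolding face_def by auto
  then show ?thesis unfolding fvec_def psilt_count_eq by simp
qed

lemma psilt_oplus_le_count_binomial:
  assumes "g_finite TYPE('a)"
  shows "int (psilt_oplus_le_count TYPE('a) l) =
    (\<Sum>i = 0..num_summands (alg_cplx :: 'a cplx). int (l choose i) * fvec TYPE('a) i)"
proof -
  let ?n = "num_summands (alg_cplx :: 'a cplx)"
  let ?F = "\<lambda>C :: 'a cplx set set. {M. set_mset M = C \<and> size M \<le> l}"
  note faces = finite_faces[OF assms]
  have multisets: "finite (?F C) \<and> card (?F C) = l choose card C" if "face C" for C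
    by (rule multisets_of_support) (use that in \<open>simp add: face_def\<close>)
  have "{M. face (set_mset M) \<and> size M \<le> l} = (\<Union>C\<in>{C. face C}. ?F C)" by auto
  then have "psilt_oplus_le_count TYPE('a) l = (\<Sum>C | face C. card (?F C))"
    unfolding psilt_oplus_le_count_eq using multisets
    by (simp add: faces card_UN_disjoint disjoint_iff)
  also have "\<dots> = (\<Sum>C | face C. l choose card C)" using multisets by (intro sum.cong) auto
  also have "\<dots> = (\<Sum>i = 0..?n. \<Sum>C\<in>{C \<in> {C. face C}. card C = i}. l choose card C)"
    using face_card by (intro sum.group[symmetric] faces) auto
  also have "\<dots> = (\<Sum>i = 0..?n. (l choose i) * card {C. face C \<and> card C = i})"
    by (intro sum.cong) auto
  finally show ?thesis unfolding fvec_eq by simp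
qed

end

theorem theorem5p5:
  fixes scale :: "'k::field \<Rightarrow> 'a::ring_1 \<Rightarrow> 'a"
  assumes "fd_algebra scale"
    and "g_finite TYPE('a)"
  shows "\<forall>l::nat. int (psilt_oplus_le_count TYPE('a) l) =
           (\<Sum>j = 0..num_summands (alg_cplx :: 'a cplx).
              int ((num_summands (alg_cplx :: 'a cplx) + l - j) choose
                   (num_summands (alg_cplx :: 'a cplx)))
              * hvec TYPE('a) (num_summands (alg_cplx :: 'a cplx)) j)"
proof
  interpret fin_dim_algebra scale by unfold_locales (rule assms(1))
  fix l
  let ?n = "num_summands (alg_cplx :: 'a cplx)"
  have "int (psilt_oplus_le_count TYPE('a) l) = (\<Sum>i = 0..?n. int (l choose i) * fvec TYPE('a) i)"
    by (rule psilt_oplus_le_count_binomial[OF assms(2)])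
  also have "\<dots> = (\<Sum>j = 0..?n. int ((?n + l - j) choose ?n) * hvec TYPE('a) ?n j)"
    unfolding hvec_def by (rule h_vector_transform[symmetric])
  finally show "int (psilt_oplus_le_count TYPE('a) l) =
      (\<Sum>j = 0..?n. int ((?n + l - j) choose ?n) * hvec TYPE('a) ?n j)" .
qed

end
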